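(* Let Assumptions (A), (B), (C), (D) of the context hold, let $(\alpha^*,p^*,\nu^* )$ be a Nash equilibrium of the mean field game, and for each $N\ge1$ let $\hat\alpha^{(N)}=(\hat\alpha^1,\dots,\hat\alpha^N)$ be the strategy profile $\hat\alpha^n(w^1,\dots,w^N):=\alpha^*(w^n)$ in the $N$-player game. Then there exists a sequence $(\epsilon_N)$ converging to $0$ such that for all $N\ge1$, $n\le N$ and $\beta\in\mathbb{A}^N$, $$J^{n,N}(\hat\alpha^{(N)})\le J^{n,N}(\beta,\hat\alpha^{-n,N})+\epsilon_N,$$ where $(\beta,\hat\alpha^{-n,N})$ denotes the profile $(\hat\alpha^1,\dots,\hat\alpha^{n-1},\beta,\hat\alpha^{n+1},\dots,\hat\alpha^N)$.
   Context: Fix $T>0$ and integers $m\ge 2$, $l\ge 1$. $E=\{e_1,\dots,e_m\}$ is the standard basis of $\mathbb{R}^m$ (the state space; the index $i$ is identified with $e_i$). $\Omega$ is the space of càdlàg functions $[0,T]\to E$ continuous at $T$, $X_t(\omega)=\omega_t$ is the canonical process, $\mathbb{F}=(\mathcal{F}_t)$ its natural filtration, $\mathcal{F}=\mathcal{F}_T$. A probability $p^\circ$ on $E$ is fixed. $\mathbb{P}$ is the probability on $(\Omega,\mathcal{F})$ under which $X$ is a continuous-time Markov chain with initial law $p^\circ$ and transition rate $1$ between any two different states. $Q^0$ is the $m\times m$ matrix with diagonal entries $-(m-1)$ and off-diagonal entries $1$; $\mathcal{M}_t:=X_t-X_0-\int_0^tQ^0X_{s-}\,ds$ is a $\mathbb{P}$-martingale.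 $M^*$ denotes transpose and $M^+$ Moore–Penrose inverse. $\psi_t:=\mathrm{diag}(Q^0X_{t-})-Q^0\mathrm{diag}(X_{t-})-\mathrm{diag}(X_{t-})Q^0$. For $Z\in\mathbb{R}^m$, $\|Z\|_{e_i}^2:=\sum_{j\ne i}|Z_j-Z_i|^2$. $\mathcal{S}=\{p\in\mathbb{R}^m: p_i\ge0,\ \sum_ip_i=1\}$; $A\subset\mathbb{R}^l$ is compact; $\mathcal{P}(A)$ is the space of probability measures on $A$ with the 1-Wasserstein distance $\mathcal{W}_1$. Data: transition rates $q(t,i,j,\alpha,p,\nu)$ on $[0,T]\times\{1,\dots,m\}^2\times A\times\mathcal{S}\times\mathcal{P}(A)$ with matrix $Q=[q(t,i,j,\cdot)]_{i,j}$; running cost $f:[0,T]\times E\times A\times\mathcal{S}\times\mathcal{P}(A)\to\mathbb{R}$; terminal cost $g:E\times\mathcal{S}\to\mathbb{R}$. It is understood that $q$ and $f$ are Borel measurable in $t$ and that $\int_0^T|f(t,e_i,\alpha,p,\nu)|^2dt<\infty$ for all $(i,\alpha,p,\nu)$. Assumption (A): (i) each $Q(t,\alpha,p,\nu)$ is a Q-matrix (nonnegative off-diagonal entries, rows summing to $0$); (ii) there are $C_1,C_2>0$ with $C_1<q<C_2$ for all arguments with $i\ne j$; (iii) there is $C>0$ with $|q(t,i,j,\alpha,p,\nu)-q(t,i,j,\alpha',p',\nu')|\le C(\|\alpha-\alpha'\|+\|p-p'\|+\mathcal{W}_1(\nu,\nu'))$ for all arguments. Assumption (B): there is $C>0$ with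 $|f(t,e_i,\alpha,p,\nu)-f(t,e_i,\alpha',p',\nu')|\le C(\|\alpha-\alpha'\|+\|p-p'\|+\mathcal{W}_1(\nu,\nu'))$ and $|g(e_i,p)-g(e_i,p')|\le C\|p-p'\|$ for all arguments. Assumption (C): with $H_i(t,z,\alpha,p,\nu):=f(t,e_i,\alpha,p,\nu)+\sum_{j\ne i}(z_j-z_i)(q(t,i,j,\alpha,p,\nu)-1)$, for all $t,i,z,p,\nu$ the map $\alpha\mapsto H_i(t,z,\alpha,p,\nu)$ on $A$ has a unique minimizer $\hat a_i(t,z,p)$, independent of $\nu$; $\hat a_i$ is measurable and there are $C_1>0$, $C_2\ge0$ with $\|\hat a_i(t,z,p)-\hat a_i(t,z',p')\|\le C_1\|z-z'\|_{e_i}+(C_1+C_2\|z\|_{e_i})\|p-p'\|$ for all $t,i,z,z',p,p'$. Assumption (D): $q$ depends neither on $p$ nor on $\nu$; one writes $q(t,i,j,\alpha)$, $Q(t,\alpha)$. Mean field game: $\mathbb{A}$ is the set of $\mathbb{F}$-predictable $A$-valued processes. For $\alpha\in\mathbb{A}$ and measurable $p:[0,T]\to\mathcal{S}$, $\nu:[0,T]\to\mathcal{P}(A)$, $d\mathbb{Q}^{(\alpha,p,\nu)}/d\mathbb{P}:=\mathcal{E}(L)_T$ with $L_t=\int_0^tX_{s-}^*(Q(s,\alpha_s,p_s,\nu_s)-Q^0)\psi_s^+d\mathcal{M}_s$ ($\mathcal{E}$ = Doléans-Dade exponential), and $J(\alpha,p,\nu):=\mathbb{E}^{\mathbb{Q}^{(\alpha,p,\nu)}}[\int_0^Tf(t,X_t,\alpha_t,p_t,\nu_t)dt+g(X_T,p_T)]$.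 A Nash equilibrium is $(\alpha^*,p^*,\nu^* )$ with $\alpha^*\in\mathbb{A}$, $p^*,\nu^*$ measurable, $\alpha^*$ minimizing $J(\cdot,p^*,\nu^* )$ over $\mathbb{A}$, and, for every $t$, $p^*_t=(\mathbb{Q}^{(\alpha^*,p^*,\nu^* )}[X_t=e_i])_i$ and $\nu^*_t$ = law of $\alpha^*_t$ under $\mathbb{Q}^{(\alpha^*,p^*,\nu^* )}$. $N$-player game: $\Omega^N$ is the product of $N$ copies of $\Omega$, $\mathbb{P}^N$ the product of $N$ copies of $\mathbb{P}$, $X^n_t(w):=w^n_t$, $\mathbb{F}^N$ the natural filtration of $(X^1,\dots,X^N)$, $\mathcal{M}^n_t:=X^n_t-X^n_0-\int_0^tQ^0X^n_{s-}ds$, $\psi^n_t:=\mathrm{diag}(Q^0X^n_{t-})-Q^0\mathrm{diag}(X^n_{t-})-\mathrm{diag}(X^n_{t-})Q^0$. $\mathbb{A}^N$ is the set of $\mathbb{F}^N$-predictable $A$-valued processes; each player $n$ chooses $\alpha^n\in\mathbb{A}^N$. Define $\mathbb{Q}^{(\alpha^1,\dots,\alpha^N)}$ by $d\mathbb{Q}^{(\alpha^1,\dots,\alpha^N)}/d\mathbb{P}^N:=\mathcal{E}^{(\alpha^1,\dots,\alpha^N)}_T$, the Doléans-Dade exponential of $L_t=\int_0^t\sum_{n=1}^N(X^n_{s-})^*(Q(s,\alpha^n_s)-Q^0)(\psi^n_s)^+d\mathcal{M}^n_s$. Let $p^N_t:=\frac1N\big(\sum_{n=1}^N\mathbf{1}(X^n_t=e_i)\big)_{i=1,\dots,m}\in\mathcal{S}$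 and $\nu(\alpha^1_t,\dots,\alpha^N_t):=\frac1N\sum_{n=1}^N\delta_{\alpha^n_t}$. Player $n$ (who wants to minimize) has cost $J^{n,N}(\alpha^1,\dots,\alpha^N):=\mathbb{E}^{\mathbb{Q}^{(\alpha^1,\dots,\alpha^N)}}[\int_0^Tf(t,X^n_t,\alpha^n_t,p^N_t,\nu(\alpha^1_t,\dots,\alpha^N_t))dt+g(X^n_T,p^N_T)]$. *)

theory Defs
  imports "HOL-Probability.Probability"
begin

unbundle vec_syntax

section \<open>States, simplex and measures on the action set\<close>

text \<open>The number of states and the dimension of the action space are \<open>CARD('m)\<close> and
  \<open>CARD('l)\<close>; the state \<open>i\<close> is identified with the basis vector \<open>axis i 1\<close>.\<close>

definition states :: "(real^'m) set" where
  "states = range (\<lambda>i. axis i 1)"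

definition prob_simplex :: "(real^'m) set" where
  "prob_simplex = {p. (\<forall>i. 0 \<le> p $ i) \<and> (\<Sum>i\<in>UNIV. p $ i) = 1}"

definition prob_measures :: "'b::topological_space set \<Rightarrow> 'b measure set" where
  "prob_measures A = space (prob_algebra (restrict_space borel A))"

definition couplings :: "'b measure \<Rightarrow> 'b measure \<Rightarrow> 'b measure \<Rightarrow> ('b \<times> 'b) measure set" where
  "couplings M \<mu> \<nu> =
     {\<pi> \<in> space (prob_algebra (M \<Otimes>\<^sub>M M)). distr \<pi> M fst = \<mu> \<and> distr \<pi> M snd = \<nu>}"

definition wasserstein1 ::
    "'b::real_normed_vector set \<Rightarrow> 'b measure \<Rightarrow> 'b measure \<Rightarrow> real" where
  "wasserstein1 A \<mu> \<nu> =
     (INF \<pi> \<in> couplings (restrict_space borel A) \<mu> \<nu>. \<integral>z. norm (fst z - snd z) \<partial>\<pi>)"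

section \<open>Matrices\<close>

definition diag_mat :: "real^'m \<Rightarrow> real^'m^'m" where
  "diag_mat v = (\<chi> i j. if i = j then v $ i else 0)"

definition moore_penrose :: "real^'n^'m \<Rightarrow> real^'m^'n" where
  "moore_penrose M = (THE B. M ** B ** M = M \<and> B ** M ** B = B \<and>
     transpose (M ** B) = M ** B \<and> transpose (B ** M) = B ** M)"

definition mat_exp :: "real^'m^'m \<Rightarrow> real^'m^'m" where
  "mat_exp M = (\<Sum>k. (1 / fact k) *\<^sub>R (((**) M ^^ k) (mat 1)))"

definition Q0 :: "real^'m^'m" where
  "Q0 = (\<chi> i j. if i = j then - (real CARD('m) - 1) else 1)"

definition psi :: "real^'m \<Rightarrow> real^'m^'m" where
  "psi x = diag_mat (Q0 *v x) - Q0 ** diag_mat x - diag_mat x ** Q0"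

definition state_norm :: "'m \<Rightarrow> real^'m \<Rightarrow> real" where
  "state_norm i z = sqrt (\<Sum>j\<in>UNIV - {i}. \<bar>z $ j - z $ i\<bar>\<^sup>2)"

section \<open>Path space and filtrations\<close>

text \<open>Paths are extensional on \<open>{0..T}\<close>, so each function on \<open>[0,T]\<close> has exactly one
  representative.\<close>

definition paths :: "real \<Rightarrow> (real \<Rightarrow> real^'m) set" where
  "paths T = {\<omega> \<in> {0..T} \<rightarrow>\<^sub>E states.
     (\<forall>t\<in>{0..<T}. continuous (at_right t) \<omega>) \<and>
     (\<forall>t\<in>{0<..T}. \<exists>x. (\<omega> \<longlongrightarrow> x) (at_left t)) \<and>
     continuous (at_left T) \<omega>}"

definition natural_filtration ::
    "'w set \<Rightarrow> (real \<Rightarrow> 'w \<Rightarrow> 'b::topological_space) set \<Rightarrow> real \<Rightarrow> 'w measure" where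
  "natural_filtration \<Omega> Ys t =
     sigma \<Omega> (\<Union>Y\<in>Ys. \<Union>s\<in>{0..t}. {Y s -` B \<inter> \<Omega> | B. B \<in> sets borel})"

definition canonical_filtration ::
    "real \<Rightarrow> real \<Rightarrow> (real \<Rightarrow> real^'m) measure" where
  "canonical_filtration T = natural_filtration (paths T) {\<lambda>s \<omega>. \<omega> s}"

definition predictable_algebra ::
    "real \<Rightarrow> 'w set \<Rightarrow> (real \<Rightarrow> 'w measure) \<Rightarrow> (real \<times> 'w) measure" where
  "predictable_algebra T \<Omega> F = sigma ({0..T} \<times> \<Omega>)
     ({{0} \<times> B | B. B \<in> sets (F 0)} \<union>
      {{s<..t} \<times> B | s t B. 0 \<le> s \<and> s \<le> t \<and> t \<le> T \<and> B \<in> sets (F s)})"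

definition predictable_controls ::
    "real \<Rightarrow> 'b::topological_space set \<Rightarrow> 'w set \<Rightarrow> (real \<Rightarrow> 'w measure) \<Rightarrow>
     (real \<Rightarrow> 'w \<Rightarrow> 'b) set" where
  "predictable_controls T A \<Omega> F =
     {\<alpha>. (\<lambda>(t, \<omega>). \<alpha> t \<omega>) \<in> predictable_algebra T \<Omega> F \<rightarrow>\<^sub>M restrict_space borel A}"

text \<open>The law on path space of the Markov chain with initial law \<open>p0\<close> and rate matrix \<open>Q0\<close>:
  given the past up to \<open>s\<close>, the law of \<open>X\<^sub>t\<close> is row \<open>X\<^sub>s\<close> of \<open>exp ((t - s) Q0)\<close>.\<close>

definition is_chain_law ::
    "real \<Rightarrow> real^'m \<Rightarrow> (real \<Rightarrow> real^'m) measure \<Rightarrow> bool" where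
  "is_chain_law T p0 P \<longleftrightarrow>
     prob_space P \<and> sets P = sets (canonical_filtration T T) \<and>
     (\<forall>i. measure P {\<omega> \<in> space P. \<omega> 0 = axis i 1} = p0 $ i) \<and>
     (\<forall>s t j. 0 \<le> s \<and> s \<le> t \<and> t \<le> T \<longrightarrow>
        (AE \<omega> in P. real_cond_exp P (canonical_filtration T s)
             (indicator {\<omega> \<in> space P. \<omega> t = axis j 1}) \<omega>
           = (\<omega> s v* mat_exp ((t - s) *\<^sub>R Q0)) $ j))"

section \<open>Stochastic integrals and stochastic exponential\<close>

text \<open>The convention \<open>X\<^bsub>0-\<^esub> = X\<^sub>0\<close> plays no role: integrals run over \<open>(0,t]\<close>.\<close>

definition left_lim :: "(real \<Rightarrow> 'b::t2_space) \<Rightarrow> real \<Rightarrow> 'b" where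
  "left_lim x t = (if t = 0 then x 0 else Lim (at_left t) x)"

text \<open>Lebesgue-Stieltjes integral of \<open>h\<close> over \<open>(0,t]\<close> against a right-continuous \<open>F\<close> of finite
  variation. The value does not depend on the decomposition of \<open>F\<close>.\<close>

definition stieltjes_integral :: "real \<Rightarrow> (real \<Rightarrow> real) \<Rightarrow> (real \<Rightarrow> real) \<Rightarrow> real" where
  "stieltjes_integral t h F = (THE I. \<exists>F1 F2.
     mono F1 \<and> mono F2 \<and>
     (\<forall>s. continuous (at_right s) F1) \<and> (\<forall>s. continuous (at_right s) F2) \<and>
     (\<forall>s\<in>{0..t}. F s = F1 s - F2 s) \<and>
     set_integrable (interval_measure F1) {0<..t} h \<and>
     set_integrable (interval_measure F2) {0<..t} h \<and>
     I = (LINT s:{0<..t}|interval_measure F1. h s) - (LINT s:{0<..t}|interval_measure F2. h s))"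

definition chain_martingale :: "(real \<Rightarrow> real^'m) \<Rightarrow> real \<Rightarrow> real^'m" where
  "chain_martingale \<omega> t = \<omega> t - \<omega> 0 - (LINT s:{0..t}|lborel. Q0 *v left_lim \<omega> s)"

text \<open>\<open>R s\<close> is the controlled rate matrix at time \<open>s\<close> along the path \<open>\<omega>\<close>. The paths of the
  martingale have finite variation, so the stochastic integral is a pathwise one.\<close>

definition girsanov_integral ::
    "(real \<Rightarrow> real^'m^'m) \<Rightarrow> (real \<Rightarrow> real^'m) \<Rightarrow> real \<Rightarrow> real" where
  "girsanov_integral R \<omega> t = (\<Sum>i\<in>UNIV. stieltjes_integral t
     (\<lambda>s. (left_lim \<omega> s v* (R s - Q0) v* moore_penrose (psi (left_lim \<omega> s))) $ i)
     (\<lambda>s. chain_martingale \<omega> s $ i))"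

text \<open>The general formula has the additional factor \<open>exp (- [L\<^sup>c,L\<^sup>c]\<^sub>t / 2)\<close>, which is \<open>1\<close> for
  \<open>L\<close> of finite variation. It is applied only to \<open>L\<close> with finitely many jumps.\<close>

definition doleans_exp :: "(real \<Rightarrow> real) \<Rightarrow> real \<Rightarrow> real" where
  "doleans_exp L t = exp (L t - L 0) *
     (\<Prod>s | s \<in> {0<..t} \<and> L s \<noteq> left_lim L s.
        (1 + (L s - left_lim L s)) * exp (- (L s - left_lim L s)))"

section \<open>Data and assumptions\<close>

type_synonym ('m, 'l) rates =
  "real \<Rightarrow> 'm \<Rightarrow> 'm \<Rightarrow> real^'l \<Rightarrow> real^'m \<Rightarrow> (real^'l) measure \<Rightarrow> real"
type_synonym ('m, 'l) rates_reduced = "real \<Rightarrow> 'm \<Rightarrow> 'm \<Rightarrow> real^'l \<Rightarrow> real"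
type_synonym ('m, 'l) running_cost =
  "real \<Rightarrow> real^'m \<Rightarrow> real^'l \<Rightarrow> real^'m \<Rightarrow> (real^'l) measure \<Rightarrow> real"
type_synonym 'm terminal_cost = "real^'m \<Rightarrow> real^'m \<Rightarrow> real"

definition measurable_data ::
    "real \<Rightarrow> (real^'l) set \<Rightarrow> ('m::finite, 'l::finite) rates \<Rightarrow> ('m, 'l) running_cost \<Rightarrow> bool" where
  "measurable_data T A q f \<longleftrightarrow>
     (\<forall>\<alpha>\<in>A. \<forall>p\<in>prob_simplex. \<forall>\<nu>\<in>prob_measures A.
        (\<forall>i j. (\<lambda>t. q t i j \<alpha> p \<nu>) \<in> borel_measurable (restrict_space borel {0..T})) \<and>
        (\<forall>i. (\<lambda>t. f t (axis i 1) \<alpha> p \<nu>) \<in> borel_measurable (restrict_space borel {0..T}) \<and>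
             set_integrable lborel {0..T} (\<lambda>t. \<bar>f t (axis i 1) \<alpha> p \<nu>\<bar>\<^sup>2)))"

definition assumption_A ::
    "real \<Rightarrow> (real^'l) set \<Rightarrow> ('m::finite, 'l::finite) rates \<Rightarrow> bool" where
  "assumption_A T A q \<longleftrightarrow>
     (\<forall>t\<in>{0..T}. \<forall>\<alpha>\<in>A. \<forall>p\<in>prob_simplex. \<forall>\<nu>\<in>prob_measures A.
        (\<forall>i j. i \<noteq> j \<longrightarrow> 0 \<le> q t i j \<alpha> p \<nu>) \<and> (\<forall>i. (\<Sum>j\<in>UNIV. q t i j \<alpha> p \<nu>) = 0)) \<and>
     (\<exists>C1>0. \<exists>C2>0. \<forall>t\<in>{0..T}. \<forall>\<alpha>\<in>A. \<forall>p\<in>prob_simplex. \<forall>\<nu>\<in>prob_measures A. \<forall>i j.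
        i \<noteq> j \<longrightarrow> C1 < q t i j \<alpha> p \<nu> \<and> q t i j \<alpha> p \<nu> < C2) \<and>
     (\<exists>C>0. \<forall>t\<in>{0..T}. \<forall>i j. \<forall>\<alpha>\<in>A. \<forall>\<alpha>'\<in>A. \<forall>p\<in>prob_simplex. \<forall>p'\<in>prob_simplex.
        \<forall>\<nu>\<in>prob_measures A. \<forall>\<nu>'\<in>prob_measures A.
        \<bar>q t i j \<alpha> p \<nu> - q t i j \<alpha>' p' \<nu>'\<bar>
          \<le> C * (norm (\<alpha> - \<alpha>') + norm (p - p') + wasserstein1 A \<nu> \<nu>'))"

definition assumption_B ::
    "real \<Rightarrow> (real^'l) set \<Rightarrow> ('m::finite, 'l::finite) running_cost \<Rightarrow> 'm terminal_cost \<Rightarrow> bool" where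
  "assumption_B T A f g \<longleftrightarrow>
     (\<exists>C>0. (\<forall>t\<in>{0..T}. \<forall>i. \<forall>\<alpha>\<in>A. \<forall>\<alpha>'\<in>A. \<forall>p\<in>prob_simplex. \<forall>p'\<in>prob_simplex.
        \<forall>\<nu>\<in>prob_measures A. \<forall>\<nu>'\<in>prob_measures A.
        \<bar>f t (axis i 1) \<alpha> p \<nu> - f t (axis i 1) \<alpha>' p' \<nu>'\<bar>
          \<le> C * (norm (\<alpha> - \<alpha>') + norm (p - p') + wasserstein1 A \<nu> \<nu>')) \<and>
       (\<forall>i. \<forall>p\<in>prob_simplex. \<forall>p'\<in>prob_simplex.
        \<bar>g (axis i 1) p - g (axis i 1) p'\<bar> \<le> C * norm (p - p')))"

definition hamiltonian ::
    "('m::finite, 'l::finite) rates \<Rightarrow> ('m, 'l) running_cost \<Rightarrow>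
     'm \<Rightarrow> real \<Rightarrow> real^'m \<Rightarrow> real^'l \<Rightarrow> real^'m \<Rightarrow> (real^'l) measure \<Rightarrow> real" where
  "hamiltonian q f i t z \<alpha> p \<nu> =
     f t (axis i 1) \<alpha> p \<nu> + (\<Sum>j\<in>UNIV - {i}. (z $ j - z $ i) * (q t i j \<alpha> p \<nu> - 1))"

definition assumption_C ::
    "real \<Rightarrow> (real^'l) set \<Rightarrow> ('m::finite, 'l::finite) rates \<Rightarrow> ('m, 'l) running_cost \<Rightarrow> bool" where
  "assumption_C T A q f \<longleftrightarrow>
     (\<exists>a :: 'm \<Rightarrow> real \<Rightarrow> real^'m \<Rightarrow> real^'m \<Rightarrow> real^'l.
        (\<forall>t\<in>{0..T}. \<forall>i z. \<forall>p\<in>prob_simplex. \<forall>\<nu>\<in>prob_measures A. \<forall>\<alpha>.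
           is_arg_min (\<lambda>\<alpha>. hamiltonian q f i t z \<alpha> p \<nu>) (\<lambda>\<alpha>. \<alpha> \<in> A) \<alpha> \<longleftrightarrow> \<alpha> = a i t z p) \<and>
        (\<forall>i. (\<lambda>(t, z, p). a i t z p)
               \<in> borel_measurable (restrict_space borel ({0..T} \<times> UNIV \<times> prob_simplex))) \<and>
        (\<exists>C1>0. \<exists>C2\<ge>0. \<forall>t\<in>{0..T}. \<forall>i z z'. \<forall>p\<in>prob_simplex. \<forall>p'\<in>prob_simplex.
           norm (a i t z p - a i t z' p')
             \<le> C1 * state_norm i (z - z') + (C1 + C2 * state_norm i z) * norm (p - p')))"

text \<open>\<open>r\<close> is the reduced rate function, written \<open>q(t,i,j,\<alpha>)\<close>.\<close>

definition assumption_D ::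
    "real \<Rightarrow> (real^'l) set \<Rightarrow> ('m::finite, 'l::finite) rates \<Rightarrow> ('m, 'l) rates_reduced \<Rightarrow> bool" where
  "assumption_D T A q r \<longleftrightarrow>
     (\<forall>t\<in>{0..T}. \<forall>i j. \<forall>\<alpha>\<in>A. \<forall>p\<in>prob_simplex. \<forall>\<nu>\<in>prob_measures A. q t i j \<alpha> p \<nu> = r t i j \<alpha>)"

section \<open>Mean field game\<close>

definition mfg_controls ::
    "real \<Rightarrow> (real^'l) set \<Rightarrow> (real \<Rightarrow> (real \<Rightarrow> real^'m) \<Rightarrow> real^'l) set" where
  "mfg_controls T A = predictable_controls T A (paths T) (canonical_filtration T)"

definition mfg_measure ::
    "real \<Rightarrow> ('m::finite, 'l::finite) rates \<Rightarrow> (real \<Rightarrow> real^'m) measure \<Rightarrow>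
     (real \<Rightarrow> (real \<Rightarrow> real^'m) \<Rightarrow> real^'l) \<Rightarrow> (real \<Rightarrow> real^'m) \<Rightarrow> (real \<Rightarrow> (real^'l) measure) \<Rightarrow>
     (real \<Rightarrow> real^'m) measure" where
  "mfg_measure T q P \<alpha> p \<nu> = density P (\<lambda>\<omega>. ennreal (doleans_exp
     (girsanov_integral (\<lambda>s. \<chi> i j. q s i j (\<alpha> s \<omega>) (p s) (\<nu> s)) \<omega>) T))"

definition mfg_cost ::
    "real \<Rightarrow> ('m::finite, 'l::finite) rates \<Rightarrow> ('m, 'l) running_cost \<Rightarrow> 'm terminal_cost \<Rightarrow>
     (real \<Rightarrow> real^'m) measure \<Rightarrow>
     (real \<Rightarrow> (real \<Rightarrow> real^'m) \<Rightarrow> real^'l) \<Rightarrow> (real \<Rightarrow> real^'m) \<Rightarrow> (real \<Rightarrow> (real^'l) measure) \<Rightarrow>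
     real" where
  "mfg_cost T q f g P \<alpha> p \<nu> =
     (\<integral>\<omega>. (LINT t:{0..T}|lborel. f t (\<omega> t) (\<alpha> t \<omega>) (p t) (\<nu> t)) + g (\<omega> T) (p T)
        \<partial>mfg_measure T q P \<alpha> p \<nu>)"

text \<open>\<open>prob_algebra\<close> carries the \<open>\<sigma>\<close>-algebra generated by the evaluations
  \<open>\<nu> \<mapsto> \<nu> B\<close>; for compact \<open>A\<close> this is the Borel \<open>\<sigma>\<close>-algebra of the Wasserstein distance.\<close>

definition mfg_nash ::
    "real \<Rightarrow> (real^'l) set \<Rightarrow> ('m::finite, 'l::finite) rates \<Rightarrow> ('m, 'l) running_cost \<Rightarrow>
     'm terminal_cost \<Rightarrow> (real \<Rightarrow> real^'m) measure \<Rightarrow>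
     (real \<Rightarrow> (real \<Rightarrow> real^'m) \<Rightarrow> real^'l) \<Rightarrow> (real \<Rightarrow> real^'m) \<Rightarrow> (real \<Rightarrow> (real^'l) measure) \<Rightarrow>
     bool" where
  "mfg_nash T A q f g P \<alpha> p \<nu> \<longleftrightarrow>
     \<alpha> \<in> mfg_controls T A \<and>
     p \<in> restrict_space borel {0..T} \<rightarrow>\<^sub>M restrict_space borel prob_simplex \<and>
     \<nu> \<in> restrict_space borel {0..T} \<rightarrow>\<^sub>M prob_algebra (restrict_space borel A) \<and>
     (\<forall>\<beta>\<in>mfg_controls T A. mfg_cost T q f g P \<alpha> p \<nu> \<le> mfg_cost T q f g P \<beta> p \<nu>) \<and>
     (\<forall>t\<in>{0..T}.
        p t = (\<chi> i. measure (mfg_measure T q P \<alpha> p \<nu>) {\<omega> \<in> paths T. \<omega> t = axis i 1}) \<and>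
        \<nu> t = distr (mfg_measure T q P \<alpha> p \<nu>) (restrict_space borel A) (\<alpha> t))"

section \<open>The game with finitely many players\<close>

definition nplayer_reference ::
    "nat \<Rightarrow> (real \<Rightarrow> real^'m) measure \<Rightarrow> (nat \<Rightarrow> real \<Rightarrow> real^'m) measure" where
  "nplayer_reference N P = Pi\<^sub>M {1..N} (\<lambda>_. P)"

definition nplayer_controls ::
    "real \<Rightarrow> (real^'l) set \<Rightarrow> nat \<Rightarrow>
     (real \<Rightarrow> (nat \<Rightarrow> real \<Rightarrow> real^'m) \<Rightarrow> real^'l) set" where
  "nplayer_controls T A N =
     (let \<Omega> = {1..N} \<rightarrow>\<^sub>E paths T
      in predictable_controls T A \<Omega> (natural_filtration \<Omega> ((\<lambda>n s w. w n s) ` {1..N})))"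

definition nplayer_measure ::
    "real \<Rightarrow> ('m::finite, 'l::finite) rates_reduced \<Rightarrow> (real \<Rightarrow> real^'m) measure \<Rightarrow> nat \<Rightarrow>
     (nat \<Rightarrow> real \<Rightarrow> (nat \<Rightarrow> real \<Rightarrow> real^'m) \<Rightarrow> real^'l) \<Rightarrow>
     (nat \<Rightarrow> real \<Rightarrow> real^'m) measure" where
  "nplayer_measure T r P N \<alpha> = density (nplayer_reference N P) (\<lambda>w. ennreal (doleans_exp
     (\<lambda>t. \<Sum>n=1..N. girsanov_integral (\<lambda>s. \<chi> i j. r s i j (\<alpha> n s w)) (w n) t) T))"

definition empirical_states :: "nat \<Rightarrow> (nat \<Rightarrow> real^'m) \<Rightarrow> real^'m" where
  "empirical_states N x = (\<chi> i. (1 / real N) * (\<Sum>n=1..N. of_bool (x n = axis i 1)))"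

text \<open>The mean of the Dirac measures at \<open>a 1, \<dots>, a N\<close>.\<close>

definition empirical_actions :: "(real^'l) set \<Rightarrow> nat \<Rightarrow> (nat \<Rightarrow> real^'l) \<Rightarrow> (real^'l) measure" where
  "empirical_actions A N a = distr (uniform_count_measure {1..N}) (restrict_space borel A) a"

definition nplayer_cost ::
    "real \<Rightarrow> (real^'l) set \<Rightarrow> ('m::finite, 'l::finite) rates_reduced \<Rightarrow> ('m, 'l) running_cost \<Rightarrow>
     'm terminal_cost \<Rightarrow> (real \<Rightarrow> real^'m) measure \<Rightarrow> nat \<Rightarrow> nat \<Rightarrow>
     (nat \<Rightarrow> real \<Rightarrow> (nat \<Rightarrow> real \<Rightarrow> real^'m) \<Rightarrow> real^'l) \<Rightarrow> real" where
  "nplayer_cost T A r f g P N n \<alpha> =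
     (\<integral>w. (LINT t:{0..T}|lborel. f t (w n t) (\<alpha> n t w)
               (empirical_states N (\<lambda>k. w k t)) (empirical_actions A N (\<lambda>k. \<alpha> k t w)))
           + g (w n T) (empirical_states N (\<lambda>k. w k T))
        \<partial>nplayer_measure T r P N \<alpha>)"

end

theory Submission
  imports Defs
begin

text \<open>Suppose that player \<open>n\<close> plays some control \<open>\<beta>\<close> while all others keep the equilibrium control, and freeze the paths \<open>w\<close>
  of the others. As a function of time and of the own path, \<open>\<beta>\<close> becomes a control \<open>\<beta>\<^sub>w\<close> that is admissible in the mean field
  game, since the history of the others is now a constant (\<open>nplayer_control_section\<close>). So \<open>\<beta>\<^sub>w\<close> costs at least the
  mean field value there, for each \<open>w\<close>. The proof transports this inequality to the game with \<open>N\<close> players.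

  The change of measure factorises. Under the reference measure no two players jump at the same time
  (\<open>AE_PiM_no_common_jumps\<close>), and then the stochastic exponential of the sum of the driving integrals is the product of one
  likelihood for each player (\<open>doleans_exp_girsanov_sum\<close>). The rates depend on the own action only, so the likelihood of an
  opponent is a function of the opponent's own path. Hence the opponents are independent with the equilibrium law, whatever \<open>\<beta>\<close>
  is, and the cost of player \<open>n\<close> is the mean over \<open>w\<close> of the cost given \<open>w\<close> (\<open>nplayer_cost_conditional\<close>).

  The cost given \<open>w\<close> differs from the mean field cost of \<open>\<beta>\<^sub>w\<close> only because empirical laws replace \<open>p\<close> and \<open>\<nu>\<close>. Player
  \<open>n\<close> contributes \<open>O(1/N)\<close> to this difference; the rest is the fluctuation of independent samples around their mean, which by consistency of
  the equilibrium is \<open>p\<close> and \<open>\<nu>\<close>. It depends on \<open>w\<close> alone (\<open>conditional_cost_error\<close>) and has mean of order \<open>1 / sqrt N\<close> for the states. For the actions, \<open>A\<close>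
  is cut into finitely many cells of diameter at most \<open>\<delta>\<close>; the Wasserstein distance is at most \<open>\<delta>\<close> plus a multiple of
  the distance of the cell frequencies (\<open>wasserstein1_le_partition\<close>). The regret is therefore at most a multiple of \<open>\<delta>\<close>
  plus \<open>c / sqrt N\<close> with \<open>c\<close> depending on \<open>\<delta>\<close> (\<open>nplayer_regret_bound\<close>), and the infimum over \<open>\<delta>\<close> tends to 0.

  The errors are weighted with the likelihood of the own path. This is unbounded, but at most a constant times \<open>K\<close> to the
  number of jumps, uniformly in the control, and the number of jumps has exponential moments
  (\<open>chain_jump_count_exponential_moment\<close>). All of this rests on an explicit formula for the likelihood. The integrator has finitely many
  jumps and a drift, and the pseudo-inverse of \<open>psi\<close> can be computed (\<open>moore_penrose_psi\<close>), so the stochastic integral is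
  a finite sum and a Lebesgue integral (\<open>girsanov_integral_explicit\<close>).\<close>

section \<open>Wasserstein distance and finite partitions\<close>

lemma prob_measures_iff:
  "\<nu> \<in> prob_measures A \<longleftrightarrow> sets \<nu> = sets (restrict_space borel A) \<and> prob_space \<nu>"
  by (auto simp: prob_measures_def space_prob_algebra)

lemma space_prob_measures: "\<nu> \<in> prob_measures A \<Longrightarrow> space \<nu> = A"
  using sets_eq_imp_space_eq[of \<nu> "restrict_space borel A"]
  by (simp add: prob_measures_iff space_restrict_space)

text \<open>Integration of a function of finitely many cells; both marginals of a coupling with a
  cellwise constant density reduce to such sums.\<close>

lemma sum_blocks_integral:
  fixes \<kappa> :: "'b \<Rightarrow> 'k" and G :: "'k \<Rightarrow> real"
  assumes "prob_space \<nu>" and "finite K" and "\<kappa> \<in> \<nu> \<rightarrow>\<^sub>M count_space K"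
  shows "integrable \<nu> (\<lambda>x. G (\<kappa> x))"
    and "(\<integral>x. G (\<kappa> x) \<partial>\<nu>) = (\<Sum>k\<in>K. G k * measure \<nu> (\<kappa> -` {k} \<inter> space \<nu>))"
proof -
  interpret prob_space \<nu> by fact
  have S: "\<kappa> -` {k} \<inter> space \<nu> \<in> sets \<nu>" if "k \<in> K" for k
    using that assms(3) by (auto intro: measurable_sets)
  have eq: "G (\<kappa> x) = (\<Sum>k\<in>K. G k * indicator (\<kappa> -` {k} \<inter> space \<nu>) x)" if "x \<in> space \<nu>" for x
  proof -
    have "\<kappa> x \<in> K" using measurable_space[OF assms(3) that] by simp
    then show ?thesis using assms(2) that
      by (subst sum.remove[of _ "\<kappa> x"]) (auto simp: indicator_def intro!: sum.neutral)
  qed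
  have I: "integrable \<nu> (\<lambda>x. G k * indicator (\<kappa> -` {k} \<inter> space \<nu>) x)" if "k \<in> K" for k
    using S[OF that] by (intro integrable_mult_right integrable_real_indicator) (auto simp: emeasure_eq_measure)
  show "integrable \<nu> (\<lambda>x. G (\<kappa> x))"
    by (subst Bochner_Integration.integrable_cong[OF refl eq]) (auto intro!: Bochner_Integration.integrable_sum I)
  have "(\<integral>x. G (\<kappa> x) \<partial>\<nu>) = (\<integral>x. (\<Sum>k\<in>K. G k * indicator (\<kappa> -` {k} \<inter> space \<nu>) x) \<partial>\<nu>)"
    by (rule Bochner_Integration.integral_cong[OF refl eq])
  also have "\<dots> = (\<Sum>k\<in>K. G k * measure \<nu> (\<kappa> -` {k} \<inter> space \<nu>))"
    using S I by (subst Bochner_Integration.integral_sum) auto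
  finally show "(\<integral>x. G (\<kappa> x) \<partial>\<nu>) = (\<Sum>k\<in>K. G k * measure \<nu> (\<kappa> -` {k} \<inter> space \<nu>))" .
qed

text \<open>The maximal coupling of two distributions on a finite set, given by its density
  \<open>H\<close> with respect to the product \<open>p \<otimes> p'\<close>. As much mass as possible,
  \<open>min (p k) (p' k)\<close>, stays on the diagonal, and the remaining excesses are coupled
  independently. A density, rather than the joint distribution itself, is what can be pulled back to a
  continuous space along a map into cells.\<close>

lemma maximal_coupling_weights:
  fixes p p' :: "'k \<Rightarrow> real"
  assumes K: "finite K" and p: "\<And>k. k \<in> K \<Longrightarrow> 0 \<le> p k" "sum p K = 1"
    and p': "\<And>k. k \<in> K \<Longrightarrow> 0 \<le> p' k" "sum p' K = 1"
  obtains H :: "'k \<Rightarrow> 'k \<Rightarrow> real" where "\<And>k l. k \<in> K \<Longrightarrow> l \<in> K \<Longrightarrow> 0 \<le> H k l"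
    "\<And>k. k \<in> K \<Longrightarrow> 0 < p k \<Longrightarrow> (\<Sum>l\<in>K. H k l * p' l) = 1"
    "\<And>l. l \<in> K \<Longrightarrow> 0 < p' l \<Longrightarrow> (\<Sum>k\<in>K. H k l * p k) = 1"
    "(\<Sum>k\<in>K. \<Sum>l\<in>K. (if k = l then 0 else H k l * p k * p' l)) \<le> (\<Sum>k\<in>K. \<bar>p k - p' k\<bar>)"
proof -
  \<comment> \<open>\<open>c\<close> is the common mass, \<open>s\<close> the mass that has to move;
    \<open>u\<close> and \<open>v\<close> are the fractions of each atom that leave it.\<close>
  define c where "c k = min (p k) (p' k)" for k
  define s where "s = 1 - sum c K"
  define u where "u k = 1 - c k / p k" for k
  define v where "v k = 1 - c k / p' k" for k
  have up: "u k * p k = p k - c k" and vp: "v k * p' k = p' k - c k" if "k \<in> K" for k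
    using p(1)[OF that] p'(1)[OF that] by (auto simp: u_def v_def c_def field_simps min_def)
  have u0: "0 \<le> u k" and v0: "0 \<le> v k" if "k \<in> K" for k
    using p(1)[OF that] p'(1)[OF that] by (auto simp: u_def v_def c_def divide_le_eq min_def)
  have su: "(\<Sum>k\<in>K. u k * p k) = s" and sv: "(\<Sum>k\<in>K. v k * p' k) = s"
    using p p' by (simp_all add: up vp sum_subtractf s_def cong: sum.cong)
  have s0: "0 \<le> s" unfolding su[symmetric] using u0 p by (auto intro!: sum_nonneg)
  have s1: "s \<le> (\<Sum>k\<in>K. \<bar>p k - p' k\<bar>)"
    unfolding su[symmetric] by (rule sum_mono) (auto simp: up c_def)
  define H where "H k l = (if k = l then c k / (p k * p' k) else 0) + u k * v l / s" for k l
  have cc: "c k / (p k * p' k) * p' k = c k / p k" "c k / (p k * p' k) * p k = c k / p' k" if "k \<in> K" for k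
    using p(1)[OF that] p'(1)[OF that] by (auto simp: c_def min_def)
  have cz: "c l = 0" if "l \<in> K" "p l = 0" for l
    using p'(1)[OF that(1)] that(2) by (simp add: c_def)
  \<comment> \<open>If no mass moves, the division by \<open>s = 0\<close> in \<open>H\<close> returns 0,
    which is the right value.\<close>
  have uz: "u k * p k = 0" and vz: "v k * p' k = 0" if "s = 0" "k \<in> K" for k
    using su sv that K u0 v0 p p' by (simp_all add: sum_nonneg_eq_0_iff)
  show ?thesis
  proof (rule that[of H])
    show "0 \<le> H k l" if "k \<in> K" "l \<in> K" for k l
      using that p p' u0 v0 s0 by (auto simp: H_def c_def intro!: add_nonneg_nonneg divide_nonneg_nonneg mult_nonneg_nonneg)
    show "(\<Sum>l\<in>K. H k l * p' l) = 1" if k: "k \<in> K" "0 < p k" for k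
    proof -
      have "(\<Sum>l\<in>K. H k l * p' l) = (\<Sum>l\<in>K. (if k = l then c k / p k else 0)) + (\<Sum>l\<in>K. u k / s * (v l * p' l))"
        unfolding sum.distrib[symmetric] by (rule sum.cong[OF refl]) (use cc cz in \<open>auto simp: H_def algebra_simps\<close>)
      also have "\<dots> = c k / p k + u k / s * s"
        unfolding sum_distrib_left[symmetric] sv using k K by simp
      also have "u k / s * s = u k" using uz[OF _ k(1)] k by auto
      finally show ?thesis by (simp add: u_def)
    qed
    show "(\<Sum>k\<in>K. H k l * p k) = 1" if l: "l \<in> K" "0 < p' l" for l
    proof -
      have "(\<Sum>k\<in>K. H k l * p k) = (\<Sum>k\<in>K. (if k = l then c l / p' l else 0)) + (\<Sum>k\<in>K. v l / s * (u k * p k))"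
        unfolding sum.distrib[symmetric] by (rule sum.cong[OF refl]) (use cc cz in \<open>auto simp: H_def algebra_simps\<close>)
      also have "\<dots> = c l / p' l + v l / s * s"
        unfolding sum_distrib_left[symmetric] su using l K by simp
      also have "v l / s * s = v l" using vz[OF _ l(1)] l by auto
      finally show ?thesis by (simp add: v_def)
    qed
    have "(\<Sum>k\<in>K. \<Sum>l\<in>K. (if k = l then 0 else H k l * p k * p' l))
        \<le> (\<Sum>k\<in>K. \<Sum>l\<in>K. (u k * p k) * (v l * p' l) / s)"
      using p p' u0 v0 s0
      by (intro sum_mono) (auto simp: H_def mult_ac intro!: divide_nonneg_nonneg mult_nonneg_nonneg)
    also have "\<dots> = (\<Sum>k\<in>K. u k * p k) * (\<Sum>l\<in>K. v l * p' l) / s"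
      by (simp add: sum_product sum_divide_distrib)
    also have "\<dots> \<le> s" using s0 by (simp add: su sv)
    finally show "(\<Sum>k\<in>K. \<Sum>l\<in>K. (if k = l then 0 else H k l * p k * p' l)) \<le> (\<Sum>k\<in>K. \<bar>p k - p' k\<bar>)"
      using s1 by linarith
  qed
qed

lemma wasserstein1_le_coupling:
  assumes "\<pi> \<in> couplings (restrict_space borel A) \<mu> \<nu>"
  shows "wasserstein1 A \<mu> \<nu> \<le> (\<integral>z. norm (fst z - snd z) \<partial>\<pi>)"
  unfolding wasserstein1_def
  by (rule cINF_lower[OF _ assms]) (auto intro!: bdd_belowI2[where m=0] integral_nonneg)

lemma wasserstein1_nonneg:
  assumes "\<mu> \<in> prob_measures A" "\<nu> \<in> prob_measures A"
  shows "0 \<le> wasserstein1 A \<mu> \<nu>"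
proof -
  interpret \<mu>: prob_space \<mu> using assms by (simp add: prob_measures_iff)
  interpret \<nu>: prob_space \<nu> using assms by (simp add: prob_measures_iff)
  \<comment> \<open>The infimum runs over a nonempty set: the product measure is a coupling.\<close>
  interpret pair_prob_space \<mu> \<nu> ..
  have s: "sets \<mu> = sets (restrict_space borel A)" "sets \<nu> = sets (restrict_space borel A)"
    using assms by (auto simp: prob_measures_iff)
  have snd_aux: "snd -` X \<inter> space \<mu> \<times> space \<nu> = space \<mu> \<times> X" if "X \<in> sets \<nu>" for X
    using sets.sets_into_space[OF that] by auto
  have "distr (\<mu> \<Otimes>\<^sub>M \<nu>) \<mu> fst = \<mu>" using \<nu>.distr_pair_fst[of \<mu>] by simp
  moreover have "distr (\<mu> \<Otimes>\<^sub>M \<nu>) \<nu> snd = \<nu>" 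
    by (rule measure_eqI) (auto simp: emeasure_distr space_pair_measure snd_aux \<nu>.emeasure_pair_measure_Times \<mu>.emeasure_space_1)
  ultimately have "\<mu> \<Otimes>\<^sub>M \<nu> \<in> couplings (restrict_space borel A) \<mu> \<nu>"
    using s by (auto simp: couplings_def space_prob_algebra prob_space_axioms cong: sets_pair_measure_cong distr_cong)
  then show ?thesis unfolding wasserstein1_def
    by (intro cINF_greatest) (auto intro!: integral_nonneg)
qed

text \<open>Two measures can be coupled so that both points lie in the same cell except on an event
  whose probability is the total variation distance of the cell masses. On that event the transport cost
  is at most the diameter of \<open>A\<close>, otherwise at most the diameter of a cell. The coupling is
  the product measure, reweighted by the maximal coupling density of the cells; the null cells, on which
  the weights are unconstrained, carry no mass.\<close>

lemma wasserstein1_le_partition: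
  fixes A :: "'b::euclidean_space set" and \<kappa> :: "'b \<Rightarrow> 'k"
  assumes \<mu>: "\<mu> \<in> prob_measures A" and \<nu>: "\<nu> \<in> prob_measures A"
    and K: "finite K" and \<kappa>: "\<kappa> \<in> restrict_space borel A \<rightarrow>\<^sub>M count_space K"
    and \<delta>: "\<And>x y. x \<in> A \<Longrightarrow> y \<in> A \<Longrightarrow> \<kappa> x = \<kappa> y \<Longrightarrow> norm (x - y) \<le> \<delta>"
    and D: "\<And>x y. x \<in> A \<Longrightarrow> y \<in> A \<Longrightarrow> norm (x - y) \<le> D" and "0 \<le> \<delta>" "0 \<le> D"
  shows "wasserstein1 A \<mu> \<nu> \<le> \<delta> + D * (\<Sum>k\<in>K. \<bar>measure \<mu> (\<kappa> -` {k} \<inter> A) - measure \<nu> (\<kappa> -` {k} \<inter> A)\<bar>)"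
proof -
  let ?M = "restrict_space borel A"
  have s: "sets \<mu> = sets ?M" "sets \<nu> = sets ?M" using \<mu> \<nu> by (auto simp: prob_measures_iff)
  have sp[simp]: "space \<mu> = A" "space \<nu> = A" using space_prob_measures \<mu> \<nu> by auto
  interpret \<mu>: prob_space \<mu> using \<mu> by (simp add: prob_measures_iff)
  interpret \<nu>: prob_space \<nu> using \<nu> by (simp add: prob_measures_iff)
  interpret pair_prob_space \<mu> \<nu> ..
  have \<kappa>1: "\<kappa> \<in> \<mu> \<rightarrow>\<^sub>M count_space K" and \<kappa>2: "\<kappa> \<in> \<nu> \<rightarrow>\<^sub>M count_space K"
    using \<kappa> s by (auto cong: measurable_cong_sets)
  have \<kappa>K: "\<kappa> x \<in> K" if "x \<in> A" for x using measurable_space[OF \<kappa>1] that by simp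
  define p where "p k = measure \<mu> (\<kappa> -` {k} \<inter> A)" for k
  define p' where "p' k = measure \<nu> (\<kappa> -` {k} \<inter> A)" for k
  note I1 = sum_blocks_integral[OF \<mu>.prob_space_axioms K \<kappa>1, folded p_def, simplified sp, folded p_def]
  note I2 = sum_blocks_integral[OF \<nu>.prob_space_axioms K \<kappa>2, folded p'_def, simplified sp, folded p'_def]
  have "sum p K = 1" "sum p' K = 1" using I1(2)[of "\<lambda>_. 1"] I2(2)[of "\<lambda>_. 1"] \<mu>.prob_space \<nu>.prob_space by auto
  note pp' = this
  have "0 \<le> p k" "0 \<le> p' k" for k by (simp_all add: p_def p'_def)
  then obtain H where H0: "\<And>k l. k \<in> K \<Longrightarrow> l \<in> K \<Longrightarrow> 0 \<le> H k l" and
    H1: "\<And>k. k \<in> K \<Longrightarrow> 0 < p k \<Longrightarrow> (\<Sum>l\<in>K. H k l * p' l) = 1" and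
    H2: "\<And>l. l \<in> K \<Longrightarrow> 0 < p' l \<Longrightarrow> (\<Sum>k\<in>K. H k l * p k) = 1" and
    H3: "(\<Sum>k\<in>K. \<Sum>l\<in>K. (if k = l then 0 else H k l * p k * p' l)) \<le> (\<Sum>k\<in>K. \<bar>p k - p' k\<bar>)"
    using maximal_coupling_weights[OF K, of p p'] pp' by blast
  define h where "h z = H (\<kappa> (fst z)) (\<kappa> (snd z))" for z
  have cK: "countable K" using K by (rule countable_finite)
  have Gm: "(\<lambda>z. G (\<kappa> (fst z)) (\<kappa> (snd z))) \<in> borel_measurable (\<mu> \<Otimes>\<^sub>M \<nu>)" for G :: "'k \<Rightarrow> 'k \<Rightarrow> real"
    by (rule measurable_compose_countable'[OF measurable_compose_countable'[OF _ measurable_compose[OF measurable_snd \<kappa>2] cK] measurable_compose[OF measurable_fst \<kappa>1] cK])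
       auto
  have hm[measurable]: "h \<in> borel_measurable (\<mu> \<Otimes>\<^sub>M \<nu>)" unfolding h_def by (rule Gm)
  have h0: "0 \<le> h z" if "z \<in> space (\<mu> \<Otimes>\<^sub>M \<nu>)" for z using that by (auto simp: h_def space_pair_measure intro!: H0 \<kappa>K)
  have pos1: "AE x in \<mu>. 0 < p (\<kappa> x)"
  proof -
    have "(\<integral>x. (if 0 < p (\<kappa> x) then 0 else 1::real) \<partial>\<mu>) = 0"
      by (subst I1(2)[of "\<lambda>k. if 0 < p k then 0 else 1"]) (auto intro!: sum.neutral simp: p_def zero_less_measure_iff)
    then have "AE x in \<mu>. (if 0 < p (\<kappa> x) then 0 else 1::real) = 0"
      by (subst (asm) integral_nonneg_eq_0_iff_AE[OF I1(1)[of "\<lambda>k. if 0 < p k then 0 else 1"]]) auto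
    then show ?thesis by eventually_elim (auto split: if_splits)
  qed
  have pos2: "AE x in \<nu>. 0 < p' (\<kappa> x)"
  proof -
    have "(\<integral>x. (if 0 < p' (\<kappa> x) then 0 else 1::real) \<partial>\<nu>) = 0"
      by (subst I2(2)[of "\<lambda>k. if 0 < p' k then 0 else 1"]) (auto intro!: sum.neutral simp: p'_def zero_less_measure_iff)
    then have "AE x in \<nu>. (if 0 < p' (\<kappa> x) then 0 else 1::real) = 0"
      by (subst (asm) integral_nonneg_eq_0_iff_AE[OF I2(1)[of "\<lambda>k. if 0 < p' k then 0 else 1"]]) auto
    then show ?thesis by eventually_elim (auto split: if_splits)
  qed
  \<comment> \<open>The weight integrates to 1 along almost every section, which gives the
    marginals.\<close>
  have in1: "AE x in \<mu>. (\<integral>\<^sup>+y. ennreal (h (x, y)) \<partial>\<nu>) = 1"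
    using pos1 AE_space
  proof eventually_elim
    case (elim x)
    have "(\<integral>\<^sup>+y. ennreal (h (x, y)) \<partial>\<nu>) = ennreal (\<integral>y. H (\<kappa> x) (\<kappa> y) \<partial>\<nu>)"
      unfolding h_def fst_conv snd_conv using elim by (subst nn_integral_eq_integral[OF I2(1)[of "H (\<kappa> x)"]]) (auto intro!: AE_I2 H0 \<kappa>K)
    also have "\<dots> = 1" using elim H1[OF \<kappa>K, of x] by (subst I2(2)) auto
    finally show ?case .
  qed
  have in2: "AE y in \<nu>. (\<integral>\<^sup>+x. ennreal (h (x, y)) \<partial>\<mu>) = 1"
    using pos2 AE_space
  proof eventually_elim
    case (elim y)
    have "(\<integral>\<^sup>+x. ennreal (h (x, y)) \<partial>\<mu>) = ennreal (\<integral>x. H (\<kappa> x) (\<kappa> y) \<partial>\<mu>)"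
      unfolding h_def fst_conv snd_conv using elim by (subst nn_integral_eq_integral[OF I1(1)[of "\<lambda>k. H k (\<kappa> y)"]]) (auto intro!: AE_I2 H0 \<kappa>K)
    also have "\<dots> = 1" using elim H2[OF \<kappa>K, of y] by (subst I1(2)[of "\<lambda>k. H k (\<kappa> y)"]) auto
    finally show ?case .
  qed
  define \<pi> where "\<pi> = density (\<mu> \<Otimes>\<^sub>M \<nu>) h"
  have sp_\<pi>: "sets \<pi> = sets (?M \<Otimes>\<^sub>M ?M)" unfolding \<pi>_def using s by (simp cong: sets_pair_measure_cong)
  have m1: "distr \<pi> ?M fst = \<mu>"
  proof (rule measure_eqI)
    show "sets (distr \<pi> ?M fst) = sets \<mu>" using s by simp
    fix X assume "X \<in> sets (distr \<pi> ?M fst)"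
    then have X[measurable]: "X \<in> sets \<mu>" using s by simp
    have "emeasure (distr \<pi> ?M fst) X = emeasure \<pi> (fst -` X \<inter> space \<pi>)"
      using X s by (intro emeasure_distr) (auto simp: \<pi>_def cong: measurable_cong_sets)
    also have "\<dots> = (\<integral>\<^sup>+z. ennreal (h z) * indicator (fst -` X \<inter> space \<pi>) z \<partial>(\<mu> \<Otimes>\<^sub>M \<nu>))"
      unfolding \<pi>_def by (subst emeasure_density) auto
    also have "\<dots> = (\<integral>\<^sup>+z. ennreal (h z) * indicator X (fst z) \<partial>(\<mu> \<Otimes>\<^sub>M \<nu>))"
      by (intro nn_integral_cong) (auto simp: \<pi>_def indicator_def)
    also have "\<dots> = (\<integral>\<^sup>+x. \<integral>\<^sup>+y. ennreal (h (x, y)) * indicator X x \<partial>\<nu> \<partial>\<mu>)"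
      by (subst \<nu>.nn_integral_fst[symmetric]) auto
    also have "\<dots> = (\<integral>\<^sup>+x. (\<integral>\<^sup>+y. ennreal (h (x, y)) \<partial>\<nu>) * indicator X x \<partial>\<mu>)"
      by (intro nn_integral_cong nn_integral_multc) simp
    also have "\<dots> = (\<integral>\<^sup>+x. indicator X x \<partial>\<mu>)"
      by (rule nn_integral_cong_AE, use in1 in eventually_elim) simp
    finally show "emeasure (distr \<pi> ?M fst) X = emeasure \<mu> X" using X by simp
  qed
  have m2: "distr \<pi> ?M snd = \<nu>"
  proof (rule measure_eqI)
    show "sets (distr \<pi> ?M snd) = sets \<nu>" using s by simp
    fix X assume "X \<in> sets (distr \<pi> ?M snd)"
    then have X[measurable]: "X \<in> sets \<nu>" using s by simp
    have "emeasure (distr \<pi> ?M snd) X = emeasure \<pi> (snd -` X \<inter> space \<pi>)"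
      using X s by (intro emeasure_distr) (auto simp: \<pi>_def cong: measurable_cong_sets)
    also have "\<dots> = (\<integral>\<^sup>+z. ennreal (h z) * indicator (snd -` X \<inter> space \<pi>) z \<partial>(\<mu> \<Otimes>\<^sub>M \<nu>))"
      unfolding \<pi>_def by (subst emeasure_density) auto
    also have "\<dots> = (\<integral>\<^sup>+z. ennreal (h z) * indicator X (snd z) \<partial>(\<mu> \<Otimes>\<^sub>M \<nu>))"
      by (intro nn_integral_cong) (auto simp: \<pi>_def indicator_def)
    also have "\<dots> = (\<integral>\<^sup>+y. \<integral>\<^sup>+x. ennreal (h (x, y)) * indicator X y \<partial>\<mu> \<partial>\<nu>)"
      by (subst nn_integral_snd[symmetric]) (auto simp: split_beta')
    also have "\<dots> = (\<integral>\<^sup>+y. (\<integral>\<^sup>+x. ennreal (h (x, y)) \<partial>\<mu>) * indicator X y \<partial>\<nu>)"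
      by (intro nn_integral_cong nn_integral_multc) simp
    also have "\<dots> = (\<integral>\<^sup>+y. indicator X y \<partial>\<nu>)"
      by (rule nn_integral_cong_AE, use in2 in eventually_elim) simp
    finally show "emeasure (distr \<pi> ?M snd) X = emeasure \<nu> X" using X by simp
  qed
  have "emeasure (distr \<pi> ?M fst) (space ?M) = 1" unfolding m1 using \<mu>.emeasure_space_1 by (simp add: space_restrict_space)
  then have ps: "prob_space \<pi>"
  proof (intro prob_spaceI)
    assume "emeasure (distr \<pi> ?M fst) (space ?M) = 1"
    moreover have f: "fst \<in> \<pi> \<rightarrow>\<^sub>M ?M" using sp_\<pi> by (auto cong: measurable_cong_sets)
    moreover have "fst -` space ?M \<inter> space \<pi> = space \<pi>" using measurable_space[OF f] by auto
    ultimately show "emeasure \<pi> (space \<pi>) = 1"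
      by (simp add: emeasure_distr)
  qed
  have "\<pi> \<in> couplings ?M \<mu> \<nu>"
    by (auto simp: couplings_def space_prob_algebra sp_\<pi> m1 m2 ps)
  then have "wasserstein1 A \<mu> \<nu> \<le> (\<integral>z. norm (fst z - snd z) \<partial>\<pi>)" by (rule wasserstein1_le_coupling)
  also have "\<dots> \<le> (\<integral>z. \<delta> + D * (if \<kappa> (fst z) = \<kappa> (snd z) then 0 else 1) \<partial>\<pi>)"
  proof (rule integral_mono')
    interpret \<pi>: prob_space \<pi> by fact
    have [measurable]: "(\<lambda>z. if \<kappa> (fst z) = \<kappa> (snd z) then 0 else 1::real) \<in> borel_measurable (\<mu> \<Otimes>\<^sub>M \<nu>)" by (rule Gm[of "\<lambda>k l. if k = l then 0 else 1"])
    then show "integrable \<pi> (\<lambda>z. \<delta> + D * (if \<kappa> (fst z) = \<kappa> (snd z) then 0 else 1))"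
      by (intro \<pi>.integrable_const_bound[where B="\<delta> + D"]) (auto simp: \<pi>_def assms)
    fix z assume "z \<in> space \<pi>"
    then show "norm (fst z - snd z) \<le> \<delta> + D * (if \<kappa> (fst z) = \<kappa> (snd z) then 0 else 1)"
      using \<delta>[of "fst z" "snd z"] D[of "fst z" "snd z"] \<open>0 \<le> \<delta>\<close> by (auto simp: \<pi>_def space_pair_measure)
  qed (auto simp: assms)
  also have "\<dots> = \<delta> + D * (\<integral>z. (if \<kappa> (fst z) = \<kappa> (snd z) then 0 else 1) \<partial>\<pi>)"
  proof -
    interpret \<pi>: prob_space \<pi> by fact
    have [measurable]: "(\<lambda>z. if \<kappa> (fst z) = \<kappa> (snd z) then 0 else 1::real) \<in> borel_measurable (\<mu> \<Otimes>\<^sub>M \<nu>)" by (rule Gm[of "\<lambda>k l. if k = l then 0 else 1"])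
    then have "integrable \<pi> (\<lambda>z. (if \<kappa> (fst z) = \<kappa> (snd z) then 0 else 1::real))"
      by (intro \<pi>.integrable_const_bound[where B=1]) (auto simp: \<pi>_def)
    then show ?thesis by (simp add: \<pi>.prob_space)
  qed
  also have "(\<integral>z. (if \<kappa> (fst z) = \<kappa> (snd z) then 0 else 1) \<partial>\<pi>)
      = (\<integral>z. h z * (if \<kappa> (fst z) = \<kappa> (snd z) then 0 else 1) \<partial>(\<mu> \<Otimes>\<^sub>M \<nu>))"
    unfolding \<pi>_def by (subst integral_density) (auto intro!: AE_I2 h0 Gm[of "\<lambda>k l. if k = l then 0 else 1"])
  also have "\<dots> = (\<integral>x. \<integral>y. h (x, y) * (if \<kappa> x = \<kappa> y then 0 else 1) \<partial>\<nu> \<partial>\<mu>)"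
  proof -
    define Hm where "Hm = (\<Sum>k\<in>K. \<Sum>l\<in>K. \<bar>H k l\<bar>)"
    have Hm: "\<bar>H k l\<bar> \<le> Hm" if "k \<in> K" "l \<in> K" for k l
    proof -
      have "\<bar>H k l\<bar> \<le> (\<Sum>l\<in>K. \<bar>H k l\<bar>)" using that K by (intro member_le_sum) auto
      also have "\<dots> \<le> Hm" unfolding Hm_def using that K by (intro member_le_sum[where f="\<lambda>k. \<Sum>l\<in>K. \<bar>H k l\<bar>"]) (auto intro!: sum_nonneg)
      finally show ?thesis .
    qed
    have "integrable (\<mu> \<Otimes>\<^sub>M \<nu>) (\<lambda>z. h z * (if \<kappa> (fst z) = \<kappa> (snd z) then 0 else 1))"
    proof (intro integrable_const_bound[where B=Hm] AE_I2)
      fix z assume "z \<in> space (\<mu> \<Otimes>\<^sub>M \<nu>)"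
      then have "\<bar>h z\<bar> \<le> Hm" unfolding h_def by (intro Hm) (auto simp: space_pair_measure intro!: \<kappa>K)
      then show "norm (h z * (if \<kappa> (fst z) = \<kappa> (snd z) then 0 else 1)) \<le> Hm" by auto
    qed (rule borel_measurable_times[OF hm Gm[of "\<lambda>k l. if k = l then 0 else 1"]])
    then show ?thesis by (subst integral_fst'[symmetric]) auto
  qed
  also have "\<dots> = (\<integral>x. (\<Sum>l\<in>K. (if \<kappa> x = l then 0 else H (\<kappa> x) l * p' l)) \<partial>\<mu>)"
    unfolding h_def fst_conv snd_conv
    by (subst I2(2)[of "\<lambda>l. H (\<kappa> x) l * (if \<kappa> x = l then 0 else 1)" for x])
       (auto intro!: Bochner_Integration.integral_cong sum.cong)
  also have "\<dots> = (\<Sum>k\<in>K. \<Sum>l\<in>K. (if k = l then 0 else H k l * p k * p' l))"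
    by (subst I1(2)[of "\<lambda>k. (\<Sum>l\<in>K. (if k = l then 0 else H k l * p' l))"])
       (auto intro!: sum.cong simp: sum_distrib_right)
  also have "\<delta> + D * \<dots> \<le> \<delta> + D * (\<Sum>k\<in>K. \<bar>p k - p' k\<bar>)" using H3 \<open>0 \<le> D\<close> by (auto intro!: mult_left_mono)
  finally show ?thesis by (simp add: p_def p'_def)
qed

text \<open>A finite net yields a finite measurable partition: a point belongs to the cell of the first
  centre that is close to it.\<close>

lemma compact_small_cells:
  fixes A :: "'b::euclidean_space set"
  assumes "compact A" "0 < \<delta>"
  obtains \<kappa> :: "'b \<Rightarrow> nat" and n where "\<kappa> \<in> restrict_space borel A \<rightarrow>\<^sub>M count_space {..<n}"
    "\<And>x y. x \<in> A \<Longrightarrow> y \<in> A \<Longrightarrow> \<kappa> x = \<kappa> y \<Longrightarrow> norm (x - y) \<le> \<delta>"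
proof -
  obtain C where C: "finite C" "A \<subseteq> (\<Union>x\<in>C. ball x (\<delta>/2))"
    using compactE_image[OF assms(1), of A "\<lambda>x. ball x (\<delta>/2)"] \<open>0 < \<delta>\<close>
    by (metis UN_I centre_in_ball half_gt_zero open_ball subsetI)
  obtain c and n :: nat where c: "C = c ` {i. i < n}"
    using finite_imp_nat_seg_image_inj_on[OF C(1)] by blast
  define \<kappa> where "\<kappa> x = (LEAST i. dist (c i) x < \<delta>/2)" for x
  have ex: "\<exists>i<n. dist (c i) x < \<delta>/2" if "x \<in> A" for x using C c that by (auto simp: subset_eq)
  have k: "\<kappa> x < n" "dist (c (\<kappa> x)) x < \<delta>/2" if x: "x \<in> A" for x
    using ex[OF x] unfolding \<kappa>_def by (meson LeastI le_less_trans Least_le)+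
  have "\<kappa> \<in> restrict_space borel A \<rightarrow>\<^sub>M count_space UNIV"
    unfolding \<kappa>_def by (intro measurable_restrict_space1) measurable
  then have "\<kappa> \<in> restrict_space borel A \<rightarrow>\<^sub>M count_space {..<n}"
    using k(1) by (auto simp: measurable_count_space_eq2_countable space_restrict_space measurable_count_space_eq2)
  moreover have "norm (x - y) \<le> \<delta>" if "x \<in> A" "y \<in> A" "\<kappa> x = \<kappa> y" for x y
    using k(2)[OF that(1)] k(2)[OF that(2)] dist_triangle_half_r[of "c (\<kappa> x)" x \<delta> y] that(3) by (simp add: dist_norm)
  ultimately show ?thesis using that by blast
qed

section \<open>Measurability of Lipschitz data\<close>

text \<open>The regularity shared by the rates and the running cost: measurable in time for frozen other
  arguments and Lipschitz in these, uniformly in time.\<close>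

definition caratheodory_lipschitz ::
    "real \<Rightarrow> (real^'l) set \<Rightarrow> real \<Rightarrow> (real \<Rightarrow> real^'l \<Rightarrow> real^'m \<Rightarrow> (real^'l) measure \<Rightarrow> real) \<Rightarrow> bool" where
  "caratheodory_lipschitz T A C F \<longleftrightarrow> 0 \<le> C \<and>
     (\<forall>\<alpha>\<in>A. \<forall>p\<in>prob_simplex. \<forall>\<nu>\<in>prob_measures A.
        (\<lambda>t. F t \<alpha> p \<nu>) \<in> borel_measurable (restrict_space borel {0..T})) \<and>
     (\<forall>t\<in>{0..T}. \<forall>\<alpha>\<in>A. \<forall>\<alpha>'\<in>A. \<forall>p\<in>prob_simplex. \<forall>p'\<in>prob_simplex.
        \<forall>\<nu>\<in>prob_measures A. \<forall>\<nu>'\<in>prob_measures A.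
        \<bar>F t \<alpha> p \<nu> - F t \<alpha>' p' \<nu>'\<bar> \<le> C * (norm (\<alpha> - \<alpha>') + norm (p - p') + wasserstein1 A \<nu> \<nu>'))"

lemma compact_norm_diff_bound:
  fixes A :: "'b::real_normed_vector set"
  assumes "compact A"
  obtains D where "0 \<le> D" "\<And>x y. x \<in> A \<Longrightarrow> y \<in> A \<Longrightarrow> norm (x - y) \<le> D"
proof -
  obtain B where B: "\<And>x. x \<in> A \<Longrightarrow> norm x \<le> B" using compact_imp_bounded[OF assms] by (auto simp: bounded_iff)
  have "norm (x - y) \<le> 2 * \<bar>B\<bar>" if "x \<in> A" "y \<in> A" for x y
    using norm_triangle_ineq4[of x y] B[OF that(1)] B[OF that(2)] by linarith
  then show ?thesis using that[of "2 * \<bar>B\<bar>"] by auto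
qed

lemma compact_prob_simplex: "compact (prob_simplex :: (real^'m) set)"
proof -
  have *: "prob_simplex = (\<Inter>i. {p::real^'m. 0 \<le> p $ i}) \<inter> {p. (\<Sum>i\<in>UNIV. p $ i) = 1}"
    by (auto simp: prob_simplex_def)
  have "closed (prob_simplex :: (real^'m) set)"
    unfolding * by (intro closed_Int closed_INT ballI closed_Collect_le closed_Collect_eq continuous_intros)
  moreover have "bounded (prob_simplex :: (real^'m) set)"
    unfolding bounded_iff
  proof (intro exI ballI)
    fix p :: "real^'m" assume "p \<in> prob_simplex"
    then show "norm p \<le> 1" using norm_le_l1_cart[of p] by (simp add: prob_simplex_def)
  qed
  ultimately show ?thesis by (simp add: compact_eq_bounded_closed)
qed

lemma abs_diff_le_if_floor_eq:
  fixes x y :: real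
  assumes "\<lfloor>x * real M\<rfloor> = \<lfloor>y * real M\<rfloor>" "0 < M"
  shows "\<bar>x - y\<bar> \<le> 1 / real M"
proof -
  have "\<bar>x * real M - y * real M\<bar> \<le> 1" using assms(1) by linarith
  then have "\<bar>x - y\<bar> * real M \<le> 1" by (simp add: abs_mult left_diff_distrib[symmetric])
  then show ?thesis using assms(2) by (simp add: field_simps)
qed

lemma map_upt_eq_iff: "map g [0..<n] = l \<longleftrightarrow> length l = n \<and> (\<forall>k<n. g k = l ! k)"
  by (metis add_0 atLeastLessThan_upt diff_zero length_map length_upt nth_equalityI nth_map nth_upt)

text \<open>Joint measurability by quantisation. The action, the state distribution and the action law
  are replaced by representatives from finitely many classes, where two laws share a class if their
  masses on each small cell of \<open>A\<close> agree up to rounding. By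
  \<open>wasserstein1_le_partition\<close> this determines the law up to a small Wasserstein error. The
  law enters the code through the measurable functions \<open>x \<mapsto> \<nu> x B\<close>.\<close>

lemma measurable_caratheodory_lipschitz:
  fixes A :: "(real^'l) set" and F :: "real \<Rightarrow> real^'l \<Rightarrow> real^'m \<Rightarrow> (real^'l) measure \<Rightarrow> real"
  assumes F: "caratheodory_lipschitz T A C F" and A: "compact A"
    and \<tau>: "\<tau> \<in> M \<rightarrow>\<^sub>M restrict_space borel {0..T}"
    and a: "a \<in> M \<rightarrow>\<^sub>M restrict_space borel A"
    and p: "p \<in> M \<rightarrow>\<^sub>M restrict_space borel prob_simplex"
    and \<nu>: "\<And>x. x \<in> space M \<Longrightarrow> \<nu> x \<in> prob_measures A"
    and \<nu>m: "\<And>B. B \<in> sets (restrict_space borel A) \<Longrightarrow> (\<lambda>x. measure (\<nu> x) B) \<in> borel_measurable M"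
  shows "(\<lambda>x. F (\<tau> x) (a x) (p x) (\<nu> x)) \<in> borel_measurable M"
proof (cases "space M = {}")
  case True then show ?thesis by (simp add: measurable_def)
next
  case False
  obtain D where D: "0 \<le> D" "\<And>x y. x \<in> A \<Longrightarrow> y \<in> A \<Longrightarrow> norm (x - y) \<le> D"
    using compact_norm_diff_bound[OF A] by blast
  define Dom :: "((real^'l) \<times> (real^'m) \<times> (real^'l) measure) set" where "Dom = A \<times> prob_simplex \<times> prob_measures A"
  have C: "0 \<le> C" using F by (simp add: caratheodory_lipschitz_def)
  have sp: "\<tau> x \<in> {0..T}" "a x \<in> A" "p x \<in> prob_simplex" "(a x, p x, \<nu> x) \<in> Dom" if "x \<in> space M" for x
    using measurable_space[OF \<tau> that] measurable_space[OF a that] measurable_space[OF p that] \<nu>[OF that]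
    by (auto simp: Dom_def space_restrict_space)
  have approx: "\<exists>G \<in> borel_measurable M. \<forall>x\<in>space M. \<bar>F (\<tau> x) (a x) (p x) (\<nu> x) - G x\<bar> \<le> 4 * C * \<epsilon>"
    if \<epsilon>: "0 < \<epsilon>" for \<epsilon>
  proof -
    obtain \<kappa> n where \<kappa>: "\<kappa> \<in> restrict_space borel A \<rightarrow>\<^sub>M count_space {..<n::nat}"
      "\<And>x y. x \<in> A \<Longrightarrow> y \<in> A \<Longrightarrow> \<kappa> x = \<kappa> y \<Longrightarrow> norm (x - y) \<le> \<epsilon>"
      using compact_small_cells[OF A \<epsilon>] by blast
    obtain \<kappa>' n' where \<kappa>': "\<kappa>' \<in> restrict_space borel prob_simplex \<rightarrow>\<^sub>M count_space {..<n'::nat}"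
      "\<And>x y::real^'m. x \<in> prob_simplex \<Longrightarrow> y \<in> prob_simplex \<Longrightarrow> \<kappa>' x = \<kappa>' y \<Longrightarrow> norm (x - y) \<le> \<epsilon>"
      using compact_small_cells[OF compact_prob_simplex \<epsilon>] by blast
    define B where "B k = \<kappa> -` {k} \<inter> A" for k
    have B: "B k \<in> sets (restrict_space borel A)" if "k < n" for k
      using measurable_sets[OF \<kappa>(1), of "{k}"] that by (simp add: B_def space_restrict_space)
    \<comment> \<open>Masses are rounded down to multiples of \<open>1 / Q\<close>, fine enough that the
      rounding errors of all cells together cost at most \<open>\<epsilon>\<close>.\<close>
    define Q where "Q = Suc (nat \<lceil>D * real n / \<epsilon>\<rceil>)"
    have Q: "0 < Q" "D * real n / real Q \<le> \<epsilon>"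
    proof -
      have "D * real n / \<epsilon> \<le> real Q" unfolding Q_def by linarith
      then show "D * real n / real Q \<le> \<epsilon>" using \<epsilon> by (simp add: Q_def field_simps)
    qed (simp add: Q_def)
    define \<Gamma> :: "(real^'l) \<times> (real^'m) \<times> (real^'l) measure \<Rightarrow> nat \<times> nat \<times> int list" where
      "\<Gamma> = (\<lambda>(\<alpha>, p, \<nu>). (\<kappa> \<alpha>, \<kappa>' p, map (\<lambda>k. \<lfloor>measure \<nu> (B k) * real Q\<rfloor>) [0..<n]))"
    \<comment> \<open>Unattained codes get an arbitrary element of the domain, so that \<open>F\<close> is
      measurable in time there too.\<close>
    define rep where "rep c = (SOME z. z \<in> Dom \<and> (c \<in> \<Gamma> ` Dom \<longrightarrow> \<Gamma> z = c))" for c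
    have "Dom \<noteq> {}" using False sp by blast
    have rep: "rep c \<in> Dom \<and> (c \<in> \<Gamma> ` Dom \<longrightarrow> \<Gamma> (rep c) = c)" for c
      unfolding rep_def by (rule someI_ex) (use \<open>Dom \<noteq> {}\<close> in blast)
    define G where "G x = (case rep (\<Gamma> (a x, p x, \<nu> x)) of (\<alpha>, p, \<nu>) \<Rightarrow> F (\<tau> x) \<alpha> p \<nu>)" for x
    have "G \<in> borel_measurable M" unfolding G_def
    proof (rule measurable_compose_countable)
      fix c
      obtain \<alpha> p' \<nu>' where c: "rep c = (\<alpha>, p', \<nu>')" by (cases "rep c")
      then have "(\<lambda>t. F t \<alpha> p' \<nu>') \<in> borel_measurable (restrict_space borel {0..T})"
        using rep[of c] F by (auto simp: Dom_def caratheodory_lipschitz_def)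
      from measurable_compose[OF \<tau> this]
      show "(\<lambda>x. case rep c of (\<alpha>, p, \<nu>) \<Rightarrow> F (\<tau> x) \<alpha> p \<nu>) \<in> borel_measurable M" by (simp add: c)
    next
      have 1: "(\<lambda>x. \<kappa> (a x)) \<in> M \<rightarrow>\<^sub>M count_space UNIV"
        by (rule measurable_compose[OF measurable_compose[OF a \<kappa>(1)] measurable_count_space])
      have 2: "(\<lambda>x. \<kappa>' (p x)) \<in> M \<rightarrow>\<^sub>M count_space UNIV"
        by (rule measurable_compose[OF measurable_compose[OF p \<kappa>'(1)] measurable_count_space])
      have 3: "(\<lambda>x. map (\<lambda>k. \<lfloor>measure (\<nu> x) (B k) * real Q\<rfloor>) [0..<n]) \<in> M \<rightarrow>\<^sub>M count_space UNIV"
      proof (rule measurableI)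
        have single: "(\<lambda>x. map (\<lambda>k. \<lfloor>measure (\<nu> x) (B k) * real Q\<rfloor>) [0..<n]) -` {l} \<inter> space M \<in> sets M" for l :: "int list"
        proof -
          have "(\<lambda>x. map (\<lambda>k. \<lfloor>measure (\<nu> x) (B k) * real Q\<rfloor>) [0..<n]) -` {l} \<inter> space M
              = {x \<in> space M. \<forall>k\<in>{..<n}. length l = n \<and> \<lfloor>measure (\<nu> x) (B k) * real Q\<rfloor> = l ! k} \<inter> {x \<in> space M. length l = n}"
            unfolding vimage_def by (auto simp: map_upt_eq_iff)
          also have "\<dots> \<in> sets M"
          proof (rule sets.Int[OF sets.sets_Collect_finite_All sets.sets_Collect_const])
            fix k assume "k \<in> {..<n}"
            then have [measurable]: "(\<lambda>x. measure (\<nu> x) (B k)) \<in> borel_measurable M" using \<nu>m B by auto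
            show "{x \<in> space M. length l = n \<and> \<lfloor>measure (\<nu> x) (B k) * real Q\<rfloor> = l ! k} \<in> sets M" by measurable
          qed auto
          finally show ?thesis .
        qed
        fix X :: "int list set"
        have "(\<lambda>x. map (\<lambda>k. \<lfloor>measure (\<nu> x) (B k) * real Q\<rfloor>) [0..<n]) -` X \<inter> space M
            = (\<Union>l\<in>X. (\<lambda>x. map (\<lambda>k. \<lfloor>measure (\<nu> x) (B k) * real Q\<rfloor>) [0..<n]) -` {l} \<inter> space M)" by auto
        also have "\<dots> \<in> sets M"
          by (rule sets.countable_UN'[OF countableI_type]) (use single in blast)+
        finally show "(\<lambda>x. map (\<lambda>k. \<lfloor>measure (\<nu> x) (B k) * real Q\<rfloor>) [0..<n]) -` X \<inter> space M \<in> sets M" .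
      qed simp
      show "(\<lambda>x. \<Gamma> (a x, p x, \<nu> x)) \<in> M \<rightarrow>\<^sub>M count_space UNIV"
        unfolding \<Gamma>_def prod.case
        using measurable_Pair[OF 1 measurable_Pair[OF 2 3]]
        by (simp add: pair_measure_countable)
    qed
    moreover have "\<bar>F (\<tau> x) (a x) (p x) (\<nu> x) - G x\<bar> \<le> 4 * C * \<epsilon>" if x: "x \<in> space M" for x
    proof -
      obtain \<alpha> p' \<nu>' where c: "rep (\<Gamma> (a x, p x, \<nu> x)) = (\<alpha>, p', \<nu>')" by (cases "rep (\<Gamma> (a x, p x, \<nu> x))")
      have d: "\<alpha> \<in> A" "p' \<in> prob_simplex" "\<nu>' \<in> prob_measures A" and g: "\<Gamma> (\<alpha>, p', \<nu>') = \<Gamma> (a x, p x, \<nu> x)"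
        using rep[of "\<Gamma> (a x, p x, \<nu> x)"] c sp(4)[OF x] by (auto simp: Dom_def)
      have 1: "norm (a x - \<alpha>) \<le> \<epsilon>" using g by (intro \<kappa>(2)) (auto simp: \<Gamma>_def d sp x)
      have 2: "norm (p x - p') \<le> \<epsilon>" using g by (intro \<kappa>'(2)) (auto simp: \<Gamma>_def d sp x)
      have "wasserstein1 A (\<nu> x) \<nu>' \<le> \<epsilon> + D * (\<Sum>k<n. \<bar>measure (\<nu> x) (B k) - measure \<nu>' (B k)\<bar>)"
        unfolding B_def by (rule wasserstein1_le_partition[OF \<nu>[OF x] d(3) _ \<kappa>(1) \<kappa>(2) D(2)]) (use \<epsilon> D in auto)
      also have "(\<Sum>k<n. \<bar>measure (\<nu> x) (B k) - measure \<nu>' (B k)\<bar>) \<le> (\<Sum>k<n. 1 / real Q)"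
        using g Q(1) by (intro sum_mono abs_diff_le_if_floor_eq) (auto simp: \<Gamma>_def)
      also have "D * (\<Sum>k<n. 1 / real Q) \<le> \<epsilon>" using Q by simp
      finally have 3: "wasserstein1 A (\<nu> x) \<nu>' \<le> \<epsilon> + \<epsilon>" using D(1) by (simp add: mult_left_mono)
      have "\<bar>F (\<tau> x) (a x) (p x) (\<nu> x) - F (\<tau> x) \<alpha> p' \<nu>'\<bar>
          \<le> C * (norm (a x - \<alpha>) + norm (p x - p') + wasserstein1 A (\<nu> x) \<nu>')"
        using F sp[OF x] d \<nu>[OF x] by (auto simp: caratheodory_lipschitz_def)
      also have "\<dots> \<le> C * (4 * \<epsilon>)" using 1 2 3 C by (intro mult_left_mono) auto
      finally show ?thesis by (simp add: G_def c mult_ac)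
    qed
    ultimately show ?thesis by blast
  qed
  have "\<exists>G. \<forall>i. G i \<in> borel_measurable M \<and> (\<forall>x\<in>space M. \<bar>F (\<tau> x) (a x) (p x) (\<nu> x) - G i x\<bar> \<le> 4 * C * inverse (real (Suc i)))"
    by (rule choice) (use approx[of "inverse (real (Suc i))" for i] in \<open>auto simp: Bex_def\<close>)
  then obtain G where G: "\<And>i. G i \<in> borel_measurable M"
    "\<And>i x. x \<in> space M \<Longrightarrow> \<bar>F (\<tau> x) (a x) (p x) (\<nu> x) - G i x\<bar> \<le> 4 * C * inverse (real (Suc i))"
    by blast
  show ?thesis
  proof (rule borel_measurable_LIMSEQ_real[OF _ G(1)])
    fix x assume x: "x \<in> space M"
    have "\<bar>G i x - F (\<tau> x) (a x) (p x) (\<nu> x)\<bar> \<le> 4 * C * inverse (real (Suc i))" for i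
      using G(2)[OF x, of i] by (subst abs_minus_commute)
    then have "eventually (\<lambda>i. norm (G i x - F (\<tau> x) (a x) (p x) (\<nu> x)) \<le> 4 * C * inverse (real (Suc i))) sequentially"
      unfolding real_norm_def by (intro always_eventually allI)
    moreover have "(\<lambda>i. 4 * C * inverse (real (Suc i))) \<longlonglongrightarrow> 0"
      using tendsto_mult[OF tendsto_const LIMSEQ_inverse_real_of_nat, of "4 * C"] by simp
    ultimately have "(\<lambda>i. G i x - F (\<tau> x) (a x) (p x) (\<nu> x)) \<longlonglongrightarrow> 0"
      by (rule Lim_null_comparison)
    then show "(\<lambda>i. G i x) \<longlonglongrightarrow> F (\<tau> x) (a x) (p x) (\<nu> x)" by (simp add: LIM_zero_iff)
  qed
qed

lemma wasserstein1_bounded: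
  fixes A :: "(real^'l) set"
  assumes "compact A"
  obtains D where "0 \<le> D" "\<And>\<mu> \<nu>. \<mu> \<in> prob_measures A \<Longrightarrow> \<nu> \<in> prob_measures A \<Longrightarrow> wasserstein1 A \<mu> \<nu> \<le> D"
    "\<And>x y. x \<in> A \<Longrightarrow> y \<in> A \<Longrightarrow> norm (x - y) \<le> D"
proof -
  obtain D where D: "0 \<le> D" "\<And>x y. x \<in> A \<Longrightarrow> y \<in> A \<Longrightarrow> norm (x - y) \<le> D"
    using compact_norm_diff_bound[OF assms] by blast
  \<comment> \<open>The partition into a single cell.\<close>
  have "wasserstein1 A \<mu> \<nu> \<le> D" if *: "\<mu> \<in> prob_measures A" "\<nu> \<in> prob_measures A" for \<mu> \<nu>
  proof -
    have "(\<lambda>_. ()) -` {()} \<inter> A = A" by auto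
    moreover have "measure \<mu> A = 1" "measure \<nu> A = 1"
      using * prob_space.prob_space[of \<mu>] prob_space.prob_space[of \<nu>] by (auto simp: prob_measures_iff space_prob_measures)
    ultimately show ?thesis
      using wasserstein1_le_partition[OF *, of UNIV "\<lambda>_. ()" D D] D by auto
  qed
  with D that show ?thesis by blast
qed

section \<open>Jumps of paths\<close>

definition jumps :: "real \<Rightarrow> (real \<Rightarrow> 'b::t2_space) \<Rightarrow> real set" where
  "jumps T \<omega> = {s \<in> {0<..T}. \<omega> s \<noteq> left_lim \<omega> s}"

text \<open>States are discrete, so one-sided limits of a path are attained on a one-sided
  neighbourhood. All path properties below come from this.\<close>

lemma states_eq_if_close:
  fixes x y :: "real^'m"
  assumes "x \<in> states" "y \<in> states" "dist x y < 1"
  shows "x = y"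
proof -
  obtain i j where ij: "x = axis i 1" "y = axis j 1" using assms by (auto simp: states_def)
  have "i = j"
  proof (rule ccontr)
    assume "i \<noteq> j"
    then have "1 \<le> \<bar>(x - y) $ i\<bar>" by (simp add: ij axis_def)
    also have "\<dots> \<le> dist x y" unfolding dist_norm by (rule component_le_norm_cart)
    finally show False using assms(3) by simp
  qed
  then show ?thesis by (simp add: ij)
qed

lemma left_lim_eqI:
  assumes "0 < s" "0 < d" "\<And>u. s - d < u \<Longrightarrow> u < s \<Longrightarrow> \<omega> u = c"
  shows "left_lim \<omega> s = c"
proof -
  have "eventually (\<lambda>u. \<omega> u = c) (at_left s)"
    unfolding eventually_at_left_field using assms by (intro exI[of _ "s - d"]) auto
  then have "(\<omega> \<longlongrightarrow> c) (at_left s)" by (rule tendsto_eventually)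
  then show ?thesis using assms(1) by (simp add: left_lim_def tendsto_Lim)
qed

lemma paths_in_states: "\<omega> \<in> paths T \<Longrightarrow> t \<in> {0..T} \<Longrightarrow> \<omega> t \<in> states"
  by (auto simp: paths_def)

lemma paths_right_constant:
  assumes \<omega>: "\<omega> \<in> paths T" and t: "t \<in> {0..<T}"
  obtains d where "0 < d" "\<And>s. t \<le> s \<Longrightarrow> s < t + d \<Longrightarrow> s \<le> T \<Longrightarrow> \<omega> s = \<omega> t"
proof -
  have "(\<omega> \<longlongrightarrow> \<omega> t) (at_right t)" using \<omega> t by (auto simp: paths_def continuous_within)
  then have "eventually (\<lambda>s. dist (\<omega> s) (\<omega> t) < 1) (at_right t)" by (rule tendstoD) simp
  then obtain b where b: "t < b" "\<And>s. t < s \<Longrightarrow> s < b \<Longrightarrow> dist (\<omega> s) (\<omega> t) < 1"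
    unfolding eventually_at_right_field by auto
  show ?thesis
  proof (rule that[of "b - t"])
    fix s assume s: "t \<le> s" "s < t + (b - t)" "s \<le> T"
    show "\<omega> s = \<omega> t"
      using s b(2)[of s] t by (cases "s = t") (auto intro!: states_eq_if_close paths_in_states[OF \<omega>])
  qed (use b in auto)
qed

lemma paths_left_constant:
  assumes \<omega>: "\<omega> \<in> paths T" and t: "t \<in> {0<..T}"
  obtains d where "0 < d" "d \<le> t" "\<And>s. t - d < s \<Longrightarrow> s < t \<Longrightarrow> \<omega> s = left_lim \<omega> t" "left_lim \<omega> t \<in> states"
proof -
  have "\<exists>x. (\<omega> \<longlongrightarrow> x) (at_left t)" using \<omega> t unfolding paths_def by blast
  then obtain x where "(\<omega> \<longlongrightarrow> x) (at_left t)" by blast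
  then have "eventually (\<lambda>s. dist (\<omega> s) x < 1/2) (at_left t)" by (rule tendstoD) simp
  then obtain b where b: "b < t" "\<And>s. b < s \<Longrightarrow> s < t \<Longrightarrow> dist (\<omega> s) x < 1/2"
    unfolding eventually_at_left_field by auto
  define b' where "b' = max b 0"
  define m where "m = (b' + t) / 2"
  have m: "b' < m" "m < t" "b' < t" using b t by (auto simp: m_def b'_def)
  have c: "\<omega> s = \<omega> m" if "b' < s" "s < t" for s
  proof (rule states_eq_if_close)
    show "dist (\<omega> s) (\<omega> m) < 1" using b(2)[of s] b(2)[of m] that m dist_triangle_half_l[of "\<omega> s" x 1 "\<omega> m"]
      by (auto simp: b'_def)
  qed (use that m t in \<open>auto intro!: paths_in_states[OF \<omega>] simp: b'_def\<close>)
  have l: "left_lim \<omega> t = \<omega> m" 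
  proof (rule left_lim_eqI[where d="t - b'"])
    show "\<omega> u = \<omega> m" if "t - (t - b') < u" "u < t" for u using that by (intro c) auto
  qed (use m t in auto)
  show ?thesis
  proof (rule that[of "t - b'"])
    show "left_lim \<omega> t \<in> states" unfolding l by (rule paths_in_states[OF \<omega>]) (use m t in \<open>simp add: b'_def\<close>)
    show "\<omega> s = left_lim \<omega> t" if "t - (t - b') < s" "s < t" for s using c[of s] that l by simp
  qed (use m in \<open>auto simp: b'_def\<close>)
qed

lemma left_lim_in_states:
  assumes "\<omega> \<in> paths T" "s \<in> {0..T}"
  shows "left_lim \<omega> s \<in> states"
proof (cases "s = 0")
  case True then show ?thesis using assms paths_in_states[OF assms(1), of 0] by (simp add: left_lim_def)
next
  case False
  then have "s \<in> {0<..T}" using assms(2) by auto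
  then show ?thesis by (rule paths_left_constant[OF assms(1)])
qed

text \<open>Around each time a path is constant on either side, so the claim holds on short intervals
  around any point; it is additive over adjacent intervals, and the Bolzano bisection principle extends
  it to all intervals.\<close>

lemma paths_increment_sum_jumps:
  fixes \<omega> :: "real \<Rightarrow> real^'m"
  assumes \<omega>: "\<omega> \<in> paths T" and ab: "0 \<le> a" "a \<le> b" "b \<le> T"
  shows "finite (jumps T \<omega> \<inter> {a<..b}) \<and>
    \<omega> b - \<omega> a = (\<Sum>\<tau>\<in>jumps T \<omega> \<inter> {a<..b}. \<omega> \<tau> - left_lim \<omega> \<tau>)"
proof -
  define P where "P a b \<longleftrightarrow> (0 \<le> a \<and> b \<le> T \<longrightarrow> finite (jumps T \<omega> \<inter> {a<..b}) \<and>
    \<omega> b - \<omega> a = (\<Sum>\<tau>\<in>jumps T \<omega> \<inter> {a<..b}. \<omega> \<tau> - left_lim \<omega> \<tau>))" for a b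
  have "P a b"
  proof (rule Bolzano[OF ab(2)])
    fix a b c assume *: "P a b" "P b c" "a \<le> b" "b \<le> c"
    show "P a c" unfolding P_def
    proof (intro impI)
      assume "0 \<le> a \<and> c \<le> T"
      with * have f: "finite (jumps T \<omega> \<inter> {a<..b})" "finite (jumps T \<omega> \<inter> {b<..c})"
        and s: "\<omega> b - \<omega> a = (\<Sum>\<tau>\<in>jumps T \<omega> \<inter> {a<..b}. \<omega> \<tau> - left_lim \<omega> \<tau>)"
          "\<omega> c - \<omega> b = (\<Sum>\<tau>\<in>jumps T \<omega> \<inter> {b<..c}. \<omega> \<tau> - left_lim \<omega> \<tau>)" by (auto simp: P_def)
      have e: "jumps T \<omega> \<inter> {a<..c} = (jumps T \<omega> \<inter> {a<..b}) \<union> (jumps T \<omega> \<inter> {b<..c})" using * by auto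
      have "(\<Sum>\<tau>\<in>jumps T \<omega> \<inter> {a<..c}. \<omega> \<tau> - left_lim \<omega> \<tau>) = (\<omega> b - \<omega> a) + (\<omega> c - \<omega> b)"
        unfolding e s by (rule sum.union_disjoint[OF f]) auto
      then show "finite (jumps T \<omega> \<inter> {a<..c}) \<and> \<omega> c - \<omega> a = (\<Sum>\<tau>\<in>jumps T \<omega> \<inter> {a<..c}. \<omega> \<tau> - left_lim \<omega> \<tau>)"
        using f by (simp add: e)
    qed
  next
    fix x assume "a \<le> x" "x \<le> b"
    then have x: "0 \<le> x" "x \<le> T" using ab by auto
    have "\<exists>d>0. \<forall>s. x \<le> s \<longrightarrow> s < x + d \<longrightarrow> s \<le> T \<longrightarrow> \<omega> s = \<omega> x"
    proof (cases "x = T")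
      case True
      then show ?thesis by (auto intro!: exI[of _ 1] arg_cong[where f=\<omega>])
    next
      case False
      then have "x \<in> {0..<T}" using x by simp
      then show ?thesis by (rule paths_right_constant[OF \<omega>]) blast
    qed
    then obtain d1 where d1: "0 < d1" "\<And>s. x \<le> s \<Longrightarrow> s < x + d1 \<Longrightarrow> s \<le> T \<Longrightarrow> \<omega> s = \<omega> x"
      by blast
    have "\<exists>d>0. \<forall>s. 0 \<le> s \<longrightarrow> x - d < s \<longrightarrow> s < x \<longrightarrow> \<omega> s = left_lim \<omega> x"
    proof (cases "x = 0")
      case True
      then show ?thesis by (auto intro!: exI[of _ 1])
    next
      case False
      then have "x \<in> {0<..T}" using x by simp
      then show ?thesis by (rule paths_left_constant[OF \<omega>]) blast
    qed
    then obtain d2 where d2: "0 < d2" "\<And>s. 0 \<le> s \<Longrightarrow> x - d2 < s \<Longrightarrow> s < x \<Longrightarrow> \<omega> s = left_lim \<omega> x"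
      by blast
    show "\<exists>d>0. \<forall>a b. a \<le> x \<and> x \<le> b \<and> b - a < d \<longrightarrow> P a b"
    proof (intro exI[of _ "min d1 d2"] conjI allI impI)
      fix a b assume h: "a \<le> x \<and> x \<le> b \<and> b - a < min d1 d2"
      show "P a b" unfolding P_def
      proof (intro impI)
        assume h2: "0 \<le> a \<and> b \<le> T"
        have wb: "\<omega> b = \<omega> x" using h h2 by (intro d1) auto
        have "s = x" if s: "s \<in> jumps T \<omega> \<inter> {a<..b}" for s
        proof (rule ccontr)
          assume "s \<noteq> x"
          then consider "s < x" | "x < s" by linarith
          then show False
          proof cases
            case 1
            have "left_lim \<omega> s = left_lim \<omega> x"
              using 1 s h h2 by (intro left_lim_eqI[where d="s - a"] d2) auto
            moreover have "\<omega> s = left_lim \<omega> x" using 1 s h h2 by (intro d2) auto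
            ultimately show False using s by (simp add: jumps_def)
          next
            case 2
            have "left_lim \<omega> s = \<omega> x"
              using 2 s h h2 x by (intro left_lim_eqI[where d="s - x"] d1) auto
            moreover have "\<omega> s = \<omega> x" using 2 s h h2 by (intro d1) auto
            ultimately show False using s by (simp add: jumps_def)
          qed
        qed
        then have sub: "jumps T \<omega> \<inter> {a<..b} \<subseteq> {x}" by blast
        \<comment> \<open>On an interval around \<open>x\<close> this short, only \<open>x\<close> itself can be
          a jump, and it counts only if the interval starts before it.\<close>
        have mem: "x \<in> jumps T \<omega> \<inter> {a<..b} \<longleftrightarrow> a < x \<and> \<omega> x \<noteq> left_lim \<omega> x"
          using h h2 by (auto simp: jumps_def)
        have J: "jumps T \<omega> \<inter> {a<..b} = (if a < x \<and> \<omega> x \<noteq> left_lim \<omega> x then {x} else {})"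
          unfolding mem[symmetric] using sub by auto
        have "\<omega> a = left_lim \<omega> x" if "a < x" using that h h2 by (intro d2) auto
        then show "finite (jumps T \<omega> \<inter> {a<..b}) \<and>
            \<omega> b - \<omega> a = (\<Sum>\<tau>\<in>jumps T \<omega> \<inter> {a<..b}. \<omega> \<tau> - left_lim \<omega> \<tau>)"
          unfolding J using wb h by (cases "a = x") auto
      qed
    qed (use d1(1) d2(1) in auto)
  qed
  then show ?thesis using ab by (simp add: P_def)
qed

lemma jumps_subset: "jumps T \<omega> \<subseteq> {0<..T}"
  by (auto simp: jumps_def)

lemma finite_jumps:
  fixes \<omega> :: "real \<Rightarrow> real^'m"
  assumes "\<omega> \<in> paths T"
  shows "finite (jumps T \<omega>)"
proof (cases "0 \<le> T")
  case True
  moreover have "jumps T \<omega> \<inter> {0<..T} = jumps T \<omega>" using jumps_subset by blast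
  ultimately show ?thesis using paths_increment_sum_jumps[OF assms, of 0 T] by simp
next
  case False
  then have "jumps T \<omega> = {}" by (auto simp: jumps_def)
  then show ?thesis by simp
qed

text \<open>The number of jumps is a limit of quantities that depend on finitely many coordinates. Once
  the mesh is below the smallest gap between jumps, each cell of the grid contains at most one jump, and
  its end points differ exactly if it contains one.\<close>

lemma eventually_grid_changes_eq_jumps:
  fixes \<omega> :: "real \<Rightarrow> real^'m" and t T :: real
  assumes \<omega>: "\<omega> \<in> paths T" and t: "0 < t" "t \<le> T"
  shows "eventually (\<lambda>n. card {k. k < n \<and> \<omega> (t * k / n) \<noteq> \<omega> (t * Suc k / n)} = card (jumps T \<omega> \<inter> {0<..t})) sequentially"
proof -
  define J where "J = jumps T \<omega> \<inter> {0<..t}"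
  have fJ: "finite J" unfolding J_def using finite_jumps[OF \<omega>] by simp
  have "eventually (\<lambda>n. \<forall>z\<in>{z \<in> J \<times> J. fst z \<noteq> snd z}. t / real n < \<bar>fst z - snd z\<bar>) sequentially"
  proof (intro eventually_ball_finite ballI)
    fix z assume "z \<in> {z \<in> J \<times> J. fst z \<noteq> snd z}"
    then have "0 < \<bar>fst z - snd z\<bar>" by auto
    moreover have "(\<lambda>n. t / real n) \<longlonglongrightarrow> 0" by (rule lim_const_over_n)
    ultimately show "\<forall>\<^sub>F n in sequentially. t / real n < \<bar>fst z - snd z\<bar>" by (intro order_tendstoD)
  qed (use fJ in auto)
  then show ?thesis using eventually_gt_at_top[of 0]
  proof eventually_elim
    case (elim n)
    then have n: "0 < real n" by simp
    have gap: "x = y" if "x \<in> J" "y \<in> J" "\<bar>x - y\<bar> < t / n" for x y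
      using elim(1) that by fastforce
    \<comment> \<open>The index of the grid cell \<open>(t k / n, t (k + 1) / n]\<close> that contains
      \<open>\<tau>\<close>.\<close>
    define f where "f \<tau> = nat (\<lceil>\<tau> * n / t\<rceil> - 1)" for \<tau> :: real
    have f: "t * f \<tau> / n < \<tau> \<and> \<tau> \<le> t * Suc (f \<tau>) / n \<and> f \<tau> < n" if "0 < \<tau>" "\<tau> \<le> t" for \<tau>
    proof -
      have "0 < \<tau> * n / t" using that t n by simp
      then have 0: "1 \<le> \<lceil>\<tau> * n / t\<rceil>" by linarith
      have "\<tau> * n / t \<le> n" using that t n by (simp add: field_simps)
      then have 1: "\<lceil>\<tau> * n / t\<rceil> \<le> int n" by linarith
      have r: "real (f \<tau>) = real_of_int \<lceil>\<tau> * n / t\<rceil> - 1" unfolding f_def using 0 by simp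
      have "real (f \<tau>) < \<tau> * n / t" "\<tau> * n / t \<le> real (f \<tau>) + 1" unfolding r by linarith+
      then have "t * f \<tau> < \<tau> * n" "\<tau> * n \<le> t * Suc (f \<tau>)" using t n by (auto simp: field_simps)
      moreover have "f \<tau> < n" using 0 1 by (auto simp: f_def nat_less_iff)
      ultimately show ?thesis using n by (simp add: field_simps)
    qed
    have uniq: "k = l" if "t * k / n < \<tau>" "\<tau> \<le> t * Suc k / n" "t * l / n < \<tau>" "\<tau> \<le> t * Suc l / n" for k l and \<tau> :: real
    proof -
      have "t * k / n < t * Suc l / n" "t * l / n < t * Suc k / n" using that by linarith+
      then have "real k < Suc l" "real l < Suc k" using t n by (simp_all add: divide_less_cancel)
      then show ?thesis by simp
    qed
    have cell: "0 \<le> t * k / n" "t * k / n \<le> t * Suc k / n" "t * Suc k / n \<le> t" if "k < n" for k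
    proof -
      show "0 \<le> t * k / n" "t * k / n \<le> t * Suc k / n" using t n by (auto simp: divide_right_mono)
      have "t * Suc k \<le> t * n" using that t by (intro mult_left_mono) auto
      then show "t * Suc k / n \<le> t" using n by (simp add: field_simps)
    qed
    have inc: "\<omega> (t * Suc k / n) - \<omega> (t * k / n)
        = (\<Sum>\<tau>\<in>jumps T \<omega> \<inter> {t * k / n<..t * Suc k / n}. \<omega> \<tau> - left_lim \<omega> \<tau>)" if "k < n" for k
      using paths_increment_sum_jumps[OF \<omega> cell(1,2)[OF that]] cell(3)[OF that] t by auto
    have "inj_on f J"
    proof (rule inj_onI)
      fix x y assume xy: "x \<in> J" "y \<in> J" "f x = f y"
      then have "t * f x / n < x" "x \<le> t * Suc (f x) / n" "t * f x / n < y" "y \<le> t * Suc (f x) / n"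
        using f[of x] f[of y] by (auto simp: J_def)
      moreover have "t * Suc (f x) / n = t * f x / n + t / n" by (simp add: distrib_left add_divide_distrib)
      ultimately have "\<bar>x - y\<bar> < t / n" by linarith
      then show "x = y" using xy gap by blast
    qed
    moreover have "f ` J = {k. k < n \<and> \<omega> (t * k / n) \<noteq> \<omega> (t * Suc k / n)}"
    proof (intro set_eqI iffI)
      fix k assume "k \<in> f ` J"
      then obtain \<tau> where \<tau>: "\<tau> \<in> J" "k = f \<tau>" by auto
      then have k: "t * k / n < \<tau>" "\<tau> \<le> t * Suc k / n" "k < n" using f[of \<tau>] by (auto simp: J_def)
      have "jumps T \<omega> \<inter> {t * k / n<..t * Suc k / n} = {\<tau>}"
      proof (intro set_eqI iffI)
        fix \<sigma> assume s: "\<sigma> \<in> jumps T \<omega> \<inter> {t * k / n<..t * Suc k / n}"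
        then have "\<sigma> \<in> J" using cell[OF k(3)] by (auto simp: J_def)
        moreover have "t * Suc k / n = t * k / n + t / n" by (simp add: distrib_left add_divide_distrib)
        then have "\<bar>\<sigma> - \<tau>\<bar> < t / n" using s k by (auto simp del: of_nat_Suc)
        ultimately show "\<sigma> \<in> {\<tau>}" using gap \<tau> by blast
      qed (use \<tau> k in \<open>auto simp: J_def\<close>)
      then have "\<omega> (t * Suc k / n) - \<omega> (t * k / n) = \<omega> \<tau> - left_lim \<omega> \<tau>" using inc[OF k(3)] by simp
      then show "k \<in> {k. k < n \<and> \<omega> (t * k / n) \<noteq> \<omega> (t * Suc k / n)}"
        using \<tau> k(3) by (auto simp: J_def jumps_def)
    next
      fix k assume k: "k \<in> {k. k < n \<and> \<omega> (t * k / n) \<noteq> \<omega> (t * Suc k / n)}"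
      then have kn: "k < n" by simp
      have "jumps T \<omega> \<inter> {t * k / n<..t * Suc k / n} \<noteq> {}"
      proof
        assume "jumps T \<omega> \<inter> {t * k / n<..t * Suc k / n} = {}"
        then have "\<omega> (t * Suc k / n) - \<omega> (t * k / n) = 0" using inc[OF kn] by simp
        then show False using k by simp
      qed
      then obtain \<tau> where \<tau>: "\<tau> \<in> jumps T \<omega>" "t * k / n < \<tau>" "\<tau> \<le> t * Suc k / n" by auto
      then have J: "\<tau> \<in> J" using cell[OF kn] by (auto simp: J_def)
      then have "f \<tau> = k" using f[of \<tau>] \<tau> by (intro uniq[of "f \<tau>" \<tau> k]) (auto simp: J_def)
      then show "k \<in> f ` J" using J by blast
    qed
    ultimately show ?case using card_image[of f J] by (simp add: J_def)
  qed
qed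

section \<open>Measurability of path functionals\<close>

lemma space_canonical_filtration [simp]: "space (canonical_filtration T t) = paths T"
  unfolding canonical_filtration_def natural_filtration_def by (subst space_measure_of) auto

lemma sets_canonical_filtration:
  "sets (canonical_filtration T t)
    = sigma_sets (paths T) (\<Union>s\<in>{0..t}. {(\<lambda>\<omega>. \<omega> s) -` B \<inter> paths T | B. B \<in> sets borel})"
  unfolding canonical_filtration_def natural_filtration_def by (subst sets_measure_of) auto

lemma measurable_canonical_coordinate:
  assumes "s \<in> {0..t}"
  shows "(\<lambda>\<omega>::real \<Rightarrow> real^'m. \<omega> s) \<in> canonical_filtration T t \<rightarrow>\<^sub>M borel"
proof (rule measurableI)
  fix B :: "(real^'m) set" assume "B \<in> sets borel"
  then show "(\<lambda>\<omega>. \<omega> s) -` B \<inter> space (canonical_filtration T t) \<in> sets (canonical_filtration T t)"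
    unfolding sets_canonical_filtration using assms by (intro sigma_sets.Basic UN_I[of s]) (auto intro!: exI[of _ B])
qed simp

lemma canonical_filtration_mono: "s \<le> t \<Longrightarrow> sets (canonical_filtration T s) \<subseteq> sets (canonical_filtration T t)"
  unfolding sets_canonical_filtration by (intro sigma_sets_mono' UN_mono) auto

lemma borel_measurable_eq_states [measurable (raw)]:
  fixes f g :: "'w \<Rightarrow> real^'m"
  assumes [measurable]: "f \<in> borel_measurable M" "g \<in> borel_measurable M"
  shows "{x \<in> space M. f x \<noteq> g x} \<in> sets M"
  by measurable

text \<open>A right-continuous path is approximated by its values at the next point of a uniform grid to
  the right; for a fixed grid point the value is a single coordinate.\<close>

lemma path_value_measurable:
  fixes X :: "'w \<Rightarrow> real \<Rightarrow> real^'m"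
  assumes X: "X \<in> M \<rightarrow>\<^sub>M canonical_filtration T T" and T: "0 < T"
  shows "(\<lambda>z. X (snd z) (fst z)) \<in> borel_measurable (restrict_space borel {0..T} \<Otimes>\<^sub>M M)"
proof (rule borel_measurable_LIMSEQ_metric)
  define h where "h n s = min T ((real_of_int \<lfloor>real (Suc n) * s\<rfloor> + 1) / real (Suc n))" for n s
  fix n
  have "(\<lambda>z. \<lfloor>real (Suc n) * fst z\<rfloor>) \<in> restrict_space borel {0..T} \<Otimes>\<^sub>M M \<rightarrow>\<^sub>M count_space UNIV"
    by (rule measurable_compose[OF measurable_fst]) (auto intro!: measurable_restrict_space1)
  then have fl: "(\<lambda>z. max 0 \<lfloor>real (Suc n) * fst z\<rfloor>) \<in> restrict_space borel {0..T} \<Otimes>\<^sub>M M \<rightarrow>\<^sub>M count_space UNIV"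
    by (rule measurable_compose) simp
  then have fl': "(\<lambda>z. max 0 \<lfloor>real (Suc n) * fst z\<rfloor>) \<in> restrict_space borel {0..T} \<Otimes>\<^sub>M M \<rightarrow>\<^sub>M count_space {0..}"
    by (rule measurable_count_space_extend[rotated 2]) auto
  have "(\<lambda>z. X (snd z) (min T ((real_of_int (max 0 \<lfloor>real (Suc n) * fst z\<rfloor>) + 1) / real (Suc n))))
      \<in> borel_measurable (restrict_space borel {0..T} \<Otimes>\<^sub>M M)"
  proof (rule measurable_compose_countable'[where I="{0..}" and
      f="\<lambda>k z. X (snd z) (min T ((real_of_int k + 1) / real (Suc n)))", OF _ fl'])
    fix k :: int assume "k \<in> {0..}"
    then show "(\<lambda>z. X (snd z) (min T ((real_of_int k + 1) / real (Suc n))))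
        \<in> borel_measurable (restrict_space borel {0..T} \<Otimes>\<^sub>M M)"
      using T by (intro measurable_compose[OF measurable_snd measurable_compose[OF X measurable_canonical_coordinate]]) auto
  qed auto
  then show "(\<lambda>z. X (snd z) (h n (fst z))) \<in> borel_measurable (restrict_space borel {0..T} \<Otimes>\<^sub>M M)"
    by (rule measurable_cong[THEN iffD1, rotated]) (auto simp: h_def space_pair_measure space_restrict_space max_def)
next
  fix z assume "z \<in> space (restrict_space borel {0..T} \<Otimes>\<^sub>M M)"
  then have s: "0 \<le> fst z" "fst z \<le> T" and w: "X (snd z) \<in> paths T"
    using measurable_space[OF X, of "snd z"] by (auto simp: space_pair_measure space_restrict_space)
  define h where "h n s = min T ((real_of_int \<lfloor>real (Suc n) * s\<rfloor> + 1) / real (Suc n))" for n s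
  have h: "fst z \<le> h n (fst z)" "h n (fst z) \<le> fst z + inverse (real (Suc n))" "h n (fst z) \<le> T" for n
  proof -
    have "real (Suc n) * fst z \<le> real_of_int \<lfloor>real (Suc n) * fst z\<rfloor> + 1" by linarith
    then have "fst z \<le> (real_of_int \<lfloor>real (Suc n) * fst z\<rfloor> + 1) / real (Suc n)" by (simp add: field_simps)
    then show "fst z \<le> h n (fst z)" using s by (simp add: h_def)
    have "real_of_int \<lfloor>real (Suc n) * fst z\<rfloor> + 1 \<le> real (Suc n) * fst z + 1" by linarith
    then have "(real_of_int \<lfloor>real (Suc n) * fst z\<rfloor> + 1) / real (Suc n) \<le> (real (Suc n) * fst z + 1) / real (Suc n)"
      by (intro divide_right_mono) auto
    also have "\<dots> = fst z + inverse (real (Suc n))" by (simp add: field_simps)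
    finally show "h n (fst z) \<le> fst z + inverse (real (Suc n))" by (simp add: h_def)
  qed (simp add: h_def)
  have "\<exists>d>0. \<forall>s. fst z \<le> s \<longrightarrow> s < fst z + d \<longrightarrow> s \<le> T \<longrightarrow> X (snd z) s = X (snd z) (fst z)"
  proof (cases "fst z = T")
    case True
    then show ?thesis by (auto intro!: exI[of _ 1] arg_cong[where f="X (snd z)"])
  next
    case False
    then have "fst z \<in> {0..<T}" using s by simp
    then show ?thesis by (rule paths_right_constant[OF w]) blast
  qed
  \<comment> \<open>Paths are locally constant to the right, so the approximation is eventually
    exact.\<close>
  then obtain d where d: "0 < d" "\<And>s. fst z \<le> s \<Longrightarrow> s < fst z + d \<Longrightarrow> s \<le> T \<Longrightarrow> X (snd z) s = X (snd z) (fst z)"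
    by blast
  have "eventually (\<lambda>n. inverse (real (Suc n)) < d) sequentially"
    using order_tendstoD(2)[OF LIMSEQ_inverse_real_of_nat d(1)] .
  then have "eventually (\<lambda>n. X (snd z) (h n (fst z)) = X (snd z) (fst z)) sequentially"
  proof eventually_elim
    case (elim n)
    show ?case using h[of n] elim by (intro d(2)) linarith+
  qed
  then show "(\<lambda>n. X (snd z) (min T ((real_of_int \<lfloor>real (Suc n) * fst z\<rfloor> + 1) / real (Suc n)))) \<longlonglongrightarrow> X (snd z) (fst z)"
    unfolding h_def by (rule tendsto_eventually)
qed

text \<open>As for the values of the path, now with the last grid point strictly to the left.\<close>

lemma path_left_lim_measurable:
  fixes X :: "'w \<Rightarrow> real \<Rightarrow> real^'m"
  assumes X: "X \<in> M \<rightarrow>\<^sub>M canonical_filtration T T" and T: "0 < T"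
  shows "(\<lambda>z. left_lim (X (snd z)) (fst z)) \<in> borel_measurable (restrict_space borel {0..T} \<Otimes>\<^sub>M M)"
proof (rule borel_measurable_LIMSEQ_metric)
  fix n
  have "(\<lambda>z. \<lceil>real (Suc n) * fst z\<rceil>) \<in> restrict_space borel {0..T} \<Otimes>\<^sub>M M \<rightarrow>\<^sub>M count_space UNIV"
    by (rule measurable_compose[OF measurable_fst]) (auto intro!: measurable_restrict_space1)
  then show "(\<lambda>z. X (snd z) (min T (max 0 ((real_of_int \<lceil>real (Suc n) * fst z\<rceil> - 1) / real (Suc n)))))
      \<in> borel_measurable (restrict_space borel {0..T} \<Otimes>\<^sub>M M)"
  proof (rule measurable_compose_countable[where
      f="\<lambda>k z. X (snd z) (min T (max 0 ((real_of_int k - 1) / real (Suc n))))", rotated])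
    fix k :: int
    show "(\<lambda>z. X (snd z) (min T (max 0 ((real_of_int k - 1) / real (Suc n)))))
        \<in> borel_measurable (restrict_space borel {0..T} \<Otimes>\<^sub>M M)"
      using T by (intro measurable_compose[OF measurable_snd measurable_compose[OF X measurable_canonical_coordinate]]) auto
  qed
next
  fix z assume "z \<in> space (restrict_space borel {0..T} \<Otimes>\<^sub>M M)"
  then have s: "0 \<le> fst z" "fst z \<le> T" and w: "X (snd z) \<in> paths T"
    using measurable_space[OF X, of "snd z"] by (auto simp: space_pair_measure space_restrict_space)
  show "(\<lambda>n. X (snd z) (min T (max 0 ((real_of_int \<lceil>real (Suc n) * fst z\<rceil> - 1) / real (Suc n))))) \<longlonglongrightarrow> left_lim (X (snd z)) (fst z)"
  proof (cases "fst z = 0")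
    case True
    then show ?thesis using T by (simp add: left_lim_def max_def)
  next
    case False
    obtain d where d: "0 < d" "d \<le> fst z" "\<And>s. fst z - d < s \<Longrightarrow> s < fst z \<Longrightarrow> X (snd z) s = left_lim (X (snd z)) (fst z)"
    proof -
      have "fst z \<in> {0<..T}" using s False by auto
      from paths_left_constant[OF w this] show ?thesis using that by blast
    qed
    have "eventually (\<lambda>n. inverse (real (Suc n)) < d) sequentially"
      using order_tendstoD(2)[OF LIMSEQ_inverse_real_of_nat d(1)] .
    then have "eventually (\<lambda>n. X (snd z) (min T (max 0 ((real_of_int \<lceil>real (Suc n) * fst z\<rceil> - 1) / real (Suc n)))) = left_lim (X (snd z)) (fst z)) sequentially"
    proof eventually_elim
      case (elim n)
      let ?c = "(real_of_int \<lceil>real (Suc n) * fst z\<rceil> - 1) / real (Suc n)"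
      have "real_of_int \<lceil>real (Suc n) * fst z\<rceil> - 1 < real (Suc n) * fst z" by linarith
      then have 1: "?c < fst z" by (simp add: field_simps)
      have "real (Suc n) * fst z - 1 \<le> real_of_int \<lceil>real (Suc n) * fst z\<rceil> - 1" by linarith
      then have "(real (Suc n) * fst z - 1) / real (Suc n) \<le> ?c" by (intro divide_right_mono) auto
      also have "(real (Suc n) * fst z - 1) / real (Suc n) = fst z - inverse (real (Suc n))" by (simp add: field_simps)
      finally have 2: "fst z - inverse (real (Suc n)) \<le> ?c" .
      have 3: "0 < ?c" "?c < T" using 1 2 elim d(2) s by linarith+
      then have "min T (max 0 ?c) = ?c" unfolding min_def max_def by argo
      then show ?case using 1 2 elim by (simp only:, intro d(3)) linarith+
    qed
    then show ?thesis by (rule tendsto_eventually)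
  qed
qed

lemma measurable_card_jumps:
  fixes X :: "'w \<Rightarrow> real \<Rightarrow> real^'m"
  assumes X: "X \<in> M \<rightarrow>\<^sub>M canonical_filtration T T" and t: "0 < t" "t \<le> T"
  shows "(\<lambda>x. real (card (jumps T (X x) \<inter> {0<..t}))) \<in> borel_measurable M"
proof (rule borel_measurable_LIMSEQ_real)
  fix n
  have m: "(\<lambda>x. X x s) \<in> borel_measurable M" if "0 \<le> s" "s \<le> t" for s
    using that t by (intro measurable_compose[OF X measurable_canonical_coordinate]) auto
  have "(\<lambda>x. \<Sum>k<n. indicator {x \<in> space M. X x (t * k / n) \<noteq> X x (t * Suc k / n)} x :: real) \<in> borel_measurable M"
  proof (intro borel_measurable_sum borel_measurable_indicator borel_measurable_eq_states m)
    fix k assume "k \<in> {..<n}"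
    then have "t * Suc k \<le> t * n" "t * k \<le> t * n" "0 < real n" using t by (auto intro!: mult_left_mono)
    then show "t * real k / real n \<le> t" "t * real (Suc k) / real n \<le> t" by (simp_all add: field_simps)
  qed (use t in auto)
  then show "(\<lambda>x. real (card {k. k < n \<and> X x (t * k / n) \<noteq> X x (t * Suc k / n)})) \<in> borel_measurable M"
    by (rule measurable_cong[THEN iffD1, rotated])
       (auto simp: indicator_def sum.If_cases of_nat_sum[symmetric] intro!: arg_cong[where f=card] simp del: of_nat_Suc)
next
  fix x assume "x \<in> space M"
  then have "X x \<in> paths T" using measurable_space[OF X] by simp
  from eventually_grid_changes_eq_jumps[OF this t]
  show "(\<lambda>n. real (card {k. k < n \<and> X x (t * k / n) \<noteq> X x (t * Suc k / n)})) \<longlonglongrightarrow> real (card (jumps T (X x) \<inter> {0<..t}))"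
    by (intro tendsto_eventually) (auto elim: eventually_mono)
qed

text \<open>The uniform distribution on the jump times together with 0. The point 0 is never a jump
  time; it makes the set nonempty, so that this is a probability kernel. A sum over the jump times is an
  integral against this kernel, multiplied by the number of atoms, and integrals against kernels are
  measurable in the parameter.\<close>

definition jump_kernel :: "real \<Rightarrow> (real \<Rightarrow> real^'m) \<Rightarrow> real measure" where
  "jump_kernel T \<omega> = distr (measure_pmf (pmf_of_set (insert 0 (jumps T \<omega>)))) borel (\<lambda>x. x)"

lemma jump_kernel_measurable:
  fixes X :: "'w \<Rightarrow> real \<Rightarrow> real^'m"
  assumes X: "X \<in> M \<rightarrow>\<^sub>M canonical_filtration T T" and T: "0 < T"
  shows "(\<lambda>x. jump_kernel T (X x)) \<in> M \<rightarrow>\<^sub>M prob_algebra borel"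
proof (rule measurable_prob_algebra_generated[where G="range (\<lambda>a. {..a})" and \<Omega>=UNIV])
  show "sets borel = sigma_sets UNIV (range (\<lambda>a::real. {..a}))"
    by (subst borel_eq_atMost) (simp add: sets_measure_of)
  show "Int_stable (range (\<lambda>a::real. {..a}))" by (auto simp: Int_stable_def)
  fix x assume x: "x \<in> space M"
  show "prob_space (jump_kernel T (X x))" unfolding jump_kernel_def by (intro measure_pmf.prob_space_distr) simp
  show "sets (jump_kernel T (X x)) = sets borel" by (simp add: jump_kernel_def)
next
  \<comment> \<open>The half-lines generate the Borel sets, and their masses are ratios of jump
    counts.\<close>
  fix A :: "real set" assume "A \<in> range (\<lambda>a. {..a})"
  then obtain a where A: "A = {..a}" by auto
  have J: "finite (jumps T (X x))" "0 \<notin> jumps T (X x)" "jumps T (X x) \<inter> {0<..T} = jumps T (X x)" if "x \<in> space M" for x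
    using finite_jumps[of "X x" T] measurable_space[OF X that] jumps_subset[of T "X x"] by auto
  have e: "emeasure (jump_kernel T (X x)) A
      = ennreal (real (card (insert 0 (jumps T (X x)) \<inter> {..a})) / real (card (insert 0 (jumps T (X x)))))" if "x \<in> space M" for x
  proof -
    have "emeasure (jump_kernel T (X x)) A = emeasure (measure_pmf (pmf_of_set (insert 0 (jumps T (X x))))) {..a}"
      unfolding jump_kernel_def A by (subst emeasure_distr) auto
    then show ?thesis using J[OF that] by (simp add: emeasure_pmf_of_set)
  qed
  consider "a < 0" | "a = 0" | "0 < a" by linarith
  then have "(\<lambda>x. real (card (insert 0 (jumps T (X x)) \<inter> {..a})) / real (card (insert 0 (jumps T (X x))))) \<in> borel_measurable M"
  proof cases
    case 1
    then have *: "insert 0 (jumps T (X x)) \<inter> {..a} = {}" for x by (auto simp: jumps_def)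
    show ?thesis unfolding * by simp
  next
    case 2
    then have *: "insert 0 (jumps T (X x)) \<inter> {..a} = {0}" for x by (auto simp: jumps_def)
    have "(\<lambda>x. 1 / (1 + real (card (jumps T (X x) \<inter> {0<..T})))) \<in> borel_measurable M"
      using measurable_card_jumps[OF X T order_refl] by measurable
    then show ?thesis unfolding * by (rule measurable_cong[THEN iffD1, rotated]) (auto simp: J)
  next
    case 3
    define b where "b = min a T"
    have b: "0 < b" "b \<le> T" using 3 T by (auto simp: b_def)
    have *: "insert 0 (jumps T (X x)) \<inter> {..a} = insert 0 (jumps T (X x) \<inter> {0<..b})" for x
      using 3 by (auto simp: jumps_def b_def)
    have "(\<lambda>x. (1 + real (card (jumps T (X x) \<inter> {0<..b}))) / (1 + real (card (jumps T (X x) \<inter> {0<..T})))) \<in> borel_measurable M"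
      using measurable_card_jumps[OF X T order_refl] measurable_card_jumps[OF X b] by measurable
    then show ?thesis unfolding * by (rule measurable_cong[THEN iffD1, rotated]) (auto simp: J)
  qed
  then have "(\<lambda>x. ennreal (real (card (insert 0 (jumps T (X x)) \<inter> {..a})) / real (card (insert 0 (jumps T (X x)))))) \<in> borel_measurable M"
    by measurable
  then show "(\<lambda>x. emeasure (jump_kernel T (X x)) A) \<in> borel_measurable M"
    by (rule measurable_cong[THEN iffD1, rotated]) (simp add: e)
qed simp

lemma sum_jumps_measurable_nonneg:
  fixes X :: "'w \<Rightarrow> real \<Rightarrow> real^'m" and H :: "real \<times> 'w \<Rightarrow> real"
  assumes X: "X \<in> M \<rightarrow>\<^sub>M canonical_filtration T T" and T: "0 < T"
    and H: "H \<in> borel_measurable (restrict_space borel {0..T} \<Otimes>\<^sub>M M)" and H0: "\<And>z. 0 \<le> H z"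
  shows "(\<lambda>x. \<Sum>s\<in>jumps T (X x). H (s, x)) \<in> borel_measurable M"
proof -
  have J: "finite (jumps T (X x))" "0 \<notin> jumps T (X x)" "jumps T (X x) \<inter> {0<..T} = jumps T (X x)" if "x \<in> space M" for x
    using finite_jumps[of "X x" T] measurable_space[OF X that] jumps_subset[of T "X x"] by auto
  \<comment> \<open>Extends \<open>H\<close> to all times by clamping, and by the value 0 at the
    artificial atom 0.\<close>
  define H' where "H' x s = indicator {0<..T} s * H (max 0 (min T s), x)" for x s
  have "(\<lambda>z. (max 0 (min T (snd z)), fst z)) \<in> M \<Otimes>\<^sub>M borel \<rightarrow>\<^sub>M restrict_space borel {0..T} \<Otimes>\<^sub>M M"
    using T by (intro measurable_Pair measurable_restrict_space2) auto
  from measurable_compose[OF this H]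
  have [measurable]: "(\<lambda>z. H (max 0 (min T (snd z)), fst z)) \<in> borel_measurable (M \<Otimes>\<^sub>M borel)" .
  have H'm: "(\<lambda>(x, s). ennreal (H' x s)) \<in> borel_measurable (M \<Otimes>\<^sub>M borel)"
    unfolding H'_def split_beta' by measurable
  have m1: "(\<lambda>x. \<integral>\<^sup>+s. ennreal (H' x s) \<partial>jump_kernel T (X x)) \<in> borel_measurable M"
    using nn_integral_measurable_subprob_algebra2[OF H'm measurable_prob_algebraD[OF jump_kernel_measurable[OF X T]]] .
  note [measurable] = m1 measurable_card_jumps[OF X T order_refl]
  have "(\<lambda>x. enn2real (\<integral>\<^sup>+s. ennreal (H' x s) \<partial>jump_kernel T (X x)) * (1 + real (card (jumps T (X x) \<inter> {0<..T})))) \<in> borel_measurable M"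
    by measurable
  then show ?thesis
  proof (rule measurable_cong[THEN iffD1, rotated])
    fix x assume x: "x \<in> space M"
    note J = J[OF x]
    have "(\<lambda>s. H (max 0 (min T s), x)) \<in> borel_measurable borel"
      using measurable_compose[OF measurable_Pair1'[OF x, of borel] \<open>(\<lambda>z. H (max 0 (min T (snd z)), fst z)) \<in> borel_measurable (M \<Otimes>\<^sub>M borel)\<close>] by simp
    then have [measurable]: "H' x \<in> borel_measurable borel" unfolding H'_def by measurable
    have "(\<integral>\<^sup>+s. ennreal (H' x s) \<partial>jump_kernel T (X x)) = (\<integral>\<^sup>+s. ennreal (H' x s) \<partial>measure_pmf (pmf_of_set (insert 0 (jumps T (X x)))))"
      unfolding jump_kernel_def by (subst nn_integral_distr) auto
    also have "\<dots> = (\<Sum>s\<in>insert 0 (jumps T (X x)). ennreal (H' x s)) / card (insert 0 (jumps T (X x)))"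
      using J by (subst nn_integral_pmf_of_set) auto
    also have "(\<Sum>s\<in>insert 0 (jumps T (X x)). ennreal (H' x s)) = ennreal (\<Sum>s\<in>insert 0 (jumps T (X x)). H' x s)"
      by (rule sum_ennreal) (auto simp: H'_def H0)
    also have "(\<Sum>s\<in>insert 0 (jumps T (X x)). H' x s) = (\<Sum>s\<in>jumps T (X x). H (s, x))"
      using J by (subst sum.insert) (auto simp: H'_def jumps_def intro!: sum.cong)
    also have "ennreal (\<Sum>s\<in>jumps T (X x). H (s, x)) / card (insert 0 (jumps T (X x)))
        = ennreal ((\<Sum>s\<in>jumps T (X x). H (s, x)) / (1 + real (card (jumps T (X x)))))"
      using J by (subst ennreal_of_nat_eq_real_of_nat, subst divide_ennreal) (auto intro!: sum_nonneg H0)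
    finally show "enn2real (\<integral>\<^sup>+s. ennreal (H' x s) \<partial>jump_kernel T (X x)) * (1 + real (card (jumps T (X x) \<inter> {0<..T})))
        = (\<Sum>s\<in>jumps T (X x). H (s, x))"
      using J by (simp add: sum_nonneg H0 enn2real_ennreal)
  qed
qed

lemma sum_jumps_measurable:
  fixes X :: "'w \<Rightarrow> real \<Rightarrow> real^'m" and H :: "real \<times> 'w \<Rightarrow> real"
  assumes X: "X \<in> M \<rightarrow>\<^sub>M canonical_filtration T T" and T: "0 < T"
    and H: "H \<in> borel_measurable (restrict_space borel {0..T} \<Otimes>\<^sub>M M)"
  shows "(\<lambda>x. \<Sum>s\<in>jumps T (X x). H (s, x)) \<in> borel_measurable M"
proof -
  note [measurable] = H
  have "(\<lambda>x. (\<Sum>s\<in>jumps T (X x). max 0 (H (s, x))) - (\<Sum>s\<in>jumps T (X x). max 0 (- H (s, x)))) \<in> borel_measurable M"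
    by (intro borel_measurable_diff sum_jumps_measurable_nonneg[OF X T]) auto
  moreover have "(\<Sum>s\<in>jumps T (X x). max 0 (H (s, x))) - (\<Sum>s\<in>jumps T (X x). max 0 (- H (s, x))) = (\<Sum>s\<in>jumps T (X x). H (s, x))" for x
    unfolding sum_subtractf[symmetric] by (rule sum.cong) auto
  ultimately show ?thesis by simp
qed

section \<open>Pathwise Stieltjes integrals\<close>

lemma nn_integral_sum_of_measures:
  assumes s: "sets M1 = sets N" "sets M2 = sets N"
    and e: "\<And>A. A \<in> sets N \<Longrightarrow> emeasure N A = emeasure M1 A + emeasure M2 A"
    and f: "f \<in> borel_measurable N"
  shows "integral\<^sup>N N f = integral\<^sup>N M1 f + integral\<^sup>N M2 f"
  using f
proof induction
  case (cong f g)
  have "integral\<^sup>N M f = integral\<^sup>N M g" if "sets M = sets N" for M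
    using cong(3) sets_eq_imp_space_eq[OF that] by (intro nn_integral_cong) auto
  then show ?case using cong s by simp
next
  case (set A)
  then show ?case using s e by simp
next
  case (mult u c)
  have [measurable]: "u \<in> borel_measurable M1" "u \<in> borel_measurable M2" "u \<in> borel_measurable N"
    using mult s by (auto cong: measurable_cong_sets)
  show ?case using mult by (simp add: nn_integral_cmult distrib_left)
next
  case (add u v)
  have [measurable]: "u \<in> borel_measurable M1" "u \<in> borel_measurable M2" "u \<in> borel_measurable N"
    "v \<in> borel_measurable M1" "v \<in> borel_measurable M2" "v \<in> borel_measurable N"
    using add s by (auto cong: measurable_cong_sets)
  show ?case using add by (simp add: nn_integral_add add_ac)
next
  case (seq U)
  have m: "\<And>i. U i \<in> borel_measurable M1" "\<And>i. U i \<in> borel_measurable M2" "\<And>i. U i \<in> borel_measurable N"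
    using seq s by (auto cong: measurable_cong_sets)
  have i: "incseq (\<lambda>i. integral\<^sup>N M (U i))" for M
    using seq(3) by (auto simp: incseq_def le_fun_def intro!: nn_integral_mono)
  show ?case
    unfolding SUP_apply[abs_def]
    by (simp add: nn_integral_monotone_convergence_SUP[OF seq(3)] m seq.IH ennreal_SUP_add[OF i i])
qed

lemma integral_sum_of_measures:
  fixes f :: "'a \<Rightarrow> real"
  assumes s: "sets M1 = sets N" "sets M2 = sets N"
    and e: "\<And>A. A \<in> sets N \<Longrightarrow> emeasure N A = emeasure M1 A + emeasure M2 A"
    and f: "integrable M1 f" "integrable M2 f"
  shows "integrable N f" "integral\<^sup>L N f = integral\<^sup>L M1 f + integral\<^sup>L M2 f"
proof -
  have [measurable]: "f \<in> borel_measurable N" using f(1) s by (auto cong: measurable_cong_sets dest: borel_measurable_integrable)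
  note nn = nn_integral_sum_of_measures[OF s e]
  have fin: "(\<integral>\<^sup>+x. ennreal (f x) \<partial>M) < \<infinity>" "(\<integral>\<^sup>+x. ennreal (- f x) \<partial>M) < \<infinity>" if "integrable M f" for M
    using that unfolding real_integrable_def by (auto simp: less_top)
  show i: "integrable N f"
    unfolding real_integrable_def using fin[OF f(1)] fin[OF f(2)] by (auto simp: nn less_top)
  show "integral\<^sup>L N f = integral\<^sup>L M1 f + integral\<^sup>L M2 f"
    using fin[OF f(1)] fin[OF f(2)]
    by (simp add: real_lebesgue_integral_def[OF i] real_lebesgue_integral_def[OF f(1)] real_lebesgue_integral_def[OF f(2)]
        nn enn2real_plus)
qed

text \<open>The functions for which \<open>interval_measure\<close> has the expected values on
  intervals.\<close>

definition distribution_like :: "(real \<Rightarrow> real) \<Rightarrow> bool" where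
  "distribution_like F \<longleftrightarrow> mono F \<and> (\<forall>s. continuous (at_right s) F)"

lemma emeasure_interval_Ioc:
  assumes "distribution_like F"
  shows "emeasure (interval_measure F) {a<..b} = ennreal (F b - F a)"
proof (cases "a \<le> b")
  case True
  then show ?thesis
    using assms emeasure_interval_measure_Ioc[OF True, of F] by (auto simp: distribution_like_def mono_def)
next
  case False
  then have "F b \<le> F a" using assms by (auto simp: distribution_like_def mono_def)
  with False show ?thesis by (simp add: ennreal_neg)
qed

lemma distribution_like_add: "distribution_like F \<Longrightarrow> distribution_like G \<Longrightarrow> distribution_like (\<lambda>x. F x + G x)"
  by (auto simp: distribution_like_def mono_def intro!: add_mono continuous_intros)

lemma distribution_like_const: "distribution_like (\<lambda>_. c)"
  by (auto simp: distribution_like_def mono_def)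

text \<open>The restriction of the measure of \<open>F\<close> to \<open>(0,t]\<close>, as a measure on
  the whole line. It depends on \<open>F\<close> only through its values on
  \<open>[0,t]\<close>.\<close>

definition cut_measure :: "real \<Rightarrow> (real \<Rightarrow> real) \<Rightarrow> real measure" where
  "cut_measure t F = density (interval_measure F) (\<lambda>x. ennreal (indicator {0<..t} x))"

lemma sets_cut_measure [simp, measurable_cong]: "sets (cut_measure t F) = sets borel"
  by (simp add: cut_measure_def)

lemma emeasure_cut_measure:
  assumes "A \<in> sets borel"
  shows "emeasure (cut_measure t F) A = emeasure (interval_measure F) ({0<..t} \<inter> A)"
proof -
  have "emeasure (cut_measure t F) A = (\<integral>\<^sup>+x. indicator ({0<..t} \<inter> A) x \<partial>interval_measure F)"
    unfolding cut_measure_def using assms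
    by (subst emeasure_density; (intro nn_integral_cong)?) (auto split: split_indicator)
  then show ?thesis using assms by simp
qed

text \<open>Two measures with the same finite masses on the intervals \<open>(a,b]\<close>
  coincide.\<close>

lemma emeasure_cut_measure_add:
  assumes F: "distribution_like F1" "distribution_like F2" "distribution_like G"
    and G: "\<And>s. s \<in> {0..t} \<Longrightarrow> G s = F1 s + F2 s" and A: "A \<in> sets borel"
  shows "emeasure (cut_measure t G) A = emeasure (cut_measure t F1) A + emeasure (cut_measure t F2) A"
proof -
  define S where "S = measure_of UNIV (sets borel) (\<lambda>A. emeasure (cut_measure t F1) A + emeasure (cut_measure t F2) A)"
  have sS: "sets S = sets borel" unfolding S_def by (metis sets.sigma_sets_eq sets_measure_of space_borel sets.space_closed)
  have eS: "emeasure S A = emeasure (cut_measure t F1) A + emeasure (cut_measure t F2) A" if "A \<in> sets borel" for A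
  proof (rule emeasure_measure_of[OF S_def])
    show "sets borel \<subseteq> Pow (UNIV::real set)" by simp
    show "positive (sets S) (\<lambda>A. emeasure (cut_measure t F1) A + emeasure (cut_measure t F2) A)"
      by (simp add: positive_def)
    show "countably_additive (sets S) (\<lambda>A. emeasure (cut_measure t F1) A + emeasure (cut_measure t F2) A)"
    proof (rule countably_additiveI)
      fix B :: "nat \<Rightarrow> real set" assume B: "range B \<subseteq> sets S" "disjoint_family B"
      then have "range B \<subseteq> sets (cut_measure t F1)" "range B \<subseteq> sets (cut_measure t F2)" by (simp_all add: sS)
      with B show "(\<Sum>i. emeasure (cut_measure t F1) (B i) + emeasure (cut_measure t F2) (B i))
          = emeasure (cut_measure t F1) (\<Union> (range B)) + emeasure (cut_measure t F2) (\<Union> (range B))"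
        by (simp add: suminf_add[symmetric] suminf_emeasure)
    qed
  qed (use that sS in simp)
  have ioc: "emeasure (cut_measure t H) {a<..b} = ennreal (H (min b t) - H (max a 0))" if "distribution_like H" for H a b
  proof -
    have "{0<..t} \<inter> {a<..b} = {max a 0<..min b t}" by auto
    then show ?thesis by (simp add: emeasure_cut_measure emeasure_interval_Ioc[OF that])
  qed
  have "cut_measure t G = S"
  proof (rule measure_eqI_generator_eq[where \<Omega>=UNIV and E="range (\<lambda>(a, b). {a<..b::real})" and A="\<lambda>i. {- real i<..real i}"])
    fix X assume "X \<in> range (\<lambda>(a, b). {a<..b::real})"
    then obtain a b where X: "X = {a<..b}" by auto
    show "emeasure (cut_measure t G) X = emeasure S X"
    proof (cases "max a 0 \<le> min b t")
      case True
      then have "G (min b t) - G (max a 0) = (F1 (min b t) - F1 (max a 0)) + (F2 (min b t) - F2 (max a 0))"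
        by (subst (1 2) G) auto
      moreover have "F1 (max a 0) \<le> F1 (min b t)" "F2 (max a 0) \<le> F2 (min b t)"
        using F True by (auto simp: distribution_like_def mono_def)
      ultimately show ?thesis by (simp add: X eS ioc F ennreal_plus[symmetric] del: ennreal_plus)
    next
      case False
      then have "min b t \<le> max a 0" by linarith
      then have "H (min b t) - H (max a 0) \<le> 0" if "distribution_like H" for H
        using that by (auto simp: distribution_like_def mono_def)
      then show ?thesis using F by (simp add: X eS ioc ennreal_neg)
    qed
  qed (auto simp: sS borel_sigma_sets_Ioc Int_stable_def UN_Ioc_eq_UNIV ioc F)
  then show ?thesis using eS[OF A] by simp
qed

lemma set_integral_cut_measure:
  fixes h :: "real \<Rightarrow> real"
  assumes h: "(\<lambda>s. indicator {0<..t} s * h s) \<in> borel_measurable borel"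
  shows "set_integrable (interval_measure F) {0<..t} h \<longleftrightarrow> integrable (cut_measure t F) (\<lambda>s. indicator {0<..t} s * h s)"
    and "(LINT s:{0<..t}|interval_measure F. h s) = integral\<^sup>L (cut_measure t F) (\<lambda>s. indicator {0<..t} s * h s)"
proof -
  have h': "(\<lambda>s. indicator {0<..t} s * h s) \<in> borel_measurable (interval_measure F)"
    using h by (simp cong: measurable_cong_sets)
  have *: "indicator {0<..t} s * (indicator {0<..t} s * h s) = indicator {0<..t} s * h s" for s
    by (simp add: indicator_def)
  show "set_integrable (interval_measure F) {0<..t} h \<longleftrightarrow> integrable (cut_measure t F) (\<lambda>s. indicator {0<..t} s * h s)"
    unfolding cut_measure_def set_integrable_def by (subst integrable_density[OF h']) (auto simp: *)
  show "(LINT s:{0<..t}|interval_measure F. h s) = integral\<^sup>L (cut_measure t F) (\<lambda>s. indicator {0<..t} s * h s)"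
    unfolding cut_measure_def set_lebesgue_integral_def by (subst integral_density[OF h']) (auto simp: *)
qed

lemma stieltjes_sum:
  fixes h :: "real \<Rightarrow> real"
  assumes F: "distribution_like F1" "distribution_like F2" "distribution_like G"
    and G: "\<And>s. s \<in> {0..t} \<Longrightarrow> G s = F1 s + F2 s"
    and h: "set_integrable (interval_measure F1) {0<..t} h" "set_integrable (interval_measure F2) {0<..t} h"
  shows "set_integrable (interval_measure G) {0<..t} h"
    "(LINT s:{0<..t}|interval_measure G. h s)
      = (LINT s:{0<..t}|interval_measure F1. h s) + (LINT s:{0<..t}|interval_measure F2. h s)"
proof -
  have hm: "(\<lambda>s. indicator {0<..t} s * h s) \<in> borel_measurable borel"
    using borel_measurable_integrable[OF h(1)[unfolded set_integrable_def]] by (simp cong: measurable_cong_sets)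
  note * = integral_sum_of_measures[of "cut_measure t F1" "cut_measure t G" "cut_measure t F2" "\<lambda>s. indicator {0<..t} s * h s",
      OF _ _ _ h[unfolded set_integral_cut_measure(1)[OF hm]]]
  show "set_integrable (interval_measure G) {0<..t} h"
    unfolding set_integral_cut_measure(1)[OF hm] by (rule *(1)) (use emeasure_cut_measure_add[OF F G] in auto)
  show "(LINT s:{0<..t}|interval_measure G. h s)
      = (LINT s:{0<..t}|interval_measure F1. h s) + (LINT s:{0<..t}|interval_measure F2. h s)"
    unfolding set_integral_cut_measure(2)[OF hm] by (rule *(2)) (use emeasure_cut_measure_add[OF F G] in auto)
qed

text \<open>The relation whose unique solution is \<open>stieltjes_integral\<close>. As a relation it
  can be established from a convenient decomposition and added up before uniqueness is invoked.\<close>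

definition has_stieltjes_integral :: "real \<Rightarrow> (real \<Rightarrow> real) \<Rightarrow> (real \<Rightarrow> real) \<Rightarrow> real \<Rightarrow> bool" where
  "has_stieltjes_integral t h F I \<longleftrightarrow> (\<exists>F1 F2. distribution_like F1 \<and> distribution_like F2 \<and>
     (\<forall>s\<in>{0..t}. F s = F1 s - F2 s) \<and>
     set_integrable (interval_measure F1) {0<..t} h \<and> set_integrable (interval_measure F2) {0<..t} h \<and>
     I = (LINT s:{0<..t}|interval_measure F1. h s) - (LINT s:{0<..t}|interval_measure F2. h s))"

text \<open>If \<open>F1 - F2 = G1 - G2\<close> then \<open>F1 + G2 = G1 + F2\<close>, and the integral
  against a sum of integrators is the sum of the integrals.\<close>

lemma has_stieltjes_integral_unique:
  assumes "has_stieltjes_integral t h F I" "has_stieltjes_integral t h F I'"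
  shows "I = I'"
proof -
  obtain F1 F2 where F: "distribution_like F1" "distribution_like F2" "\<forall>s\<in>{0..t}. F s = F1 s - F2 s"
     "set_integrable (interval_measure F1) {0<..t} h" "set_integrable (interval_measure F2) {0<..t} h"
     "I = (LINT s:{0<..t}|interval_measure F1. h s) - (LINT s:{0<..t}|interval_measure F2. h s)"
    using assms(1) unfolding has_stieltjes_integral_def by blast
  obtain G1 G2 where G: "distribution_like G1" "distribution_like G2" "\<forall>s\<in>{0..t}. F s = G1 s - G2 s"
     "set_integrable (interval_measure G1) {0<..t} h" "set_integrable (interval_measure G2) {0<..t} h"
     "I' = (LINT s:{0<..t}|interval_measure G1. h s) - (LINT s:{0<..t}|interval_measure G2. h s)"
    using assms(2) unfolding has_stieltjes_integral_def by blast
  have e: "F1 s + G2 s = G1 s + F2 s" if "s \<in> {0..t}" for s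
    using bspec[OF F(3) that] bspec[OF G(3) that] by linarith
  note d = distribution_like_add[OF F(1) G(2)]
  have "(LINT s:{0<..t}|interval_measure (\<lambda>x. F1 x + G2 x). h s)
      = (LINT s:{0<..t}|interval_measure G1. h s) + (LINT s:{0<..t}|interval_measure F2. h s)"
    by (rule stieltjes_sum(2)[OF G(1) F(2) d _ G(4) F(5)]) (rule e)
  moreover have "(LINT s:{0<..t}|interval_measure (\<lambda>x. F1 x + G2 x). h s)
      = (LINT s:{0<..t}|interval_measure F1. h s) + (LINT s:{0<..t}|interval_measure G2. h s)"
    by (rule stieltjes_sum(2)[OF F(1) G(2) d refl F(4) G(5)])
  ultimately show ?thesis by (simp add: F(6) G(6))
qed

lemma stieltjes_integral_eq:
  assumes "has_stieltjes_integral t h F I"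
  shows "stieltjes_integral t h F = I"
proof -
  have eq: "has_stieltjes_integral t h F = (\<lambda>I. \<exists>F1 F2.
     mono F1 \<and> mono F2 \<and>
     (\<forall>s. continuous (at_right s) F1) \<and> (\<forall>s. continuous (at_right s) F2) \<and>
     (\<forall>s\<in>{0..t}. F s = F1 s - F2 s) \<and>
     set_integrable (interval_measure F1) {0<..t} h \<and>
     set_integrable (interval_measure F2) {0<..t} h \<and>
     I = (LINT s:{0<..t}|interval_measure F1. h s) - (LINT s:{0<..t}|interval_measure F2. h s))"
    unfolding has_stieltjes_integral_def[abs_def] distribution_like_def by (intro ext) (simp only: conj_ac)
  have "stieltjes_integral t h F = (THE I. has_stieltjes_integral t h F I)"
    unfolding eq stieltjes_integral_def ..
  also have "\<dots> = I" using assms by (intro the_equality) (auto dest: has_stieltjes_integral_unique)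
  finally show ?thesis .
qed

lemma has_stieltjes_integral_add:
  assumes "has_stieltjes_integral t h F I" "has_stieltjes_integral t h G J"
  shows "has_stieltjes_integral t h (\<lambda>s. F s + G s) (I + J)"
proof -
  obtain F1 F2 where F: "distribution_like F1" "distribution_like F2" "\<forall>s\<in>{0..t}. F s = F1 s - F2 s"
     "set_integrable (interval_measure F1) {0<..t} h" "set_integrable (interval_measure F2) {0<..t} h"
     "I = (LINT s:{0<..t}|interval_measure F1. h s) - (LINT s:{0<..t}|interval_measure F2. h s)"
    using assms(1) unfolding has_stieltjes_integral_def by blast
  obtain G1 G2 where G: "distribution_like G1" "distribution_like G2" "\<forall>s\<in>{0..t}. G s = G1 s - G2 s"
     "set_integrable (interval_measure G1) {0<..t} h" "set_integrable (interval_measure G2) {0<..t} h"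
     "J = (LINT s:{0<..t}|interval_measure G1. h s) - (LINT s:{0<..t}|interval_measure G2. h s)"
    using assms(2) unfolding has_stieltjes_integral_def by blast
  have d: "distribution_like (\<lambda>x. F1 x + G1 x)" "distribution_like (\<lambda>x. F2 x + G2 x)"
    by (intro distribution_like_add F G)+
  note * = stieltjes_sum[OF F(1) G(1) d(1) refl F(4) G(4)] stieltjes_sum[OF F(2) G(2) d(2) refl F(5) G(5)]
  have "F s + G s = F1 s + G1 s - (F2 s + G2 s)" if "s \<in> {0..t}" for s
    using bspec[OF F(3) that] bspec[OF G(3) that] by linarith
  then show ?thesis
    unfolding has_stieltjes_integral_def
    by (intro exI[of _ "\<lambda>x. F1 x + G1 x"] exI[of _ "\<lambda>x. F2 x + G2 x"]) (use d * F(6) G(6) in auto)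
qed

lemma has_stieltjes_integral_uminus:
  assumes "has_stieltjes_integral t h F I"
  shows "has_stieltjes_integral t h (\<lambda>s. - F s) (- I)"
proof -
  obtain F1 F2 where F: "distribution_like F1" "distribution_like F2" "\<forall>s\<in>{0..t}. F s = F1 s - F2 s"
     "set_integrable (interval_measure F1) {0<..t} h" "set_integrable (interval_measure F2) {0<..t} h"
     "I = (LINT s:{0<..t}|interval_measure F1. h s) - (LINT s:{0<..t}|interval_measure F2. h s)"
    using assms(1) unfolding has_stieltjes_integral_def by blast
  show ?thesis unfolding has_stieltjes_integral_def
    by (intro exI[of _ F2] exI[of _ F1]) (use F in auto)
qed

lemma has_stieltjes_integral_cong:
  assumes "has_stieltjes_integral t h F I" "\<And>s. s \<in> {0..t} \<Longrightarrow> F s = G s"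
  shows "has_stieltjes_integral t h G I"
  using assms unfolding has_stieltjes_integral_def by auto

text \<open>The distribution function of a measure \<open>M\<close> on the line differs from
  \<open>F\<close> by the constant \<open>M (-\<infinity>,0]\<close>; this constant serves as the second
  term of the decomposition and generates the zero measure.\<close>

lemma has_stieltjes_integral_measure:
  fixes h :: "real \<Rightarrow> real"
  assumes M: "finite_borel_measure M" and h: "set_integrable M {0<..t} h"
    and F: "\<And>s. s \<in> {0..t} \<Longrightarrow> F s = measure M {0<..s}"
  shows "has_stieltjes_integral t h F (LINT s:{0<..t}|M. h s)"
proof -
  interpret finite_borel_measure M by fact
  have d: "distribution_like (cdf M)"
    by (auto simp: distribution_like_def mono_def cdf_nondecreasing intro: cdf_is_right_cont)
  have eq: "interval_measure (cdf M) = M"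
  proof (rule measure_eqI_generator_eq[where \<Omega>=UNIV and E="range (\<lambda>(a, b). {a<..b::real})" and A="\<lambda>i. {- real i<..real i}"])
    fix X assume "X \<in> range (\<lambda>(a, b). {a<..b::real})"
    then obtain a b where X: "X = {a<..b}" by auto
    show "emeasure (interval_measure (cdf M)) X = emeasure M X"
      by (cases "a \<le> b") (simp_all add: X emeasure_interval_Ioc[OF d] emeasure_Ioc ennreal_neg cdf_nondecreasing)
  qed (auto simp: M_is_borel borel_sigma_sets_Ioc Int_stable_def UN_Ioc_eq_UNIV emeasure_interval_Ioc[OF d])
  have z: "emeasure (interval_measure (\<lambda>_. cdf M 0)) A = 0" if "A \<in> sets borel" for A
  proof -
    have "emeasure (interval_measure (\<lambda>_. cdf M 0)) A \<le> emeasure (interval_measure (\<lambda>_. cdf M 0)) UNIV"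
      by (rule emeasure_mono) auto
    also have "UNIV = (\<Union>i. {- real i<..real i})" by (rule UN_Ioc_eq_UNIV[symmetric])
    also have "emeasure (interval_measure (\<lambda>_. cdf M 0)) \<dots> \<le> (\<Sum>i. emeasure (interval_measure (\<lambda>_. cdf M 0)) {- real i<..real i})"
      by (rule emeasure_subadditive_countably) auto
    also have "\<dots> = 0" by (simp add: emeasure_interval_Ioc[OF distribution_like_const])
    finally show ?thesis by simp
  qed
  have zn: "interval_measure (\<lambda>_. cdf M 0) = null_measure borel" by (rule measure_eqI) (auto simp: z)
  have hm: "(\<lambda>s. indicator {0<..t} s *\<^sub>R h s) \<in> borel_measurable borel"
    using borel_measurable_integrable[OF h[unfolded set_integrable_def]] M_is_borel by (simp cong: measurable_cong_sets)
  have ae: "AE x in null_measure borel. (indicator {0<..t} x *\<^sub>R h x) = (0::real)"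
    by (rule AE_I[of _ _ UNIV]) auto
  have z1: "integrable (null_measure borel) (\<lambda>s. indicator {0<..t} s *\<^sub>R h s)"
    using hm by (subst integrable_cong_AE[OF _ _ ae]) (auto cong: measurable_cong_sets)
  have z2: "integral\<^sup>L (null_measure borel) (\<lambda>s. indicator {0<..t} s *\<^sub>R h s) = 0"
    using hm by (subst integral_cong_AE[OF _ _ ae]) (auto cong: measurable_cong_sets)
  have F': "F s = cdf M s - cdf M 0" if "s \<in> {0..t}" for s
    using F[OF that] that cdf_diff_eq[of 0 s] by (cases "s = 0") auto
  show ?thesis
    unfolding has_stieltjes_integral_def
  proof (intro exI conjI ballI)
    show "distribution_like (cdf M)" "distribution_like (\<lambda>_. cdf M 0)" by (rule d distribution_like_const)+
    show "F s = cdf M s - cdf M 0" if "s \<in> {0..t}" for s using F'[OF that] .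
    show "set_integrable (interval_measure (cdf M)) {0<..t} h" unfolding eq by (rule h)
    show "set_integrable (interval_measure (\<lambda>_. cdf M 0)) {0<..t} h" unfolding zn set_integrable_def by (rule z1)
    show "(LINT s:{0<..t}|M. h s) = (LINT s:{0<..t}|interval_measure (cdf M). h s)
        - (LINT s:{0<..t}|interval_measure (\<lambda>_. cdf M 0). h s)"
      unfolding eq zn using z2 by (simp add: set_lebesgue_integral_def)
  qed
qed

section \<open>Integrators with jumps and drift\<close>

definition bounded_measurable_on :: "real \<Rightarrow> (real \<Rightarrow> real) \<Rightarrow> bool" where
  "bounded_measurable_on T h \<longleftrightarrow>
     h \<in> borel_measurable (restrict_space borel {0..T}) \<and> (\<exists>B. \<forall>s\<in>{0..T}. \<bar>h s\<bar> \<le> B)"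

lemma bounded_measurable_onE:
  assumes "bounded_measurable_on T h"
  obtains B where "0 \<le> B" "\<And>s. s \<in> {0..T} \<Longrightarrow> \<bar>h s\<bar> \<le> B"
proof -
  obtain B where B: "\<forall>s\<in>{0..T}. \<bar>h s\<bar> \<le> B" using assms by (auto simp: bounded_measurable_on_def)
  show ?thesis by (rule that[of "\<bar>B\<bar>"]) (use B in force)+
qed

lemma bounded_measurable_on_const: "bounded_measurable_on T (\<lambda>_. c)"
  by (auto simp: bounded_measurable_on_def)

lemma bounded_measurable_on_mult:
  assumes "bounded_measurable_on T f" "bounded_measurable_on T g"
  shows "bounded_measurable_on T (\<lambda>s. f s * g s)"
proof -
  obtain A where A: "0 \<le> A" "\<And>s. s \<in> {0..T} \<Longrightarrow> \<bar>f s\<bar> \<le> A" using bounded_measurable_onE[OF assms(1)] by blast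
  obtain B where B: "0 \<le> B" "\<And>s. s \<in> {0..T} \<Longrightarrow> \<bar>g s\<bar> \<le> B" using bounded_measurable_onE[OF assms(2)] by blast
  have "\<bar>f s * g s\<bar> \<le> A * B" if "s \<in> {0..T}" for s
    unfolding abs_mult using A B that by (intro mult_mono) auto
  then show ?thesis using assms unfolding bounded_measurable_on_def
    by (intro conjI borel_measurable_times exI[of _ "A * B"]) auto
qed

lemma bounded_measurable_on_add:
  assumes "bounded_measurable_on T f" "bounded_measurable_on T g"
  shows "bounded_measurable_on T (\<lambda>s. f s + g s)"
proof -
  obtain A where A: "0 \<le> A" "\<And>s. s \<in> {0..T} \<Longrightarrow> \<bar>f s\<bar> \<le> A" using bounded_measurable_onE[OF assms(1)] by blast
  obtain B where B: "0 \<le> B" "\<And>s. s \<in> {0..T} \<Longrightarrow> \<bar>g s\<bar> \<le> B" using bounded_measurable_onE[OF assms(2)] by blast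
  have "\<bar>f s + g s\<bar> \<le> A + B" if "s \<in> {0..T}" for s
    using A(2)[OF that] B(2)[OF that] by linarith
  then show ?thesis using assms unfolding bounded_measurable_on_def
    by (intro conjI borel_measurable_add exI[of _ "A + B"]) auto
qed

lemma bounded_measurable_on_diff:
  assumes "bounded_measurable_on T f" "bounded_measurable_on T g"
  shows "bounded_measurable_on T (\<lambda>s. f s - g s)"
  using bounded_measurable_on_add[OF assms(1) bounded_measurable_on_mult[OF bounded_measurable_on_const[of T "-1"] assms(2)]]
  by simp

lemma bounded_measurable_on_sum:
  assumes "\<And>i. i \<in> I \<Longrightarrow> bounded_measurable_on T (f i)"
  shows "bounded_measurable_on T (\<lambda>s. \<Sum>i\<in>I. f i s)"
  using assms
proof (induction I rule: infinite_finite_induct)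
  case (insert x F)
  then show ?case by (simp add: bounded_measurable_on_add)
qed (simp_all add: bounded_measurable_on_const)

lemma bounded_measurable_on_pos_part:
  assumes "bounded_measurable_on T f"
  shows "bounded_measurable_on T (\<lambda>s. max 0 (f s))"
proof -
  obtain A where A: "0 \<le> A" "\<And>s. s \<in> {0..T} \<Longrightarrow> \<bar>f s\<bar> \<le> A" using bounded_measurable_onE[OF assms(1)] by blast
  have "\<bar>max 0 (f s)\<bar> \<le> A" if "s \<in> {0..T}" for s using A(1) A(2)[OF that] by linarith
  moreover have [measurable]: "f \<in> borel_measurable (restrict_space borel {0..T})" using assms by (simp add: bounded_measurable_on_def)
  have "(\<lambda>s. max 0 (f s)) \<in> borel_measurable (restrict_space borel {0..T})" by measurable
  ultimately show ?thesis unfolding bounded_measurable_on_def by blast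
qed

lemma bounded_measurable_on_cong:
  assumes "bounded_measurable_on T f" "\<And>s. s \<in> {0..T} \<Longrightarrow> f s = g s"
  shows "bounded_measurable_on T g"
proof -
  have "f \<in> borel_measurable (restrict_space borel {0..T}) \<longleftrightarrow> g \<in> borel_measurable (restrict_space borel {0..T})"
    by (rule measurable_cong) (auto simp: space_restrict_space assms(2))
  then show ?thesis using assms by (simp add: bounded_measurable_on_def)
qed

lemma bounded_measurable_on_cut:
  assumes "bounded_measurable_on T h" "t \<le> T"
  shows "(\<lambda>s. indicator {0<..t} s * h s) \<in> borel_measurable borel"
proof -
  have "(\<lambda>s. indicator {0..T} s *\<^sub>R h s) \<in> borel_measurable borel"
    using assms(1) by (simp add: bounded_measurable_on_def borel_measurable_restrict_space_iff)
  then have "(\<lambda>s. indicator {0<..t} s * (indicator {0..T} s *\<^sub>R h s)) \<in> borel_measurable borel" by measurable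
  moreover have "(\<lambda>s. indicator {0<..t} s * (indicator {0..T} s *\<^sub>R h s)) = (\<lambda>s. indicator {0<..t} s * h s)"
    using assms(2) by (auto simp: indicator_def)
  ultimately show ?thesis by simp
qed

lemma bounded_measurable_on_set_integrable:
  assumes h: "bounded_measurable_on T h" and t: "t \<le> T" and M: "finite_measure M" "sets M = sets borel"
  shows "set_integrable M {0<..t} h"
proof -
  interpret finite_measure M by fact
  obtain B where B: "0 \<le> B" "\<And>s. s \<in> {0..T} \<Longrightarrow> \<bar>h s\<bar> \<le> B" using bounded_measurable_onE[OF h] by blast
  show ?thesis unfolding set_integrable_def
  proof (rule integrable_const_bound[where B=B])
    show "(\<lambda>x. indicat_real {0<..t} x *\<^sub>R h x) \<in> borel_measurable M"
      using bounded_measurable_on_cut[OF h t] M(2) by (simp cong: measurable_cong_sets)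
    show "AE x in M. norm (indicat_real {0<..t} x *\<^sub>R h x) \<le> B"
      using B t by (auto simp: indicator_def)
  qed
qed

lemma emeasure_lborel_Ioc_finite: "emeasure lborel {a<..b::real} < \<top>"
  by (cases "a \<le> b") auto

lemma bounded_measurable_on_set_integrable_lborel:
  assumes h: "bounded_measurable_on T h" and t: "t \<le> T"
  shows "set_integrable lborel {0<..t} h"
proof -
  obtain B where B: "0 \<le> B" "\<And>s. s \<in> {0..T} \<Longrightarrow> \<bar>h s\<bar> \<le> B" using bounded_measurable_onE[OF h] by blast
  have "integrable lborel (\<lambda>x. indicat_real {0<..t} x * B)"
    by (rule integrable_mult_left) (auto simp: integrable_indicator_iff emeasure_lborel_Ioc_finite)
  then show ?thesis unfolding set_integrable_def
  proof (rule Bochner_Integration.integrable_bound)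
    show "(\<lambda>x. indicat_real {0<..t} x *\<^sub>R h x) \<in> borel_measurable lborel"
      using bounded_measurable_on_cut[OF h t] by simp
    show "AE x in lborel. norm (indicat_real {0<..t} x *\<^sub>R h x) \<le> norm (indicat_real {0<..t} x * B)"
      using B t by (auto simp: indicator_def)
  qed
qed

text \<open>A step is the distribution function of a multiple of a Dirac measure.\<close>

lemma has_stieltjes_integral_jump:
  assumes h: "bounded_measurable_on T h" and t: "t \<le> T" and \<tau>: "0 < \<tau>"
  shows "has_stieltjes_integral t h (\<lambda>s. c * of_bool (\<tau> \<le> s)) (c * (indicator {0<..t} \<tau> * h \<tau>))"
proof -
  have pos: "has_stieltjes_integral t h (\<lambda>s. c * of_bool (\<tau> \<le> s)) (c * (indicator {0<..t} \<tau> * h \<tau>))" if c: "0 \<le> c" for c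
  proof -
    define M where "M = density (return borel \<tau>) (\<lambda>_. ennreal c)"
    have sM: "sets M = sets borel" by (simp add: M_def)
    have e: "emeasure M A = ennreal (c * indicator A \<tau>)" if "A \<in> sets borel" for A
      unfolding M_def using that c by (subst emeasure_density) (auto simp: nn_integral_cmult ennreal_mult ennreal_indicator)
    have fM: "finite_measure M"
      by (rule finite_measureI) (use e[of UNIV] sets_eq_imp_space_eq[OF sM] in simp)
    then have fb: "finite_borel_measure M" using sM by (simp add: finite_borel_measure_def finite_borel_measure_axioms_def)
    have m: "measure M A = c * indicator A \<tau>" if "A \<in> sets borel" for A
      using e[OF that] c by (simp add: measure_def)
    have cut: "(\<lambda>s. indicator {0<..t} s *\<^sub>R h s) \<in> borel_measurable (return borel \<tau>)"
      using bounded_measurable_on_cut[OF h t] by (simp cong: measurable_cong_sets)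
    have "(LINT s:{0<..t}|M. h s) = c * (indicator {0<..t} \<tau> * h \<tau>)"
      unfolding M_def set_lebesgue_integral_def using c cut bounded_measurable_on_cut[OF h t]
      by (subst integral_density[OF cut]) (auto simp: integral_return)
    then show ?thesis
      using has_stieltjes_integral_measure[OF fb bounded_measurable_on_set_integrable[OF h t fM sM], of "\<lambda>s. c * of_bool (\<tau> \<le> s)"] \<tau>
      by (auto simp: m indicator_def)
  qed
  show ?thesis
  proof (cases "0 \<le> c")
    case False
    then show ?thesis using has_stieltjes_integral_uminus[OF pos[of "-c"]] by simp
  qed (rule pos)
qed

lemma has_stieltjes_integral_jumps:
  assumes h: "bounded_measurable_on T h" and t: "t \<le> T" and J: "finite J" "J \<subseteq> {0<..}"
  shows "has_stieltjes_integral t h (\<lambda>s. \<Sum>\<tau>\<in>J. c \<tau> * of_bool (\<tau> \<le> s)) (\<Sum>\<tau>\<in>J. c \<tau> * (indicator {0<..t} \<tau> * h \<tau>))"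
  using J
proof (induction J rule: finite_induct)
  case empty
  then show ?case using has_stieltjes_integral_jump[OF h t, of 1 0] by simp
next
  case (insert x F)
  then have "0 < x" "F \<subseteq> {0<..}" by auto
  then show ?case
    unfolding sum.insert[OF insert.hyps]
    by (intro has_stieltjes_integral_add has_stieltjes_integral_jump[OF h t] insert.IH)
qed

lemma has_stieltjes_integral_absolutely_continuous:
  assumes h: "bounded_measurable_on T h" and t: "t \<le> T" and b: "bounded_measurable_on T b"
  shows "has_stieltjes_integral t h (\<lambda>s. LINT u:{0<..s}|lborel. b u) (LINT s:{0<..t}|lborel. h s * b s)"
proof -
  have pos: "has_stieltjes_integral t h (\<lambda>s. LINT u:{0<..s}|lborel. b u) (LINT s:{0<..t}|lborel. h s * b s)"
    if b: "bounded_measurable_on T b" and b0: "\<And>s. 0 \<le> b s" for b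
  proof -
    have bm: "(\<lambda>s. indicator {0<..t} s * b s) \<in> borel_measurable borel" using bounded_measurable_on_cut[OF b t] .
    define M where "M = density lborel (\<lambda>s. ennreal (indicator {0<..t} s * b s))"
    have sM: "sets M = sets borel" by (simp add: M_def)
    have e: "emeasure M {0<..s} = ennreal (LINT u:{0<..s}|lborel. b u)" if "s \<le> t" for s
    proof -
      have "emeasure M {0<..s} = (\<integral>\<^sup>+u. ennreal (indicator {0<..s} u *\<^sub>R b u) \<partial>lborel)"
        unfolding M_def using that bm by (subst emeasure_density) (auto intro!: nn_integral_cong split: split_indicator)
      also have "\<dots> = ennreal (LINT u:{0<..s}|lborel. b u)"
        unfolding set_lebesgue_integral_def
        using bounded_measurable_on_set_integrable_lborel[OF b, of s] that t b0
        by (intro nn_integral_eq_integral) (auto simp: set_integrable_def)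
      finally show ?thesis .
    qed
    have "emeasure M UNIV = emeasure M {0<..t}"
      unfolding M_def using bm by (subst (1 2) emeasure_density) (auto intro!: nn_integral_cong split: split_indicator)
    then have fM: "finite_measure M"
      by (intro finite_measureI) (use e[of t] sets_eq_imp_space_eq[OF sM] in simp)
    then have fb: "finite_borel_measure M" using sM by (simp add: finite_borel_measure_def finite_borel_measure_axioms_def)
    have m: "measure M {0<..s} = (LINT u:{0<..s}|lborel. b u)" if "s \<le> t" for s
      using e[OF that] b0 by (simp add: measure_def set_lebesgue_integral_def)
    have cut: "(\<lambda>s. indicator {0<..t} s *\<^sub>R h s) \<in> borel_measurable lborel"
      using bounded_measurable_on_cut[OF h t] by (simp cong: measurable_cong_sets)
    have "(LINT s:{0<..t}|M. h s) = (LINT s:{0<..t}|lborel. h s * b s)"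
      unfolding M_def set_lebesgue_integral_def using bm b0
      by (subst integral_density[OF cut]) (auto intro!: Bochner_Integration.integral_cong split: split_indicator)
    then show ?thesis
      using has_stieltjes_integral_measure[OF fb bounded_measurable_on_set_integrable[OF h t fM sM], of "\<lambda>s. LINT u:{0<..s}|lborel. b u"]
      by (auto simp: m)
  qed
  have b': "bounded_measurable_on T (\<lambda>s. - b s)"
    using bounded_measurable_on_diff[OF bounded_measurable_on_const[of T 0] b] by simp
  note p = bounded_measurable_on_pos_part[OF b] and n = bounded_measurable_on_pos_part[OF b']
  have "has_stieltjes_integral t h (\<lambda>s. (LINT u:{0<..s}|lborel. max 0 (b u)) + - (LINT u:{0<..s}|lborel. max 0 (- b u)))
    ((LINT s:{0<..t}|lborel. h s * max 0 (b s)) + - (LINT s:{0<..t}|lborel. h s * max 0 (- b s)))"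
    by (intro has_stieltjes_integral_add has_stieltjes_integral_uminus pos p n) auto
  moreover have "(LINT u:{0<..s}|lborel. max 0 (b u)) + - (LINT u:{0<..s}|lborel. max 0 (- b u)) = (LINT u:{0<..s}|lborel. b u)" if "s \<in> {0..t}" for s
  proof -
    have sT: "s \<le> T" using that t by simp
    have "(LINT u:{0<..s}|lborel. max 0 (b u) - max 0 (- b u)) = (LINT u:{0<..s}|lborel. max 0 (b u)) - (LINT u:{0<..s}|lborel. max 0 (- b u))"
      by (rule set_integral_diff(2)[OF bounded_measurable_on_set_integrable_lborel[OF p sT]
            bounded_measurable_on_set_integrable_lborel[OF n sT]])
    moreover have "max 0 (b u) - max 0 (- b u) = b u" for u by simp
    ultimately show ?thesis by simp
  qed
  moreover have "(LINT s:{0<..t}|lborel. h s * max 0 (b s)) + - (LINT s:{0<..t}|lborel. h s * max 0 (- b s)) = (LINT s:{0<..t}|lborel. h s * b s)"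
  proof -
    have "(LINT s:{0<..t}|lborel. h s * max 0 (b s) - h s * max 0 (- b s)) = (LINT s:{0<..t}|lborel. h s * max 0 (b s)) - (LINT s:{0<..t}|lborel. h s * max 0 (- b s))"
      by (rule set_integral_diff(2)[OF bounded_measurable_on_set_integrable_lborel[OF bounded_measurable_on_mult[OF h p] t]
            bounded_measurable_on_set_integrable_lborel[OF bounded_measurable_on_mult[OF h n] t]])
    moreover have "h u * max 0 (b u) - h u * max 0 (- b u) = h u * b u" for u
      unfolding right_diff_distrib[symmetric] by (simp add: max_def)
    ultimately show ?thesis by simp
  qed
  ultimately show ?thesis using has_stieltjes_integral_cong[where G="\<lambda>s. LINT u:{0<..s}|lborel. b u"] by auto
qed

text \<open>The only integrators that occur: finitely many jumps \<open>c \<tau>\<close> and a drift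
  with bounded density.\<close>

lemma stieltjes_integral_jumps_drift:
  assumes h: "bounded_measurable_on T h" and b: "bounded_measurable_on T b" and t: "t \<le> T" and J: "finite J" "J \<subseteq> {0<..}"
    and F: "\<And>s. s \<in> {0..t} \<Longrightarrow> F s = (\<Sum>\<tau>\<in>J \<inter> {0<..s}. c \<tau>) - (LINT u:{0<..s}|lborel. b u)"
  shows "stieltjes_integral t h F = (\<Sum>\<tau>\<in>J \<inter> {0<..t}. h \<tau> * c \<tau>) - (LINT s:{0<..t}|lborel. h s * b s)"
proof (rule stieltjes_integral_eq)
  have s: "(\<Sum>\<tau>\<in>J. c \<tau> * of_bool (\<tau> \<le> s)) = (\<Sum>\<tau>\<in>J \<inter> {0<..s}. c \<tau>)" for s
    using J by (intro sum.mono_neutral_cong_right) auto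
  have s': "(\<Sum>\<tau>\<in>J. c \<tau> * (indicator {0<..t} \<tau> * h \<tau>)) = (\<Sum>\<tau>\<in>J \<inter> {0<..t}. h \<tau> * c \<tau>)"
    using J by (intro sum.mono_neutral_cong_right) auto
  have "has_stieltjes_integral t h (\<lambda>s. (\<Sum>\<tau>\<in>J. c \<tau> * of_bool (\<tau> \<le> s)) + - (LINT u:{0<..s}|lborel. b u))
     ((\<Sum>\<tau>\<in>J. c \<tau> * (indicator {0<..t} \<tau> * h \<tau>)) + - (LINT s:{0<..t}|lborel. h s * b s))"
    by (intro has_stieltjes_integral_add has_stieltjes_integral_uminus has_stieltjes_integral_jumps[OF h t J]
        has_stieltjes_integral_absolutely_continuous[OF h t b])
  then have "has_stieltjes_integral t h F ((\<Sum>\<tau>\<in>J. c \<tau> * (indicator {0<..t} \<tau> * h \<tau>)) + - (LINT s:{0<..t}|lborel. h s * b s))"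
    by (rule has_stieltjes_integral_cong) (simp add: F s)
  then show "has_stieltjes_integral t h F ((\<Sum>\<tau>\<in>J \<inter> {0<..t}. h \<tau> * c \<tau>) - (LINT s:{0<..t}|lborel. h s * b s))"
    by (simp add: s')
qed

text \<open>The factors \<open>exp (- c)\<close> of the stochastic exponential cancel the jumps
  contained in \<open>exp (L T)\<close>, which leaves the drift and the factors \<open>1 + c\<close>.
  Times in \<open>J\<close> with \<open>c = 0\<close> are not jumps of \<open>L\<close> but contribute
  the factor 1.\<close>

lemma doleans_exp_jumps_drift:
  assumes b: "bounded_measurable_on T b" and T: "0 \<le> T" and J: "finite J" "J \<subseteq> {0<..T}"
    and L: "\<And>t. t \<in> {0..T} \<Longrightarrow> L t = (\<Sum>\<tau>\<in>J \<inter> {0<..t}. c \<tau>) - (LINT s:{0<..t}|lborel. b s)"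
  shows "doleans_exp L T = exp (- (LINT s:{0<..T}|lborel. b s)) * (\<Prod>\<tau>\<in>J. 1 + c \<tau>)"
proof -
  obtain B where B: "0 \<le> B" "\<And>s. s \<in> {0..T} \<Longrightarrow> \<bar>b s\<bar> \<le> B" using bounded_measurable_onE[OF b] by blast
  \<comment> \<open>The left limit of \<open>L\<close> removes exactly the jump at \<open>s\<close>, since
    the drift is Lipschitz with constant \<open>B\<close>.\<close>
  have ll: "left_lim L s = L s - (if s \<in> J then c s else 0)" if s: "s \<in> {0<..T}" for s
  proof -
    have "eventually (\<lambda>u. \<forall>\<tau>\<in>J. \<tau> < s \<longrightarrow> \<tau> < u) (at_left s)"
    proof (rule eventually_ball_finite[OF J(1)], intro ballI)
      fix \<tau> assume "\<tau> \<in> J"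
      show "eventually (\<lambda>u. \<tau> < s \<longrightarrow> \<tau> < u) (at_left s)"
        by (cases "\<tau> < s") (auto simp: eventually_at_left_field)
    qed
    moreover have "eventually (\<lambda>u. 0 < u \<and> u < s) (at_left s)"
      unfolding eventually_at_left_field using s by (intro exI[of _ 0]) auto
    ultimately have "eventually (\<lambda>u. norm (L u - (L s - (if s \<in> J then c s else 0))) \<le> B * (s - u)) (at_left s)"
    proof eventually_elim
      case (elim u)
      have uT: "u \<le> T" "s \<le> T" using elim s by auto
      have e: "J \<inter> {0<..u} = J \<inter> {0<..<s}" using elim by force
      have e2: "J \<inter> {0<..s} = (if s \<in> J then insert s (J \<inter> {0<..<s}) else J \<inter> {0<..<s})" using s by (auto simp: less_le)
      have "(\<Sum>\<tau>\<in>J \<inter> {0<..s}. c \<tau>) = (\<Sum>\<tau>\<in>J \<inter> {0<..u}. c \<tau>) + (if s \<in> J then c s else 0)"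
        unfolding e e2 using J(1) by simp
      moreover have "(LINT v:{0<..s}|lborel. b v) = (LINT v:{0<..u}|lborel. b v) + (LINT v:{u<..s}|lborel. b v)"
      proof -
        have "{0<..s} = {0<..u} \<union> {u<..s}" using elim by auto
        moreover have "set_integrable lborel {u<..s} b"
          by (rule set_integrable_subset[OF bounded_measurable_on_set_integrable_lborel[OF b uT(2)]]) (use elim in auto)
        ultimately show ?thesis
          using bounded_measurable_on_set_integrable_lborel[OF b uT(1)] by (simp add: set_integral_Un)
      qed
      ultimately have "L u - (L s - (if s \<in> J then c s else 0)) = (LINT v:{u<..s}|lborel. b v)"
        using elim s by (subst (1 2) L) auto
      also have "norm \<dots> \<le> (\<integral>v. indicator {u<..s} v * B \<partial>lborel)"
        unfolding set_lebesgue_integral_def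
      proof (rule order_trans[OF integral_norm_bound integral_mono'])
        show "integrable lborel (\<lambda>v. indicator {u<..s} v * B)"
          by (rule integrable_mult_left) (auto simp: integrable_indicator_iff emeasure_lborel_Ioc_finite)
        show "norm (indicator {u<..s} v *\<^sub>R b v) \<le> indicator {u<..s} v * B" for v
          using B(2)[of v] elim s by (auto simp: indicator_def)
      qed (use B in auto)
      also have "\<dots> = B * (s - u)" using elim by simp
      finally show ?case .
    qed
    moreover have "((\<lambda>u. B * (s - u)) \<longlongrightarrow> 0) (at_left s)"
      by (rule tendsto_eq_intros refl | simp)+
    ultimately have "((\<lambda>u. L u - (L s - (if s \<in> J then c s else 0))) \<longlongrightarrow> 0) (at_left s)"
      by (rule Lim_null_comparison)
    then have "(L \<longlongrightarrow> L s - (if s \<in> J then c s else 0)) (at_left s)" by (rule LIM_zero_cancel)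
    then show ?thesis using s by (simp add: left_lim_def tendsto_Lim)
  qed
  have set: "{s. s \<in> {0<..T} \<and> L s \<noteq> left_lim L s} = {s \<in> J. c s \<noteq> 0}"
    using J(2) by (auto simp: ll split: if_splits)
  have J_T: "J \<inter> {0<..T} = J" using J by auto
  have L0: "L 0 = 0" using T L[of 0] by (simp add: set_lebesgue_integral_def)
  have LT: "L T = sum c J - (LINT s:{0<..T}|lborel. b s)" using T L[of T] by (simp add: J_T)
  have "doleans_exp L T = exp (L T) * (\<Prod>s\<in>{s \<in> J. c s \<noteq> 0}. (1 + c s) * exp (- c s))"
    unfolding doleans_exp_def set L0
    using J(2) by (intro arg_cong2[where f="(*)"] prod.cong) (auto simp: ll subset_eq)
  also have "(\<Prod>s\<in>{s \<in> J. c s \<noteq> 0}. (1 + c s) * exp (- c s)) = (\<Prod>s\<in>J. (1 + c s) * exp (- c s))"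
    using J(1) by (intro prod.mono_neutral_left) auto
  also have "\<dots> = (\<Prod>s\<in>J. 1 + c s) * exp (- sum c J)"
    using J(1) by (simp add: prod.distrib exp_sum sum_negf[symmetric])
  also have "exp (L T) * ((\<Prod>s\<in>J. 1 + c s) * exp (- sum c J)) = exp (L T - sum c J) * (\<Prod>s\<in>J. 1 + c s)"
    by (simp add: exp_diff exp_minus field_simps)
  finally show ?thesis by (simp add: LT)
qed

section \<open>The pseudo-inverse of \<open>psi\<close>\<close>

definition penrose_inverse :: "real^'n^'m \<Rightarrow> real^'m^'n \<Rightarrow> bool" where
  "penrose_inverse M B \<longleftrightarrow> M ** B ** M = M \<and> B ** M ** B = B \<and>
     transpose (M ** B) = M ** B \<and> transpose (B ** M) = B ** M"

text \<open>Penrose's argument: the symmetric products \<open>M B\<close> and \<open>M C\<close> absorb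
  each other, hence agree, and likewise \<open>B M\<close> and \<open>C M\<close>.\<close>

lemma penrose_inverse_unique:
  assumes "penrose_inverse M B" "penrose_inverse M C"
  shows "B = C"
proof -
  note B = assms(1)[unfolded penrose_inverse_def] and C = assms(2)[unfolded penrose_inverse_def]
  have "M ** B = (M ** C ** M) ** B" using C by simp
  also have "\<dots> = (M ** C) ** (M ** B)" by (simp add: matrix_mul_assoc)
  also have "\<dots> = transpose (M ** C) ** transpose (M ** B)" using B C by simp
  also have "\<dots> = transpose ((M ** B) ** (M ** C))" by (simp add: matrix_transpose_mul)
  also have "(M ** B) ** (M ** C) = (M ** B ** M) ** C" by (simp add: matrix_mul_assoc)
  also have "transpose ((M ** B ** M) ** C) = M ** C" using B C by simp
  finally have 1: "M ** B = M ** C" .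
  have "B ** M = B ** (M ** C ** M)" using C by simp
  also have "\<dots> = (B ** M) ** (C ** M)" by (simp add: matrix_mul_assoc)
  also have "\<dots> = transpose (B ** M) ** transpose (C ** M)" using B C by simp
  also have "\<dots> = transpose ((C ** M) ** (B ** M))" by (simp add: matrix_transpose_mul)
  also have "(C ** M) ** (B ** M) = C ** (M ** B ** M)" by (simp add: matrix_mul_assoc)
  also have "transpose (C ** (M ** B ** M)) = C ** M" using B C by simp
  finally have 2: "B ** M = C ** M" .
  have "B = B ** M ** B" using B by simp
  also have "\<dots> = C ** (M ** B)" unfolding 2 by (simp add: matrix_mul_assoc)
  also have "\<dots> = C ** M ** C" unfolding 1 by (simp add: matrix_mul_assoc)
  finally show ?thesis using C by simp
qed

lemma moore_penrose_eq:
  assumes "penrose_inverse M B"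
  shows "moore_penrose M = B"
proof -
  have "moore_penrose M = (THE B. penrose_inverse M B)" by (simp add: moore_penrose_def penrose_inverse_def)
  also have "\<dots> = B" using assms by (intro the_equality) (auto dest: penrose_inverse_unique)
  finally show ?thesis .
qed

text \<open>In state \<open>a\<close>, the matrix is the Laplacian of the star graph with centre
  \<open>a\<close>.\<close>

lemma psi_axis:
  "psi (axis a 1 :: real^'m) $ j $ k =
     (if j = k then (if j = a then real CARD('m) - 1 else 1) else if j = a \<or> k = a then -1 else 0)"
proof -
  have 1: "(\<Sum>l\<in>UNIV. (Q0 :: real^'m^'m) $ j $ l * axis a 1 $ l) = Q0 $ j $ a" for j
    by (simp add: axis_def if_distrib cong: if_cong)
  have 2: "(Q0 ** diag_mat (axis a 1) :: real^'m^'m) $ j $ k = Q0 $ j $ k * axis a 1 $ k"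
    by (simp add: matrix_matrix_mult_def diag_mat_def if_distrib cong: if_cong)
  have 3: "(diag_mat (axis a 1) ** Q0 :: real^'m^'m) $ j $ k = axis a 1 $ j * Q0 $ j $ k"
    by (simp add: matrix_matrix_mult_def diag_mat_def if_distrib[of "\<lambda>x. x * _"] cong: if_cong)
  have "psi (axis a 1 :: real^'m) $ j $ k
      = (if j = k then Q0 $ j $ a else 0) - Q0 $ j $ k * axis a 1 $ k - axis a 1 $ j * Q0 $ j $ k"
    unfolding psi_def vector_minus_component 2 3 by (simp add: diag_mat_def matrix_vector_mult_def 1)
  then show ?thesis by (auto simp: Q0_def axis_def)
qed

text \<open>The orthogonal projection onto the vectors with coordinate sum 0.\<close>

definition centering :: "real^'m^'m" where
  "centering = (\<chi> i j. of_bool (i = j) - 1 / real CARD('m))"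

text \<open>The projection that deletes coordinate \<open>a\<close>; it inverts the star Laplacian after
  the potential is grounded at \<open>a\<close>.\<close>

definition punctured :: "'m \<Rightarrow> real^'m^'m" where
  "punctured a = (\<chi> i j. of_bool (i = j \<and> i \<noteq> a))"

lemma transpose_symmetric: "(\<And>i j. M $ i $ j = M $ j $ i) \<Longrightarrow> transpose M = M"
  by (simp add: transpose_def vec_eq_iff)

lemma sum_psi_axis:
  "(\<Sum>k\<in>UNIV. psi (axis a 1 :: real^'m) $ j $ k) = 0"
proof (cases "j = a")
  case True
  have "(\<Sum>k\<in>UNIV. psi (axis a 1 :: real^'m) $ j $ k) = (\<Sum>k\<in>insert a (UNIV - {a}). psi (axis a 1 :: real^'m) $ j $ k)"
    by (rule sum.cong) auto
  also have "\<dots> = (real CARD('m) - 1) + (\<Sum>k\<in>UNIV - {a}. -1)"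
    using True by (subst sum.insert) (auto simp: psi_axis intro!: sum.cong)
  also have "\<dots> = 0" by (simp add: card_Diff_singleton of_nat_diff Suc_leI)
  finally show ?thesis .
next
  case False
  have "(\<Sum>k\<in>UNIV. psi (axis a 1 :: real^'m) $ j $ k) = (\<Sum>k\<in>{j, a}. psi (axis a 1 :: real^'m) $ j $ k)"
    using False by (intro sum.mono_neutral_right) (auto simp: psi_axis)
  then show ?thesis using False by (simp add: psi_axis)
qed

lemma psi_centering: "psi (axis a 1 :: real^'m) ** centering = psi (axis a 1)"
proof -
  have "(psi (axis a 1 :: real^'m) ** centering) $ j $ l = psi (axis a 1) $ j $ l" for j l
  proof -
    have "(psi (axis a 1 :: real^'m) ** centering) $ j $ l
        = (\<Sum>k\<in>UNIV. (if k = l then psi (axis a 1 :: real^'m) $ j $ k else 0)) - (\<Sum>k\<in>UNIV. psi (axis a 1 :: real^'m) $ j $ k) / real CARD('m)"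
      unfolding matrix_matrix_mult_def centering_def vec_lambda_beta sum_divide_distrib sum_subtractf[symmetric]
      by (intro sum.cong) (auto simp: algebra_simps)
    then show ?thesis by (simp add: sum_psi_axis)
  qed
  then show ?thesis by (simp add: vec_eq_iff)
qed

lemma psi_symmetric: "transpose (psi (axis a 1 :: real^'m)) = psi (axis a 1)"
  by (rule transpose_symmetric) (auto simp: psi_axis)

lemma centering_symmetric: "transpose centering = (centering :: real^'m^'m)"
  by (rule transpose_symmetric) (auto simp: centering_def)

lemma punctured_symmetric: "transpose (punctured a) = (punctured a :: real^'m^'m)"
  by (rule transpose_symmetric) (auto simp: punctured_def)

lemma centering_psi: "centering ** psi (axis a 1 :: real^'m) = psi (axis a 1)"
proof -
  have "transpose (psi (axis a 1 :: real^'m) ** centering) = transpose (psi (axis a 1))" by (simp add: psi_centering)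
  then show ?thesis by (simp add: matrix_transpose_mul psi_symmetric centering_symmetric)
qed

lemma sum_centering: "(\<Sum>k\<in>UNIV. (centering :: real^'m^'m) $ k $ l) = 0"
  by (simp add: centering_def sum_subtractf)

lemma psi_punctured_centering: "psi (axis a 1 :: real^'m) ** punctured a ** centering = centering"
proof -
  have pd: "(psi (axis a 1 :: real^'m) ** punctured a) $ j $ l = of_bool (j = l) - of_bool (j = a)" for j l
  proof -
    have "(psi (axis a 1 :: real^'m) ** punctured a) $ j $ l = (\<Sum>k\<in>UNIV. (if k = l then psi (axis a 1) $ j $ k * of_bool (k \<noteq> a) else 0))"
      unfolding matrix_matrix_mult_def punctured_def vec_lambda_beta by (intro sum.cong) auto
    then show ?thesis by (auto simp: psi_axis)
  qed
  have "(psi (axis a 1 :: real^'m) ** punctured a ** centering) $ j $ l = centering $ j $ l" for j l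
  proof -
    have "(psi (axis a 1 :: real^'m) ** punctured a ** centering) $ j $ l
        = (\<Sum>k\<in>UNIV. (if j = k then centering $ k $ l else 0)) - of_bool (j = a) * (\<Sum>k\<in>UNIV. centering $ k $ l)"
      unfolding matrix_matrix_mult_def[of "psi (axis a 1 :: real^'m) ** punctured a"] vec_lambda_beta pd sum_distrib_left sum_subtractf[symmetric]
      by (intro sum.cong) (auto simp: algebra_simps)
    then show ?thesis by (simp add: sum_centering)
  qed
  then show ?thesis by (simp add: vec_eq_iff)
qed

text \<open>The image of the centering matrix is fixed by it, because it lies in the image of any star
  Laplacian.\<close>

lemma centering_idempotent: "centering ** centering = (centering :: real^'m^'m)"
proof -
  let ?P = "psi (axis undefined 1 :: real^'m)" and ?D = "punctured undefined :: real^'m^'m"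
  have "centering ** (?P ** ?D ** centering) = ?P ** ?D ** centering"
    by (simp add: matrix_mul_assoc centering_psi)
  then show ?thesis by (simp add: psi_punctured_centering)
qed

text \<open>Solving the star Laplacian means grounding the potential at the centre \<open>a\<close>;
  projecting both argument and solution onto vectors of sum 0 makes the solution operator symmetric,
  hence the pseudo-inverse.\<close>

lemma moore_penrose_psi:
  fixes a :: "'m::finite"
  defines "B \<equiv> centering ** punctured a ** centering :: real^'m^'m"
  shows "moore_penrose (psi (axis a 1 :: real^'m)) = B" and "B ** psi (axis a 1) = centering"
proof -
  let ?P = "psi (axis a 1 :: real^'m)"
  have PB: "?P ** B = centering"
    unfolding B_def by (simp add: matrix_mul_assoc psi_centering psi_punctured_centering)
  have tB: "transpose B = B"
    unfolding B_def by (simp add: matrix_transpose_mul centering_symmetric punctured_symmetric matrix_mul_assoc)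
  have "transpose (?P ** B) = transpose centering" using PB by simp
  then show BP: "B ** ?P = centering" by (simp add: matrix_transpose_mul tB psi_symmetric centering_symmetric)
  have "centering ** B = B" unfolding B_def by (simp add: matrix_mul_assoc centering_idempotent)
  then have "penrose_inverse ?P B"
    by (simp add: penrose_inverse_def PB BP centering_psi centering_symmetric)
  then show "moore_penrose ?P = B" by (rule moore_penrose_eq)
qed

text \<open>The potential difference along the edge from \<open>a\<close> to \<open>j\<close> is the
  flow through that edge of the star. These differences are all that the stochastic integral sees,
  because the increments of the integrator are differences of states.\<close>

lemma moore_penrose_psi_differences:
  fixes y :: "real^'m"
  assumes y: "(\<Sum>j\<in>UNIV. y $ j) = 0"
  shows "(y v* moore_penrose (psi (axis a 1))) $ j - (y v* moore_penrose (psi (axis a 1))) $ a = (if j = a then 0 else y $ j)"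
proof -
  let ?v = "y v* moore_penrose (psi (axis a 1 :: real^'m))"
  have "?v v* psi (axis a 1) = y v* centering"
    by (simp add: vector_matrix_mul_assoc moore_penrose_psi)
  also have "\<dots> = y"
  proof -
    have "(y v* centering) $ j = (\<Sum>i\<in>UNIV. (if i = j then y $ i else 0)) - (\<Sum>i\<in>UNIV. y $ i) / real CARD('m)" for j
      unfolding vector_matrix_mult_def centering_def vec_lambda_beta sum_divide_distrib sum_subtractf[symmetric]
      by (intro sum.cong) (auto simp: algebra_simps)
    then show ?thesis by (simp add: vec_eq_iff y)
  qed
  finally have v: "?v v* psi (axis a 1) = y" .
  show ?thesis
  proof (cases "j = a")
    case False
    have "y $ j = (?v v* psi (axis a 1)) $ j" by (simp only: v)
    also have "\<dots> = (\<Sum>i\<in>UNIV. ?v $ i * psi (axis a 1) $ i $ j)"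
      by (simp add: vector_matrix_mult_def[of ?v])
    also have "\<dots> = (\<Sum>i\<in>{j, a}. ?v $ i * psi (axis a 1) $ i $ j)"
      using False by (intro sum.mono_neutral_right) (auto simp: psi_axis)
    also have "\<dots> = ?v $ j - ?v $ a" using False by (simp add: psi_axis)
    finally show ?thesis using False by simp
  qed simp
qed

section \<open>The pathwise Girsanov integral\<close>

text \<open>For states \<open>x\<close> and \<open>y\<close>, the entry of \<open>R\<close> for the
  transition from \<open>x\<close> to \<open>y\<close>. The bilinear form avoids decoding the index of a
  state and makes measurability evident.\<close>

definition jump_rate :: "real^'m^'m \<Rightarrow> real^'m \<Rightarrow> real^'m \<Rightarrow> real" where
  "jump_rate R x y = (\<Sum>i\<in>UNIV. \<Sum>j\<in>UNIV. x $ i * R $ i $ j * y $ j)"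

text \<open>The total jump intensity out of state \<open>x\<close> under \<open>R\<close>, minus the one
  under the reference rates 1.\<close>

definition excess_intensity :: "real^'m^'m \<Rightarrow> real^'m \<Rightarrow> real" where
  "excess_intensity R x = (\<Sum>i\<in>UNIV. x $ i * (\<Sum>j\<in>UNIV - {i}. R $ i $ j - 1))"

lemma sum_axis: "(\<Sum>i\<in>UNIV. (axis a 1 :: real^'m) $ i * f i) = f a"
proof -
  have "(\<Sum>i\<in>UNIV. (axis a 1 :: real^'m) $ i * f i) = (\<Sum>i\<in>UNIV. (if i = a then f i else 0))"
    by (intro sum.cong) (auto simp: axis_def)
  then show ?thesis by simp
qed

lemma jump_rate_axis: "jump_rate R (axis a 1) (axis b 1) = R $ a $ b"
proof -
  have "jump_rate R (axis a 1) (axis b 1) = (\<Sum>i\<in>UNIV. axis a 1 $ i * (\<Sum>j\<in>UNIV. axis b 1 $ j * R $ i $ j))"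
    unfolding jump_rate_def sum_distrib_left by (intro sum.cong) (auto simp: mult_ac)
  then show ?thesis by (simp add: sum_axis)
qed

lemma excess_intensity_axis: "excess_intensity R (axis a 1) = (\<Sum>j\<in>UNIV - {a}. R $ a $ j - 1)"
  by (simp add: excess_intensity_def sum_axis)

text \<open>A function on the states is linear in the state. This turns measurability of a composition
  with a random state into measurability of a finite sum.\<close>

lemma state_expand:
  assumes "x \<in> states"
  shows "\<phi> x = (\<Sum>a\<in>UNIV. x $ a * \<phi> (axis a 1) :: real)"
proof -
  obtain b where "x = axis b 1" using assms by (auto simp: states_def)
  then show ?thesis by (simp add: sum_axis)
qed

lemma states_component_le: "x \<in> states \<Longrightarrow> \<bar>x $ i\<bar> \<le> 1"
  by (auto simp: states_def axis_def)

lemma borel_measurable_vec_component [measurable (raw)]: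
  fixes f :: "'a \<Rightarrow> real^'n"
  assumes "f \<in> borel_measurable M"
  shows "(\<lambda>x. f x $ i) \<in> borel_measurable M"
  by (rule measurable_compose[OF assms borel_measurable_continuous_onI]) (intro continuous_intros)

lemma bounded_measurable_left_lim:
  fixes \<omega> :: "real \<Rightarrow> real^'m"
  assumes \<omega>: "\<omega> \<in> paths T" and T: "0 < T"
  shows "bounded_measurable_on T (\<lambda>s. left_lim \<omega> s $ i)"
proof -
  have "(\<lambda>_. \<omega>) \<in> count_space {()} \<rightarrow>\<^sub>M canonical_filtration T T" using \<omega> by simp
  from path_left_lim_measurable[OF this T]
  have "(\<lambda>z. left_lim \<omega> (fst z)) \<in> borel_measurable (restrict_space borel {0..T} \<Otimes>\<^sub>M count_space {()})" .
  from measurable_compose[OF measurable_Pair2' this, of "()"]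
  have "(\<lambda>s. left_lim \<omega> s) \<in> borel_measurable (restrict_space borel {0..T})" by simp
  then have "(\<lambda>s. left_lim \<omega> s $ i) \<in> borel_measurable (restrict_space borel {0..T})" by measurable
  moreover have "\<bar>left_lim \<omega> s $ i\<bar> \<le> 1" if "s \<in> {0..T}" for s
    using left_lim_in_states[OF \<omega> that] states_component_le by blast
  ultimately show ?thesis unfolding bounded_measurable_on_def by blast
qed

text \<open>The martingale moves by the jumps of the path and by the compensating drift; the single time
  0, where the two integrals differ, is a null set.\<close>

lemma chain_martingale_component:
  fixes \<omega> :: "real \<Rightarrow> real^'m"
  assumes \<omega>: "\<omega> \<in> paths T" and T: "0 < T" and s: "s \<in> {0..T}"
  shows "chain_martingale \<omega> s $ i = (\<Sum>\<tau>\<in>jumps T \<omega> \<inter> {0<..s}. (\<omega> \<tau> - left_lim \<omega> \<tau>) $ i)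
      - (LINT u:{0<..s}|lborel. (Q0 *v left_lim \<omega> u) $ i)"
proof -
  have Qc: "(Q0 *v left_lim \<omega> u) $ j = (\<Sum>k\<in>UNIV. Q0 $ j $ k * left_lim \<omega> u $ k)" for u j
    by (simp add: matrix_vector_mult_def)
  have bm: "bounded_measurable_on T (\<lambda>u. (Q0 *v left_lim \<omega> u) $ j)" for j
    unfolding Qc by (intro bounded_measurable_on_sum bounded_measurable_on_mult bounded_measurable_on_const bounded_measurable_left_lim \<omega> T)
  have i0: "integrable lborel (\<lambda>u. indicator {0<..s} u *\<^sub>R (Q0 *v left_lim \<omega> u))"
  proof -
    have "integrable lborel (\<lambda>u. (\<Sum>j\<in>UNIV. (indicator {0<..s} u *\<^sub>R (Q0 *v left_lim \<omega> u) $ j) *\<^sub>R axis j (1::real)))"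
      using bounded_measurable_on_set_integrable_lborel[OF bm] s unfolding set_integrable_def
      by (intro Bochner_Integration.integrable_sum integrable_scaleR_left) auto
    moreover have "(\<Sum>j\<in>UNIV. (indicator {0<..s} u *\<^sub>R (Q0 *v left_lim \<omega> u) $ j) *\<^sub>R axis j (1::real)) = indicator {0<..s} u *\<^sub>R (Q0 *v left_lim \<omega> u)" for u
      by (simp add: vec_eq_iff axis_def if_distrib cong: if_cong)
    ultimately show ?thesis by simp
  qed
  have "(LINT u:{0..s}|lborel. Q0 *v left_lim \<omega> u) = (LINT u:{0<..s}|lborel. Q0 *v left_lim \<omega> u)"
    unfolding set_lebesgue_integral_def
  proof (rule integral_cong_AE)
    have ae: "AE u in lborel. indicator {0..s} u *\<^sub>R (Q0 *v left_lim \<omega> u) = indicator {0<..s} u *\<^sub>R (Q0 *v left_lim \<omega> u)"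
      using AE_lborel_singleton[of "0::real"] by eventually_elim (auto simp: indicator_def)
    then show "AE u in lborel. indicator {0..s} u *\<^sub>R (Q0 *v left_lim \<omega> u) = indicator {0<..s} u *\<^sub>R (Q0 *v left_lim \<omega> u)" .
    show m: "(\<lambda>u. indicator {0<..s} u *\<^sub>R (Q0 *v left_lim \<omega> u)) \<in> borel_measurable lborel"
      using i0 by (rule borel_measurable_integrable)
    have "(\<lambda>u. indicator {0<..s} u *\<^sub>R (Q0 *v left_lim \<omega> u) + indicator {0} u *\<^sub>R (indicator {0..s} 0 *\<^sub>R (Q0 *v left_lim \<omega> 0))) \<in> borel_measurable lborel"
      using m by measurable
    moreover have "(\<lambda>u. indicator {0<..s} u *\<^sub>R (Q0 *v left_lim \<omega> u) + indicator {0} u *\<^sub>R (indicator {0..s} 0 *\<^sub>R (Q0 *v left_lim \<omega> 0)))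
        = (\<lambda>u. indicator {0..s} u *\<^sub>R (Q0 *v left_lim \<omega> u))"
      by (auto simp: indicator_def fun_eq_iff)
    ultimately show "(\<lambda>u. indicator {0..s} u *\<^sub>R (Q0 *v left_lim \<omega> u)) \<in> borel_measurable lborel" by simp
  qed
  also have "(LINT u:{0<..s}|lborel. Q0 *v left_lim \<omega> u) $ i = (LINT u:{0<..s}|lborel. (Q0 *v left_lim \<omega> u) $ i)"
    unfolding set_lebesgue_integral_def
    using integral_bounded_linear[OF bounded_linear_vec_nth i0, of i] by simp
  finally have I: "(LINT u:{0..s}|lborel. Q0 *v left_lim \<omega> u) $ i = (LINT u:{0<..s}|lborel. (Q0 *v left_lim \<omega> u) $ i)" .
  have "\<omega> s - \<omega> 0 = (\<Sum>\<tau>\<in>jumps T \<omega> \<inter> {0<..s}. \<omega> \<tau> - left_lim \<omega> \<tau>)"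
    using paths_increment_sum_jumps[OF \<omega>, of 0 s] s by auto
  then show ?thesis unfolding chain_martingale_def vector_minus_component I
    by (metis (no_types, lifting) sum.cong sum_component vector_minus_component)
qed

text \<open>Each jump of the path from \<open>a\<close> to \<open>b\<close> contributes the difference
  of two components of the integrand, which is the relative excess \<open>R a b - 1\<close> by the
  formula for the pseudo-inverse; the compensator contributes the sum of these excesses over all
  targets.\<close>

lemma girsanov_integral_explicit:
  fixes \<omega> :: "real \<Rightarrow> real^'m" and R :: "real \<Rightarrow> real^'m^'m"
  assumes \<omega>: "\<omega> \<in> paths T" and T: "0 < T"
    and R: "\<And>i j. bounded_measurable_on T (\<lambda>s. R s $ i $ j)"
    and rows: "\<And>s i. s \<in> {0..T} \<Longrightarrow> (\<Sum>j\<in>UNIV. R s $ i $ j) = 0"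
    and t: "t \<in> {0..T}"
  shows "girsanov_integral R \<omega> t = (\<Sum>\<tau>\<in>jumps T \<omega> \<inter> {0<..t}. jump_rate (R \<tau>) (left_lim \<omega> \<tau>) (\<omega> \<tau>) - 1)
      - (LINT s:{0<..t}|lborel. excess_intensity (R s) (left_lim \<omega> s))"
proof -
  \<comment> \<open>The integrand of the stochastic integral.\<close>
  define v where "v s = left_lim \<omega> s v* (R s - Q0) v* moore_penrose (psi (left_lim \<omega> s))" for s
  \<comment> \<open>The rows of \<open>R - Q0\<close> sum to 0, so the pseudo-inverse formula for
    differences applies.\<close>
  have vdiff: "v s $ j - v s $ a = (if j = a then 0 else R s $ a $ j - 1)" if s: "s \<in> {0..T}" and a: "left_lim \<omega> s = axis a 1" for s a j
  proof -
    have y: "(axis a 1 v* (R s - Q0)) $ j = R s $ a $ j - (Q0 :: real^'m^'m) $ a $ j" for j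
      unfolding vector_matrix_mult_def by (simp add: mult.commute sum_axis)
    have "(\<Sum>j\<in>UNIV. (Q0 :: real^'m^'m) $ a $ j) = 0"
    proof -
      have "(\<Sum>j\<in>UNIV. (Q0 :: real^'m^'m) $ a $ j) = (\<Sum>j\<in>insert a (UNIV - {a}). Q0 $ a $ j)" by (rule sum.cong) auto
      also have "\<dots> = - (real CARD('m) - 1) + (\<Sum>k\<in>UNIV - {a}. 1)"
        by (subst sum.insert) (auto simp: Q0_def intro!: sum.cong)
      also have "\<dots> = 0" by (simp add: card_Diff_singleton of_nat_diff Suc_leI)
      finally show ?thesis .
    qed
    then have "(\<Sum>j\<in>UNIV. (axis a 1 v* (R s - Q0)) $ j) = 0" unfolding y sum_subtractf by (simp add: rows[OF s])
    from moore_penrose_psi_differences[OF this, of a j] show ?thesis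
      unfolding v_def a by (simp add: y) (simp add: Q0_def)
  qed
  have vbm: "bounded_measurable_on T (\<lambda>s. v s $ i)" for i
  proof (rule bounded_measurable_on_cong)
    let ?B = "\<lambda>a. moore_penrose (psi (axis a 1 :: real^'m))"
    show "bounded_measurable_on T (\<lambda>s. \<Sum>a\<in>UNIV. left_lim \<omega> s $ a *
        (\<Sum>k\<in>UNIV. (\<Sum>l\<in>UNIV. axis a 1 $ l * (R s $ l $ k - Q0 $ l $ k)) * ?B a $ k $ i))"
      by (intro bounded_measurable_on_sum bounded_measurable_on_mult bounded_measurable_on_diff bounded_measurable_on_const
          bounded_measurable_left_lim \<omega> T R)
    fix s assume "s \<in> {0..T}"
    then have "left_lim \<omega> s \<in> states" using left_lim_in_states \<omega> by blast
    from state_expand[OF this, of "\<lambda>x. (x v* (R s - Q0) v* moore_penrose (psi x)) $ i"]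
    show "(\<Sum>a\<in>UNIV. left_lim \<omega> s $ a *
        (\<Sum>k\<in>UNIV. (\<Sum>l\<in>UNIV. axis a 1 $ l * (R s $ l $ k - Q0 $ l $ k)) * ?B a $ k $ i)) = v s $ i"
      by (simp add: v_def vector_matrix_mult_def)
  qed
  have Qbm: "bounded_measurable_on T (\<lambda>u. (Q0 *v left_lim \<omega> u) $ j)" for j
    unfolding matrix_vector_mult_def vec_lambda_beta
    by (intro bounded_measurable_on_sum bounded_measurable_on_mult bounded_measurable_on_const bounded_measurable_left_lim \<omega> T)
  have tT: "t \<le> T" using t by simp
  have si: "stieltjes_integral t (\<lambda>s. v s $ i) (\<lambda>s. chain_martingale \<omega> s $ i)
      = (\<Sum>\<tau>\<in>jumps T \<omega> \<inter> {0<..t}. v \<tau> $ i * (\<omega> \<tau> - left_lim \<omega> \<tau>) $ i) - (LINT s:{0<..t}|lborel. v s $ i * (Q0 *v left_lim \<omega> s) $ i)" for i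
    by (rule stieltjes_integral_jumps_drift[OF vbm Qbm tT finite_jumps[OF \<omega>]])
       (use jumps_subset chain_martingale_component[OF \<omega> T] t in \<open>auto simp: jumps_def\<close>)
  have "girsanov_integral R \<omega> t = (\<Sum>i\<in>UNIV. (\<Sum>\<tau>\<in>jumps T \<omega> \<inter> {0<..t}. v \<tau> $ i * (\<omega> \<tau> - left_lim \<omega> \<tau>) $ i))
      - (\<Sum>i\<in>UNIV. (LINT s:{0<..t}|lborel. v s $ i * (Q0 *v left_lim \<omega> s) $ i))"
    unfolding girsanov_integral_def v_def[symmetric] si sum_subtractf ..
  also have "(\<Sum>i\<in>UNIV. (\<Sum>\<tau>\<in>jumps T \<omega> \<inter> {0<..t}. v \<tau> $ i * (\<omega> \<tau> - left_lim \<omega> \<tau>) $ i))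
      = (\<Sum>\<tau>\<in>jumps T \<omega> \<inter> {0<..t}. \<Sum>i\<in>UNIV. v \<tau> $ i * (\<omega> \<tau> - left_lim \<omega> \<tau>) $ i)" by (rule sum.swap)
  also have "\<dots> = (\<Sum>\<tau>\<in>jumps T \<omega> \<inter> {0<..t}. jump_rate (R \<tau>) (left_lim \<omega> \<tau>) (\<omega> \<tau>) - 1)"
  proof (rule sum.cong[OF refl])
    fix \<tau> assume "\<tau> \<in> jumps T \<omega> \<inter> {0<..t}"
    then have \<tau>: "\<tau> \<in> {0..T}" "\<omega> \<tau> \<noteq> left_lim \<omega> \<tau>" by (auto simp: jumps_def)
    obtain a b where ab: "left_lim \<omega> \<tau> = axis a 1" "\<omega> \<tau> = axis b 1"
      using left_lim_in_states[OF \<omega> \<tau>(1)] paths_in_states[OF \<omega> \<tau>(1)] by (auto simp: states_def)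
    have "(\<Sum>i\<in>UNIV. v \<tau> $ i * (\<omega> \<tau> - left_lim \<omega> \<tau>) $ i)
        = (\<Sum>i\<in>UNIV. axis b 1 $ i * v \<tau> $ i) - (\<Sum>i\<in>UNIV. axis a 1 $ i * v \<tau> $ i)"
      unfolding sum_subtractf[symmetric] ab by (intro sum.cong) (auto simp: algebra_simps)
    also have "\<dots> = v \<tau> $ b - v \<tau> $ a" by (simp add: sum_axis)
    also have "\<dots> = R \<tau> $ a $ b - 1" using vdiff[OF \<tau>(1) ab(1), of b] \<tau>(2) ab by auto
    finally show "(\<Sum>i\<in>UNIV. v \<tau> $ i * (\<omega> \<tau> - left_lim \<omega> \<tau>) $ i) = jump_rate (R \<tau>) (left_lim \<omega> \<tau>) (\<omega> \<tau>) - 1"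
      by (simp add: ab jump_rate_axis)
  qed
  also have "(\<Sum>i\<in>UNIV. (LINT s:{0<..t}|lborel. v s $ i * (Q0 *v left_lim \<omega> s) $ i))
      = (LINT s:{0<..t}|lborel. (\<Sum>i\<in>UNIV. v s $ i * (Q0 *v left_lim \<omega> s) $ i))"
    unfolding set_lebesgue_integral_def scaleR_sum_right
    using bounded_measurable_on_set_integrable_lborel[OF bounded_measurable_on_mult[OF vbm Qbm] tT]
    by (subst Bochner_Integration.integral_sum) (auto simp: set_integrable_def)
  also have "\<dots> = (LINT s:{0<..t}|lborel. excess_intensity (R s) (left_lim \<omega> s))"
  proof (rule set_lebesgue_integral_cong)
    show "\<forall>s. s \<in> {0<..t} \<longrightarrow> (\<Sum>i\<in>UNIV. v s $ i * (Q0 *v left_lim \<omega> s) $ i) = excess_intensity (R s) (left_lim \<omega> s)"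
    proof (intro allI impI)
      fix s assume "s \<in> {0<..t}"
      then have s: "s \<in> {0..T}" using t by auto
      obtain a where a: "left_lim \<omega> s = axis a 1" using left_lim_in_states[OF \<omega> s] by (auto simp: states_def)
      have q: "((Q0 :: real^'m^'m) *v axis a 1) $ i = Q0 $ i $ a" for i
        unfolding matrix_vector_mult_def by (simp add: mult.commute[of "Q0 $ _ $ _"] sum_axis)
      have "(\<Sum>i\<in>UNIV. v s $ i * (Q0 *v left_lim \<omega> s) $ i) = (\<Sum>i\<in>insert a (UNIV - {a}). v s $ i * Q0 $ i $ a)"
        unfolding a q by (rule sum.cong) auto
      also have "\<dots> = v s $ a * - (real CARD('m) - 1) + (\<Sum>i\<in>UNIV - {a}. v s $ i)"
        by (subst sum.insert) (auto simp: Q0_def intro!: sum.cong)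
      also have "\<dots> = (\<Sum>i\<in>UNIV - {a}. v s $ i - v s $ a)"
        by (simp add: sum_subtractf card_Diff_singleton of_nat_diff Suc_leI algebra_simps)
      also have "\<dots> = (\<Sum>i\<in>UNIV - {a}. R s $ a $ i - 1)"
        by (rule sum.cong) (auto simp: vdiff[OF s a])
      finally show "(\<Sum>i\<in>UNIV. v s $ i * (Q0 *v left_lim \<omega> s) $ i) = excess_intensity (R s) (left_lim \<omega> s)"
        by (simp add: a excess_intensity_axis)
    qed
  qed simp
  finally show ?thesis .
qed

section \<open>The reference chain\<close>

lemma Q0_eq_centering: "(Q0 :: real^'m^'m) = - real CARD('m) *\<^sub>R centering"
  by (simp add: vec_eq_iff Q0_def centering_def algebra_simps)

text \<open>The rate matrix is a multiple of a projection, so its exponential is explicit.\<close>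

lemma mat_exp_Q0:
  "mat_exp (h *\<^sub>R (Q0 :: real^'m^'m)) = exp (- real CARD('m) * h) *\<^sub>R centering + (mat 1 - centering)"
proof -
  let ?c = "- real CARD('m) * h" and ?C = "centering :: real^'m^'m"
  have Q: "h *\<^sub>R (Q0 :: real^'m^'m) = ?c *\<^sub>R ?C" by (simp add: Q0_eq_centering mult.commute)
  have smult: "(a *\<^sub>R A) ** B = a *\<^sub>R (A ** B)" "A ** (a *\<^sub>R B) = a *\<^sub>R (A ** B)" for a and A B :: "real^'m^'m"
    by (simp_all add: matrix_matrix_mult_def vec_eq_iff sum_distrib_left mult_ac)
  have diff: "A ** (B - D) = A ** B - A ** D" for A B D :: "real^'m^'m"
    by (simp add: matrix_matrix_mult_def vec_eq_iff algebra_simps sum_subtractf)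
  have pow: "((**) (c *\<^sub>R ?C) ^^ k) (mat 1) = c ^ k *\<^sub>R ?C + (if k = 0 then mat 1 - ?C else 0)" for k and c :: real
  proof (induction k)
    case (Suc k)
    have "((**) (c *\<^sub>R ?C) ^^ Suc k) (mat 1) = (c *\<^sub>R ?C) ** (c ^ k *\<^sub>R ?C + (if k = 0 then mat 1 - ?C else 0))"
      by (simp only: funpow.simps o_apply Suc.IH)
    also have "\<dots> = c ^ Suc k *\<^sub>R ?C"
      by (auto simp: smult matrix_add_ldistrib centering_idempotent diff)
    finally show ?case by simp
  qed simp
  have "(\<lambda>k. (?c ^ k /\<^sub>R fact k) *\<^sub>R ?C) sums (exp ?c *\<^sub>R ?C)"
    by (intro sums_scaleR_left exp_converges)
  moreover have "(\<lambda>k. if k = 0 then mat 1 - ?C else 0) sums (mat 1 - ?C)"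
    by (rule sums_single)
  ultimately have "(\<lambda>k. (?c ^ k /\<^sub>R fact k) *\<^sub>R ?C + (if k = 0 then mat 1 - ?C else 0)) sums (exp ?c *\<^sub>R ?C + (mat 1 - ?C))"
    by (rule sums_add)
  moreover have "(?c ^ k /\<^sub>R fact k) *\<^sub>R ?C + (if k = 0 then mat 1 - ?C else 0)
      = (1 / fact k) *\<^sub>R (((**) (?c *\<^sub>R ?C) ^^ k) (mat 1))" for k
    unfolding pow by (cases k) (auto simp: scaleR_right_distrib field_simps)
  ultimately show ?thesis unfolding mat_exp_def Q by (simp add: sums_iff)
qed

text \<open>From \<open>exp x \<ge> 1 + x\<close>: the chain stays put for time \<open>h\<close> with
  probability at least \<open>1 - (m - 1) h\<close>.\<close>

lemma mat_exp_Q0_diag_ge: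
  "1 - (real CARD('m) - 1) * h \<le> mat_exp (h *\<^sub>R (Q0 :: real^'m^'m)) $ j $ j"
proof -
  let ?m = "real CARD('m)"
  have m: "1 \<le> ?m" by (simp add: Suc_leI)
  have "1 - (?m - 1) * h = (1 - ?m * h) * (1 - 1 / ?m) + 1 / ?m" using m by (simp add: field_simps)
  also have "\<dots> \<le> exp (- ?m * h) * (1 - 1 / ?m) + 1 / ?m"
    using m exp_ge_add_one_self[of "- ?m * h"] by (intro add_right_mono mult_right_mono) auto
  also have "\<dots> = mat_exp (h *\<^sub>R (Q0 :: real^'m^'m)) $ j $ j"
    unfolding mat_exp_Q0 by (simp add: centering_def mat_def)
  finally show ?thesis .
qed

lemma chain_law_space: "is_chain_law T p0 P \<Longrightarrow> space P = paths T"
  unfolding is_chain_law_def by (metis sets_eq_imp_space_eq space_canonical_filtration)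

lemma chain_law_measurable_canonical:
  "is_chain_law T p0 P \<Longrightarrow> (\<lambda>\<omega>. \<omega>) \<in> P \<rightarrow>\<^sub>M canonical_filtration T T"
  unfolding is_chain_law_def by (auto cong: measurable_cong_sets)

lemma chain_law_subalgebra:
  assumes "is_chain_law T p0 P" "s \<le> T"
  shows "subalgebra P (canonical_filtration T s)"
  using assms canonical_filtration_mono[OF assms(2)] chain_law_space[OF assms(1)]
  by (auto simp: subalgebra_def is_chain_law_def)

lemma chain_law_coordinate:
  assumes "is_chain_law T p0 P" "t \<in> {0..T}"
  shows "(\<lambda>\<omega>. \<omega> t) \<in> borel_measurable P"
  using measurable_compose[OF chain_law_measurable_canonical[OF assms(1)] measurable_canonical_coordinate[OF assms(2)]] .

text \<open>Split according to the state at time \<open>s\<close>: on each part the conditional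
  probability to be elsewhere at time \<open>t\<close> is controlled by a diagonal entry of the
  transition matrix. The Markov property enters the later estimates in this form, where the event
  \<open>B\<close> stands for the whole past.\<close>

lemma chain_change_probability_le:
  fixes P :: "(real \<Rightarrow> real^'m) measure"
  assumes P: "is_chain_law T p0 P" and st: "0 \<le> s" "s \<le> t" "t \<le> T"
    and B: "B \<in> sets (canonical_filtration T s)"
  shows "measure P (B \<inter> {\<omega> \<in> space P. \<omega> t \<noteq> \<omega> s}) \<le> (real CARD('m) - 1) * (t - s) * measure P B"
proof -
  interpret prob_space P using P by (simp add: is_chain_law_def)
  let ?F = "canonical_filtration T s"
  have sub: "subalgebra P ?F" using chain_law_subalgebra[OF P] st by simp
  interpret finite_measure_subalgebra P ?F by standard (rule sub)
  have sp: "space P = paths T" by (rule chain_law_space[OF P])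
  have FP: "A \<in> sets P" if "A \<in> sets ?F" for A using sub that by (auto simp: subalgebra_def)
  have [measurable]: "(\<lambda>\<omega>. \<omega> s) \<in> borel_measurable P" "(\<lambda>\<omega>. \<omega> t) \<in> borel_measurable P"
    using chain_law_coordinate[OF P] st by auto
  define Bj where "Bj j = B \<inter> {\<omega> \<in> space P. \<omega> s = axis j 1}" for j
  have BjF: "Bj j \<in> sets ?F" for j
  proof -
    have "(\<lambda>\<omega>. \<omega> s) -` {axis j 1} \<inter> space ?F \<in> sets ?F"
      using measurable_canonical_coordinate[of s s T] st by (intro measurable_sets[of _ _ borel]) auto
    moreover have "Bj j = B \<inter> ((\<lambda>\<omega>. \<omega> s) -` {axis j 1} \<inter> space ?F)" by (auto simp: Bj_def sp)
    ultimately show ?thesis using B by simp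
  qed
  have Bj_bound: "measure P (Bj j \<inter> {\<omega> \<in> space P. \<omega> t \<noteq> axis j 1}) \<le> (real CARD('m) - 1) * (t - s) * measure P (Bj j)" for j
  proof -
    define S where "S = {\<omega> \<in> space P. \<omega> t = axis j 1}"
    have S[measurable]: "S \<in> sets P" unfolding S_def by measurable
    note [measurable] = FP[OF BjF[of j]]
    let ?e = "mat_exp ((t - s) *\<^sub>R (Q0 :: real^'m^'m)) $ j $ j"
    have ae: "AE \<omega> in P. real_cond_exp P ?F (indicator S) \<omega> = (\<omega> s v* mat_exp ((t - s) *\<^sub>R Q0)) $ j"
      using P st unfolding is_chain_law_def S_def by blast
    have "measure P (Bj j \<inter> S) = (\<integral>\<omega>\<in>Bj j. indicator S \<omega> \<partial>P)"
    proof -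
      have "(\<integral>\<omega>\<in>Bj j. indicator S \<omega> \<partial>P) = (\<integral>\<omega>. indicat_real (Bj j \<inter> S) \<omega> \<partial>P)"
        unfolding set_lebesgue_integral_def by (intro Bochner_Integration.integral_cong) (auto simp: indicator_def)
      then show ?thesis by simp
    qed
    also have "\<dots> = (\<integral>\<omega>\<in>Bj j. real_cond_exp P ?F (indicator S) \<omega> \<partial>P)"
      by (rule real_cond_exp_intA[OF integrable_real_indicator[OF S] BjF]) (simp add: emeasure_eq_measure)
    also have "\<dots> = (\<integral>\<omega>. indicator (Bj j) \<omega> * ?e \<partial>P)"
      unfolding set_lebesgue_integral_def
    proof (rule integral_cong_AE)
      show "AE \<omega> in P. indicator (Bj j) \<omega> *\<^sub>R real_cond_exp P ?F (indicator S) \<omega> = indicator (Bj j) \<omega> * ?e"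
        using ae
      proof eventually_elim
        case (elim \<omega>)
        show ?case
        proof (cases "\<omega> \<in> Bj j")
          case True
          then have "\<omega> s = axis j 1" by (simp add: Bj_def)
          then have "(\<omega> s v* mat_exp ((t - s) *\<^sub>R Q0)) $ j = ?e"
            by (simp add: vector_matrix_mult_def sum_axis)
          then show ?thesis using elim by simp
        qed simp
      qed
    qed measurable
    also have "\<dots> = ?e * measure P (Bj j)" by simp
    finally have "measure P (Bj j \<inter> S) = ?e * measure P (Bj j)" .
    moreover have "(1 - (real CARD('m) - 1) * (t - s)) * measure P (Bj j) \<le> ?e * measure P (Bj j)"
      by (intro mult_right_mono mat_exp_Q0_diag_ge) simp
    moreover have "measure P (Bj j \<inter> {\<omega> \<in> space P. \<omega> t \<noteq> axis j 1}) = measure P (Bj j) - measure P (Bj j \<inter> S)"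
    proof -
      have "Bj j \<inter> {\<omega> \<in> space P. \<omega> t \<noteq> axis j 1} = Bj j - Bj j \<inter> S" using sets.sets_into_space[OF FP[OF BjF[of j]]] by (auto simp: S_def)
      then show ?thesis by (simp add: finite_measure_Diff)
    qed
    ultimately show ?thesis by (simp add: algebra_simps)
  qed
  have "B \<subseteq> space P" using sets.sets_into_space[OF FP[OF B]] .
  have BU: "(\<Union>j\<in>UNIV. Bj j) = B"
    using \<open>B \<subseteq> space P\<close> paths_in_states[of _ T s] st by (fastforce simp: Bj_def states_def sp)
  have dj: "disjoint_family_on Bj UNIV" by (auto simp: disjoint_family_on_def Bj_def axis_eq_axis)
  have "B \<inter> {\<omega> \<in> space P. \<omega> t \<noteq> \<omega> s} = (\<Union>j\<in>UNIV. Bj j \<inter> {\<omega> \<in> space P. \<omega> t \<noteq> axis j 1})"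
    unfolding BU[symmetric] by (auto simp: Bj_def)
  also have "measure P \<dots> \<le> (\<Sum>j\<in>UNIV. measure P (Bj j \<inter> {\<omega> \<in> space P. \<omega> t \<noteq> axis j 1}))"
    using FP[OF BjF] by (intro finite_measure_subadditive_finite) auto
  also have "\<dots> \<le> (\<Sum>j\<in>UNIV. (real CARD('m) - 1) * (t - s) * measure P (Bj j))"
    by (intro sum_mono Bj_bound)
  also have "\<dots> = (real CARD('m) - 1) * (t - s) * measure P (\<Union>j\<in>UNIV. Bj j)"
    unfolding sum_distrib_left[symmetric] using FP[OF BjF] dj by (subst finite_measure_finite_Union) auto
  finally show ?thesis unfolding BU .
qed

text \<open>A jump at time \<open>t\<close> forces \<open>X\<^sub>t\<close> to differ from the earlier
  values close to \<open>t\<close>, and the probability of each of these events tends to 0.\<close>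

lemma chain_no_fixed_jump:
  fixes P :: "(real \<Rightarrow> real^'m) measure"
  assumes P: "is_chain_law T p0 P" and t: "0 < t" "t \<le> T"
  shows "AE \<omega> in P. \<omega> t = left_lim \<omega> t"
proof -
  interpret prob_space P using P by (simp add: is_chain_law_def)
  have sp: "space P = paths T" by (rule chain_law_space[OF P])
  \<comment> \<open>A sequence that increases to \<open>t\<close> and starts at 0.\<close>
  define u where "u k = t - t * inverse (real (Suc k))" for k
  have u: "0 \<le> u k" "u k < t" for k
  proof -
    have "inverse (real (Suc k)) \<le> 1" by (simp add: field_simps)
    then have "t * inverse (real (Suc k)) \<le> t * 1" using t by (intro mult_left_mono) auto
    then show "0 \<le> u k" by (simp add: u_def)
    show "u k < t" using t by (simp add: u_def)
  qed
  have [measurable]: "(\<lambda>\<omega>. \<omega> (u k)) \<in> borel_measurable P" "(\<lambda>\<omega>. \<omega> t) \<in> borel_measurable P" for k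
    using chain_law_coordinate[OF P] u[of k] t by auto
  define E where "E k = {\<omega> \<in> space P. \<omega> t \<noteq> \<omega> (u k)}" for k
  have E[measurable]: "E k \<in> sets P" for k unfolding E_def by measurable
  have Ebound: "measure P (E k) \<le> (real CARD('m) - 1) * (t * inverse (real (Suc k)))" for k
  proof -
    have "space P \<in> sets (canonical_filtration T (u k))"
      using sets.top[of "canonical_filtration T (u k)"] by (simp add: sp)
    from chain_change_probability_le[OF P u(1) less_imp_le[OF u(2)] t(2) this]
    show ?thesis using prob_space by (simp add: E_def u_def Int_absorb1 subset_eq)
  qed
  have lim: "(\<lambda>k. (real CARD('m) - 1) * (t * inverse (real (Suc k)))) \<longlonglongrightarrow> 0"
    using tendsto_mult[OF tendsto_const tendsto_mult[OF tendsto_const LIMSEQ_inverse_real_of_nat]] by simp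
  have null: "(\<Inter>k\<in>{n..}. E k) \<in> null_sets P" for n
  proof -
    have m: "(\<Inter>k\<in>{n..}. E k) \<in> sets P" by (intro sets.countable_INT') auto
    have "measure P (\<Inter>k\<in>{n..}. E k) \<le> 0"
    proof (rule LIMSEQ_le_const[OF lim], intro exI allI impI)
      fix k assume "n \<le> k"
      then have "measure P (\<Inter>k\<in>{n..}. E k) \<le> measure P (E k)" by (intro finite_measure_mono) auto
      then show "measure P (\<Inter>k\<in>{n..}. E k) \<le> (real CARD('m) - 1) * (t * inverse (real (Suc k)))"
        using Ebound[of k] by linarith
    qed
    then have "measure P (\<Inter>k\<in>{n..}. E k) = 0" using measure_nonneg by (metis order_antisym)
    then show ?thesis using m by (simp add: null_sets_def emeasure_eq_measure)
  qed
  have "AE \<omega> in P. \<forall>n. \<omega> \<notin> (\<Inter>k\<in>{n..}. E k)"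
    unfolding AE_all_countable using AE_not_in[OF null] by blast
  then show ?thesis using AE_space
  proof eventually_elim
    case (elim \<omega>)
    then have w: "\<omega> \<in> paths T" by (simp add: sp)
    show ?case
    proof (rule ccontr)
      assume ne: "\<omega> t \<noteq> left_lim \<omega> t"
      have "t \<in> {0<..T}" using t by simp
      from paths_left_constant[OF w this] obtain d where d: "0 < d" "\<And>s. t - d < s \<Longrightarrow> s < t \<Longrightarrow> \<omega> s = left_lim \<omega> t" by blast
      have "(\<lambda>k. t * inverse (real (Suc k))) \<longlonglongrightarrow> 0"
        using tendsto_mult[OF tendsto_const LIMSEQ_inverse_real_of_nat] by simp
      then have "eventually (\<lambda>k. t * inverse (real (Suc k)) < d) sequentially" using d(1) by (rule order_tendstoD)
      then obtain n where n: "\<And>k. n \<le> k \<Longrightarrow> t * inverse (real (Suc k)) < d" by (auto simp: eventually_sequentially)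
      have "\<omega> \<in> E k" if "n \<le> k" for k
      proof -
        have "\<omega> (u k) = left_lim \<omega> t" using n[OF that] u(2)[of k] by (intro d(2)) (auto simp: u_def)
        then show ?thesis using ne elim by (simp add: E_def)
      qed
      then show False using elim by auto
    qed
  qed
qed

text \<open>A bound on conditional probabilities, known for the events of a
  sub-\<open>\<sigma>\<close>-algebra, carries over to weights measurable with respect to it.\<close>

lemma nn_integral_subalgebra_le:
  assumes sub: "subalgebra M F" and D: "D \<in> sets M"
    and le: "\<And>B. B \<in> sets F \<Longrightarrow> emeasure M (B \<inter> D) \<le> c * emeasure M B"
    and g: "g \<in> borel_measurable F"
  shows "(\<integral>\<^sup>+x. g x * indicator D x \<partial>M) \<le> c * (\<integral>\<^sup>+x. g x \<partial>M)"
proof -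
  define N where "N = density M (indicator D)"
  have subN: "subalgebra N F" using sub by (simp add: N_def subalgebra_def)
  have gM: "g \<in> borel_measurable M" using measurable_from_subalg[OF sub g] .
  have BM: "B \<in> sets M" if "B \<in> sets F" for B using sub that by (auto simp: subalgebra_def)
  have "(\<integral>\<^sup>+x. g x * indicator D x \<partial>M) = (\<integral>\<^sup>+x. g x \<partial>N)"
    unfolding N_def using gM D by (subst nn_integral_density) (auto simp: mult.commute)
  also have "\<dots> = (\<integral>\<^sup>+x. g x \<partial>restr_to_subalg N F)" by (rule nn_integral_subalgebra2[OF subN g, symmetric])
  also have "\<dots> \<le> (\<integral>\<^sup>+x. g x \<partial>scale_measure c (restr_to_subalg M F))"
  proof (rule nn_integral_mono_measure)
    show s: "sets (restr_to_subalg N F) = sets (scale_measure c (restr_to_subalg M F))"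
      by (simp add: sets_restr_to_subalg[OF sub] sets_restr_to_subalg[OF subN])
    show "restr_to_subalg N F \<le> scale_measure c (restr_to_subalg M F)"
    proof (subst le_measure[OF s], intro ballI)
      fix B assume "B \<in> sets (restr_to_subalg N F)"
      then have B: "B \<in> sets F" by (simp add: sets_restr_to_subalg[OF subN])
      have "emeasure N B = emeasure M (B \<inter> D)"
        unfolding N_def using BM[OF B] D by (subst emeasure_density) (auto simp: indicator_inter_arith[symmetric] Int_commute)
      then show "emeasure (restr_to_subalg N F) B \<le> emeasure (scale_measure c (restr_to_subalg M F)) B"
        using le[OF B] B
        by (simp add: emeasure_restr_to_subalg[OF sub] emeasure_restr_to_subalg[OF subN])
    qed
  qed
  also have "\<dots> = c * (\<integral>\<^sup>+x. g x \<partial>restr_to_subalg M F)"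
    by (rule nn_integral_scale_measure) (use g in \<open>simp add: sets_restr_to_subalg[OF sub] cong: measurable_cong_sets\<close>)
  also have "(\<integral>\<^sup>+x. g x \<partial>restr_to_subalg M F) = (\<integral>\<^sup>+x. g x \<partial>M)" by (rule nn_integral_subalgebra2[OF sub g])
  finally show ?thesis .
qed

text \<open>On a grid with \<open>n\<close> cells, each cell changes the state with conditional
  probability at most \<open>(m - 1) T / n\<close>, and then multiplies the weight by \<open>K\<close>.
  So the moment of the number of changes is at most \<open>(1 + (K - 1) (m - 1) T / n) ^ n\<close>, and
  Fatou's lemma passes to the number of jumps.\<close>

lemma chain_jump_count_exponential_moment:
  fixes P :: "(real \<Rightarrow> real^'m) measure"
  assumes P: "is_chain_law T p0 P" and T: "0 < T" and K: "1 \<le> K"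
  shows "(\<integral>\<^sup>+\<omega>. ennreal (K ^ card (jumps T \<omega>)) \<partial>P) \<le> ennreal (exp ((K - 1) * (real CARD('m) - 1) * T))"
proof -
  interpret prob_space P using P by (simp add: is_chain_law_def)
  have sp: "space P = paths T" by (rule chain_law_space[OF P])
  let ?x = "(K - 1) * (real CARD('m) - 1) * T"
  have m1: "1 \<le> real CARD('m)" by (simp add: Suc_leI)
  have x0: "0 \<le> ?x" using K T m1 by simp
  define c where "c n k \<omega> = card {i. i < k \<and> \<omega> (T * i / n) \<noteq> \<omega> (T * Suc i / n)}" for n k :: nat and \<omega> :: "real \<Rightarrow> real^'m"
  have cS: "c n (Suc k) \<omega> = c n k \<omega> + (if \<omega> (T * k / n) \<noteq> \<omega> (T * Suc k / n) then 1 else 0)" for n k \<omega>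
  proof -
    have e: "{i. i < Suc k \<and> \<omega> (T * i / n) \<noteq> \<omega> (T * Suc i / n)} = {i. i < k \<and> \<omega> (T * i / n) \<noteq> \<omega> (T * Suc i / n)}
        \<union> (if \<omega> (T * k / n) \<noteq> \<omega> (T * Suc k / n) then {k} else {})"
      by (auto simp: less_Suc_eq simp del: of_nat_Suc)
    then show ?thesis unfolding c_def by (subst e, subst card_Un_disjoint) (auto simp del: of_nat_Suc)
  qed
  have cm: "(\<lambda>\<omega>. ennreal (K ^ c n k \<omega>)) \<in> borel_measurable (canonical_filtration T (T * k / n))"
    if "0 < n" "k \<le> n" for n k
  proof -
    let ?F = "canonical_filtration T (T * k / n)"
    have coord: "(\<lambda>\<omega>. \<omega> (T * i / n)) \<in> borel_measurable ?F" if "i \<le> k" for i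
      using that T \<open>0 < n\<close> by (intro measurable_canonical_coordinate) (auto intro!: divide_right_mono mult_left_mono)
    have "(\<lambda>\<omega>. \<Sum>i<k. indicator {\<omega> \<in> space ?F. \<omega> (T * i / n) \<noteq> \<omega> (T * Suc i / n)} \<omega> :: real) \<in> borel_measurable ?F"
      by (intro borel_measurable_sum borel_measurable_indicator borel_measurable_eq_states coord) auto
    then have r: "(\<lambda>\<omega>. real (c n k \<omega>)) \<in> borel_measurable ?F"
      by (rule measurable_cong[THEN iffD1, rotated])
         (auto simp: c_def indicator_def sum.If_cases of_nat_sum[symmetric] intro!: arg_cong[where f=card] simp del: of_nat_Suc)
    have "(\<lambda>\<omega>. ennreal (K powr real (c n k \<omega>))) \<in> borel_measurable ?F"
      using r by measurable
    then show ?thesis using K by (simp add: powr_realpow)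
  qed
  have step: "(\<integral>\<^sup>+\<omega>. ennreal (K ^ c n k \<omega>) \<partial>P) \<le> ennreal ((1 + ?x / n) ^ k)" if n: "0 < n" and kn: "k \<le> n" for n k
    using kn
  proof (induction k)
    case 0
    then show ?case by (simp add: c_def emeasure_space_1)
  next
    case (Suc k)
    then have k: "k < n" by simp
    let ?s = "T * k / n" and ?t = "T * Suc k / n"
    have "T * Suc k \<le> T * n" using k T by (intro mult_left_mono) auto
    then have st: "0 \<le> ?s" "?s \<le> ?t" "?t \<le> T"
      using T n by (auto simp: divide_right_mono mult_left_mono pos_divide_le_eq simp del: of_nat_Suc)
    have "?t - ?s = T / n" by (simp add: distrib_left add_divide_distrib)
    define D where "D = {\<omega> \<in> space P. \<omega> ?t \<noteq> \<omega> ?s}"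
    have "?s \<in> {0..T}" "?t \<in> {0..T}" using st by auto
    then have D[measurable]: "D \<in> sets P" unfolding D_def
      by (intro borel_measurable_eq_states chain_law_coordinate[OF P])
    let ?F = "canonical_filtration T ?s"
    have sub: "subalgebra P ?F" using chain_law_subalgebra[OF P] st by simp
    have gF: "(\<lambda>\<omega>. ennreal (K ^ c n k \<omega>)) \<in> borel_measurable ?F" using cm n k by simp
    have gP[measurable]: "(\<lambda>\<omega>. ennreal (K ^ c n k \<omega>)) \<in> borel_measurable P" using measurable_from_subalg[OF sub gF] .
    have DB: "emeasure P (B \<inter> D) \<le> ennreal ((real CARD('m) - 1) * (T / n)) * emeasure P B" if B: "B \<in> sets ?F" for B
    proof -
      have "measure P (B \<inter> D) \<le> (real CARD('m) - 1) * (T / n) * measure P B"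
        using chain_change_probability_le[OF P st B] \<open>?t - ?s = T / n\<close> by (simp add: D_def)
      then show ?thesis using m1 T by (simp add: emeasure_eq_measure ennreal_mult[symmetric] ennreal_leI)
    qed
    have "(\<integral>\<^sup>+\<omega>. ennreal (K ^ c n (Suc k) \<omega>) \<partial>P)
        = (\<integral>\<^sup>+\<omega>. ennreal (K ^ c n k \<omega>) + ennreal (K - 1) * (ennreal (K ^ c n k \<omega>) * indicator D \<omega>) \<partial>P)"
    proof (rule nn_integral_cong)
      fix \<omega> assume "\<omega> \<in> space P"
      then have "K ^ c n (Suc k) \<omega> = K ^ c n k \<omega> + (K - 1) * (K ^ c n k \<omega> * indicator D \<omega>)"
        unfolding cS by (auto simp: D_def indicator_def algebra_simps)
      then show "ennreal (K ^ c n (Suc k) \<omega>) = ennreal (K ^ c n k \<omega>) + ennreal (K - 1) * (ennreal (K ^ c n k \<omega>) * indicator D \<omega>)"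
        using K by (simp add: ennreal_plus ennreal_mult ennreal_indicator[symmetric] del: ennreal_plus flip: ennreal_plus ennreal_mult)
    qed
    also have "\<dots> = (\<integral>\<^sup>+\<omega>. ennreal (K ^ c n k \<omega>) \<partial>P) + ennreal (K - 1) * (\<integral>\<^sup>+\<omega>. ennreal (K ^ c n k \<omega>) * indicator D \<omega> \<partial>P)"
      by (subst nn_integral_add) (auto simp: nn_integral_cmult)
    \<comment> \<open>The weight of the first \<open>k\<close> cells is known at the beginning of the next
      one.\<close>
    also have "\<dots> \<le> (\<integral>\<^sup>+\<omega>. ennreal (K ^ c n k \<omega>) \<partial>P)
        + ennreal (K - 1) * (ennreal ((real CARD('m) - 1) * (T / n)) * (\<integral>\<^sup>+\<omega>. ennreal (K ^ c n k \<omega>) \<partial>P))"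
      by (intro add_left_mono mult_left_mono nn_integral_subalgebra_le[OF sub D DB gF]) auto
    also have "\<dots> = ennreal (1 + ?x / n) * (\<integral>\<^sup>+\<omega>. ennreal (K ^ c n k \<omega>) \<partial>P)"
    proof -
      have "ennreal (1 + ?x / n) = 1 + ennreal (K - 1) * ennreal ((real CARD('m) - 1) * (T / n))"
        using K m1 T by (simp add: ennreal_mult[symmetric] ennreal_plus mult.assoc x0 flip: ennreal_1)
      then show ?thesis by (simp add: distrib_right mult.assoc)
    qed
    also have "\<dots> \<le> ennreal (1 + ?x / n) * ennreal ((1 + ?x / n) ^ k)"
      using Suc by (intro mult_left_mono) auto
    also have "\<dots> = ennreal ((1 + ?x / n) ^ Suc k)" unfolding power_Suc using x0 by (intro ennreal_mult[symmetric]) auto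
    finally show ?case .
  qed
  have bound: "(\<integral>\<^sup>+\<omega>. ennreal (K ^ c (Suc n) (Suc n) \<omega>) \<partial>P) \<le> ennreal (exp ?x)" for n
  proof -
    have "(1 + ?x / Suc n) ^ Suc n \<le> exp ?x" using x0 by (intro exp_ge_one_plus_x_over_n_power_n) auto
    then show ?thesis using order_trans[OF step[of "Suc n" "Suc n"] ennreal_leI] by simp
  qed
  have "(\<integral>\<^sup>+\<omega>. ennreal (K ^ card (jumps T \<omega>)) \<partial>P) = (\<integral>\<^sup>+\<omega>. liminf (\<lambda>n. ennreal (K ^ c (Suc n) (Suc n) \<omega>)) \<partial>P)"
  proof (rule nn_integral_cong)
    fix \<omega> assume "\<omega> \<in> space P"
    then have w: "\<omega> \<in> paths T" by (simp add: sp)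
    have "jumps T \<omega> \<inter> {0<..T} = jumps T \<omega>" using jumps_subset by blast
    then have "eventually (\<lambda>n. c n n \<omega> = card (jumps T \<omega>)) sequentially"
      using eventually_grid_changes_eq_jumps[OF w T order_refl] by (simp add: c_def)
    then have "eventually (\<lambda>n. c (Suc n) (Suc n) \<omega> = card (jumps T \<omega>)) sequentially"
      by (subst eventually_sequentially_Suc)
    then have "eventually (\<lambda>n. ennreal (K ^ c (Suc n) (Suc n) \<omega>) = ennreal (K ^ card (jumps T \<omega>))) sequentially"
      by eventually_elim simp
    then have "(\<lambda>n. ennreal (K ^ c (Suc n) (Suc n) \<omega>)) \<longlonglongrightarrow> ennreal (K ^ card (jumps T \<omega>))" by (rule tendsto_eventually)
    then show "ennreal (K ^ card (jumps T \<omega>)) = liminf (\<lambda>n. ennreal (K ^ c (Suc n) (Suc n) \<omega>))"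
      by (simp add: lim_imp_Liminf)
  qed
  also have "\<dots> \<le> liminf (\<lambda>n. (\<integral>\<^sup>+\<omega>. ennreal (K ^ c (Suc n) (Suc n) \<omega>) \<partial>P))"
  proof (rule nn_integral_liminf)
    fix n
    have "(\<lambda>\<omega>. ennreal (K ^ c (Suc n) (Suc n) \<omega>)) \<in> borel_measurable (canonical_filtration T T)"
      using cm[of "Suc n" "Suc n"] by simp
    then show "(\<lambda>\<omega>. ennreal (K ^ c (Suc n) (Suc n) \<omega>)) \<in> borel_measurable P"
      using P by (simp add: is_chain_law_def cong: measurable_cong_sets)
  qed
  also have "\<dots> \<le> liminf (\<lambda>n::nat. ennreal (exp ?x))"
    by (intro Liminf_mono always_eventually allI bound)
  also have "\<dots> = ennreal (exp ?x)" by (simp add: Liminf_const)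
  finally show ?thesis .
qed

section \<open>Likelihoods of controlled paths\<close>

text \<open>Regularity of the rate matrices that a control generates along one path.\<close>

definition admissible_rates :: "real \<Rightarrow> real \<Rightarrow> (real \<Rightarrow> real^'m^'m) \<Rightarrow> bool" where
  "admissible_rates T K R \<longleftrightarrow> (\<forall>i j. bounded_measurable_on T (\<lambda>s. R s $ i $ j)) \<and>
     (\<forall>s\<in>{0..T}. \<forall>i. (\<Sum>j\<in>UNIV. R s $ i $ j) = 0) \<and>
     (\<forall>s\<in>{0..T}. \<forall>i j. i \<noteq> j \<longrightarrow> 0 < R s $ i $ j \<and> R s $ i $ j \<le> K)"

text \<open>The value of the stochastic exponential at time \<open>T\<close>: the classical likelihood
  ratio of two jump processes, with reference rates 1.\<close>

definition likelihood :: "real \<Rightarrow> (real \<Rightarrow> real^'m^'m) \<Rightarrow> (real \<Rightarrow> real^'m) \<Rightarrow> real" where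
  "likelihood T R \<omega> = exp (- (LINT s:{0<..T}|lborel. excess_intensity (R s) (left_lim \<omega> s))) *
     (\<Prod>\<tau>\<in>jumps T \<omega>. jump_rate (R \<tau>) (left_lim \<omega> \<tau>) (\<omega> \<tau>))"

lemma excess_intensity_bounded_measurable:
  fixes R :: "real \<Rightarrow> real^'m^'m"
  assumes R: "admissible_rates T K R" and \<omega>: "\<omega> \<in> paths T" and T: "0 < T"
  shows "bounded_measurable_on T (\<lambda>s. excess_intensity (R s) (left_lim \<omega> s))"
  unfolding excess_intensity_def
  by (intro bounded_measurable_on_sum bounded_measurable_on_mult bounded_measurable_on_diff bounded_measurable_on_const
      bounded_measurable_left_lim \<omega> T) (use R in \<open>simp add: admissible_rates_def\<close>)

lemma jump_states:
  fixes \<omega> :: "real \<Rightarrow> real^'m"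
  assumes \<omega>: "\<omega> \<in> paths T" and \<tau>: "\<tau> \<in> jumps T \<omega>"
  obtains a b where "left_lim \<omega> \<tau> = axis a 1" "\<omega> \<tau> = axis b 1" "a \<noteq> b" "\<tau> \<in> {0..T}"
proof -
  have t: "\<tau> \<in> {0..T}" "\<omega> \<tau> \<noteq> left_lim \<omega> \<tau>" using \<tau> by (auto simp: jumps_def)
  then obtain a b where "left_lim \<omega> \<tau> = axis a 1" "\<omega> \<tau> = axis b 1"
    using left_lim_in_states[OF \<omega> t(1)] paths_in_states[OF \<omega> t(1)] by (auto simp: states_def)
  with t that show ?thesis by auto
qed

lemma jump_rate_bounds:
  fixes R :: "real \<Rightarrow> real^'m^'m"
  assumes R: "admissible_rates T K R" and \<omega>: "\<omega> \<in> paths T" and \<tau>: "\<tau> \<in> jumps T \<omega>"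
  shows "0 < jump_rate (R \<tau>) (left_lim \<omega> \<tau>) (\<omega> \<tau>)" "jump_rate (R \<tau>) (left_lim \<omega> \<tau>) (\<omega> \<tau>) \<le> K"
proof -
  obtain a b where ab: "left_lim \<omega> \<tau> = axis a 1" "\<omega> \<tau> = axis b 1" "a \<noteq> b" "\<tau> \<in> {0..T}"
    by (rule jump_states[OF \<omega> \<tau>])
  have "0 < R \<tau> $ a $ b \<and> R \<tau> $ a $ b \<le> K" using R ab(3,4) unfolding admissible_rates_def by blast
  then show "0 < jump_rate (R \<tau>) (left_lim \<omega> \<tau>) (\<omega> \<tau>)" "jump_rate (R \<tau>) (left_lim \<omega> \<tau>) (\<omega> \<tau>) \<le> K"
    by (simp_all add: ab jump_rate_axis)
qed

text \<open>Every jump contributes a factor of at most \<open>K\<close>, and the excess intensity is at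
  least \<open>- m\<close>.\<close>

lemma likelihood_bounds:
  fixes R :: "real \<Rightarrow> real^'m^'m"
  assumes R: "admissible_rates T K R" and \<omega>: "\<omega> \<in> paths T" and T: "0 < T"
  shows "0 < likelihood T R \<omega>"
    "likelihood T R \<omega> \<le> exp (real CARD('m) * T) * K ^ card (jumps T \<omega>)"
proof -
  have jr: "0 < jump_rate (R \<tau>) (left_lim \<omega> \<tau>) (\<omega> \<tau>) \<and> jump_rate (R \<tau>) (left_lim \<omega> \<tau>) (\<omega> \<tau>) \<le> K"
    if "\<tau> \<in> jumps T \<omega>" for \<tau>
    using jump_rate_bounds[OF R \<omega> that] by simp
  show "0 < likelihood T R \<omega>" unfolding likelihood_def using jr by (auto intro!: mult_pos_pos prod_pos)
  have "(\<Prod>\<tau>\<in>jumps T \<omega>. jump_rate (R \<tau>) (left_lim \<omega> \<tau>) (\<omega> \<tau>)) \<le> (\<Prod>\<tau>\<in>jumps T \<omega>. K)"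
    using jr by (intro prod_mono) (auto intro: less_imp_le)
  then have 1: "(\<Prod>\<tau>\<in>jumps T \<omega>. jump_rate (R \<tau>) (left_lim \<omega> \<tau>) (\<omega> \<tau>)) \<le> K ^ card (jumps T \<omega>)" by simp
  have "(LINT s:{0<..T}|lborel. - real CARD('m)) \<le> (LINT s:{0<..T}|lborel. excess_intensity (R s) (left_lim \<omega> s))"
  proof (rule set_integral_mono)
    show "set_integrable lborel {0<..T} (\<lambda>s. - real CARD('m))"
      by (rule bounded_measurable_on_set_integrable_lborel[OF bounded_measurable_on_const order_refl])
    show "set_integrable lborel {0<..T} (\<lambda>s. excess_intensity (R s) (left_lim \<omega> s))"
      by (rule bounded_measurable_on_set_integrable_lborel[OF excess_intensity_bounded_measurable[OF R \<omega> T] order_refl])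
    fix s assume "s \<in> {0<..T}"
    then have s: "s \<in> {0..T}" by auto
    obtain a where a: "left_lim \<omega> s = axis a 1" using left_lim_in_states[OF \<omega> s] by (auto simp: states_def)
    have "- real CARD('m) \<le> (\<Sum>j\<in>UNIV - {a}. - 1)" by (simp add: card_Diff_singleton)
    also have "\<dots> \<le> (\<Sum>j\<in>UNIV - {a}. R s $ a $ j - 1)"
      using R s by (intro sum_mono) (auto simp: admissible_rates_def intro!: less_imp_le)
    finally show "- real CARD('m) \<le> excess_intensity (R s) (left_lim \<omega> s)" by (simp add: a excess_intensity_axis)
  qed
  also have "(LINT s:{0<..T}|lborel. - real CARD('m)) = - (real CARD('m) * T)"
    using T by (simp add: set_lebesgue_integral_def)
  finally have "exp (- (LINT s:{0<..T}|lborel. excess_intensity (R s) (left_lim \<omega> s))) \<le> exp (real CARD('m) * T)" by simp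
  then show "likelihood T R \<omega> \<le> exp (real CARD('m) * T) * K ^ card (jumps T \<omega>)"
    unfolding likelihood_def using 1 prod_nonneg[of "jumps T \<omega>" "\<lambda>\<tau>. jump_rate (R \<tau>) (left_lim \<omega> \<tau>) (\<omega> \<tau>)"] jr
    by (intro mult_mono) (auto intro: less_imp_le)
qed

lemma likelihood_cong:
  assumes "\<And>s. s \<in> {0..T} \<Longrightarrow> R s = R' s"
  shows "likelihood T R \<omega> = likelihood T R' \<omega>"
proof -
  have "(LINT s:{0<..T}|lborel. excess_intensity (R s) (left_lim \<omega> s)) = (LINT s:{0<..T}|lborel. excess_intensity (R' s) (left_lim \<omega> s))"
    by (rule set_lebesgue_integral_cong) (auto simp: assms)
  moreover have "(\<Prod>\<tau>\<in>jumps T \<omega>. jump_rate (R \<tau>) (left_lim \<omega> \<tau>) (\<omega> \<tau>)) = (\<Prod>\<tau>\<in>jumps T \<omega>. jump_rate (R' \<tau>) (left_lim \<omega> \<tau>) (\<omega> \<tau>))"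
    by (rule prod.cong) (auto simp: assms jumps_def)
  ultimately show ?thesis by (simp add: likelihood_def)
qed

text \<open>Without common jumps, every jump time belongs to exactly one summand, so the exponential of
  the sum is the product of the exponentials. With common jumps the factors would be \<open>1 + \<Sum>
  (j - 1)\<close> instead of \<open>\<Prod> j\<close>.\<close>

lemma doleans_exp_girsanov_sum:
  fixes R :: "'n \<Rightarrow> real \<Rightarrow> real^'m^'m"
  assumes T: "0 < T" and I: "finite I"
    and R: "\<And>n. n \<in> I \<Longrightarrow> admissible_rates T K (R n)" and \<omega>: "\<And>n. n \<in> I \<Longrightarrow> \<omega> n \<in> paths T"
    and disj: "\<And>k l. k \<in> I \<Longrightarrow> l \<in> I \<Longrightarrow> k \<noteq> l \<Longrightarrow> jumps T (\<omega> k) \<inter> jumps T (\<omega> l) = {}"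
  shows "doleans_exp (\<lambda>t. \<Sum>n\<in>I. girsanov_integral (R n) (\<omega> n) t) T = (\<Prod>n\<in>I. likelihood T (R n) (\<omega> n))"
proof -
  define j where "j n \<tau> = jump_rate (R n \<tau>) (left_lim (\<omega> n) \<tau>) (\<omega> n \<tau>)" for n \<tau>
  define b where "b n s = excess_intensity (R n s) (left_lim (\<omega> n) s)" for n s
  define J where "J = (\<Union>n\<in>I. jumps T (\<omega> n))"
  define c where "c \<tau> = (\<Sum>n\<in>I. if \<tau> \<in> jumps T (\<omega> n) then j n \<tau> - 1 else 0)" for \<tau>
  have fJ: "finite J" unfolding J_def using I finite_jumps[OF \<omega>] by auto
  have bm: "bounded_measurable_on T (b n)" if "n \<in> I" for n
    unfolding b_def by (rule excess_intensity_bounded_measurable[OF R[OF that] \<omega>[OF that] T])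
  have int: "(LINT s:{0<..t}|lborel. (\<Sum>n\<in>I. b n s)) = (\<Sum>n\<in>I. (LINT s:{0<..t}|lborel. b n s))" if "t \<le> T" for t
    unfolding set_lebesgue_integral_def scaleR_sum_right
    using bounded_measurable_on_set_integrable_lborel[OF bm that]
    by (subst Bochner_Integration.integral_sum) (auto simp: set_integrable_def)
  have "doleans_exp (\<lambda>t. \<Sum>n\<in>I. girsanov_integral (R n) (\<omega> n) t) T
      = exp (- (LINT s:{0<..T}|lborel. (\<Sum>n\<in>I. b n s))) * (\<Prod>\<tau>\<in>J. 1 + c \<tau>)"
  proof (rule doleans_exp_jumps_drift[OF _ _ fJ])
    show "bounded_measurable_on T (\<lambda>s. \<Sum>n\<in>I. b n s)" by (intro bounded_measurable_on_sum bm)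
    show "J \<subseteq> {0<..T}" using jumps_subset by (auto simp: J_def)
    fix t assume t: "t \<in> {0..T}"
    have "(\<Sum>\<tau>\<in>J \<inter> {0<..t}. c \<tau>) = (\<Sum>n\<in>I. \<Sum>\<tau>\<in>J \<inter> {0<..t}. if \<tau> \<in> jumps T (\<omega> n) then j n \<tau> - 1 else 0)"
      unfolding c_def by (rule sum.swap)
    also have "\<dots> = (\<Sum>n\<in>I. \<Sum>\<tau>\<in>jumps T (\<omega> n) \<inter> {0<..t}. j n \<tau> - 1)"
      using fJ by (intro sum.cong sum.mono_neutral_cong_right) (auto simp: J_def)
    finally have c: "(\<Sum>\<tau>\<in>J \<inter> {0<..t}. c \<tau>) = (\<Sum>n\<in>I. \<Sum>\<tau>\<in>jumps T (\<omega> n) \<inter> {0<..t}. j n \<tau> - 1)" .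
    have "(\<Sum>n\<in>I. girsanov_integral (R n) (\<omega> n) t)
        = (\<Sum>n\<in>I. (\<Sum>\<tau>\<in>jumps T (\<omega> n) \<inter> {0<..t}. j n \<tau> - 1) - (LINT s:{0<..t}|lborel. b n s))"
      unfolding j_def b_def using R by (intro sum.cong refl girsanov_integral_explicit[OF \<omega> T _ _ t]) (auto simp: admissible_rates_def)
    then show "(\<Sum>n\<in>I. girsanov_integral (R n) (\<omega> n) t) = (\<Sum>\<tau>\<in>J \<inter> {0<..t}. c \<tau>) - (LINT s:{0<..t}|lborel. (\<Sum>n\<in>I. b n s))"
      using t by (simp add: c int sum_subtractf)
  qed (use T in simp)
  also have "(\<Prod>\<tau>\<in>J. 1 + c \<tau>) = (\<Prod>n\<in>I. \<Prod>\<tau>\<in>jumps T (\<omega> n). 1 + c \<tau>)"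
    unfolding J_def using I finite_jumps[OF \<omega>] disj by (intro prod.UNION_disjoint) auto
  also have "\<dots> = (\<Prod>n\<in>I. \<Prod>\<tau>\<in>jumps T (\<omega> n). j n \<tau>)"
  proof (intro prod.cong refl)
    fix n \<tau> assume n: "n \<in> I" and \<tau>: "\<tau> \<in> jumps T (\<omega> n)"
    have "c \<tau> = (\<Sum>k\<in>I. if k = n then j n \<tau> - 1 else 0)"
      unfolding c_def using disj[OF n] \<tau> by (intro sum.cong) auto
    then show "1 + c \<tau> = j n \<tau>" using I n by simp
  qed
  also have "exp (- (LINT s:{0<..T}|lborel. (\<Sum>n\<in>I. b n s))) = (\<Prod>n\<in>I. exp (- (LINT s:{0<..T}|lborel. b n s)))"
    using I by (simp add: int exp_sum sum_negf[symmetric])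
  finally show ?thesis by (simp add: likelihood_def j_def b_def prod.distrib)
qed

lemma doleans_exp_girsanov:
  assumes "0 < T" "admissible_rates T K R" "\<omega> \<in> paths T"
  shows "doleans_exp (girsanov_integral R \<omega>) T = likelihood T R \<omega>"
  using doleans_exp_girsanov_sum[of T "{()}" K "\<lambda>_. R" "\<lambda>_. \<omega>"] assms by simp

lemma clamp_measurable:
  fixes T :: real
  assumes "0 < T"
  shows "(\<lambda>z. (max 0 (min T (snd z)), fst z)) \<in> M \<Otimes>\<^sub>M borel \<rightarrow>\<^sub>M restrict_space borel {0..T} \<Otimes>\<^sub>M M"
  using assms by (intro measurable_Pair measurable_restrict_space2) auto

lemma time_integral_measurable:
  fixes h :: "real \<times> 'w \<Rightarrow> real"
  assumes h: "h \<in> borel_measurable (restrict_space borel {0..T} \<Otimes>\<^sub>M M)" and T: "0 < T"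
    and S: "S \<in> sets borel" "S \<subseteq> {0..T}"
  shows "(\<lambda>w. LINT s:S|lborel. h (s, w)) \<in> borel_measurable M"
proof -
  have "(\<lambda>z. h (max 0 (min T (snd z)), fst z)) \<in> borel_measurable (M \<Otimes>\<^sub>M borel)"
    by (rule measurable_compose[OF clamp_measurable[OF T] h])
  then have "(\<lambda>z. indicator S (snd z) *\<^sub>R h (max 0 (min T (snd z)), fst z)) \<in> borel_measurable (M \<Otimes>\<^sub>M borel)"
    using S(1) by measurable
  then have "(\<lambda>(w, s). indicator S s *\<^sub>R h (max 0 (min T s), w)) \<in> borel_measurable (M \<Otimes>\<^sub>M lborel)"
    by (simp add: split_beta' cong: measurable_cong_sets)
  from lborel.borel_measurable_lebesgue_integral[OF this]
  have "(\<lambda>w. \<integral>s. indicator S s *\<^sub>R h (max 0 (min T s), w) \<partial>lborel) \<in> borel_measurable M" .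
  moreover have "(\<integral>s. indicator S s *\<^sub>R h (max 0 (min T s), w) \<partial>lborel) = (LINT s:S|lborel. h (s, w))" for w
    unfolding set_lebesgue_integral_def using S(2)
    by (intro Bochner_Integration.integral_cong) (auto simp: indicator_def subset_eq max_def min_def)
  ultimately show ?thesis by simp
qed

text \<open>The product over the jumps becomes a sum after taking logarithms.\<close>

lemma likelihood_measurable:
  fixes X :: "'w \<Rightarrow> real \<Rightarrow> real^'m" and R :: "'w \<Rightarrow> real \<Rightarrow> real^'m^'m"
  assumes X: "X \<in> M \<rightarrow>\<^sub>M canonical_filtration T T" and T: "0 < T"
    and Rm: "\<And>i j. (\<lambda>z. R (snd z) (fst z) $ i $ j) \<in> borel_measurable (restrict_space borel {0..T} \<Otimes>\<^sub>M M)"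
    and R: "\<And>w. w \<in> space M \<Longrightarrow> admissible_rates T K (R w)"
  shows "(\<lambda>w. likelihood T (R w) (X w)) \<in> borel_measurable M"
proof -
  let ?B = "restrict_space borel {0..T} \<Otimes>\<^sub>M M"
  have [measurable]: "(\<lambda>z. left_lim (X (snd z)) (fst z) $ i) \<in> borel_measurable ?B" "(\<lambda>z. X (snd z) (fst z) $ i) \<in> borel_measurable ?B" for i
    by (intro borel_measurable_vec_component path_left_lim_measurable[OF X T] path_value_measurable[OF X T])+
  note [measurable] = Rm
  have e: "(\<lambda>z. excess_intensity (R (snd z) (fst z)) (left_lim (X (snd z)) (fst z))) \<in> borel_measurable ?B"
    unfolding excess_intensity_def by measurable
  have "(\<lambda>z. jump_rate (R (snd z) (fst z)) (left_lim (X (snd z)) (fst z)) (X (snd z) (fst z))) \<in> borel_measurable ?B"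
    unfolding jump_rate_def by measurable
  then have l: "(\<lambda>z. ln (jump_rate (R (snd z) (fst z)) (left_lim (X (snd z)) (fst z)) (X (snd z) (fst z)))) \<in> borel_measurable ?B"
    by measurable
  have "(\<lambda>w. exp (- (LINT s:{0<..T}|lborel. excess_intensity (R w s) (left_lim (X w) s))) *
      exp (\<Sum>\<tau>\<in>jumps T (X w). ln (jump_rate (R w \<tau>) (left_lim (X w) \<tau>) (X w \<tau>)))) \<in> borel_measurable M"
  proof -
    have [measurable]: "(\<lambda>w. LINT s:{0<..T}|lborel. excess_intensity (R w s) (left_lim (X w) s)) \<in> borel_measurable M"
      by (rule time_integral_measurable[OF e T, of "{0<..T}", unfolded fst_conv snd_conv]) auto
    have [measurable]: "(\<lambda>w. \<Sum>\<tau>\<in>jumps T (X w). ln (jump_rate (R w \<tau>) (left_lim (X w) \<tau>) (X w \<tau>))) \<in> borel_measurable M"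
      using sum_jumps_measurable[OF X T l] by simp
    show ?thesis by measurable
  qed
  then show ?thesis
  proof (rule measurable_cong[THEN iffD1, rotated])
    fix w assume w: "w \<in> space M"
    have p: "X w \<in> paths T" using measurable_space[OF X w] by simp
    have "0 < jump_rate (R w \<tau>) (left_lim (X w) \<tau>) (X w \<tau>)" if "\<tau> \<in> jumps T (X w)" for \<tau>
      using jump_rate_bounds(1)[OF R[OF w] p that] .
    then have "exp (\<Sum>\<tau>\<in>jumps T (X w). ln (jump_rate (R w \<tau>) (left_lim (X w) \<tau>) (X w \<tau>)))
        = (\<Prod>\<tau>\<in>jumps T (X w). jump_rate (R w \<tau>) (left_lim (X w) \<tau>) (X w \<tau>))"
      using finite_jumps[OF p] by (simp add: exp_sum)
    then show "exp (- (LINT s:{0<..T}|lborel. excess_intensity (R w s) (left_lim (X w) s))) *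
      exp (\<Sum>\<tau>\<in>jumps T (X w). ln (jump_rate (R w \<tau>) (left_lim (X w) \<tau>) (X w \<tau>))) = likelihood T (R w) (X w)"
      by (simp add: likelihood_def)
  qed
qed

lemma density_cong_AE:
  assumes "AE x in M. f x = g x"
  shows "density M f = density M g"
proof -
  have "(\<lambda>A. \<integral>\<^sup>+x. f x * indicator A x \<partial>M) = (\<lambda>A. \<integral>\<^sup>+x. g x * indicator A x \<partial>M)"
    using assms by (intro ext nn_integral_cong_AE) auto
  then show ?thesis by (simp add: density_def)
qed

section \<open>Independent copies of the chain\<close>

lemma jump_set_measurable:
  fixes X Y :: "'w \<Rightarrow> real \<Rightarrow> real^'m"
  assumes X: "X \<in> M \<rightarrow>\<^sub>M canonical_filtration T T" and Y: "Y \<in> M \<rightarrow>\<^sub>M canonical_filtration T T" and T: "0 < T"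
  shows "{w \<in> space M. jumps T (X w) \<inter> jumps T (Y w) \<noteq> {}} \<in> sets M"
proof -
  let ?B = "restrict_space borel {0..T} \<Otimes>\<^sub>M M"
  have "{z \<in> space ?B. Y (snd z) (fst z) \<noteq> left_lim (Y (snd z)) (fst z)} \<in> sets ?B"
    by (intro borel_measurable_eq_states path_left_lim_measurable[OF Y T] path_value_measurable[OF Y T])
  then have "(\<lambda>z. indicator {z \<in> space ?B. Y (snd z) (fst z) \<noteq> left_lim (Y (snd z)) (fst z)} z :: real) \<in> borel_measurable ?B"
    by measurable
  from sum_jumps_measurable[OF X T this]
  have [measurable]: "(\<lambda>w. \<Sum>s\<in>jumps T (X w). indicator {z \<in> space ?B. Y (snd z) (fst z) \<noteq> left_lim (Y (snd z)) (fst z)} (s, w) :: real) \<in> borel_measurable M" .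
  have "{w \<in> space M. jumps T (X w) \<inter> jumps T (Y w) \<noteq> {}}
      = {w \<in> space M. (\<Sum>s\<in>jumps T (X w). indicator {z \<in> space ?B. Y (snd z) (fst z) \<noteq> left_lim (Y (snd z)) (fst z)} (s, w) :: real) \<noteq> 0}"
  proof (intro Collect_cong conj_cong refl)
    fix w assume w: "w \<in> space M"
    have f: "finite (jumps T (X w))" using finite_jumps measurable_space[OF X w] by simp
    have "indicator {z \<in> space ?B. Y (snd z) (fst z) \<noteq> left_lim (Y (snd z)) (fst z)} (s, w) = (of_bool (s \<in> jumps T (Y w)) :: real)"
      if "s \<in> jumps T (X w)" for s
      using that w by (auto simp: indicator_def jumps_def space_pair_measure space_restrict_space)
    then have "(\<Sum>s\<in>jumps T (X w). indicator {z \<in> space ?B. Y (snd z) (fst z) \<noteq> left_lim (Y (snd z)) (fst z)} (s, w))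
        = (\<Sum>s\<in>jumps T (X w). of_bool (s \<in> jumps T (Y w)) :: real)" by (intro sum.cong refl)
    then show "jumps T (X w) \<inter> jumps T (Y w) \<noteq> {} \<longleftrightarrow>
        (\<Sum>s\<in>jumps T (X w). indicator {z \<in> space ?B. Y (snd z) (fst z) \<noteq> left_lim (Y (snd z)) (fst z)} (s, w) :: real) \<noteq> 0"
      using f by (auto simp: sum_nonneg_eq_0_iff)
  qed
  then show ?thesis by simp
qed

text \<open>Given the path of player \<open>l\<close>, the independent path of player \<open>k\<close>
  would have to jump at one of finitely many fixed times.\<close>

lemma AE_PiM_no_common_jumps:
  fixes P :: "(real \<Rightarrow> real^'m) measure"
  assumes P: "is_chain_law T p0 P" and T: "0 < T" and I: "finite I" and kl: "k \<in> I" "l \<in> I" "k \<noteq> l"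
  shows "AE w in Pi\<^sub>M I (\<lambda>_. P). jumps T (w k) \<inter> jumps T (w l) = {}"
proof -
  interpret prob_space P using P by (simp add: is_chain_law_def)
  interpret product_sigma_finite "\<lambda>_. P" ..
  let ?M = "Pi\<^sub>M I (\<lambda>_. P)"
  have sp: "space P = paths T" by (rule chain_law_space[OF P])
  have comp: "(\<lambda>w. w n) \<in> ?M \<rightarrow>\<^sub>M canonical_filtration T T" if "n \<in> I" for n
    by (rule measurable_compose[OF measurable_component_singleton[OF that] chain_law_measurable_canonical[OF P]])
  define N where "N = {w \<in> space ?M. jumps T (w k) \<inter> jumps T (w l) \<noteq> {}}"
  have N: "N \<in> sets ?M" unfolding N_def by (rule jump_set_measurable[OF comp[OF kl(1)] comp[OF kl(2)] T])
  let ?I = "I - {k}"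
  have ins: "insert k ?I = I" using kl by auto
  have "emeasure ?M N = (\<integral>\<^sup>+w. indicator N w \<partial>?M)" using N by simp
  also have "\<dots> = (\<integral>\<^sup>+w. indicator N w \<partial>Pi\<^sub>M (insert k ?I) (\<lambda>_. P))" unfolding ins ..
  also have "\<dots> = (\<integral>\<^sup>+w. (\<integral>\<^sup>+x. indicator N (w(k := x)) \<partial>P) \<partial>Pi\<^sub>M ?I (\<lambda>_. P))"
    by (rule product_nn_integral_insert) (use I N ins in auto)
  also have "\<dots> = (\<integral>\<^sup>+w. 0 \<partial>Pi\<^sub>M ?I (\<lambda>_. P))"
  proof (rule nn_integral_cong)
    fix w assume w: "w \<in> space (Pi\<^sub>M ?I (\<lambda>_. P))"
    have wl: "w l \<in> paths T" using w kl by (auto simp: space_PiM PiE_iff sp)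
    have "AE x in P. \<forall>t\<in>jumps T (w l). x t = left_lim x t"
      using jumps_subset[of T "w l"] by (intro AE_finite_allI finite_jumps[OF wl] chain_no_fixed_jump[OF P]) auto
    then have "AE x in P. indicator N (w(k := x)) = (0::ennreal)"
    proof eventually_elim
      case (elim x)
      have "jumps T x \<inter> jumps T (w l) = {}" using elim by (auto simp: jumps_def)
      then show ?case using kl by (simp add: N_def indicator_def)
    qed
    then show "(\<integral>\<^sup>+x. indicator N (w(k := x)) \<partial>P) = 0" by (simp add: nn_integral_0_iff_AE nn_integral_cong_AE)
  qed
  finally have "N \<in> null_sets ?M" using N by (simp add: null_sets_def)
  then show ?thesis by (rule AE_I') (auto simp: N_def)
qed

lemma PiM_density:
  assumes I: "finite I" and P: "prob_space P" and D: "D \<in> borel_measurable P" and PD: "prob_space (density P D)"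
  shows "Pi\<^sub>M I (\<lambda>_. density P D) = density (Pi\<^sub>M I (\<lambda>_. P)) (\<lambda>w. \<Prod>k\<in>I. D (w k))"
proof -
  interpret P: prob_space P by fact
  interpret Q: prob_space "density P D" by fact
  interpret p: product_sigma_finite "\<lambda>_. P" ..
  interpret q: product_sigma_finite "\<lambda>_. density P D" ..
  note [measurable] = D
  have m: "(\<lambda>w. \<Prod>k\<in>I. D (w k)) \<in> borel_measurable (Pi\<^sub>M I (\<lambda>_. P))" by measurable
  show ?thesis
  proof (rule q.PiM_eqI[OF I, symmetric])
    show "sets (density (Pi\<^sub>M I (\<lambda>_. P)) (\<lambda>w. \<Prod>k\<in>I. D (w k))) = sets (Pi\<^sub>M I (\<lambda>_. density P D))"
      by (simp cong: sets_PiM_cong)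
    fix A assume A: "\<And>i. i \<in> I \<Longrightarrow> A i \<in> sets (density P D)"
    then have AP: "\<And>i. i \<in> I \<Longrightarrow> A i \<in> sets P" by simp
    have "emeasure (density (Pi\<^sub>M I (\<lambda>_. P)) (\<lambda>w. \<Prod>k\<in>I. D (w k))) (Pi\<^sub>E I A)
        = (\<integral>\<^sup>+w. (\<Prod>k\<in>I. D (w k)) * indicator (Pi\<^sub>E I A) w \<partial>Pi\<^sub>M I (\<lambda>_. P))"
      using AP by (intro emeasure_density m sets_PiM_I_finite I)
    also have "\<dots> = (\<integral>\<^sup>+w. (\<Prod>k\<in>I. D (w k) * indicator (A k) (w k)) \<partial>Pi\<^sub>M I (\<lambda>_. P))"
    proof (rule nn_integral_cong)
      fix w assume "w \<in> space (Pi\<^sub>M I (\<lambda>_. P))"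
      then have "indicator (Pi\<^sub>E I A) w = (\<Prod>k\<in>I. indicator (A k) (w k) :: ennreal)"
        using I by (auto simp: indicator_def space_PiM PiE_iff prod_zero_iff)
      then show "(\<Prod>k\<in>I. D (w k)) * indicator (Pi\<^sub>E I A) w = (\<Prod>k\<in>I. D (w k) * indicator (A k) (w k))"
        by (simp add: prod.distrib)
    qed
    also have "\<dots> = (\<Prod>k\<in>I. \<integral>\<^sup>+x. D x * indicator (A k) x \<partial>P)"
      using AP by (intro p.product_nn_integral_prod I) auto
    also have "\<dots> = (\<Prod>k\<in>I. emeasure (density P D) (A k))"
      using AP by (intro prod.cong refl) (simp add: emeasure_density)
    finally show "emeasure (density (Pi\<^sub>M I (\<lambda>_. P)) (\<lambda>w. \<Prod>k\<in>I. D (w k))) (Pi\<^sub>E I A) = (\<Prod>k\<in>I. emeasure (density P D) (A k))" .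
  qed
qed

section \<open>Predictable controls\<close>

text \<open>Predictable rectangles are measurable rectangles.\<close>

lemma predictable_control_jointly_measurable:
  assumes \<beta>: "\<beta> \<in> predictable_controls T A \<Omega> F"
    and G: "space G = \<Omega>" "\<And>s. s \<in> {0..T} \<Longrightarrow> sets (F s) \<subseteq> sets G" and T: "0 < T"
  shows "(\<lambda>z. \<beta> (fst z) (snd z)) \<in> restrict_space borel {0..T} \<Otimes>\<^sub>M G \<rightarrow>\<^sub>M restrict_space borel A"
proof -
  let ?B = "restrict_space borel {0..T} \<Otimes>\<^sub>M G"
  let ?gen = "{{0} \<times> B | B. B \<in> sets (F 0)} \<union>
      {{s<..t} \<times> B | s t B. 0 \<le> s \<and> s \<le> t \<and> t \<le> T \<and> B \<in> sets (F s)}"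
  have sp: "space ?B = {0..T} \<times> \<Omega>" by (simp add: space_pair_measure space_restrict_space G)
  have gen: "?gen \<subseteq> sets ?B"
  proof -
    have "{0} \<times> B \<in> sets ?B" if "B \<in> sets (F 0)" for B
      using that G(2)[of 0] T by (intro pair_measureI) (auto simp: sets_restrict_space_iff)
    moreover have "{s<..t} \<times> B \<in> sets ?B" if "0 \<le> s" "s \<le> t" "t \<le> T" "B \<in> sets (F s)" for s t B
      using that G(2)[of s] by (intro pair_measureI) (auto simp: sets_restrict_space_iff)
    ultimately show ?thesis by auto
  qed
  have "?gen \<subseteq> Pow ({0..T} \<times> \<Omega>)" using gen sets.sets_into_space[of _ ?B] sp by blast
  then have pa: "sets (predictable_algebra T \<Omega> F) = sigma_sets ({0..T} \<times> \<Omega>) ?gen" "space (predictable_algebra T \<Omega> F) = {0..T} \<times> \<Omega>"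
    unfolding predictable_algebra_def by (simp_all add: sets_measure_of space_measure_of)
  have sub: "sets (predictable_algebra T \<Omega> F) \<subseteq> sets ?B"
    unfolding pa(1) sp[symmetric] by (rule sets.sigma_sets_subset[OF gen])
  have "(\<lambda>(t, \<omega>). \<beta> t \<omega>) \<in> predictable_algebra T \<Omega> F \<rightarrow>\<^sub>M restrict_space borel A"
    using \<beta> by (simp add: predictable_controls_def)
  then have "(\<lambda>z. \<beta> (fst z) (snd z)) \<in> predictable_algebra T \<Omega> F \<rightarrow>\<^sub>M restrict_space borel A" by (simp add: split_beta')
  then show ?thesis using sub by (auto simp: measurable_def sp pa(2))
qed

lemma mfg_control_jointly_measurable:
  assumes "\<beta> \<in> mfg_controls T A" "0 < T"
  shows "(\<lambda>z. \<beta> (fst z) (snd z)) \<in> restrict_space borel {0..T} \<Otimes>\<^sub>M canonical_filtration T T \<rightarrow>\<^sub>M restrict_space borel A"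
  by (rule predictable_control_jointly_measurable[OF assms(1)[unfolded mfg_controls_def]])
     (use assms(2) canonical_filtration_mono in auto)

lemma space_natural_filtration [simp]: "space (natural_filtration \<Omega> Y t) = \<Omega>"
  unfolding natural_filtration_def by (subst space_measure_of) auto

lemma sets_natural_filtration:
  "sets (natural_filtration \<Omega> Y t) = sigma_sets \<Omega> (\<Union>Y\<in>Y. \<Union>s\<in>{0..t}. {Y s -` B \<inter> \<Omega> | B. B \<in> sets borel})"
  unfolding natural_filtration_def by (subst sets_measure_of) auto

lemma nplayer_control_jointly_measurable:
  fixes P :: "(real \<Rightarrow> real^'m) measure"
  assumes \<beta>: "\<beta> \<in> nplayer_controls T A N" and T: "0 < T" and P: "is_chain_law T p0 P"
  shows "(\<lambda>z. \<beta> (fst z) (snd z)) \<in> restrict_space borel {0..T} \<Otimes>\<^sub>M Pi\<^sub>M {1..N} (\<lambda>_. P) \<rightarrow>\<^sub>M restrict_space borel A"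
proof (rule predictable_control_jointly_measurable[OF \<beta>[unfolded nplayer_controls_def Let_def]])
  have sp: "space P = paths T" by (rule chain_law_space[OF P])
  show spN: "space (Pi\<^sub>M {1..N} (\<lambda>_. P)) = ({1..N} \<rightarrow>\<^sub>E paths T)" by (simp add: space_PiM sp)
  fix t assume t: "t \<in> {0..T}"
  have c: "(\<lambda>w. w n s) \<in> borel_measurable (Pi\<^sub>M {1..N} (\<lambda>_. P))" if "n \<in> {1..N}" "s \<in> {0..T}" for n s
    by (rule measurable_compose[OF measurable_component_singleton[OF that(1)] chain_law_coordinate[OF P that(2)]])
  show "sets (natural_filtration ({1..N} \<rightarrow>\<^sub>E paths T) ((\<lambda>n s w. w n s) ` {1..N}) t) \<subseteq> sets (Pi\<^sub>M {1..N} (\<lambda>_. P))"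
    unfolding sets_natural_filtration spN[symmetric]
  proof (rule sets.sigma_sets_subset, safe)
    fix n s and B :: "(real^'m) set" assume "n \<in> {1..N}" "s \<in> {0..t}" "B \<in> sets borel"
    then show "(\<lambda>w. w n s) -` B \<inter> space (Pi\<^sub>M {1..N} (\<lambda>_. P)) \<in> sets (Pi\<^sub>M {1..N} (\<lambda>_. P))"
      using t by (intro measurable_sets[OF c]) auto
  qed
qed (rule T)

text \<open>With the paths of the others frozen, the information of all players up to time
  \<open>s\<close> is the information about the own path up to time \<open>s\<close>. Hence the section
  map pulls predictable generators back to predictable generators, and the section of a control of the
  game with \<open>N\<close> players is an admissible control of the mean field game.\<close>

lemma nplayer_control_section:
  fixes \<beta> :: "real \<Rightarrow> (nat \<Rightarrow> real \<Rightarrow> real^'m) \<Rightarrow> real^'l"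
  assumes \<beta>: "\<beta> \<in> nplayer_controls T A N" and n: "n \<in> {1..N}" and w: "w \<in> ({1..N} - {n}) \<rightarrow>\<^sub>E paths T" and T: "0 \<le> T"
  shows "(\<lambda>t x. \<beta> t (w(n := x))) \<in> mfg_controls T A"
proof -
  let ?\<Omega> = "{1..N} \<rightarrow>\<^sub>E (paths T :: (real \<Rightarrow> real^'m) set)"
  let ?F = "natural_filtration ?\<Omega> ((\<lambda>n s w. w n s) ` {1..N})"
  let ?G = "canonical_filtration T :: real \<Rightarrow> (real \<Rightarrow> real^'m) measure"
  have upd: "w(n := x) \<in> ?\<Omega>" if "x \<in> paths T" for x using w n that by (auto simp: PiE_iff extensional_def)
  \<comment> \<open>The coordinates of the other players become constants.\<close>
  have sec: "(\<lambda>x. w(n := x)) \<in> ?G s \<rightarrow>\<^sub>M ?F s" for s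
    unfolding natural_filtration_def
  proof (rule measurable_measure_of)
    show "(\<Union>Y\<in>(\<lambda>n s w. w n s) ` {1..N}. \<Union>s\<in>{0..s}. {Y s -` B \<inter> ?\<Omega> |B. B \<in> sets borel}) \<subseteq> Pow ?\<Omega>" by auto
    show "(\<lambda>x. w(n := x)) \<in> space (?G s) \<rightarrow> ?\<Omega>" using upd by simp
    fix y assume "y \<in> (\<Union>Y\<in>(\<lambda>n s w. w n s) ` {1..N}. \<Union>s\<in>{0..s}. {Y s -` B \<inter> ?\<Omega> |B. B \<in> sets borel})"
    then obtain k u and B :: "(real^'m) set" where y: "k \<in> {1..N}" "u \<in> {0..s}" "B \<in> sets borel" "y = (\<lambda>w. w k u) -` B \<inter> ?\<Omega>" by auto
    have "(\<lambda>x. (w(n := x)) k u) \<in> ?G s \<rightarrow>\<^sub>M borel"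
    proof (cases "k = n")
      case True then show ?thesis using measurable_canonical_coordinate[OF y(2)] by simp
    qed simp
    from measurable_sets[OF this y(3)]
    have "(\<lambda>x. (w(n := x)) k u) -` B \<inter> space (?G s) \<in> sets (?G s)" .
    moreover have "(\<lambda>x. w(n := x)) -` y \<inter> space (?G s) = (\<lambda>x. (w(n := x)) k u) -` B \<inter> space (?G s)"
      using upd by (auto simp: y(4))
    ultimately show "(\<lambda>x. w(n := x)) -` y \<inter> space (?G s) \<in> sets (?G s)" by simp
  qed
  let ?gen = "{{0} \<times> B | B. B \<in> sets (?F 0)} \<union> {{s<..t} \<times> B | s t B. 0 \<le> s \<and> s \<le> t \<and> t \<le> T \<and> B \<in> sets (?F s)}"
  let ?gen' = "{{0} \<times> B | B. B \<in> sets (?G 0)} \<union> {{s<..t} \<times> B | s t B. 0 \<le> s \<and> s \<le> t \<and> t \<le> T \<and> B \<in> sets (?G s)}"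
    have g: "?gen \<subseteq> Pow ({0..T} \<times> ?\<Omega>)" using T sets.sets_into_space[of _ "?F _"] by fastforce
    have g': "?gen' \<subseteq> Pow ({0..T} \<times> paths T)" using T sets.sets_into_space[of _ "?G _"] by fastforce
    have sp': "space (predictable_algebra T (paths T) ?G) = {0..T} \<times> paths T"
      and se': "sets (predictable_algebra T (paths T) ?G) = sigma_sets ({0..T} \<times> paths T) ?gen'"
      unfolding predictable_algebra_def using g' by (simp_all add: space_measure_of sets_measure_of)
    have "(\<lambda>(t, x). (t, w(n := x))) \<in> predictable_algebra T (paths T) ?G \<rightarrow>\<^sub>M predictable_algebra T ?\<Omega> ?F"
      unfolding predictable_algebra_def[of T ?\<Omega>]
    proof (rule measurable_measure_of[OF g])
      show "(\<lambda>(t, x). (t, w(n := x))) \<in> space (predictable_algebra T (paths T) ?G) \<rightarrow> {0..T} \<times> ?\<Omega>"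
        using upd by (auto simp: sp')
      fix y assume "y \<in> ?gen"
      then consider (z) B where "y = {0} \<times> B" "B \<in> sets (?F 0)" | (i) s t B where "y = {s<..t} \<times> B" "0 \<le> s" "s \<le> t" "t \<le> T" "B \<in> sets (?F s)"
        by blast
      then show "(\<lambda>(t, x). (t, w(n := x))) -` y \<inter> space (predictable_algebra T (paths T) ?G) \<in> sets (predictable_algebra T (paths T) ?G)"
      proof cases
        case z
        have "(\<lambda>(t, x). (t, w(n := x))) -` y \<inter> space (predictable_algebra T (paths T) ?G) = {0} \<times> ((\<lambda>x. w(n := x)) -` B \<inter> space (?G 0))"
          using T by (auto simp: sp' z(1))
        also have "\<dots> \<in> ?gen'" using measurable_sets[OF sec z(2)] by blast
        finally show ?thesis unfolding se' by (rule sigma_sets.Basic)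
      next
        case i
        have "(\<lambda>(t, x). (t, w(n := x))) -` y \<inter> space (predictable_algebra T (paths T) ?G) = {s<..t} \<times> ((\<lambda>x. w(n := x)) -` B \<inter> space (?G s))"
          using T i(2-4) by (auto simp: sp' i(1))
        also have "\<dots> \<in> ?gen'" using measurable_sets[OF sec i(5)] i(2-4) by blast
        finally show ?thesis unfolding se' by (rule sigma_sets.Basic)
      qed
    qed
    moreover have "(\<lambda>(t, \<omega>). \<beta> t \<omega>) \<in> predictable_algebra T ?\<Omega> ?F \<rightarrow>\<^sub>M restrict_space borel A"
      using \<beta> by (simp add: nplayer_controls_def predictable_controls_def Let_def)
    ultimately have "(\<lambda>z. (\<lambda>(t, \<omega>). \<beta> t \<omega>) ((\<lambda>(t, x). (t, w(n := x))) z)) \<in> predictable_algebra T (paths T) ?G \<rightarrow>\<^sub>M restrict_space borel A"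
      by (rule measurable_compose)
    then show ?thesis by (simp add: mfg_controls_def predictable_controls_def split_beta')
qed

section \<open>Controlled likelihoods and costs\<close>

lemma jointly_measurable_section:
  assumes "(\<lambda>z. u (fst z) (snd z)) \<in> B \<Otimes>\<^sub>M M \<rightarrow>\<^sub>M N" "w \<in> space M"
  shows "(\<lambda>s. u s w) \<in> B \<rightarrow>\<^sub>M N"
  using measurable_compose[OF measurable_Pair2'[OF assms(2)] assms(1)] by simp

lemma jointly_measurable_time_section:
  assumes "(\<lambda>z. u (fst z) (snd z)) \<in> B \<Otimes>\<^sub>M M \<rightarrow>\<^sub>M N" "s \<in> space B"
  shows "u s \<in> M \<rightarrow>\<^sub>M N"
  using measurable_compose[OF measurable_Pair1'[OF assms(2)] assms(1)] by simp

lemma norm_diff_prob_simplex: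
  fixes p p' :: "real^'m"
  assumes "p \<in> prob_simplex" "p' \<in> prob_simplex"
  shows "norm (p - p') \<le> 2"
proof -
  have "norm p \<le> 1" if "p \<in> prob_simplex" for p :: "real^'m"
    using norm_le_l1_cart[of p] that by (simp add: prob_simplex_def)
  from this[OF assms(1)] this[OF assms(2)] show ?thesis using norm_triangle_ineq4[of p p'] by linarith
qed

text \<open>The data of the games with explicit constants: \<open>K\<close> bounds the transition rates and \<open>C\<close> is a common Lipschitz constant. The
  rates depend on time and action only.\<close>

locale mean_field_setting =
  fixes T :: real and A :: "(real^'l) set" and p0 :: "real^'m" and P :: "(real \<Rightarrow> real^'m) measure"
    and r :: "('m, 'l) rates_reduced" and f :: "('m, 'l) running_cost" and g :: "'m terminal_cost"
    and K C :: real
  assumes T_pos: "0 < T" and A_compact: "compact A" and A_nonempty: "A \<noteq> {}"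
    and chain: "is_chain_law T p0 P" and K_ge: "1 \<le> K"
    and r_lip: "\<And>i j. caratheodory_lipschitz T A C (\<lambda>t a (p::real^'m) \<nu>. r t i j a)"
    and r_rows: "\<And>t a i. t \<in> {0..T} \<Longrightarrow> a \<in> A \<Longrightarrow> (\<Sum>j\<in>UNIV. r t i j a) = 0"
    and r_bounds: "\<And>t a i j. t \<in> {0..T} \<Longrightarrow> a \<in> A \<Longrightarrow> i \<noteq> j \<Longrightarrow> 0 < r t i j a \<and> r t i j a \<le> K"
    and f_lip: "\<And>i. caratheodory_lipschitz T A C (\<lambda>t. f t (axis i 1))"
    and f_integrable: "\<And>i a p \<nu>. a \<in> A \<Longrightarrow> p \<in> prob_simplex \<Longrightarrow> \<nu> \<in> prob_measures A \<Longrightarrow>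
        set_integrable lborel {0..T} (\<lambda>t. f t (axis i 1) a p \<nu>)"
    and g_lip: "\<And>i p p'. p \<in> prob_simplex \<Longrightarrow> p' \<in> prob_simplex \<Longrightarrow>
        \<bar>g (axis i 1) p - g (axis i 1) p'\<bar> \<le> C * norm (p - p')"
begin

sublocale P: prob_space P
  using chain by (simp add: is_chain_law_def)

lemma space_P: "space P = paths T"
  by (rule chain_law_space[OF chain])

lemma C_nonneg: "0 \<le> C"
  using f_lip by (simp add: caratheodory_lipschitz_def)

abbreviation "time_interval \<equiv> restrict_space borel {0..T}"
abbreviation "actions \<equiv> restrict_space borel A"

lemma space_time [simp]: "space time_interval = {0..T}" by (simp add: space_restrict_space)
lemma space_actions [simp]: "space actions = A" by (simp add: space_restrict_space)

definition rate_matrix :: "(real \<Rightarrow> real^'l) \<Rightarrow> real \<Rightarrow> real^'m^'m" where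
  "rate_matrix u s = (\<chi> i j. r s i j (u s))"

text \<open>The density, with respect to the reference chain, of the path of a player who applies the
  actions \<open>u\<close> along the path \<open>x\<close>.\<close>

definition lik :: "(real \<Rightarrow> real^'l) \<Rightarrow> (real \<Rightarrow> real^'m) \<Rightarrow> real" where
  "lik u x = likelihood T (rate_matrix u) x"

text \<open>The cost of one path, for actions \<open>u\<close>, state distributions \<open>p\<close> and
  action laws \<open>\<nu>\<close>. In the mean field game the last two are deterministic, in the game
  with finitely many players they are the empirical ones.\<close>

definition path_cost ::
    "(real \<Rightarrow> real^'m) \<Rightarrow> (real \<Rightarrow> real^'l) \<Rightarrow> (real \<Rightarrow> real^'m) \<Rightarrow> (real \<Rightarrow> (real^'l) measure) \<Rightarrow> real" where
  "path_cost x u p \<nu> = (LINT t:{0..T}|lborel. f t (x t) (u t) (p t) (\<nu> t)) + g (x T) (p T)"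

lemma dirac_prob_measure: "a \<in> A \<Longrightarrow> return actions a \<in> prob_measures A"
  by (simp add: prob_measures_iff prob_space_return)

lemma axis_prob_simplex: "axis i 1 \<in> prob_simplex"
  by (simp add: prob_simplex_def axis_def)

lemma rate_measurable:
  assumes u: "(\<lambda>z. u (fst z) (snd z)) \<in> time_interval \<Otimes>\<^sub>M M \<rightarrow>\<^sub>M actions"
  shows "(\<lambda>z. rate_matrix (\<lambda>s. u s (snd z)) (fst z) $ i $ j) \<in> borel_measurable (time_interval \<Otimes>\<^sub>M M)"
proof -
  obtain a where a: "a \<in> A" using A_nonempty by blast
  \<comment> \<open>As Lipschitz data the rates are constant in the last two arguments; a fixed vertex and
    a Dirac measure fill these in.\<close>
  have "(\<lambda>z. r (fst z) i j (u (fst z) (snd z))) \<in> borel_measurable (time_interval \<Otimes>\<^sub>M M)"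
    by (rule measurable_caratheodory_lipschitz[OF r_lip A_compact measurable_fst u, of "\<lambda>_. axis undefined 1" "\<lambda>_. return actions a"])
      (auto intro!: dirac_prob_measure[OF a] axis_prob_simplex measurable_const simp: space_restrict_space)
  then show ?thesis by (simp add: rate_matrix_def)
qed

lemma admissible_rate_matrix:
  assumes u: "u \<in> time_interval \<rightarrow>\<^sub>M actions"
  shows "admissible_rates T K (rate_matrix u)"
proof -
  have uA: "u s \<in> A" if "s \<in> {0..T}" for s using measurable_space[OF u] that by simp
  have "(\<lambda>z. u (fst z)) \<in> time_interval \<Otimes>\<^sub>M count_space {()} \<rightarrow>\<^sub>M actions" using u by (rule measurable_compose[OF measurable_fst])
  from rate_measurable[of "\<lambda>s _. u s", OF this]
  have "(\<lambda>z. rate_matrix u (fst z) $ i $ j) \<in> borel_measurable (time_interval \<Otimes>\<^sub>M count_space {()})" for i j .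
  from measurable_compose[OF measurable_Pair2' this, of "()"]
  have m: "(\<lambda>s. rate_matrix u s $ i $ j) \<in> borel_measurable time_interval" for i j by simp
  have b: "\<bar>rate_matrix u s $ i $ j\<bar> \<le> real CARD('m) * K" if s: "s \<in> {0..T}" for s i j
  proof -
    have off: "0 < r s i l (u s) \<and> r s i l (u s) \<le> K" if "i \<noteq> l" for i l using r_bounds[OF s uA[OF s] that] .
    have K: "K \<le> real CARD('m) * K"
      using K_ge mult_right_mono[of 1 "real CARD('m)" K] by (simp add: Suc_leI)
    show ?thesis
    proof (cases "i = j")
      case False
      have "0 < r s i j (u s)" "r s i j (u s) \<le> real CARD('m) * K" using off[OF False] K by linarith+
      then show ?thesis by (simp add: rate_matrix_def)
    next
      case True
      have "(\<Sum>l\<in>insert i (UNIV - {i}). r s i l (u s)) = 0"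
        using r_rows[OF s uA[OF s], of i] by (simp add: insert_absorb)
      then have "r s i i (u s) = - (\<Sum>l\<in>UNIV - {i}. r s i l (u s))"
        by (subst (asm) sum.insert) auto
      moreover have "0 \<le> (\<Sum>l\<in>UNIV - {i}. r s i l (u s))" using off by (intro sum_nonneg) (auto intro: less_imp_le)
      moreover have "(\<Sum>l\<in>UNIV - {i}. r s i l (u s)) \<le> (\<Sum>l\<in>UNIV - {i}. K)" using off by (intro sum_mono) auto
      moreover have "(\<Sum>l\<in>UNIV - {i}. K) \<le> real CARD('m) * K" using K_ge by (simp add: card_Diff_singleton)
      ultimately show ?thesis using True by (simp add: rate_matrix_def)
    qed
  qed
  show ?thesis unfolding admissible_rates_def bounded_measurable_on_def
  proof (intro conjI allI ballI impI)
    show "\<exists>B. \<forall>s\<in>{0..T}. \<bar>rate_matrix u s $ i $ j\<bar> \<le> B" for i j using b by blast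
  qed (use m r_rows r_bounds uA in \<open>auto simp: rate_matrix_def\<close>)
qed

lemma lik_measurable:
  assumes X: "X \<in> M \<rightarrow>\<^sub>M canonical_filtration T T" and u: "(\<lambda>z. u (fst z) (snd z)) \<in> time_interval \<Otimes>\<^sub>M M \<rightarrow>\<^sub>M actions"
  shows "(\<lambda>w. lik (\<lambda>s. u s w) (X w)) \<in> borel_measurable M"
  unfolding lik_def
  by (rule likelihood_measurable[OF X T_pos rate_measurable[OF u]])
     (rule admissible_rate_matrix[OF jointly_measurable_section[OF u]])

text \<open>A bound for the likelihood that does not depend on the control, with mean at most
  \<open>lik_mass\<close>. Errors that hold uniformly in the own path are weighted with it.\<close>

definition lik_bound :: "(real \<Rightarrow> real^'m) \<Rightarrow> real" where
  "lik_bound x = exp (real CARD('m) * T) * K ^ card (jumps T x)"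

definition lik_mass :: real where
  "lik_mass = exp (real CARD('m) * T) * exp ((K - 1) * (real CARD('m) - 1) * T)"

lemma lik_bounds:
  assumes "u \<in> time_interval \<rightarrow>\<^sub>M actions" "x \<in> paths T"
  shows "0 < lik u x" "lik u x \<le> lik_bound x"
  using likelihood_bounds[OF admissible_rate_matrix[OF assms(1)] assms(2) T_pos]
  by (auto simp: lik_def lik_bound_def)

lemma lik_bound_integrable: "integrable P lik_bound" "(\<integral>x. lik_bound x \<partial>P) \<le> lik_mass"
proof -
  have "(\<lambda>x. real (card (jumps T x \<inter> {0<..T}))) \<in> borel_measurable P"
    by (rule measurable_card_jumps[OF chain_law_measurable_canonical[OF chain] T_pos order_refl])
  moreover have "jumps T x \<inter> {0<..T} = jumps T x" for x :: "real \<Rightarrow> real^'m" using jumps_subset by blast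
  ultimately have [measurable]: "(\<lambda>x. real (card (jumps T x))) \<in> borel_measurable P" by simp
  have "(\<lambda>x. exp (real CARD('m) * T) * K powr real (card (jumps T x))) \<in> borel_measurable P" by measurable
  then have m: "lik_bound \<in> borel_measurable P"
    using K_ge by (simp add: lik_bound_def[abs_def] powr_realpow)
  have l0: "0 \<le> lik_bound x" for x using K_ge by (simp add: lik_bound_def)
  have le: "(\<integral>\<^sup>+x. ennreal (lik_bound x) \<partial>P) \<le> ennreal lik_mass"
  proof -
    have m': "(\<lambda>x. ennreal (K ^ card (jumps T x))) \<in> borel_measurable P"
    proof -
      have "(\<lambda>x. ennreal (K powr real (card (jumps T x)))) \<in> borel_measurable P" by measurable
      then show ?thesis using K_ge by (simp add: powr_realpow)
    qed
    have "(\<integral>\<^sup>+x. ennreal (lik_bound x) \<partial>P) = ennreal (exp (real CARD('m) * T)) * (\<integral>\<^sup>+x. ennreal (K ^ card (jumps T x)) \<partial>P)"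
      using K_ge by (subst nn_integral_cmult[OF m', symmetric]) (simp add: lik_bound_def ennreal_mult)
    also have "\<dots> \<le> ennreal (exp (real CARD('m) * T)) * ennreal (exp ((K - 1) * (real CARD('m) - 1) * T))"
      by (intro mult_left_mono chain_jump_count_exponential_moment[OF chain T_pos K_ge]) simp
    finally show ?thesis by (simp add: lik_mass_def ennreal_mult)
  qed
  show i: "integrable P lik_bound"
    by (rule integrableI_nonneg[OF m AE_I2[OF l0]]) (use le in \<open>auto intro: le_less_trans\<close>)
  show "(\<integral>x. lik_bound x \<partial>P) \<le> lik_mass"
    using le l0 by (subst (asm) nn_integral_eq_integral[OF i]) (auto simp: lik_mass_def)
qed

lemma lik_mass_nonneg: "0 \<le> lik_mass" by (simp add: lik_mass_def)

lemma running_cost_measurable: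
  assumes X: "X \<in> M \<rightarrow>\<^sub>M canonical_filtration T T"
    and u: "(\<lambda>z. u (fst z) (snd z)) \<in> time_interval \<Otimes>\<^sub>M M \<rightarrow>\<^sub>M actions"
    and p: "(\<lambda>z. p (fst z) (snd z)) \<in> time_interval \<Otimes>\<^sub>M M \<rightarrow>\<^sub>M restrict_space borel prob_simplex"
    and \<nu>: "\<And>t w. t \<in> {0..T} \<Longrightarrow> w \<in> space M \<Longrightarrow> \<nu> t w \<in> prob_measures A"
    and \<nu>m: "\<And>B. B \<in> sets actions \<Longrightarrow> (\<lambda>z. measure (\<nu> (fst z) (snd z)) B) \<in> borel_measurable (time_interval \<Otimes>\<^sub>M M)"
  shows "(\<lambda>z. f (fst z) (X (snd z) (fst z)) (u (fst z) (snd z)) (p (fst z) (snd z)) (\<nu> (fst z) (snd z)))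
    \<in> borel_measurable (time_interval \<Otimes>\<^sub>M M)"
proof -
  let ?B = "time_interval \<Otimes>\<^sub>M M"
  have "(\<lambda>z. f (fst z) (axis i 1) (u (fst z) (snd z)) (p (fst z) (snd z)) (\<nu> (fst z) (snd z))) \<in> borel_measurable ?B" for i
    by (rule measurable_caratheodory_lipschitz[OF f_lip A_compact measurable_fst u p])
       (use \<nu> \<nu>m in \<open>auto simp: space_pair_measure space_restrict_space\<close>)
  then have "(\<lambda>z. \<Sum>i\<in>UNIV. X (snd z) (fst z) $ i * f (fst z) (axis i 1) (u (fst z) (snd z)) (p (fst z) (snd z)) (\<nu> (fst z) (snd z))) \<in> borel_measurable ?B"
    by (intro borel_measurable_sum borel_measurable_times borel_measurable_vec_component path_value_measurable[OF X T_pos])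
  then show ?thesis
  proof (rule measurable_cong[THEN iffD1, rotated])
    fix z assume "z \<in> space ?B"
    then have "X (snd z) (fst z) \<in> states"
      using measurable_space[OF X, of "snd z"] by (auto simp: space_pair_measure space_restrict_space intro!: paths_in_states)
    from state_expand[OF this, of "\<lambda>x. f (fst z) x (u (fst z) (snd z)) (p (fst z) (snd z)) (\<nu> (fst z) (snd z))"]
    show "(\<Sum>i\<in>UNIV. X (snd z) (fst z) $ i * f (fst z) (axis i 1) (u (fst z) (snd z)) (p (fst z) (snd z)) (\<nu> (fst z) (snd z)))
       = f (fst z) (X (snd z) (fst z)) (u (fst z) (snd z)) (p (fst z) (snd z)) (\<nu> (fst z) (snd z))"
      by simp
  qed
qed

lemma path_cost_measurable:
  assumes X: "X \<in> M \<rightarrow>\<^sub>M canonical_filtration T T"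
    and u: "(\<lambda>z. u (fst z) (snd z)) \<in> time_interval \<Otimes>\<^sub>M M \<rightarrow>\<^sub>M actions"
    and p: "(\<lambda>z. p (fst z) (snd z)) \<in> time_interval \<Otimes>\<^sub>M M \<rightarrow>\<^sub>M restrict_space borel prob_simplex"
    and \<nu>: "\<And>t w. t \<in> {0..T} \<Longrightarrow> w \<in> space M \<Longrightarrow> \<nu> t w \<in> prob_measures A"
    and \<nu>m: "\<And>B. B \<in> sets actions \<Longrightarrow> (\<lambda>z. measure (\<nu> (fst z) (snd z)) B) \<in> borel_measurable (time_interval \<Otimes>\<^sub>M M)"
  shows "(\<lambda>w. path_cost (X w) (\<lambda>t. u t w) (\<lambda>t. p t w) (\<lambda>t. \<nu> t w)) \<in> borel_measurable M"
proof -
  have 1: "(\<lambda>w. LINT t:{0..T}|lborel. f t (X w t) (u t w) (p t w) (\<nu> t w)) \<in> borel_measurable M"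
    using time_integral_measurable[OF running_cost_measurable[OF assms] T_pos, of "{0..T}"] by simp
  have TT: "T \<in> space time_interval" using T_pos by simp
  have "continuous_on prob_simplex (g (axis i 1))" for i
  proof (rule lipschitz_on_continuous_on)
    show "C-lipschitz_on prob_simplex (g (axis i 1))"
      by (rule lipschitz_onI) (use g_lip C_nonneg in \<open>auto simp: dist_norm\<close>)
  qed
  then have gm: "g (axis i 1) \<in> borel_measurable (restrict_space borel prob_simplex)" for i
    by (rule borel_measurable_continuous_on_restrict)
  have "(\<lambda>w. X w T) \<in> borel_measurable M"
    using T_pos by (intro measurable_compose[OF X measurable_canonical_coordinate]) simp
  then have "(\<lambda>w. \<Sum>i\<in>UNIV. X w T $ i * g (axis i 1) (p T w)) \<in> borel_measurable M"
    by (intro borel_measurable_sum borel_measurable_times borel_measurable_vec_component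
        measurable_compose[OF jointly_measurable_time_section[OF p TT] gm])
  then have 2: "(\<lambda>w. g (X w T) (p T w)) \<in> borel_measurable M"
  proof (rule measurable_cong[THEN iffD1, rotated])
    fix w assume "w \<in> space M"
    then have "X w T \<in> states" using measurable_space[OF X] T_pos by (auto intro!: paths_in_states)
    from state_expand[OF this, of "\<lambda>x. g x (p T w)"]
    show "(\<Sum>i\<in>UNIV. X w T $ i * g (axis i 1) (p T w)) = g (X w T) (p T w)" by simp
  qed
  show ?thesis unfolding path_cost_def using 1 2 by (rule borel_measurable_add)
qed

text \<open>The domain of all arguments but time is bounded, so by the Lipschitz condition one reference
  value dominates the running cost up to a constant.\<close>

lemma running_cost_dominated:
  obtains F where "set_integrable lborel {0..T} F" "\<And>t. 0 \<le> F t"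
    "\<And>t x a p \<nu>. t \<in> {0..T} \<Longrightarrow> x \<in> states \<Longrightarrow> a \<in> A \<Longrightarrow> p \<in> prob_simplex \<Longrightarrow> \<nu> \<in> prob_measures A \<Longrightarrow> \<bar>f t x a p \<nu>\<bar> \<le> F t"
proof -
  obtain a0 where a0: "a0 \<in> A" using A_nonempty by blast
  define pb :: "real^'m" where "pb = axis undefined 1"
  define vb where "vb = return actions a0"
  have pb: "pb \<in> prob_simplex" and vb: "vb \<in> prob_measures A"
    unfolding pb_def vb_def by (rule axis_prob_simplex, rule dirac_prob_measure[OF a0])
  obtain D where D: "0 \<le> D" "\<And>\<mu> \<nu>. \<mu> \<in> prob_measures A \<Longrightarrow> \<nu> \<in> prob_measures A \<Longrightarrow> wasserstein1 A \<mu> \<nu> \<le> D"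
    "\<And>x y. x \<in> A \<Longrightarrow> y \<in> A \<Longrightarrow> norm (x - y) \<le> D"
    using wasserstein1_bounded[OF A_compact] by blast
  define F where "F t = (\<Sum>i\<in>UNIV. \<bar>f t (axis i 1) a0 pb vb\<bar>) + C * (D + 2 + D)" for t
  show ?thesis
  proof (rule that[of F])
    have c: "set_integrable lborel {0..T} (\<lambda>t. C * (D + 2 + D))"
      using T_pos by (simp add: set_integrable_def)
    have "set_integrable lborel {0..T} (\<lambda>t. \<bar>f t (axis i 1) a0 pb vb\<bar>)" for i
      by (rule set_integrable_abs[OF f_integrable[OF a0 pb vb]])
    then have "set_integrable lborel {0..T} (\<lambda>t. \<Sum>i\<in>UNIV. \<bar>f t (axis i 1) a0 pb vb\<bar>)"
      unfolding set_integrable_def scaleR_sum_right by (intro Bochner_Integration.integrable_sum)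
    then show "set_integrable lborel {0..T} F" unfolding F_def by (intro set_integral_add(1) c)
    show "0 \<le> F t" for t unfolding F_def using C_nonneg D(1) by (intro add_nonneg_nonneg sum_nonneg mult_nonneg_nonneg) auto
    fix t a \<nu> and x p :: "real^'m" assume h: "t \<in> {0..T}" "x \<in> states" "a \<in> A" "p \<in> prob_simplex" "\<nu> \<in> prob_measures A"
    obtain i where x: "x = axis i 1" using h(2) by (auto simp: states_def)
    have "\<bar>f t x a p \<nu> - f t x a0 pb vb\<bar> \<le> C * (norm (a - a0) + norm (p - pb) + wasserstein1 A \<nu> vb)"
      using f_lip[of i] h a0 pb vb unfolding caratheodory_lipschitz_def x by blast
    also have "\<dots> \<le> C * (D + 2 + D)"
      using C_nonneg h a0 pb vb by (intro mult_left_mono add_mono D norm_diff_prob_simplex) auto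
    finally have "\<bar>f t x a p \<nu>\<bar> \<le> \<bar>f t x a0 pb vb\<bar> + C * (D + 2 + D)" by linarith
    also have "\<bar>f t x a0 pb vb\<bar> \<le> (\<Sum>i\<in>UNIV. \<bar>f t (axis i 1) a0 pb vb\<bar>)"
      unfolding x by (rule member_le_sum[where f="\<lambda>i. \<bar>f t (axis i 1) a0 pb vb\<bar>"]) auto
    finally show "\<bar>f t x a p \<nu>\<bar> \<le> F t" by (simp add: F_def)
  qed
qed

lemma path_cost_bounded:
  obtains B where "0 \<le> B"
    "\<And>x u p \<nu>. x \<in> paths T \<Longrightarrow> (\<And>t. t \<in> {0..T} \<Longrightarrow> u t \<in> A) \<Longrightarrow> (\<And>t. t \<in> {0..T} \<Longrightarrow> p t \<in> prob_simplex) \<Longrightarrow>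
      (\<And>t. t \<in> {0..T} \<Longrightarrow> \<nu> t \<in> prob_measures A) \<Longrightarrow> \<bar>path_cost x u p \<nu>\<bar> \<le> B"
proof -
  obtain F where F: "set_integrable lborel {0..T} F" "\<And>t. 0 \<le> F t"
    "\<And>t x a p \<nu>. t \<in> {0..T} \<Longrightarrow> x \<in> states \<Longrightarrow> a \<in> A \<Longrightarrow> p \<in> prob_simplex \<Longrightarrow> \<nu> \<in> prob_measures A \<Longrightarrow> \<bar>f t x a p \<nu>\<bar> \<le> F t"
    using running_cost_dominated by blast
  define pb :: "real^'m" where "pb = axis undefined 1"
  have pb: "pb \<in> prob_simplex" unfolding pb_def by (rule axis_prob_simplex)
  define G where "G = (\<Sum>i\<in>UNIV. \<bar>g (axis i 1) pb\<bar>) + C * 2"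
  have G: "\<bar>g x p\<bar> \<le> G" if x: "x \<in> states" and p: "p \<in> prob_simplex" for x p
  proof -
    obtain i where i: "x = axis i 1" using x by (auto simp: states_def)
    have "\<bar>g x p - g x pb\<bar> \<le> C * norm (p - pb)" unfolding i by (rule g_lip[OF p pb])
    also have "\<dots> \<le> C * 2" using C_nonneg by (intro mult_left_mono norm_diff_prob_simplex p pb)
    finally have "\<bar>g x p\<bar> \<le> \<bar>g x pb\<bar> + C * 2" by linarith
    also have "\<bar>g x pb\<bar> \<le> (\<Sum>i\<in>UNIV. \<bar>g (axis i 1) pb\<bar>)"
      unfolding i by (rule member_le_sum[where f="\<lambda>i. \<bar>g (axis i 1) pb\<bar>"]) auto
    finally show ?thesis by (simp add: G_def)
  qed
  have F0: "0 \<le> (LINT t:{0..T}|lborel. F t)"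
    unfolding set_lebesgue_integral_def by (rule Bochner_Integration.integral_nonneg) (simp add: F(2))
  show ?thesis
  proof (rule that[of "(LINT t:{0..T}|lborel. F t) + G"])
    show "0 \<le> (LINT t:{0..T}|lborel. F t) + G"
      using F0 C_nonneg by (auto simp: G_def intro!: add_nonneg_nonneg sum_nonneg)
    fix x p :: "real \<Rightarrow> real^'m" and u \<nu> assume h: "x \<in> paths T" "\<And>t. t \<in> {0..T} \<Longrightarrow> u t \<in> A" "\<And>t. t \<in> {0..T} \<Longrightarrow> p t \<in> prob_simplex"
      "\<And>t. t \<in> {0..T} \<Longrightarrow> \<nu> t \<in> prob_measures A"
    have "\<bar>LINT t:{0..T}|lborel. f t (x t) (u t) (p t) (\<nu> t)\<bar> \<le> (LINT t:{0..T}|lborel. F t)"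
      unfolding set_lebesgue_integral_def real_norm_def[symmetric]
    proof (rule order_trans[OF integral_norm_bound integral_mono'])
      show "integrable lborel (\<lambda>t. indicator {0..T} t *\<^sub>R F t)" using F(1) by (simp add: set_integrable_def)
      fix t
      show "norm (indicator {0..T} t *\<^sub>R f t (x t) (u t) (p t) (\<nu> t)) \<le> indicator {0..T} t *\<^sub>R F t"
        using F(3)[OF _ paths_in_states[OF h(1)] h(2) h(3) h(4), of t t t t t] by (auto simp: indicator_def)
    qed (use F(2) in \<open>auto simp: indicator_def\<close>)
    moreover have "\<bar>g (x T) (p T)\<bar> \<le> G" using T_pos by (intro G paths_in_states[OF h(1)] h(3)) auto
    ultimately show "\<bar>path_cost x u p \<nu>\<bar> \<le> (LINT t:{0..T}|lborel. F t) + G"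
      unfolding path_cost_def by linarith
  qed
qed

lemma running_cost_set_integrable:
  assumes h: "x \<in> paths T" "\<And>t. t \<in> {0..T} \<Longrightarrow> u t \<in> A" "\<And>t. t \<in> {0..T} \<Longrightarrow> p t \<in> prob_simplex"
      "\<And>t. t \<in> {0..T} \<Longrightarrow> \<nu> t \<in> prob_measures A"
    and m: "(\<lambda>t. f t (x t) (u t) (p t) (\<nu> t)) \<in> borel_measurable time_interval"
  shows "set_integrable lborel {0..T} (\<lambda>t. f t (x t) (u t) (p t) (\<nu> t))"
proof -
  obtain F where F: "set_integrable lborel {0..T} F" "\<And>t. 0 \<le> F t"
    "\<And>t x a p \<nu>. t \<in> {0..T} \<Longrightarrow> x \<in> states \<Longrightarrow> a \<in> A \<Longrightarrow> p \<in> prob_simplex \<Longrightarrow> \<nu> \<in> prob_measures A \<Longrightarrow> \<bar>f t x a p \<nu>\<bar> \<le> F t"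
    using running_cost_dominated by blast
  show ?thesis
  proof (rule set_integrable_bound[OF F(1)])
    show "set_borel_measurable lborel {0..T} (\<lambda>t. f t (x t) (u t) (p t) (\<nu> t))"
      using m by (simp add: set_borel_measurable_def borel_measurable_restrict_space_iff)
    show "AE t in lborel. t \<in> {0..T} \<longrightarrow> norm (f t (x t) (u t) (p t) (\<nu> t)) \<le> norm (F t)"
      using F(2) F(3)[OF _ paths_in_states[OF h(1)] h(2) h(3) h(4)] by (intro AE_I2) fastforce
  qed
qed

text \<open>The Lipschitz conditions, for the same path and the same actions; \<open>h\<close> majorises
  the distance of the laws and is integrable in time.\<close>

lemma path_cost_diff_le:
  assumes x: "x \<in> paths T" and u: "\<And>t. t \<in> {0..T} \<Longrightarrow> u t \<in> A"
    and p: "\<And>t. t \<in> {0..T} \<Longrightarrow> p t \<in> prob_simplex" and p': "\<And>t. t \<in> {0..T} \<Longrightarrow> p' t \<in> prob_simplex"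
    and \<nu>: "\<And>t. t \<in> {0..T} \<Longrightarrow> \<nu> t \<in> prob_measures A" and \<nu>': "\<And>t. t \<in> {0..T} \<Longrightarrow> \<nu>' t \<in> prob_measures A"
    and m: "(\<lambda>t. f t (x t) (u t) (p t) (\<nu> t)) \<in> borel_measurable time_interval"
      "(\<lambda>t. f t (x t) (u t) (p' t) (\<nu>' t)) \<in> borel_measurable time_interval"
    and h: "set_integrable lborel {0..T} h"
      "\<And>t. t \<in> {0..T} \<Longrightarrow> norm (p t - p' t) + wasserstein1 A (\<nu> t) (\<nu>' t) \<le> h t"
  shows "\<bar>path_cost x u p \<nu> - path_cost x u p' \<nu>'\<bar> \<le> C * (LINT t:{0..T}|lborel. h t) + C * norm (p T - p' T)"
proof -
  have i1: "set_integrable lborel {0..T} (\<lambda>t. f t (x t) (u t) (p t) (\<nu> t))"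
    by (rule running_cost_set_integrable[OF x u p \<nu> m(1)])
  have i2: "set_integrable lborel {0..T} (\<lambda>t. f t (x t) (u t) (p' t) (\<nu>' t))"
    by (rule running_cost_set_integrable[OF x u p' \<nu>' m(2)])
  have hC: "set_integrable lborel {0..T} (\<lambda>t. C * h t)" using h(1) by simp
  have le: "\<bar>f t (x t) (u t) (p t) (\<nu> t) - f t (x t) (u t) (p' t) (\<nu>' t)\<bar> \<le> C * h t" if t: "t \<in> {0..T}" for t
  proof -
    obtain i where i: "x t = axis i 1" using paths_in_states[OF x t] by (auto simp: states_def)
    have "\<bar>f t (x t) (u t) (p t) (\<nu> t) - f t (x t) (u t) (p' t) (\<nu>' t)\<bar>
        \<le> C * (norm (u t - u t) + norm (p t - p' t) + wasserstein1 A (\<nu> t) (\<nu>' t))"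
      using f_lip[of i] t u[OF t] p[OF t] p'[OF t] \<nu>[OF t] \<nu>'[OF t] unfolding caratheodory_lipschitz_def i by blast
    also have "\<dots> \<le> C * h t" using C_nonneg h(2)[OF t] by (intro mult_left_mono) auto
    finally show ?thesis .
  qed
  have "\<bar>(LINT t:{0..T}|lborel. f t (x t) (u t) (p t) (\<nu> t)) - (LINT t:{0..T}|lborel. f t (x t) (u t) (p' t) (\<nu>' t))\<bar>
      = \<bar>LINT t:{0..T}|lborel. f t (x t) (u t) (p t) (\<nu> t) - f t (x t) (u t) (p' t) (\<nu>' t)\<bar>"
    by (subst set_integral_diff(2)[OF i1 i2]) (rule refl)
  also have "\<dots> \<le> (LINT t:{0..T}|lborel. C * h t)"
    unfolding set_lebesgue_integral_def real_norm_def[symmetric]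
  proof (rule order_trans[OF integral_norm_bound integral_mono'])
    show "integrable lborel (\<lambda>t. indicator {0..T} t *\<^sub>R (C * h t))" using hC by (simp add: set_integrable_def)
    show "norm (indicator {0..T} t *\<^sub>R (f t (x t) (u t) (p t) (\<nu> t) - f t (x t) (u t) (p' t) (\<nu>' t))) \<le> indicator {0..T} t *\<^sub>R (C * h t)" for t
      using le[of t] by (auto simp: indicator_def)
    show "0 \<le> indicator {0..T} t *\<^sub>R (C * h t)" for t
      using order_trans[OF abs_ge_zero le[of t]] by (auto simp: indicator_def)
  qed
  also have "\<dots> = C * (LINT t:{0..T}|lborel. h t)" by simp
  finally have 1: "\<bar>(LINT t:{0..T}|lborel. f t (x t) (u t) (p t) (\<nu> t)) - (LINT t:{0..T}|lborel. f t (x t) (u t) (p' t) (\<nu>' t))\<bar>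
      \<le> C * (LINT t:{0..T}|lborel. h t)" .
  have TT: "T \<in> {0..T}" using T_pos by simp
  obtain i where i: "x T = axis i 1" using paths_in_states[OF x TT] by (auto simp: states_def)
  have "\<bar>g (x T) (p T) - g (x T) (p' T)\<bar> \<le> C * norm (p T - p' T)" unfolding i by (rule g_lip[OF p[OF TT] p'[OF TT]])
  with 1 show ?thesis unfolding path_cost_def by linarith
qed

end

section \<open>Law of large numbers\<close>

text \<open>The variance of a sum of independent variables is additive: integrating out the new
  coordinate kills the mixed term.\<close>

lemma PiM_centered_sum_second_moment:
  fixes \<mu> :: "'a measure" and z :: "'a \<Rightarrow> real"
  assumes \<mu>: "prob_space \<mu>" and z: "z \<in> borel_measurable \<mu>" "\<And>x. x \<in> space \<mu> \<Longrightarrow> \<bar>z x\<bar> \<le> 1" "(\<integral>x. z x \<partial>\<mu>) = 0"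
    and J: "finite J"
  shows "(\<integral>w. (\<Sum>k\<in>J. z (w k))\<^sup>2 \<partial>Pi\<^sub>M J (\<lambda>_. \<mu>)) \<le> card J"
  using J
proof (induction J rule: finite_induct)
  case (insert n J)
  interpret \<mu>: prob_space \<mu> by fact
  interpret product_sigma_finite "\<lambda>_. \<mu>" ..
  interpret J: prob_space "Pi\<^sub>M J (\<lambda>_. \<mu>)" by (intro prob_space_PiM \<mu>)
  define S where "S w = (\<Sum>k\<in>J. z (w k))" for w
  have bound: "\<bar>\<Sum>k\<in>I. z (w k)\<bar> \<le> real (card I)" if "w \<in> space (Pi\<^sub>M I (\<lambda>_. \<mu>))" for w and I :: "'b set"
  proof -
    have "\<bar>\<Sum>k\<in>I. z (w k)\<bar> \<le> (\<Sum>k\<in>I. \<bar>z (w k)\<bar>)" by (rule sum_abs)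
    also have "\<dots> \<le> (\<Sum>k\<in>I. 1)" using that z(2) by (intro sum_mono) (auto simp: space_PiM PiE_iff)
    finally show ?thesis by simp
  qed
  have sq: "\<bar>(\<Sum>k\<in>I. z (w k))\<^sup>2\<bar> \<le> (real (card I))\<^sup>2" if "w \<in> space (Pi\<^sub>M I (\<lambda>_. \<mu>))" for w and I :: "'b set"
    using power_mono[OF bound[OF that] abs_ge_zero, of 2] by simp
  have m: "(\<lambda>w. \<Sum>k\<in>I. z (w k)) \<in> borel_measurable (Pi\<^sub>M I (\<lambda>_. \<mu>))" for I :: "'b set"
    using z(1) by measurable
  have int: "integrable (Pi\<^sub>M I (\<lambda>_. \<mu>)) (\<lambda>w. (\<Sum>k\<in>I. z (w k))\<^sup>2)" if "finite I" for I :: "'b set"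
  proof -
    interpret I: prob_space "Pi\<^sub>M I (\<lambda>_. \<mu>)" by (intro prob_space_PiM \<mu>)
    show ?thesis using sq m by (intro I.integrable_const_bound[where B="(real (card I))\<^sup>2"] AE_I2) auto
  qed
  have iz: "integrable \<mu> z" "integrable \<mu> (\<lambda>x. (z x)\<^sup>2)"
  proof -
    show "integrable \<mu> z" using z by (intro \<mu>.integrable_const_bound[where B=1] AE_I2) auto
    have "\<bar>(z x)\<^sup>2\<bar> \<le> 1" if "x \<in> space \<mu>" for x using z(2)[OF that] by (simp add: abs_square_le_1)
    then show "integrable \<mu> (\<lambda>x. (z x)\<^sup>2)" using z by (intro \<mu>.integrable_const_bound[where B=1] AE_I2) auto
  qed
  have z2: "(\<integral>x. (z x)\<^sup>2 \<partial>\<mu>) \<le> 1"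
  proof -
    have "(\<integral>x. (z x)\<^sup>2 \<partial>\<mu>) \<le> (\<integral>x. 1 \<partial>\<mu>)"
      using z(2) by (intro integral_mono iz) (auto simp: abs_square_le_1)
    then show ?thesis using \<mu>.prob_space by simp
  qed
  have "(\<integral>w. (\<Sum>k\<in>insert n J. z (w k))\<^sup>2 \<partial>Pi\<^sub>M (insert n J) (\<lambda>_. \<mu>))
      = (\<integral>w. (\<integral>x. (\<Sum>k\<in>insert n J. z ((w(n := x)) k))\<^sup>2 \<partial>\<mu>) \<partial>Pi\<^sub>M J (\<lambda>_. \<mu>))"
    using insert.hyps by (intro product_integral_insert int) auto
  also have "\<dots> = (\<integral>w. (\<integral>x. (z x)\<^sup>2 \<partial>\<mu>) + (S w)\<^sup>2 \<partial>Pi\<^sub>M J (\<lambda>_. \<mu>))"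
  proof (intro Bochner_Integration.integral_cong refl)
    fix w
    have "(\<Sum>k\<in>insert n J. z ((w(n := x)) k)) = z x + S w" for x
      using insert.hyps by (auto simp: S_def intro!: sum.cong)
    then have "(\<integral>x. (\<Sum>k\<in>insert n J. z ((w(n := x)) k))\<^sup>2 \<partial>\<mu>) = (\<integral>x. (z x)\<^sup>2 + (2 * S w * z x + (S w)\<^sup>2) \<partial>\<mu>)"
      by (intro Bochner_Integration.integral_cong refl) (simp add: power2_eq_square algebra_simps)
    also have "\<dots> = (\<integral>x. (z x)\<^sup>2 \<partial>\<mu>) + (\<integral>x. 2 * S w * z x + (S w)\<^sup>2 \<partial>\<mu>)"
      using iz by (intro Bochner_Integration.integral_add) auto
    also have "(\<integral>x. 2 * S w * z x + (S w)\<^sup>2 \<partial>\<mu>) = (\<integral>x. 2 * S w * z x \<partial>\<mu>) + (\<integral>x. (S w)\<^sup>2 \<partial>\<mu>)"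
      using iz by (intro Bochner_Integration.integral_add) auto
    finally show "(\<integral>x. (\<Sum>k\<in>insert n J. z ((w(n := x)) k))\<^sup>2 \<partial>\<mu>) = (\<integral>x. (z x)\<^sup>2 \<partial>\<mu>) + (S w)\<^sup>2"
      using z(3) by (simp add: \<mu>.prob_space)
  qed
  also have "\<dots> = (\<integral>x. (z x)\<^sup>2 \<partial>\<mu>) + (\<integral>w. (S w)\<^sup>2 \<partial>Pi\<^sub>M J (\<lambda>_. \<mu>))"
    using int[OF insert.hyps(1)] by (subst Bochner_Integration.integral_add) (auto simp: S_def J.prob_space)
  also have "\<dots> \<le> 1 + card J" using z2 insert.IH by (simp add: S_def)
  finally show ?case using insert.hyps by simp
qed simp

text \<open>By the nonnegativity of the variance of the absolute value.\<close>

lemma PiM_centered_sum_first_moment: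
  fixes \<mu> :: "'a measure" and z :: "'a \<Rightarrow> real"
  assumes \<mu>: "prob_space \<mu>" and z: "z \<in> borel_measurable \<mu>" "\<And>x. x \<in> space \<mu> \<Longrightarrow> \<bar>z x\<bar> \<le> 1" "(\<integral>x. z x \<partial>\<mu>) = 0"
    and J: "finite J"
  shows "integrable (Pi\<^sub>M J (\<lambda>_. \<mu>)) (\<lambda>w. \<bar>\<Sum>k\<in>J. z (w k)\<bar>)"
    "(\<integral>w. \<bar>\<Sum>k\<in>J. z (w k)\<bar> \<partial>Pi\<^sub>M J (\<lambda>_. \<mu>)) \<le> sqrt (card J)"
proof -
  interpret J: prob_space "Pi\<^sub>M J (\<lambda>_. \<mu>)" by (intro prob_space_PiM \<mu>)
  have m: "(\<lambda>w. \<Sum>k\<in>J. z (w k)) \<in> borel_measurable (Pi\<^sub>M J (\<lambda>_. \<mu>))" using z(1) by measurable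
  have bound: "\<bar>\<Sum>k\<in>J. z (w k)\<bar> \<le> real (card J)" if "w \<in> space (Pi\<^sub>M J (\<lambda>_. \<mu>))" for w
  proof -
    have "\<bar>\<Sum>k\<in>J. z (w k)\<bar> \<le> (\<Sum>k\<in>J. \<bar>z (w k)\<bar>)" by (rule sum_abs)
    also have "\<dots> \<le> (\<Sum>k\<in>J. 1)" using that z(2) by (intro sum_mono) (auto simp: space_PiM PiE_iff)
    finally show ?thesis by simp
  qed
  have sq: "(\<Sum>k\<in>J. z (w k))\<^sup>2 \<le> (real (card J))\<^sup>2" if "w \<in> space (Pi\<^sub>M J (\<lambda>_. \<mu>))" for w
    using power_mono[OF bound[OF that] abs_ge_zero, of 2] by simp
  show i: "integrable (Pi\<^sub>M J (\<lambda>_. \<mu>)) (\<lambda>w. \<bar>\<Sum>k\<in>J. z (w k)\<bar>)"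
    using m bound by (intro J.integrable_const_bound[where B="real (card J)"] AE_I2) auto
  have i2: "integrable (Pi\<^sub>M J (\<lambda>_. \<mu>)) (\<lambda>w. \<bar>\<Sum>k\<in>J. z (w k)\<bar>\<^sup>2)"
    using m sq by (intro J.integrable_const_bound[where B="(real (card J))\<^sup>2"] AE_I2) auto
  have "0 \<le> J.variance (\<lambda>w. \<bar>\<Sum>k\<in>J. z (w k)\<bar>)" by (rule J.variance_positive)
  then have "(\<integral>w. \<bar>\<Sum>k\<in>J. z (w k)\<bar> \<partial>Pi\<^sub>M J (\<lambda>_. \<mu>))\<^sup>2 \<le> (\<integral>w. \<bar>\<Sum>k\<in>J. z (w k)\<bar>\<^sup>2 \<partial>Pi\<^sub>M J (\<lambda>_. \<mu>))"
    by (subst (asm) J.variance_eq[OF i i2]) simp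
  also have "\<dots> \<le> card J" using PiM_centered_sum_second_moment[OF \<mu> z J] by simp
  finally show "(\<integral>w. \<bar>\<Sum>k\<in>J. z (w k)\<bar> \<partial>Pi\<^sub>M J (\<lambda>_. \<mu>)) \<le> sqrt (card J)" by (rule real_le_rsqrt)
qed

text \<open>Fubini's theorem on \<open>[0,T]\<close>.\<close>

lemma expectation_time_integral_le:
  fixes h :: "real \<times> 'w \<Rightarrow> real"
  assumes M: "prob_space M" and h: "h \<in> borel_measurable (restrict_space borel {0..T} \<Otimes>\<^sub>M M)"
    and b: "\<And>t w. t \<in> {0..T} \<Longrightarrow> w \<in> space M \<Longrightarrow> \<bar>h (t, w)\<bar> \<le> B"
    and c: "\<And>t. t \<in> {0..T} \<Longrightarrow> (\<integral>w. h (t, w) \<partial>M) \<le> c" and T: "0 < T"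
  shows "integrable M (\<lambda>w. LINT t:{0..T}|lborel. h (t, w))"
    "(\<integral>w. (LINT t:{0..T}|lborel. h (t, w)) \<partial>M) \<le> T * c"
proof -
  interpret M: prob_space M by fact
  let ?L = "restrict_space lborel {0..T} :: real measure"
  have sL: "space ?L = {0..T}" by (simp add: space_restrict_space)
  interpret L: finite_measure ?L
    by (rule finite_measureI) (use T in \<open>simp add: space_restrict_space emeasure_restrict_space\<close>)
  interpret pair_sigma_finite M ?L ..
  interpret p: finite_measure "M \<Otimes>\<^sub>M ?L" by (intro finite_measure_pair_measure L.finite_measure_axioms M.finite_measure_axioms)
  have "sets (?L \<Otimes>\<^sub>M M) = sets (restrict_space borel {0..T} \<Otimes>\<^sub>M M)"
    by (intro sets_pair_measure_cong refl) (simp add: sets_restrict_space)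
  then have hL: "h \<in> borel_measurable (?L \<Otimes>\<^sub>M M)" using h by (simp cong: measurable_cong_sets)
  have hm: "(\<lambda>z. h (snd z, fst z)) \<in> borel_measurable (M \<Otimes>\<^sub>M ?L)"
    by (rule measurable_compose[OF _ hL]) measurable
  have i: "integrable (M \<Otimes>\<^sub>M ?L) (\<lambda>(w, t). h (t, w))"
    using hm b by (intro p.integrable_const_bound[where B=B] AE_I2) (auto simp: space_pair_measure sL split_beta')
  have eq: "(LINT t:{0..T}|lborel. h (t, w)) = (\<integral>t. h (t, w) \<partial>?L)" for w
    by (subst integral_restrict_space) (auto simp: set_lebesgue_integral_def)
  show "integrable M (\<lambda>w. LINT t:{0..T}|lborel. h (t, w))"
    unfolding eq using integrable_fst'[OF i] by simp
  have "(\<integral>w. (LINT t:{0..T}|lborel. h (t, w)) \<partial>M) = (\<integral>t. (\<integral>w. h (t, w) \<partial>M) \<partial>?L)"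
    unfolding eq by (rule Fubini_integral[OF i, symmetric])
  also have "\<dots> \<le> (\<integral>t. c \<partial>?L)"
    using integrable_snd[OF i] c by (intro integral_mono) (auto simp: sL)
  also have "\<dots> = T * c" using T by (simp add: measure_def emeasure_restrict_space sL)
  finally show "(\<integral>w. (LINT t:{0..T}|lborel. h (t, w)) \<partial>M) \<le> T * c" .
qed

text \<open>The contribution of player \<open>n\<close> to an empirical frequency is at most \<open>1 /
  N\<close>; what remains involves the other players only.\<close>

lemma empirical_frequency_deviation:
  fixes y :: "'n \<Rightarrow> real"
  assumes I: "finite I" "card I = N" "n \<in> I" and y: "0 \<le> y n" "y n \<le> 1" and m: "0 \<le> m" "m \<le> 1"
  shows "\<bar>1 / real N * (\<Sum>k\<in>I. y k) - m\<bar> \<le> (1 + \<bar>\<Sum>k\<in>I - {n}. y k - m\<bar>) / real N"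
proof -
  have N: "0 < real N" using I by (auto simp: card_gt_0_iff)
  have "1 / real N * (\<Sum>k\<in>I. y k) - m = (\<Sum>k\<in>I. y k - m) / real N"
    using N I(2) by (simp add: sum_subtractf field_simps)
  also have "(\<Sum>k\<in>I. y k - m) = (y n - m) + (\<Sum>k\<in>I - {n}. y k - m)" using I by (simp add: sum.remove)
  also have "\<bar>((y n - m) + (\<Sum>k\<in>I - {n}. y k - m)) / real N\<bar> \<le> (1 + \<bar>\<Sum>k\<in>I - {n}. y k - m\<bar>) / real N"
  proof -
    have "\<bar>(y n - m) + (\<Sum>k\<in>I - {n}. y k - m)\<bar> \<le> 1 + \<bar>\<Sum>k\<in>I - {n}. y k - m\<bar>" using y m by linarith
    then show ?thesis using N by (simp add: abs_divide divide_right_mono)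
  qed
  finally show ?thesis .
qed

section \<open>The mean field equilibrium\<close>

context mean_field_setting
begin

lemma sets_P: "sets P = sets (canonical_filtration T T)"
  using chain by (simp add: is_chain_law_def)

lemma control_measurable:
  assumes "\<beta> \<in> mfg_controls T A"
  shows "(\<lambda>z. \<beta> (fst z) (snd z)) \<in> time_interval \<Otimes>\<^sub>M P \<rightarrow>\<^sub>M actions"
proof -
  have "sets (time_interval \<Otimes>\<^sub>M P) = sets (time_interval \<Otimes>\<^sub>M canonical_filtration T T)"
    by (intro sets_pair_measure_cong refl sets_P)
  then show ?thesis using mfg_control_jointly_measurable[OF assms T_pos] by (simp cong: measurable_cong_sets)
qed

lemma canonical_measurable: "(\<lambda>\<omega>. \<omega>) \<in> P \<rightarrow>\<^sub>M canonical_filtration T T"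
  by (rule chain_law_measurable_canonical[OF chain])

lemma control_lik_measurable:
  "\<beta> \<in> mfg_controls T A \<Longrightarrow> (\<lambda>\<omega>. lik (\<lambda>s. \<beta> s \<omega>) \<omega>) \<in> borel_measurable P"
  by (rule lik_measurable[OF canonical_measurable control_measurable])

lemma equilibrium_cost_measurable:
  assumes \<beta>: "\<beta> \<in> mfg_controls T A" and p: "p \<in> time_interval \<rightarrow>\<^sub>M restrict_space borel prob_simplex"
    and \<nu>: "\<nu> \<in> time_interval \<rightarrow>\<^sub>M prob_algebra actions"
  shows "(\<lambda>\<omega>. path_cost \<omega> (\<lambda>t. \<beta> t \<omega>) p \<nu>) \<in> borel_measurable P"
    and "(\<lambda>z. f (fst z) (snd z (fst z)) (\<beta> (fst z) (snd z)) (p (fst z)) (\<nu> (fst z))) \<in> borel_measurable (time_interval \<Otimes>\<^sub>M P)"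
proof -
  have \<nu>1: "\<nu> t \<in> prob_measures A" if "t \<in> {0..T}" for t
    using measurable_space[OF \<nu>, of t] that by (simp add: prob_measures_def)
  have \<nu>2: "(\<lambda>z. measure (\<nu> (fst z)) B) \<in> borel_measurable (time_interval \<Otimes>\<^sub>M P)" if "B \<in> sets actions" for B
    by (rule measurable_compose[OF measurable_fst measurable_compose[OF \<nu> measurable_measure_prob_algebra[OF that]]])
  have p1: "(\<lambda>z. p (fst z)) \<in> time_interval \<Otimes>\<^sub>M P \<rightarrow>\<^sub>M restrict_space borel prob_simplex"
    by (rule measurable_compose[OF measurable_fst p])
  show "(\<lambda>\<omega>. path_cost \<omega> (\<lambda>t. \<beta> t \<omega>) p \<nu>) \<in> borel_measurable P"
    by (rule path_cost_measurable[OF canonical_measurable control_measurable[OF \<beta>], of "\<lambda>t _. p t" "\<lambda>t _. \<nu> t", OF p1 \<nu>1 \<nu>2])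
  show "(\<lambda>z. f (fst z) (snd z (fst z)) (\<beta> (fst z) (snd z)) (p (fst z)) (\<nu> (fst z))) \<in> borel_measurable (time_interval \<Otimes>\<^sub>M P)"
    by (rule running_cost_measurable[OF canonical_measurable control_measurable[OF \<beta>], of "\<lambda>t _. p t" "\<lambda>t _. \<nu> t", OF p1 \<nu>1 \<nu>2])
qed

end

text \<open>A mean field equilibrium, with the law of the controlled path written as \<open>\<mu>\<close> and the costs written with explicit
  likelihoods.\<close>

locale mean_field_equilibrium = mean_field_setting T A p0 P r f g K C
  for T :: real and A :: "(real^'l) set" and p0 :: "real^'m" and P :: "(real \<Rightarrow> real^'m) measure"
    and r :: "('m, 'l) rates_reduced" and f :: "('m, 'l) running_cost" and g :: "'m terminal_cost"
    and K C :: real +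
  fixes \<alpha> :: "real \<Rightarrow> (real \<Rightarrow> real^'m) \<Rightarrow> real^'l" and p :: "real \<Rightarrow> real^'m" and \<nu> :: "real \<Rightarrow> (real^'l) measure"
    and \<mu> :: "(real \<Rightarrow> real^'m) measure"
  assumes \<alpha>: "\<alpha> \<in> mfg_controls T A"
    and \<mu>_def: "\<mu> = density P (\<lambda>\<omega>. ennreal (lik (\<lambda>s. \<alpha> s \<omega>) \<omega>))"
    and p_measurable: "p \<in> restrict_space borel {0..T} \<rightarrow>\<^sub>M restrict_space borel prob_simplex"
    and \<nu>_measurable: "\<nu> \<in> restrict_space borel {0..T} \<rightarrow>\<^sub>M prob_algebra (restrict_space borel A)"
    and p_consistent: "\<And>t i. t \<in> {0..T} \<Longrightarrow> p t $ i = measure \<mu> {\<omega> \<in> paths T. \<omega> t = axis i 1}"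
    and \<nu>_consistent: "\<And>t. t \<in> {0..T} \<Longrightarrow> \<nu> t = distr \<mu> (restrict_space borel A) (\<alpha> t)"
    and optimal: "\<And>\<beta>. \<beta> \<in> mfg_controls T A \<Longrightarrow>
      (\<integral>\<omega>. lik (\<lambda>s. \<alpha> s \<omega>) \<omega> * path_cost \<omega> (\<lambda>t. \<alpha> t \<omega>) p \<nu> \<partial>P)
        \<le> (\<integral>\<omega>. lik (\<lambda>s. \<beta> s \<omega>) \<omega> * path_cost \<omega> (\<lambda>t. \<beta> t \<omega>) p \<nu> \<partial>P)"
begin

lemma sets_\<mu> [simp, measurable_cong]: "sets \<mu> = sets P" and space_\<mu>: "space \<mu> = paths T"
  by (simp_all add: \<mu>_def space_P)

lemma p_simplex: "t \<in> {0..T} \<Longrightarrow> p t \<in> prob_simplex"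
  using measurable_space[OF p_measurable, of t] by (simp add: space_restrict_space)

lemma \<nu>_prob: "t \<in> {0..T} \<Longrightarrow> \<nu> t \<in> prob_measures A"
  using measurable_space[OF \<nu>_measurable, of t] by (simp add: prob_measures_def)

lemma \<alpha>_section: "t \<in> {0..T} \<Longrightarrow> \<alpha> t \<in> P \<rightarrow>\<^sub>M actions"
  by (rule jointly_measurable_time_section[OF control_measurable[OF \<alpha>]]) simp

text \<open>The consistency condition says that the image of \<open>\<mu>\<close> under the control at any time is the probability measure
  \<open>\<nu> t\<close>. So \<open>\<mu>\<close> has mass 1 itself.\<close>

sublocale \<mu>: prob_space \<mu>
proof -
  have 0: "0 \<in> {0..T}" using T_pos by simp
  have "prob_space (distr \<mu> actions (\<alpha> 0))"
    using \<nu>_prob[OF 0] \<nu>_consistent[OF 0] by (simp add: prob_measures_iff)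
  then show "prob_space \<mu>"
    using \<alpha>_section[OF 0] by (intro prob_space_distrD[of "\<alpha> 0"]) (simp_all cong: measurable_cong_sets)
qed

definition mfg_value :: real where
  "mfg_value = (\<integral>\<omega>. lik (\<lambda>s. \<alpha> s \<omega>) \<omega> * path_cost \<omega> (\<lambda>t. \<alpha> t \<omega>) p \<nu> \<partial>P)"

definition deviation :: "'n set \<Rightarrow> ((real \<Rightarrow> real^'m) \<Rightarrow> real) \<Rightarrow> ('n \<Rightarrow> real \<Rightarrow> real^'m) \<Rightarrow> real" where
  "deviation J h w = \<bar>\<Sum>k\<in>J. h (w k) - (\<integral>x. h x \<partial>\<mu>)\<bar>"

lemma deviation_expectation:
  assumes h: "h \<in> borel_measurable \<mu>" "\<And>x. x \<in> space \<mu> \<Longrightarrow> 0 \<le> h x \<and> h x \<le> 1" and J: "finite J"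
  shows "integrable (Pi\<^sub>M J (\<lambda>_. \<mu>)) (deviation J h)" "(\<integral>w. deviation J h w \<partial>Pi\<^sub>M J (\<lambda>_. \<mu>)) \<le> sqrt (card J)"
    "\<And>w. w \<in> space (Pi\<^sub>M J (\<lambda>_. \<mu>)) \<Longrightarrow> \<bar>deviation J h w\<bar> \<le> card J" "0 \<le> (\<integral>x. h x \<partial>\<mu>)" "(\<integral>x. h x \<partial>\<mu>) \<le> 1"
proof -
  have i: "integrable \<mu> h" using h by (intro \<mu>.integrable_const_bound[where B=1] AE_I2) auto
  show m0: "0 \<le> (\<integral>x. h x \<partial>\<mu>)" using h(2) by (intro Bochner_Integration.integral_nonneg) auto
  have "(\<integral>x. h x \<partial>\<mu>) \<le> (\<integral>x. 1 \<partial>\<mu>)" using h(2) by (intro integral_mono i) auto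
  then show m1: "(\<integral>x. h x \<partial>\<mu>) \<le> 1" using \<mu>.prob_space by simp
  define z where "z x = h x - (\<integral>x. h x \<partial>\<mu>)" for x
  have z: "z \<in> borel_measurable \<mu>" "\<And>x. x \<in> space \<mu> \<Longrightarrow> \<bar>z x\<bar> \<le> 1" "(\<integral>x. z x \<partial>\<mu>) = 0"
  proof -
    show "z \<in> borel_measurable \<mu>" unfolding z_def using h(1) by measurable
    show "\<bar>z x\<bar> \<le> 1" if "x \<in> space \<mu>" for x using h(2)[OF that] m0 m1 unfolding z_def by linarith
    show "(\<integral>x. z x \<partial>\<mu>) = 0" unfolding z_def using i by (simp add: \<mu>.prob_space)
  qed
  have d: "deviation J h = (\<lambda>w. \<bar>\<Sum>k\<in>J. z (w k)\<bar>)" by (simp add: deviation_def z_def fun_eq_iff)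
  show "integrable (Pi\<^sub>M J (\<lambda>_. \<mu>)) (deviation J h)" "(\<integral>w. deviation J h w \<partial>Pi\<^sub>M J (\<lambda>_. \<mu>)) \<le> sqrt (card J)"
    unfolding d using PiM_centered_sum_first_moment[OF \<mu>.prob_space_axioms z J] by simp_all
  show "\<bar>deviation J h w\<bar> \<le> card J" if "w \<in> space (Pi\<^sub>M J (\<lambda>_. \<mu>))" for w
  proof -
    have "\<bar>deviation J h w\<bar> \<le> (\<Sum>k\<in>J. \<bar>z (w k)\<bar>)" unfolding d abs_abs by (rule sum_abs)
    also have "\<dots> \<le> (\<Sum>k\<in>J. 1)" using that z(2) by (intro sum_mono) (auto simp: space_PiM PiE_iff)
    finally show ?thesis by simp
  qed
qed

end

section \<open>The game with finitely many players\<close>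

lemma empirical_states_simplex:
  fixes x :: "nat \<Rightarrow> real^'m"
  assumes "1 \<le> N" "\<And>k. k \<in> {1..N} \<Longrightarrow> x k \<in> states"
  shows "empirical_states N x \<in> prob_simplex"
proof -
  have "(\<Sum>i\<in>UNIV. \<Sum>k=1..N. of_bool (x k = axis i 1)) = (\<Sum>k=1..N. \<Sum>i\<in>UNIV. of_bool (x k = axis i 1) :: real)"
    by (rule sum.swap)
  also have "\<dots> = (\<Sum>k=1..N. 1)"
  proof (rule sum.cong[OF refl])
    fix k assume "k \<in> {1..N}"
    then obtain j where j: "x k = axis j 1" using assms(2) by (auto simp: states_def)
    show "(\<Sum>i\<in>UNIV. of_bool (x k = axis i 1) :: real) = 1" by (simp add: j axis_eq_axis of_bool_def)
  qed
  finally have "(\<Sum>i\<in>UNIV. \<Sum>k=1..N. of_bool (x k = axis i 1) :: real) = real N" by simp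
  then show ?thesis
    using assms(1) by (auto simp: prob_simplex_def empirical_states_def sum_divide_distrib[symmetric] intro!: divide_nonneg_nonneg sum_nonneg)
qed

lemma empirical_actions_measure:
  fixes a :: "nat \<Rightarrow> real^'l"
  assumes N: "1 \<le> N" and a: "\<And>k. k \<in> {1..N} \<Longrightarrow> a k \<in> A"
  shows "empirical_actions A N a \<in> prob_measures A"
    and "B \<in> sets (restrict_space borel A) \<Longrightarrow>
      measure (empirical_actions A N a) B = 1 / real N * (\<Sum>k=1..N. of_bool (a k \<in> B))"
proof -
  have am: "a \<in> uniform_count_measure {1..N} \<rightarrow>\<^sub>M restrict_space borel A"
    using a by (auto simp: measurable_def space_restrict_space space_uniform_count_measure sets_uniform_count_measure)
  have "prob_space (uniform_count_measure {1..N})" using N by (intro prob_space_uniform_count_measure) auto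
  then show "empirical_actions A N a \<in> prob_measures A"
    unfolding prob_measures_iff empirical_actions_def using am by (auto intro: prob_space.prob_space_distr)
  assume B: "B \<in> sets (restrict_space borel A)"
  have "measure (empirical_actions A N a) B = measure (uniform_count_measure {1..N}) (a -` B \<inter> {1..N})"
    unfolding empirical_actions_def using measure_distr[OF am B] by (simp add: space_uniform_count_measure)
  also have "\<dots> = real (card (a -` B \<inter> {1..N})) / real N"
    by (subst measure_uniform_count_measure) auto
  also have "card (a -` B \<inter> {1..N}) = card ({1..N} \<inter> {k. a k \<in> B})" by (rule arg_cong[where f=card]) auto
  finally show "measure (empirical_actions A N a) B = 1 / real N * (\<Sum>k=1..N. of_bool (a k \<in> B))"
    by simp
qed

context mean_field_equilibrium
begin

abbreviation "players N \<equiv> Pi\<^sub>M {1..N} (\<lambda>_. P)"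

definition profile :: "nat \<Rightarrow> (real \<Rightarrow> (nat \<Rightarrow> real \<Rightarrow> real^'m) \<Rightarrow> real^'l) \<Rightarrow> nat \<Rightarrow> real \<Rightarrow> (nat \<Rightarrow> real \<Rightarrow> real^'m) \<Rightarrow> real^'l" where
  "profile n \<beta> = (\<lambda>k t w. \<alpha> t (w k))(n := \<beta>)"

definition player_cost ::
    "nat \<Rightarrow> nat \<Rightarrow> (real \<Rightarrow> (nat \<Rightarrow> real \<Rightarrow> real^'m) \<Rightarrow> real^'l) \<Rightarrow> (nat \<Rightarrow> real \<Rightarrow> real^'m) \<Rightarrow> real" where
  "player_cost N n \<beta> w = path_cost (w n) (\<lambda>t. \<beta> t w) (\<lambda>t. empirical_states N (\<lambda>k. w k t))
     (\<lambda>t. empirical_actions A N (\<lambda>k. profile n \<beta> k t w))"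

lemma player_path_measurable:
  "k \<in> I \<Longrightarrow> (\<lambda>w. w k) \<in> Pi\<^sub>M I (\<lambda>_. P) \<rightarrow>\<^sub>M canonical_filtration T T"
  by (subst measurable_cong_sets[OF refl sets_P[symmetric]]) (rule measurable_component_singleton)

lemma player_paths: "w \<in> space (Pi\<^sub>M I (\<lambda>_. P)) \<Longrightarrow> k \<in> I \<Longrightarrow> w k \<in> paths T"
  by (auto simp: space_PiM PiE_iff space_P)

lemma equilibrium_control_player:
  assumes "k \<in> I"
  shows "(\<lambda>z. \<alpha> (fst z) ((snd z) k)) \<in> time_interval \<Otimes>\<^sub>M Pi\<^sub>M I (\<lambda>_. P) \<rightarrow>\<^sub>M actions"
proof -
  have "(\<lambda>z. (fst z, (snd z) k)) \<in> time_interval \<Otimes>\<^sub>M Pi\<^sub>M I (\<lambda>_. P) \<rightarrow>\<^sub>M time_interval \<Otimes>\<^sub>M P"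
    using assms by (intro measurable_Pair measurable_fst measurable_compose[OF measurable_snd measurable_component_singleton])
  from measurable_compose[OF this control_measurable[OF \<alpha>]] show ?thesis by simp
qed

lemma profile_measurable:
  assumes \<beta>: "(\<lambda>z. \<beta> (fst z) (snd z)) \<in> time_interval \<Otimes>\<^sub>M players N \<rightarrow>\<^sub>M actions" and k: "k \<in> {1..N}"
  shows "(\<lambda>z. profile n \<beta> k (fst z) (snd z)) \<in> time_interval \<Otimes>\<^sub>M players N \<rightarrow>\<^sub>M actions"
  using \<beta> equilibrium_control_player[OF k] by (auto simp: profile_def)

lemma profile_in_A:
  assumes \<beta>: "(\<lambda>z. \<beta> (fst z) (snd z)) \<in> time_interval \<Otimes>\<^sub>M players N \<rightarrow>\<^sub>M actions" and k: "k \<in> {1..N}"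
    and "t \<in> {0..T}" "w \<in> space (players N)"
  shows "profile n \<beta> k t w \<in> A"
  using measurable_space[OF profile_measurable[OF \<beta> k], of "(t, w)" n] assms(3,4) by (simp add: space_pair_measure)

lemma empirical_states_measurable:
  assumes N: "1 \<le> N"
  shows "(\<lambda>z. empirical_states N (\<lambda>k. (snd z) k (fst z))) \<in> time_interval \<Otimes>\<^sub>M players N \<rightarrow>\<^sub>M restrict_space borel prob_simplex"
proof (rule measurable_restrict_space2)
  let ?B = "time_interval \<Otimes>\<^sub>M players N"
  show "(\<lambda>z. empirical_states N (\<lambda>k. (snd z) k (fst z))) \<in> space ?B \<rightarrow> prob_simplex"
    by (auto simp: space_pair_measure intro!: empirical_states_simplex[OF N] paths_in_states player_paths)
  have pv: "(\<lambda>z. (snd z) k (fst z)) \<in> borel_measurable ?B" if "k \<in> {1..N}" for k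
    by (rule path_value_measurable[OF player_path_measurable[OF that] T_pos])
  have o: "(\<lambda>z. of_bool ((snd z) k (fst z) = axis i 1) :: real) \<in> borel_measurable ?B" if "k \<in> {1..N}" for k i
  proof -
    have "{z \<in> space ?B. (snd z) k (fst z) \<noteq> axis i 1} \<in> sets ?B"
      by (rule borel_measurable_eq_states[OF pv[OF that]]) simp
    then have "(\<lambda>z. 1 - indicator {z \<in> space ?B. (snd z) k (fst z) \<noteq> axis i 1} z :: real) \<in> borel_measurable ?B" by measurable
    then show ?thesis by (rule measurable_cong[THEN iffD1, rotated]) (auto simp: indicator_def)
  qed
  have "(\<lambda>z. \<Sum>i\<in>UNIV. (1 / real N * (\<Sum>k=1..N. of_bool ((snd z) k (fst z) = axis i 1))) *\<^sub>R axis i (1::real)) \<in> borel_measurable ?B"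
    by (intro borel_measurable_sum borel_measurable_scaleR borel_measurable_times borel_measurable_const o)
  moreover have "(\<Sum>i\<in>UNIV. (1 / real N * (\<Sum>k=1..N. of_bool ((snd z) k (fst z) = axis i 1))) *\<^sub>R axis i (1::real))
      = empirical_states N (\<lambda>k. (snd z) k (fst z))" for z :: "real \<times> (nat \<Rightarrow> real \<Rightarrow> real^'m)"
    by (simp add: vec_eq_iff empirical_states_def axis_def if_distrib cong: if_cong)
  ultimately show "(\<lambda>z. empirical_states N (\<lambda>k. (snd z) k (fst z))) \<in> borel_measurable ?B" by simp
qed

lemma empirical_actions_measurable:
  assumes N: "1 \<le> N" and \<beta>: "(\<lambda>z. \<beta> (fst z) (snd z)) \<in> time_interval \<Otimes>\<^sub>M players N \<rightarrow>\<^sub>M actions" and B: "B \<in> sets actions"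
  shows "(\<lambda>z. measure (empirical_actions A N (\<lambda>k. profile n \<beta> k (fst z) (snd z))) B) \<in> borel_measurable (time_interval \<Otimes>\<^sub>M players N)"
proof -
  let ?B = "time_interval \<Otimes>\<^sub>M players N"
  have "(\<lambda>z. of_bool (profile n \<beta> k (fst z) (snd z) \<in> B) :: real) \<in> borel_measurable ?B" if "k \<in> {1..N}" for k
    using measurable_compose[OF profile_measurable[OF \<beta> that] borel_measurable_indicator[OF B], of n]
    by (simp add: indicator_def of_bool_def)
  then have "(\<lambda>z. 1 / real N * (\<Sum>k=1..N. of_bool (profile n \<beta> k (fst z) (snd z) \<in> B))) \<in> borel_measurable ?B"
    by (intro borel_measurable_times borel_measurable_const borel_measurable_sum)
  then show ?thesis
  proof (rule measurable_cong[THEN iffD1, rotated])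
    fix z assume "z \<in> space ?B"
    then have z: "fst z \<in> {0..T}" "snd z \<in> space (players N)" by (auto simp: space_pair_measure)
    show "1 / real N * (\<Sum>k=1..N. of_bool (profile n \<beta> k (fst z) (snd z) \<in> B))
        = measure (empirical_actions A N (\<lambda>k. profile n \<beta> k (fst z) (snd z))) B"
      by (rule empirical_actions_measure(2)[OF N profile_in_A[OF \<beta> _ z] B, symmetric])
  qed
qed

lemma player_cost_measurable:
  assumes N: "1 \<le> N" and n: "n \<in> {1..N}" and \<beta>: "(\<lambda>z. \<beta> (fst z) (snd z)) \<in> time_interval \<Otimes>\<^sub>M players N \<rightarrow>\<^sub>M actions"
  shows "player_cost N n \<beta> \<in> borel_measurable (players N)"
    and "(\<lambda>z. f (fst z) (snd z n (fst z)) (\<beta> (fst z) (snd z)) (empirical_states N (\<lambda>k. (snd z) k (fst z)))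
        (empirical_actions A N (\<lambda>k. profile n \<beta> k (fst z) (snd z)))) \<in> borel_measurable (time_interval \<Otimes>\<^sub>M players N)"
proof -
  have \<nu>: "empirical_actions A N (\<lambda>k. profile n \<beta> k t w) \<in> prob_measures A" if "t \<in> {0..T}" "w \<in> space (players N)" for t w
    by (intro empirical_actions_measure(1)[OF N] profile_in_A[OF \<beta>] that)
  show "player_cost N n \<beta> \<in> borel_measurable (players N)"
    unfolding player_cost_def[abs_def]
    by (rule path_cost_measurable[OF player_path_measurable[OF n] \<beta> empirical_states_measurable[OF N] \<nu> empirical_actions_measurable[OF N \<beta>]])
  show "(\<lambda>z. f (fst z) (snd z n (fst z)) (\<beta> (fst z) (snd z)) (empirical_states N (\<lambda>k. (snd z) k (fst z)))
        (empirical_actions A N (\<lambda>k. profile n \<beta> k (fst z) (snd z)))) \<in> borel_measurable (time_interval \<Otimes>\<^sub>M players N)"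
    by (rule running_cost_measurable[OF player_path_measurable[OF n] \<beta> empirical_states_measurable[OF N] \<nu> empirical_actions_measurable[OF N \<beta>]])
qed

definition player_lik :: "nat \<Rightarrow> (real \<Rightarrow> (nat \<Rightarrow> real \<Rightarrow> real^'m) \<Rightarrow> real^'l) \<Rightarrow> nat \<Rightarrow> (nat \<Rightarrow> real \<Rightarrow> real^'m) \<Rightarrow> real" where
  "player_lik n \<beta> k w = lik (\<lambda>s. profile n \<beta> k s w) (w k)"

lemma player_lik_measurable:
  assumes \<beta>: "(\<lambda>z. \<beta> (fst z) (snd z)) \<in> time_interval \<Otimes>\<^sub>M players N \<rightarrow>\<^sub>M actions" and k: "k \<in> {1..N}"
  shows "player_lik n \<beta> k \<in> borel_measurable (players N)"
  unfolding player_lik_def[abs_def]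
  by (rule lik_measurable[OF player_path_measurable[OF k] profile_measurable[OF \<beta> k]])

lemma player_lik_bounds:
  assumes \<beta>: "(\<lambda>z. \<beta> (fst z) (snd z)) \<in> time_interval \<Otimes>\<^sub>M players N \<rightarrow>\<^sub>M actions" and k: "k \<in> {1..N}"
    and w: "w \<in> space (players N)"
  shows "0 < player_lik n \<beta> k w" "player_lik n \<beta> k w \<le> lik_bound (w k)"
  unfolding player_lik_def
  by (rule lik_bounds[OF jointly_measurable_section[OF profile_measurable[OF \<beta> k] w] player_paths[OF w k]])+

text \<open>Almost surely no two players jump together, so the density is the product of the likelihoods
  of the players.\<close>

lemma nplayer_measure_eq:
  assumes \<beta>: "(\<lambda>z. \<beta> (fst z) (snd z)) \<in> time_interval \<Otimes>\<^sub>M players N \<rightarrow>\<^sub>M actions"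
  shows "nplayer_measure T r P N (profile n \<beta>) = density (players N) (\<lambda>w. ennreal (\<Prod>k=1..N. player_lik n \<beta> k w))"
  unfolding nplayer_measure_def nplayer_reference_def
proof (rule density_cong_AE)
  have "AE w in players N. \<forall>k\<in>{1..N}. \<forall>l\<in>{1..N}. k \<noteq> l \<longrightarrow> jumps T (w k) \<inter> jumps T (w l) = {}"
  proof (intro AE_finite_allI finite_atLeastAtMost)
    fix k l assume kl: "k \<in> {1..N}" "l \<in> {1..N}"
    show "AE w in players N. k \<noteq> l \<longrightarrow> jumps T (w k) \<inter> jumps T (w l) = {}"
      using AE_PiM_no_common_jumps[OF chain T_pos finite_atLeastAtMost kl] by (cases "k = l") auto
  qed
  then show "AE w in players N. ennreal (doleans_exp (\<lambda>t. \<Sum>k=1..N. girsanov_integral (\<lambda>s. \<chi> i j. r s i j (profile n \<beta> k s w)) (w k) t) T)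
      = ennreal (\<Prod>k=1..N. player_lik n \<beta> k w)"
    using AE_space
  proof eventually_elim
    case (elim w)
    have "doleans_exp (\<lambda>t. \<Sum>k\<in>{1..N}. girsanov_integral (rate_matrix (\<lambda>s. profile n \<beta> k s w)) (w k) t) T
        = (\<Prod>k\<in>{1..N}. likelihood T (rate_matrix (\<lambda>s. profile n \<beta> k s w)) (w k))"
    proof (rule doleans_exp_girsanov_sum[OF T_pos finite_atLeastAtMost])
      fix k assume k: "k \<in> {1..N}"
      show "admissible_rates T K (rate_matrix (\<lambda>s. profile n \<beta> k s w))"
        by (rule admissible_rate_matrix[OF jointly_measurable_section[OF profile_measurable[OF \<beta> k] elim(2)]])
      show "w k \<in> paths T" by (rule player_paths[OF elim(2) k])
    qed (use elim in auto)
    then show ?case by (simp add: player_lik_def lik_def rate_matrix_def[abs_def])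
  qed
qed

lemma nplayer_cost_eq:
  assumes N: "1 \<le> N" and n: "n \<in> {1..N}" and \<beta>: "(\<lambda>z. \<beta> (fst z) (snd z)) \<in> time_interval \<Otimes>\<^sub>M players N \<rightarrow>\<^sub>M actions"
  shows "nplayer_cost T A r f g P N n (profile n \<beta>) = (\<integral>w. (\<Prod>k=1..N. player_lik n \<beta> k w) * player_cost N n \<beta> w \<partial>players N)"
proof -
  have c: "(LINT t:{0..T}|lborel. f t (w n t) (profile n \<beta> n t w)
               (empirical_states N (\<lambda>k. w k t)) (empirical_actions A N (\<lambda>k. profile n \<beta> k t w)))
           + g (w n T) (empirical_states N (\<lambda>k. w k T)) = player_cost N n \<beta> w" for w
    by (simp add: player_cost_def path_cost_def profile_def)
  have m: "(\<lambda>w. \<Prod>k=1..N. player_lik n \<beta> k w) \<in> borel_measurable (players N)"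
    by (intro borel_measurable_prod player_lik_measurable[OF \<beta>])
  have p: "AE w in players N. 0 \<le> (\<Prod>k=1..N. player_lik n \<beta> k w)"
    by (intro AE_I2 prod_nonneg ballI less_imp_le player_lik_bounds(1)[OF \<beta>])
  show ?thesis unfolding nplayer_cost_def c nplayer_measure_eq[OF \<beta>]
    by (subst integral_density[OF player_cost_measurable(1)[OF N n \<beta>] m p]) simp
qed

text \<open>The cost of player \<open>n\<close> given the paths \<open>w\<close> of the others. The own
  path is integrated against the reference measure with the own likelihood as weight.\<close>

definition conditional_cost ::
    "nat \<Rightarrow> nat \<Rightarrow> (real \<Rightarrow> (nat \<Rightarrow> real \<Rightarrow> real^'m) \<Rightarrow> real^'l) \<Rightarrow> (nat \<Rightarrow> real \<Rightarrow> real^'m) \<Rightarrow> real" where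
  "conditional_cost N n \<beta> w = (\<integral>x. lik (\<lambda>s. \<beta> s (w(n := x))) x * player_cost N n \<beta> (w(n := x)) \<partial>P)"

lemma \<mu>_product:
  "finite J \<Longrightarrow> Pi\<^sub>M J (\<lambda>_. \<mu>) = density (Pi\<^sub>M J (\<lambda>_. P)) (\<lambda>w. \<Prod>k\<in>J. ennreal (lik (\<lambda>s. \<alpha> s (w k)) (w k)))"
  unfolding \<mu>_def
  by (rule PiM_density) (use P.prob_space_axioms \<mu>.prob_space_axioms control_lik_measurable[OF \<alpha>] in \<open>simp_all add: \<mu>_def\<close>)

lemma insert_player: "n \<in> {1..N} \<Longrightarrow> insert n ({1..N} - {n}) = {1..N::nat}" by auto

lemma update_player:
  assumes "n \<in> {1..N}" "w \<in> space (Pi\<^sub>M ({1..N} - {n}) (\<lambda>_. P))" "x \<in> paths T"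
  shows "w(n := x) \<in> space (players N)"
  using assms by (auto simp: space_PiM PiE_iff extensional_def space_P)

lemma conditional_cost_integrand_measurable:
  assumes N: "1 \<le> N" and n: "n \<in> {1..N}" and \<beta>: "(\<lambda>z. \<beta> (fst z) (snd z)) \<in> time_interval \<Otimes>\<^sub>M players N \<rightarrow>\<^sub>M actions"
  shows "(\<lambda>z. lik (\<lambda>s. \<beta> s ((fst z)(n := snd z))) (snd z) * player_cost N n \<beta> ((fst z)(n := snd z)))
    \<in> borel_measurable (Pi\<^sub>M ({1..N} - {n}) (\<lambda>_. P) \<Otimes>\<^sub>M P)"
proof -
  have "(\<lambda>w. player_lik n \<beta> n w * player_cost N n \<beta> w) \<in> borel_measurable (players N)"
    by (intro borel_measurable_times player_lik_measurable[OF \<beta> n] player_cost_measurable(1)[OF N n \<beta>])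
  moreover have "(\<lambda>z. (fst z)(n := snd z)) \<in> Pi\<^sub>M ({1..N} - {n}) (\<lambda>_. P) \<Otimes>\<^sub>M P \<rightarrow>\<^sub>M players N"
    using measurable_add_dim[of n "{1..N} - {n}" "\<lambda>_. P"] insert_player[OF n] by (simp add: split_beta')
  ultimately have "(\<lambda>z. player_lik n \<beta> n ((fst z)(n := snd z)) * player_cost N n \<beta> ((fst z)(n := snd z)))
      \<in> borel_measurable (Pi\<^sub>M ({1..N} - {n}) (\<lambda>_. P) \<Otimes>\<^sub>M P)"
    by (rule measurable_compose[rotated])
  then show ?thesis by (simp add: player_lik_def profile_def)
qed

text \<open>The opponents are independent with law \<open>\<mu>\<close>, whatever player
  \<open>n\<close> does: their likelihoods depend on their own paths only, because neither the rates nor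
  the equilibrium control see the other players. So the cost is a mean of conditional costs over a
  measure that does not change with \<open>\<beta>\<close>.\<close>

lemma nplayer_cost_conditional:
  assumes N: "1 \<le> N" and n: "n \<in> {1..N}" and \<beta>: "(\<lambda>z. \<beta> (fst z) (snd z)) \<in> time_interval \<Otimes>\<^sub>M players N \<rightarrow>\<^sub>M actions"
  shows "integrable (Pi\<^sub>M ({1..N} - {n}) (\<lambda>_. \<mu>)) (conditional_cost N n \<beta>)"
    and "nplayer_cost T A r f g P N n (profile n \<beta>) = (\<integral>w. conditional_cost N n \<beta> w \<partial>Pi\<^sub>M ({1..N} - {n}) (\<lambda>_. \<mu>))"
proof -
  let ?J = "{1..N} - {n}"
  interpret product_sigma_finite "\<lambda>_. P" ..
  interpret J: prob_space "Pi\<^sub>M ?J (\<lambda>_. \<mu>)" by (intro prob_space_PiM \<mu>.prob_space_axioms)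
  \<comment> \<open>Costs are bounded, so all integrands are dominated by a multiple of a product of
    likelihood bounds.\<close>
  obtain B where B: "0 \<le> B"
    "\<And>x u p \<nu>. x \<in> paths T \<Longrightarrow> (\<And>t. t \<in> {0..T} \<Longrightarrow> u t \<in> A) \<Longrightarrow> (\<And>t. t \<in> {0..T} \<Longrightarrow> p t \<in> prob_simplex) \<Longrightarrow>
      (\<And>t. t \<in> {0..T} \<Longrightarrow> \<nu> t \<in> prob_measures A) \<Longrightarrow> \<bar>path_cost x u p \<nu>\<bar> \<le> B"
    using path_cost_bounded by blast
  have cost: "\<bar>player_cost N n \<beta> w\<bar> \<le> B" if w: "w \<in> space (players N)" for w
    unfolding player_cost_def
    by (intro B(2) player_paths[OF w n] empirical_states_simplex[OF N] empirical_actions_measure(1)[OF N]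
        paths_in_states[OF player_paths[OF w]] profile_in_A[OF \<beta> _ _ w])
       (use profile_in_A[OF \<beta> n _ w, of _ n] in \<open>auto simp: profile_def\<close>)
  have likm: "(\<lambda>w. \<Prod>k\<in>I. lik (\<lambda>s. \<alpha> s (w k)) (w k)) \<in> borel_measurable (Pi\<^sub>M I (\<lambda>_. P))" for I :: "nat set"
    by (intro borel_measurable_prod lik_measurable player_path_measurable equilibrium_control_player)
  have lik0: "0 < lik (\<lambda>s. \<alpha> s (w k)) (w k)" if "w \<in> space (Pi\<^sub>M I (\<lambda>_. P))" "k \<in> I" for w k and I :: "nat set"
    using lik_bounds(1)[OF jointly_measurable_section[OF control_measurable[OF \<alpha>]], of "w k"] player_paths[OF that] by (simp add: space_P)
  have V: "conditional_cost N n \<beta> \<in> borel_measurable (Pi\<^sub>M ?J (\<lambda>_. P))"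
    unfolding conditional_cost_def[abs_def]
    by (rule P.borel_measurable_lebesgue_integral)
       (use conditional_cost_integrand_measurable[OF N n \<beta>] in \<open>simp only: split_beta'\<close>)
  have likle: "\<bar>lik (\<lambda>s. \<beta> s (w(n := x))) x * player_cost N n \<beta> (w(n := x))\<bar> \<le> lik_bound x * B"
    if w: "w \<in> space (Pi\<^sub>M ?J (\<lambda>_. P))" and x: "x \<in> space P" for w x
  proof -
    have wx: "w(n := x) \<in> space (players N)" using x by (intro update_player[OF n w]) (simp add: space_P)
    have "0 < lik (\<lambda>s. \<beta> s (w(n := x))) x" "lik (\<lambda>s. \<beta> s (w(n := x))) x \<le> lik_bound x"
      using player_lik_bounds[OF \<beta> n wx, of n] by (simp_all add: player_lik_def profile_def)
    then show ?thesis unfolding abs_mult using cost[OF wx] B(1) by (intro mult_mono) auto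
  qed
  have Vle: "\<bar>conditional_cost N n \<beta> w\<bar> \<le> lik_mass * B" if w: "w \<in> space (Pi\<^sub>M ?J (\<lambda>_. P))" for w
  proof -
    have "\<bar>conditional_cost N n \<beta> w\<bar> \<le> (\<integral>x. lik_bound x * B \<partial>P)"
      unfolding conditional_cost_def real_norm_def[symmetric]
    proof (rule order_trans[OF integral_norm_bound integral_mono'])
      show "integrable P (\<lambda>x. lik_bound x * B)" using lik_bound_integrable(1) by simp
      show "norm (lik (\<lambda>s. \<beta> s (w(n := x))) x * player_cost N n \<beta> (w(n := x))) \<le> lik_bound x * B" if "x \<in> space P" for x
        using likle[OF w that] by simp
      show "0 \<le> lik_bound x * B" for x using B(1) K_ge by (simp add: lik_bound_def)
    qed
    also have "\<dots> \<le> lik_mass * B" using lik_bound_integrable(2) B(1) by (simp add: mult_right_mono)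
    finally show ?thesis .
  qed
  have sets_J: "sets (Pi\<^sub>M ?J (\<lambda>_. \<mu>)) = sets (Pi\<^sub>M ?J (\<lambda>_. P))" by (intro sets_PiM_cong) auto
  have space_J: "space (Pi\<^sub>M ?J (\<lambda>_. \<mu>)) = space (Pi\<^sub>M ?J (\<lambda>_. P))" by (rule sets_eq_imp_space_eq[OF sets_J])
  show "integrable (Pi\<^sub>M ?J (\<lambda>_. \<mu>)) (conditional_cost N n \<beta>)"
    using V Vle space_J sets_J
    by (intro J.integrable_const_bound[where B="lik_mass * B"] AE_I2) (auto cong: measurable_cong_sets)
  have dens: "(\<Prod>k\<in>?J. ennreal (lik (\<lambda>s. \<alpha> s (w k)) (w k))) = ennreal (\<Prod>k\<in>?J. lik (\<lambda>s. \<alpha> s (w k)) (w k))"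
    if "w \<in> space (Pi\<^sub>M ?J (\<lambda>_. P))" for w
    using lik0[OF that] by (intro prod_ennreal) (auto intro: less_imp_le)
  have "Pi\<^sub>M ?J (\<lambda>_. \<mu>) = density (Pi\<^sub>M ?J (\<lambda>_. P)) (\<lambda>w. ennreal (\<Prod>k\<in>?J. lik (\<lambda>s. \<alpha> s (w k)) (w k)))"
    unfolding \<mu>_product[OF finite_Diff[OF finite_atLeastAtMost]]
    by (rule density_cong_AE) (use dens in auto)
  then have \<mu>J: "Pi\<^sub>M ?J (\<lambda>_. \<mu>) = density (Pi\<^sub>M ?J (\<lambda>_. P)) (\<lambda>w. ennreal (\<Prod>k\<in>?J. lik (\<lambda>s. \<alpha> s (w k)) (w k)))" .
  have pos: "AE w in Pi\<^sub>M ?J (\<lambda>_. P). 0 \<le> (\<Prod>k\<in>?J. lik (\<lambda>s. \<alpha> s (w k)) (w k))"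
    by (intro AE_I2 prod_nonneg ballI less_imp_le lik0)
  have E: "(\<integral>w. conditional_cost N n \<beta> w \<partial>Pi\<^sub>M ?J (\<lambda>_. \<mu>))
      = (\<integral>w. (\<Prod>k\<in>?J. lik (\<lambda>s. \<alpha> s (w k)) (w k)) * conditional_cost N n \<beta> w \<partial>Pi\<^sub>M ?J (\<lambda>_. P))"
    unfolding \<mu>J by (subst integral_density[OF V likm pos]) simp
  have prodm: "(\<lambda>w. (\<Prod>k=1..N. player_lik n \<beta> k w) * player_cost N n \<beta> w) \<in> borel_measurable (players N)"
    by (intro borel_measurable_times borel_measurable_prod player_lik_measurable[OF \<beta>] player_cost_measurable(1)[OF N n \<beta>])
  have int: "integrable (players N) (\<lambda>w. (\<Prod>k=1..N. player_lik n \<beta> k w) * player_cost N n \<beta> w)"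
  proof (rule Bochner_Integration.integrable_bound[OF _ prodm])
    show "integrable (players N) (\<lambda>w. (\<Prod>k=1..N. lik_bound (w k)) * B)"
      by (intro integrable_mult_left product_integrable_prod lik_bound_integrable(1)) simp
    show "AE w in players N. norm ((\<Prod>k=1..N. player_lik n \<beta> k w) * player_cost N n \<beta> w) \<le> norm ((\<Prod>k=1..N. lik_bound (w k)) * B)"
    proof (rule AE_I2)
      fix w assume w: "w \<in> space (players N)"
      have "(\<Prod>k=1..N. player_lik n \<beta> k w) \<le> (\<Prod>k=1..N. lik_bound (w k))"
        using player_lik_bounds[OF \<beta> _ w] by (intro prod_mono) (auto intro: less_imp_le)
      moreover have "0 \<le> (\<Prod>k=1..N. player_lik n \<beta> k w)"
        using player_lik_bounds(1)[OF \<beta> _ w] by (intro prod_nonneg) (auto intro: less_imp_le)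
      ultimately show "norm ((\<Prod>k=1..N. player_lik n \<beta> k w) * player_cost N n \<beta> w) \<le> norm ((\<Prod>k=1..N. lik_bound (w k)) * B)"
        unfolding real_norm_def abs_mult using cost[OF w] B(1) by (intro mult_mono) auto
    qed
  qed
  have "nplayer_cost T A r f g P N n (profile n \<beta>) = (\<integral>w. (\<Prod>k=1..N. player_lik n \<beta> k w) * player_cost N n \<beta> w \<partial>players N)"
    by (rule nplayer_cost_eq[OF N n \<beta>])
  also have "\<dots> = (\<integral>w. (\<Prod>k\<in>insert n ?J. player_lik n \<beta> k w) * player_cost N n \<beta> w \<partial>Pi\<^sub>M (insert n ?J) (\<lambda>_. P))"
    unfolding insert_player[OF n] ..
  also have "\<dots> = (\<integral>w. (\<integral>x. (\<Prod>k\<in>insert n ?J. player_lik n \<beta> k (w(n := x))) * player_cost N n \<beta> (w(n := x)) \<partial>P) \<partial>Pi\<^sub>M ?J (\<lambda>_. P))"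
    by (rule product_integral_insert) (use int insert_player[OF n] in auto)
  also have "\<dots> = (\<integral>w. (\<Prod>k\<in>?J. lik (\<lambda>s. \<alpha> s (w k)) (w k)) * conditional_cost N n \<beta> w \<partial>Pi\<^sub>M ?J (\<lambda>_. P))"
  proof (intro Bochner_Integration.integral_cong refl)
    fix w
    have "(\<Prod>k\<in>insert n ?J. player_lik n \<beta> k (w(n := x))) = lik (\<lambda>s. \<beta> s (w(n := x))) x * (\<Prod>k\<in>?J. lik (\<lambda>s. \<alpha> s (w k)) (w k))" for x
      by (subst prod.insert) (auto simp: player_lik_def profile_def intro!: prod.cong)
    then have "(\<integral>x. (\<Prod>k\<in>insert n ?J. player_lik n \<beta> k (w(n := x))) * player_cost N n \<beta> (w(n := x)) \<partial>P)
        = (\<integral>x. (\<Prod>k\<in>?J. lik (\<lambda>s. \<alpha> s (w k)) (w k)) * (lik (\<lambda>s. \<beta> s (w(n := x))) x * player_cost N n \<beta> (w(n := x))) \<partial>P)"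
      by (simp add: mult_ac)
    then show "(\<integral>x. (\<Prod>k\<in>insert n ?J. player_lik n \<beta> k (w(n := x))) * player_cost N n \<beta> (w(n := x)) \<partial>P)
        = (\<Prod>k\<in>?J. lik (\<lambda>s. \<alpha> s (w k)) (w k)) * conditional_cost N n \<beta> w"
      by (simp add: conditional_cost_def)
  qed
  finally show "nplayer_cost T A r f g P N n (profile n \<beta>) = (\<integral>w. conditional_cost N n \<beta> w \<partial>Pi\<^sub>M ?J (\<lambda>_. \<mu>))"
    by (simp only: E)
qed

section \<open>Empirical laws of the opponents\<close>

definition in_state :: "real \<Rightarrow> 'm \<Rightarrow> (real \<Rightarrow> real^'m) \<Rightarrow> real" where
  "in_state t i x = of_bool (x t = axis i 1)"

definition in_cell :: "(real^'l \<Rightarrow> nat) \<Rightarrow> real \<Rightarrow> nat \<Rightarrow> (real \<Rightarrow> real^'m) \<Rightarrow> real" where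
  "in_cell \<kappa> t c x = of_bool (\<kappa> (\<alpha> t x) = c)"

lemma of_bool_measurable:
  assumes "{x \<in> space M. Q x} \<in> sets M"
  shows "(\<lambda>x. of_bool (Q x) :: real) \<in> borel_measurable M"
proof -
  have "(\<lambda>x. indicator {x \<in> space M. Q x} x :: real) \<in> borel_measurable M" using assms by measurable
  then show ?thesis by (rule measurable_cong[THEN iffD1, rotated]) (auto simp: indicator_def)
qed

lemma state_set_measurable:
  assumes X: "X \<in> M \<rightarrow>\<^sub>M canonical_filtration T T"
  shows "{z \<in> space (time_interval \<Otimes>\<^sub>M M). X (snd z) (fst z) = axis i 1} \<in> sets (time_interval \<Otimes>\<^sub>M M)"
proof -
  have "{z \<in> space (time_interval \<Otimes>\<^sub>M M). X (snd z) (fst z) \<noteq> axis i 1} \<in> sets (time_interval \<Otimes>\<^sub>M M)"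
    by (intro borel_measurable_eq_states path_value_measurable[OF X T_pos]) simp
  then have "space (time_interval \<Otimes>\<^sub>M M) - {z \<in> space (time_interval \<Otimes>\<^sub>M M). X (snd z) (fst z) \<noteq> axis i 1} \<in> sets (time_interval \<Otimes>\<^sub>M M)"
    by (rule sets.compl_sets)
  moreover have "space (time_interval \<Otimes>\<^sub>M M) - {z \<in> space (time_interval \<Otimes>\<^sub>M M). X (snd z) (fst z) \<noteq> axis i 1}
      = {z \<in> space (time_interval \<Otimes>\<^sub>M M). X (snd z) (fst z) = axis i 1}" by auto
  ultimately show ?thesis by simp
qed

lemma in_state_player_measurable:
  assumes "k \<in> I"
  shows "(\<lambda>z. in_state (fst z) i (snd z k)) \<in> borel_measurable (time_interval \<Otimes>\<^sub>M Pi\<^sub>M I (\<lambda>_. P))"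
  unfolding in_state_def by (rule of_bool_measurable[OF state_set_measurable[OF player_path_measurable[OF assms]]])

lemma cell_set:
  assumes \<kappa>: "\<kappa> \<in> actions \<rightarrow>\<^sub>M count_space {..<nn}" and c: "c < nn"
  shows "\<kappa> -` {c} \<inter> A \<in> sets actions"
  using measurable_sets[OF \<kappa>, of "{c}"] c by simp

lemma in_cell_player_measurable:
  assumes \<kappa>: "\<kappa> \<in> actions \<rightarrow>\<^sub>M count_space {..<nn}" and c: "c < nn" and k: "k \<in> I"
  shows "(\<lambda>z. in_cell \<kappa> (fst z) c (snd z k)) \<in> borel_measurable (time_interval \<Otimes>\<^sub>M Pi\<^sub>M I (\<lambda>_. P))"
proof -
  let ?B = "time_interval \<Otimes>\<^sub>M Pi\<^sub>M I (\<lambda>_. P)"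
  have "(\<lambda>z. \<alpha> (fst z) (snd z k)) -` (\<kappa> -` {c} \<inter> A) \<inter> space ?B \<in> sets ?B"
    by (rule measurable_sets[OF equilibrium_control_player[OF k] cell_set[OF \<kappa> c]])
  moreover have "(\<lambda>z. \<alpha> (fst z) (snd z k)) -` (\<kappa> -` {c} \<inter> A) \<inter> space ?B = {z \<in> space ?B. \<kappa> (\<alpha> (fst z) (snd z k)) = c}"
    using measurable_space[OF equilibrium_control_player[OF k]] by auto
  ultimately show ?thesis unfolding in_cell_def by (intro of_bool_measurable) simp
qed

lemma in_state_measurable: "t \<in> {0..T} \<Longrightarrow> in_state t i \<in> borel_measurable \<mu>"
proof -
  assume t: "t \<in> {0..T}"
  have "{\<omega> \<in> space P. \<omega> t \<noteq> axis i 1} \<in> sets P"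
    by (intro borel_measurable_eq_states chain_law_coordinate[OF chain t]) simp
  then have "space P - {\<omega> \<in> space P. \<omega> t \<noteq> axis i 1} \<in> sets P" by (rule sets.compl_sets)
  moreover have "space P - {\<omega> \<in> space P. \<omega> t \<noteq> axis i 1} = {\<omega> \<in> space P. \<omega> t = axis i 1}" by auto
  ultimately have "in_state t i \<in> borel_measurable P"
    unfolding in_state_def[abs_def] by (intro of_bool_measurable) simp
  then show ?thesis by (simp cong: measurable_cong_sets)
qed

lemma in_cell_measurable:
  assumes t: "t \<in> {0..T}" and \<kappa>: "\<kappa> \<in> actions \<rightarrow>\<^sub>M count_space {..<nn}" and c: "c < nn"
  shows "in_cell \<kappa> t c \<in> borel_measurable \<mu>"
proof -
  have "\<alpha> t -` (\<kappa> -` {c} \<inter> A) \<inter> space P \<in> sets P" by (rule measurable_sets[OF \<alpha>_section[OF t] cell_set[OF \<kappa> c]])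
  moreover have "\<alpha> t -` (\<kappa> -` {c} \<inter> A) \<inter> space P = {\<omega> \<in> space P. \<kappa> (\<alpha> t \<omega>) = c}"
    using measurable_space[OF \<alpha>_section[OF t]] by auto
  ultimately have "in_cell \<kappa> t c \<in> borel_measurable P"
    unfolding in_cell_def[abs_def] by (intro of_bool_measurable) simp
  then show ?thesis by (simp cong: measurable_cong_sets)
qed

lemma integral_in_state: "t \<in> {0..T} \<Longrightarrow> (\<integral>x. in_state t i x \<partial>\<mu>) = p t $ i"
proof -
  assume t: "t \<in> {0..T}"
  have "(\<integral>x. in_state t i x \<partial>\<mu>) = (\<integral>x. indicator {\<omega> \<in> paths T. \<omega> t = axis i 1} x \<partial>\<mu>)"
    by (intro Bochner_Integration.integral_cong) (auto simp: in_state_def indicator_def space_\<mu>)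
  also have "\<dots> = measure \<mu> ({\<omega> \<in> paths T. \<omega> t = axis i 1} \<inter> space \<mu>)" by simp
  also have "{\<omega> \<in> paths T. \<omega> t = axis i 1} \<inter> space \<mu> = {\<omega> \<in> paths T. \<omega> t = axis i 1}" by (auto simp: space_\<mu>)
  finally show ?thesis using p_consistent[OF t] by simp
qed

lemma integral_in_cell:
  assumes t: "t \<in> {0..T}" and \<kappa>: "\<kappa> \<in> actions \<rightarrow>\<^sub>M count_space {..<nn}" and c: "c < nn"
  shows "(\<integral>x. in_cell \<kappa> t c x \<partial>\<mu>) = measure (\<nu> t) (\<kappa> -` {c} \<inter> A)"
proof -
  have am: "\<alpha> t \<in> \<mu> \<rightarrow>\<^sub>M actions" using \<alpha>_section[OF t] by (simp cong: measurable_cong_sets)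
  have "measure (\<nu> t) (\<kappa> -` {c} \<inter> A) = measure \<mu> (\<alpha> t -` (\<kappa> -` {c} \<inter> A) \<inter> space \<mu>)"
    unfolding \<nu>_consistent[OF t] by (rule measure_distr[OF am cell_set[OF \<kappa> c]])
  also have "\<dots> = (\<integral>x. indicator (\<alpha> t -` (\<kappa> -` {c} \<inter> A) \<inter> space \<mu>) x \<partial>\<mu>)" by simp
  also have "\<dots> = (\<integral>x. in_cell \<kappa> t c x \<partial>\<mu>)"
    using measurable_space[OF am] by (intro Bochner_Integration.integral_cong) (auto simp: in_cell_def indicator_def)
  finally show ?thesis ..
qed

lemma deviation_update: "deviation ({1..N} - {n}) h (w(n := x)) = deviation ({1..N} - {n}) h w"
  unfolding deviation_def by (intro arg_cong[where f=abs] sum.cong) auto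

text \<open>The norm is bounded by the sum of the coordinates, each of which is a deviation of
  frequencies; the consistency of the equilibrium makes \<open>p t\<close> the mean.\<close>

lemma empirical_states_deviation:
  assumes N: "1 \<le> N" and n: "n \<in> {1..N}" and t: "t \<in> {0..T}"
  shows "norm (empirical_states N (\<lambda>k. w k t) - p t) \<le> (\<Sum>i\<in>UNIV. (1 + deviation ({1..N} - {n}) (in_state t i) w) / real N)"
proof -
  have "norm (empirical_states N (\<lambda>k. w k t) - p t) \<le> (\<Sum>i\<in>UNIV. \<bar>(empirical_states N (\<lambda>k. w k t) - p t) $ i\<bar>)"
    by (rule norm_le_l1_cart)
  also have "\<dots> \<le> (\<Sum>i\<in>UNIV. (1 + deviation ({1..N} - {n}) (in_state t i) w) / real N)"
  proof (rule sum_mono)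
    fix i
    have "0 \<le> p t $ i" "p t $ i \<le> 1" using p_consistent[OF t] by simp_all
    then have "\<bar>1 / real N * (\<Sum>k\<in>{1..N}. in_state t i (w k)) - p t $ i\<bar> \<le> (1 + \<bar>\<Sum>k\<in>{1..N} - {n}. in_state t i (w k) - p t $ i\<bar>) / real N"
      using n by (intro empirical_frequency_deviation) (auto simp: in_state_def)
    then show "\<bar>(empirical_states N (\<lambda>k. w k t) - p t) $ i\<bar> \<le> (1 + deviation ({1..N} - {n}) (in_state t i) w) / real N"
      unfolding deviation_def integral_in_state[OF t]
      by (simp only: empirical_states_def vector_minus_component vec_lambda_beta in_state_def)
  qed
  finally show ?thesis .
qed

text \<open>The law of the actions is compared with \<open>\<nu> t\<close> on finitely many cells of
  \<open>A\<close>. The frequencies of the cells among the opponents are sums of functions of their own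
  paths; the action of player \<open>n\<close>, which may depend on everybody, costs \<open>1 /
  N\<close> per cell.\<close>

lemma empirical_actions_deviation:
  assumes N: "1 \<le> N" and n: "n \<in> {1..N}" and t: "t \<in> {0..T}"
    and \<beta>: "(\<lambda>z. \<beta> (fst z) (snd z)) \<in> time_interval \<Otimes>\<^sub>M players N \<rightarrow>\<^sub>M actions" and w: "w \<in> space (players N)"
    and \<kappa>: "\<kappa> \<in> actions \<rightarrow>\<^sub>M count_space {..<nn}" "\<And>x y. x \<in> A \<Longrightarrow> y \<in> A \<Longrightarrow> \<kappa> x = \<kappa> y \<Longrightarrow> norm (x - y) \<le> \<delta>"
    and D: "\<And>x y. x \<in> A \<Longrightarrow> y \<in> A \<Longrightarrow> norm (x - y) \<le> D" and "0 \<le> \<delta>" "0 \<le> D"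
  shows "wasserstein1 A (empirical_actions A N (\<lambda>k. profile n \<beta> k t w)) (\<nu> t)
    \<le> \<delta> + D * (\<Sum>c<nn. (1 + deviation ({1..N} - {n}) (in_cell \<kappa> t c) w) / real N)"
proof -
  have a: "profile n \<beta> k t w \<in> A" if "k \<in> {1..N}" for k by (rule profile_in_A[OF \<beta> that t w])
  have "wasserstein1 A (empirical_actions A N (\<lambda>k. profile n \<beta> k t w)) (\<nu> t)
     \<le> \<delta> + D * (\<Sum>c<nn. \<bar>measure (empirical_actions A N (\<lambda>k. profile n \<beta> k t w)) (\<kappa> -` {c} \<inter> A) - measure (\<nu> t) (\<kappa> -` {c} \<inter> A)\<bar>)"
    by (rule wasserstein1_le_partition[OF empirical_actions_measure(1)[OF N a] \<nu>_prob[OF t] _ \<kappa>(1) \<kappa>(2) D]) (use assms in auto)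
  also have "(\<Sum>c<nn. \<bar>measure (empirical_actions A N (\<lambda>k. profile n \<beta> k t w)) (\<kappa> -` {c} \<inter> A) - measure (\<nu> t) (\<kappa> -` {c} \<inter> A)\<bar>)
      \<le> (\<Sum>c<nn. (1 + deviation ({1..N} - {n}) (in_cell \<kappa> t c) w) / real N)"
  proof (rule sum_mono)
    fix c assume "c \<in> {..<nn}"
    then have c: "c < nn" by simp
    let ?B = "\<kappa> -` {c} \<inter> A" and ?m = "measure (\<nu> t) (\<kappa> -` {c} \<inter> A)"
    interpret \<nu>t: prob_space "\<nu> t" using \<nu>_prob[OF t] by (simp add: prob_measures_iff)
    have e: "measure (empirical_actions A N (\<lambda>k. profile n \<beta> k t w)) ?B = 1 / real N * (\<Sum>k\<in>{1..N}. of_bool (profile n \<beta> k t w \<in> ?B))"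
      by (rule empirical_actions_measure(2)[OF N a cell_set[OF \<kappa>(1) c]])
    have "\<bar>1 / real N * (\<Sum>k\<in>{1..N}. of_bool (profile n \<beta> k t w \<in> ?B)) - ?m\<bar>
        \<le> (1 + \<bar>\<Sum>k\<in>{1..N} - {n}. of_bool (profile n \<beta> k t w \<in> ?B) - ?m\<bar>) / real N"
      using n by (intro empirical_frequency_deviation) auto
    also have "(\<Sum>k\<in>{1..N} - {n}. of_bool (profile n \<beta> k t w \<in> ?B) - ?m) = (\<Sum>k\<in>{1..N} - {n}. in_cell \<kappa> t c (w k) - ?m)"
    proof (intro sum.cong refl)
      fix k assume k: "k \<in> {1..N} - {n}"
      then have "profile n \<beta> k t w = \<alpha> t (w k)" by (simp add: profile_def)
      then show "of_bool (profile n \<beta> k t w \<in> ?B) - ?m = in_cell \<kappa> t c (w k) - ?m"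
        using a[of k] k by (simp add: in_cell_def)
    qed
    also have "\<bar>\<dots>\<bar> = deviation ({1..N} - {n}) (in_cell \<kappa> t c) w"
      by (simp only: deviation_def integral_in_cell[OF t \<kappa>(1) c])
    finally show "\<bar>measure (empirical_actions A N (\<lambda>k. profile n \<beta> k t w)) ?B - ?m\<bar> \<le> (1 + deviation ({1..N} - {n}) (in_cell \<kappa> t c) w) / real N"
      unfolding e .
  qed
  finally show ?thesis using \<open>0 \<le> D\<close> by (simp add: mult_left_mono)
qed

text \<open>The bound for the distance of both empirical laws from the equilibrium, at time \<open>fst
  z\<close>, for the paths \<open>snd z\<close> of the opponents. The cells of \<open>A\<close> have
  diameter \<open>\<delta>\<close> and number \<open>nn\<close>; \<open>D\<close> bounds the diameter of
  \<open>A\<close>.\<close>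

definition law_error :: "(real^'l \<Rightarrow> nat) \<Rightarrow> nat \<Rightarrow> real \<Rightarrow> real \<Rightarrow> nat \<Rightarrow> nat \<Rightarrow> real \<times> (nat \<Rightarrow> real \<Rightarrow> real^'m) \<Rightarrow> real" where
  "law_error \<kappa> nn \<delta> D N n z =
     (\<Sum>i\<in>UNIV. (1 + deviation ({1..N} - {n}) (in_state (fst z) i) (snd z)) / real N) +
     (\<delta> + D * (\<Sum>c<nn. (1 + deviation ({1..N} - {n}) (in_cell \<kappa> (fst z) c) (snd z)) / real N))"

definition cost_error :: "(real^'l \<Rightarrow> nat) \<Rightarrow> nat \<Rightarrow> real \<Rightarrow> real \<Rightarrow> nat \<Rightarrow> nat \<Rightarrow> (nat \<Rightarrow> real \<Rightarrow> real^'m) \<Rightarrow> real" where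
  "cost_error \<kappa> nn \<delta> D N n w = C * (LINT t:{0..T}|lborel. law_error \<kappa> nn \<delta> D N n (t, w)) +
     C * (\<Sum>i\<in>UNIV. (1 + deviation ({1..N} - {n}) (in_state T i) w) / real N)"

lemma deviation_nonneg: "0 \<le> deviation J h w"
  by (simp add: deviation_def)

lemma deviation_in_state_measurable:
  assumes J: "J \<subseteq> I"
  shows "(\<lambda>z. deviation J (in_state (fst z) i) (snd z)) \<in> borel_measurable (time_interval \<Otimes>\<^sub>M Pi\<^sub>M I (\<lambda>_. P))"
proof -
  let ?B = "time_interval \<Otimes>\<^sub>M Pi\<^sub>M I (\<lambda>_. P)"
  have "(\<lambda>t. p t $ i) \<in> borel_measurable time_interval"
    by (intro borel_measurable_vec_component measurable_compose[OF p_measurable]) (intro measurable_restrict_space1, simp)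
  from measurable_compose[OF measurable_fst this]
  have pm: "(\<lambda>z. p (fst z) $ i) \<in> borel_measurable ?B" .
  have "(\<lambda>z. \<bar>\<Sum>k\<in>J. in_state (fst z) i (snd z k) - p (fst z) $ i\<bar>) \<in> borel_measurable ?B"
    by (intro borel_measurable_abs borel_measurable_sum borel_measurable_diff in_state_player_measurable pm) (use J in auto)
  then show ?thesis
    by (rule measurable_cong[THEN iffD1, rotated])
       (simp add: deviation_def integral_in_state space_pair_measure mem_Times_iff)
qed

lemma deviation_in_cell_measurable:
  assumes J: "J \<subseteq> I" and \<kappa>: "\<kappa> \<in> actions \<rightarrow>\<^sub>M count_space {..<nn}" and c: "c < nn"
  shows "(\<lambda>z. deviation J (in_cell \<kappa> (fst z) c) (snd z)) \<in> borel_measurable (time_interval \<Otimes>\<^sub>M Pi\<^sub>M I (\<lambda>_. P))"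
proof -
  let ?B = "time_interval \<Otimes>\<^sub>M Pi\<^sub>M I (\<lambda>_. P)"
  have "(\<lambda>t. measure (\<nu> t) (\<kappa> -` {c} \<inter> A)) \<in> borel_measurable time_interval"
    by (rule measurable_compose[OF \<nu>_measurable measurable_measure_prob_algebra[OF cell_set[OF \<kappa> c]]])
  from measurable_compose[OF measurable_fst this]
  have pm: "(\<lambda>z. measure (\<nu> (fst z)) (\<kappa> -` {c} \<inter> A)) \<in> borel_measurable ?B" .
  have "(\<lambda>z. \<bar>\<Sum>k\<in>J. in_cell \<kappa> (fst z) c (snd z k) - measure (\<nu> (fst z)) (\<kappa> -` {c} \<inter> A)\<bar>) \<in> borel_measurable ?B"
    by (intro borel_measurable_abs borel_measurable_sum borel_measurable_diff in_cell_player_measurable[OF \<kappa> c] pm) (use J in auto)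
  then show ?thesis
    by (rule measurable_cong[THEN iffD1, rotated])
       (simp add: deviation_def integral_in_cell[OF _ \<kappa> c] space_pair_measure mem_Times_iff)
qed

lemma law_error_measurable:
  assumes \<kappa>: "\<kappa> \<in> actions \<rightarrow>\<^sub>M count_space {..<nn}"
  shows "law_error \<kappa> nn \<delta> D N n \<in> borel_measurable (time_interval \<Otimes>\<^sub>M Pi\<^sub>M ({1..N} - {n}) (\<lambda>_. P))"
  unfolding law_error_def[abs_def]
  by (intro borel_measurable_add borel_measurable_sum borel_measurable_divide borel_measurable_times borel_measurable_const
      deviation_in_state_measurable deviation_in_cell_measurable[OF _ \<kappa>]) auto

lemma deviation_bound:
  assumes N: "1 \<le> N" and w: "w \<in> space (Pi\<^sub>M ({1..N} - {n}) (\<lambda>_. P))"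
    and h: "h \<in> borel_measurable \<mu>" "\<And>x. 0 \<le> h x \<and> h x \<le> 1"
  shows "0 \<le> (1 + deviation ({1..N} - {n}) h w) / real N" "(1 + deviation ({1..N} - {n}) h w) / real N \<le> 2"
proof -
  have sp: "space (Pi\<^sub>M ({1..N} - {n}) (\<lambda>_. \<mu>)) = space (Pi\<^sub>M ({1..N} - {n}) (\<lambda>_. P))"
    by (rule sets_eq_imp_space_eq, intro sets_PiM_cong) auto
  have w': "w \<in> space (Pi\<^sub>M ({1..N} - {n}) (\<lambda>_. \<mu>))" using w by (simp only: sp)
  have "\<bar>deviation ({1..N} - {n}) h w\<bar> \<le> real (card ({1..N} - {n}))"
    by (rule deviation_expectation(3)[OF h(1) _ _ w']) (auto simp: h(2))
  also have "\<dots> \<le> real (card {1..N})" by (intro of_nat_mono card_mono) auto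
  finally have "deviation ({1..N} - {n}) h w \<le> real N" by simp
  then have "1 + deviation ({1..N} - {n}) h w \<le> 2 * real N" using N by simp
  then show "(1 + deviation ({1..N} - {n}) h w) / real N \<le> 2" using N by (simp add: field_simps)
  show "0 \<le> (1 + deviation ({1..N} - {n}) h w) / real N" by (simp add: deviation_nonneg)
qed

lemma deviation_mean:
  assumes N: "1 \<le> N" and h: "h \<in> borel_measurable \<mu>" "\<And>x. 0 \<le> h x \<and> h x \<le> 1"
  shows "integrable (Pi\<^sub>M ({1..N} - {n}) (\<lambda>_. \<mu>)) (\<lambda>w. (1 + deviation ({1..N} - {n}) h w) / real N)"
    "(\<integral>w. (1 + deviation ({1..N} - {n}) h w) / real N \<partial>Pi\<^sub>M ({1..N} - {n}) (\<lambda>_. \<mu>)) \<le> 2 / sqrt (real N)"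
proof -
  let ?J = "{1..N} - {n}"
  interpret J: prob_space "Pi\<^sub>M ?J (\<lambda>_. \<mu>)" by (intro prob_space_PiM \<mu>.prob_space_axioms)
  have i: "integrable (Pi\<^sub>M ?J (\<lambda>_. \<mu>)) (deviation ?J h)" by (rule deviation_expectation(1)[OF h(1)]) (auto simp: h(2))
  show "integrable (Pi\<^sub>M ?J (\<lambda>_. \<mu>)) (\<lambda>w. (1 + deviation ?J h w) / real N)"
    by (intro integrable_divide Bochner_Integration.integrable_add J.integrable_const i)
  have "(\<integral>w. deviation ?J h w \<partial>Pi\<^sub>M ?J (\<lambda>_. \<mu>)) \<le> sqrt (card ?J)" by (rule deviation_expectation(2)[OF h(1)]) (auto simp: h(2))
  also have "\<dots> \<le> sqrt (real (card {1..N}))" by (intro real_sqrt_le_mono of_nat_mono card_mono) auto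
  finally have d: "(\<integral>w. deviation ?J h w \<partial>Pi\<^sub>M ?J (\<lambda>_. \<mu>)) \<le> sqrt (real N)" by simp
  have "(\<integral>w. 1 + deviation ?J h w \<partial>Pi\<^sub>M ?J (\<lambda>_. \<mu>)) = (\<integral>w. 1 \<partial>Pi\<^sub>M ?J (\<lambda>_. \<mu>)) + (\<integral>w. deviation ?J h w \<partial>Pi\<^sub>M ?J (\<lambda>_. \<mu>))"
    by (rule Bochner_Integration.integral_add[OF J.integrable_const i])
  also have "(\<integral>w. 1 \<partial>Pi\<^sub>M ?J (\<lambda>_. \<mu>)) = (1::real)" using J.prob_space by simp
  finally have "(\<integral>w. (1 + deviation ?J h w) / real N \<partial>Pi\<^sub>M ?J (\<lambda>_. \<mu>)) = (1 + (\<integral>w. deviation ?J h w \<partial>Pi\<^sub>M ?J (\<lambda>_. \<mu>))) / real N"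
    by (simp only: integral_divide_zero)
  also have "\<dots> \<le> (sqrt (real N) + sqrt (real N)) / real N"
    using d N by (intro divide_right_mono add_mono) auto
  also have "\<dots> = 2 / sqrt (real N)"
    using N by (simp add: field_simps)
  finally show "(\<integral>w. (1 + deviation ?J h w) / real N \<partial>Pi\<^sub>M ?J (\<lambda>_. \<mu>)) \<le> 2 / sqrt (real N)" .
qed

text \<open>Each deviation has mean of order \<open>1 / sqrt N\<close>; the number of cells enters the
  constant only.\<close>

lemma cost_error_mean:
  assumes N: "1 \<le> N" and \<kappa>: "\<kappa> \<in> actions \<rightarrow>\<^sub>M count_space {..<nn}" and \<delta>: "0 \<le> \<delta>" and D: "0 \<le> D"
  shows "integrable (Pi\<^sub>M ({1..N} - {n}) (\<lambda>_. \<mu>)) (cost_error \<kappa> nn \<delta> D N n)"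
    and "(\<integral>w. cost_error \<kappa> nn \<delta> D N n w \<partial>Pi\<^sub>M ({1..N} - {n}) (\<lambda>_. \<mu>))
      \<le> C * T * \<delta> + C * (T * (real CARD('m) + D * real nn) + real CARD('m)) * (2 / sqrt (real N))"
    and "\<And>w. w \<in> space (Pi\<^sub>M ({1..N} - {n}) (\<lambda>_. P)) \<Longrightarrow> set_integrable lborel {0..T} (\<lambda>t. law_error \<kappa> nn \<delta> D N n (t, w))"
proof -
  let ?J = "{1..N} - {n}" and ?s = "2 / sqrt (real N)"
  interpret J: prob_space "Pi\<^sub>M ?J (\<lambda>_. \<mu>)" by (intro prob_space_PiM \<mu>.prob_space_axioms)
  have setsJ: "sets (Pi\<^sub>M ?J (\<lambda>_. \<mu>)) = sets (Pi\<^sub>M ?J (\<lambda>_. P))" by (intro sets_PiM_cong) auto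
  have spaceJ: "space (Pi\<^sub>M ?J (\<lambda>_. \<mu>)) = space (Pi\<^sub>M ?J (\<lambda>_. P))" by (rule sets_eq_imp_space_eq[OF setsJ])
  have st: "in_state t i \<in> borel_measurable \<mu>" "0 \<le> in_state t i x \<and> in_state t i x \<le> 1" if "t \<in> {0..T}" for t i x
    using in_state_measurable[OF that] by (auto simp: in_state_def)
  have ce: "in_cell \<kappa> t c \<in> borel_measurable \<mu>" "0 \<le> in_cell \<kappa> t c x \<and> in_cell \<kappa> t c x \<le> 1" if "t \<in> {0..T}" "c < nn" for t c x
    using in_cell_measurable[OF that(1) \<kappa> that(2)] by (auto simp: in_cell_def)
  let ?B = "(\<Sum>i\<in>(UNIV::'m set). 2) + (\<delta> + D * (\<Sum>c<nn. 2))"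
  have bound: "\<bar>law_error \<kappa> nn \<delta> D N n (t, w)\<bar> \<le> ?B" if t: "t \<in> {0..T}" and w: "w \<in> space (Pi\<^sub>M ?J (\<lambda>_. P))" for t w
  proof -
    have "0 \<le> law_error \<kappa> nn \<delta> D N n (t, w)"
      unfolding law_error_def using \<delta> D by (intro add_nonneg_nonneg mult_nonneg_nonneg sum_nonneg divide_nonneg_nonneg) (auto simp: deviation_nonneg)
    moreover have "law_error \<kappa> nn \<delta> D N n (t, w) \<le> ?B"
      unfolding law_error_def fst_conv snd_conv using D
      by (intro add_mono order_refl mult_left_mono sum_mono deviation_bound(2)[OF N w st[OF t]] deviation_bound(2)[OF N w ce[OF t]]) auto
    ultimately show ?thesis by simp
  qed
  have mB: "law_error \<kappa> nn \<delta> D N n \<in> borel_measurable (time_interval \<Otimes>\<^sub>M Pi\<^sub>M ?J (\<lambda>_. \<mu>))"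
    using law_error_measurable[OF \<kappa>, of \<delta> D N n] sets_pair_measure_cong[OF refl[of "sets time_interval"] setsJ] by (simp cong: measurable_cong_sets)
  have mean: "(\<integral>w. law_error \<kappa> nn \<delta> D N n (t, w) \<partial>Pi\<^sub>M ?J (\<lambda>_. \<mu>)) \<le> real CARD('m) * ?s + (\<delta> + D * (real nn * ?s))"
    if t: "t \<in> {0..T}" for t
  proof -
    have iS: "integrable (Pi\<^sub>M ?J (\<lambda>_. \<mu>)) (\<lambda>w. (1 + deviation ?J (in_state t i) w) / real N)" for i
      by (rule deviation_mean(1)[OF N st[OF t]])
    have ic: "integrable (Pi\<^sub>M ?J (\<lambda>_. \<mu>)) (\<lambda>w. (1 + deviation ?J (in_cell \<kappa> t c) w) / real N)" if "c \<in> {..<nn}" for c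
      using that by (intro deviation_mean(1)[OF N ce[OF t]]) auto
    have i1: "integrable (Pi\<^sub>M ?J (\<lambda>_. \<mu>)) (\<lambda>w. \<Sum>i\<in>(UNIV::'m set). (1 + deviation ?J (in_state t i) w) / real N)"
      by (intro Bochner_Integration.integrable_sum iS)
    have i2: "integrable (Pi\<^sub>M ?J (\<lambda>_. \<mu>)) (\<lambda>w. \<Sum>c<nn. (1 + deviation ?J (in_cell \<kappa> t c) w) / real N)"
      by (intro Bochner_Integration.integrable_sum ic)
    have i3: "integrable (Pi\<^sub>M ?J (\<lambda>_. \<mu>)) (\<lambda>w. \<delta> + D * (\<Sum>c<nn. (1 + deviation ?J (in_cell \<kappa> t c) w) / real N))"
      by (intro Bochner_Integration.integrable_add integrable_mult_right i2 J.integrable_const)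
    have "(\<integral>w. law_error \<kappa> nn \<delta> D N n (t, w) \<partial>Pi\<^sub>M ?J (\<lambda>_. \<mu>))
        = (\<integral>w. (\<Sum>i\<in>(UNIV::'m set). (1 + deviation ?J (in_state t i) w) / real N) \<partial>Pi\<^sub>M ?J (\<lambda>_. \<mu>))
        + (\<integral>w. \<delta> + D * (\<Sum>c<nn. (1 + deviation ?J (in_cell \<kappa> t c) w) / real N) \<partial>Pi\<^sub>M ?J (\<lambda>_. \<mu>))"
      unfolding law_error_def fst_conv snd_conv by (rule Bochner_Integration.integral_add[OF i1 i3])
    also have "(\<integral>w. (\<Sum>i\<in>(UNIV::'m set). (1 + deviation ?J (in_state t i) w) / real N) \<partial>Pi\<^sub>M ?J (\<lambda>_. \<mu>))
        = (\<Sum>i\<in>(UNIV::'m set). (\<integral>w. (1 + deviation ?J (in_state t i) w) / real N \<partial>Pi\<^sub>M ?J (\<lambda>_. \<mu>)))"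
      by (rule Bochner_Integration.integral_sum) (rule iS)
    also have "(\<integral>w. \<delta> + D * (\<Sum>c<nn. (1 + deviation ?J (in_cell \<kappa> t c) w) / real N) \<partial>Pi\<^sub>M ?J (\<lambda>_. \<mu>))
        = (\<integral>w. \<delta> \<partial>Pi\<^sub>M ?J (\<lambda>_. \<mu>)) + (\<integral>w. D * (\<Sum>c<nn. (1 + deviation ?J (in_cell \<kappa> t c) w) / real N) \<partial>Pi\<^sub>M ?J (\<lambda>_. \<mu>))"
      by (rule Bochner_Integration.integral_add[OF J.integrable_const integrable_mult_right[OF i2]])
    also have "(\<integral>w. \<delta> \<partial>Pi\<^sub>M ?J (\<lambda>_. \<mu>)) = \<delta>" using J.prob_space by simp
    also have "(\<integral>w. D * (\<Sum>c<nn. (1 + deviation ?J (in_cell \<kappa> t c) w) / real N) \<partial>Pi\<^sub>M ?J (\<lambda>_. \<mu>))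
        = D * (\<integral>w. (\<Sum>c<nn. (1 + deviation ?J (in_cell \<kappa> t c) w) / real N) \<partial>Pi\<^sub>M ?J (\<lambda>_. \<mu>))"
      by (rule integral_mult_right_zero)
    also have "(\<integral>w. (\<Sum>c<nn. (1 + deviation ?J (in_cell \<kappa> t c) w) / real N) \<partial>Pi\<^sub>M ?J (\<lambda>_. \<mu>))
        = (\<Sum>c<nn. (\<integral>w. (1 + deviation ?J (in_cell \<kappa> t c) w) / real N \<partial>Pi\<^sub>M ?J (\<lambda>_. \<mu>)))"
      by (rule Bochner_Integration.integral_sum) (rule ic)
    also have "(\<Sum>i\<in>(UNIV::'m set). (\<integral>w. (1 + deviation ?J (in_state t i) w) / real N \<partial>Pi\<^sub>M ?J (\<lambda>_. \<mu>)))
        + (\<delta> + D * (\<Sum>c<nn. (\<integral>w. (1 + deviation ?J (in_cell \<kappa> t c) w) / real N \<partial>Pi\<^sub>M ?J (\<lambda>_. \<mu>))))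
        \<le> (\<Sum>i\<in>(UNIV::'m set). ?s) + (\<delta> + D * (\<Sum>c<nn. ?s))"
      using D by (intro add_mono order_refl mult_left_mono sum_mono deviation_mean(2)[OF N st[OF t]] deviation_mean(2)[OF N ce[OF t]]) auto
    finally show ?thesis by simp
  qed
  have bJ: "\<bar>law_error \<kappa> nn \<delta> D N n (t, w)\<bar> \<le> ?B" if "t \<in> {0..T}" "w \<in> space (Pi\<^sub>M ?J (\<lambda>_. \<mu>))" for t w
    using bound that spaceJ by simp
  note E = expectation_time_integral_le[OF J.prob_space_axioms mB bJ mean T_pos]
  have TT: "T \<in> {0..T}" using T_pos by simp
  have iT: "integrable (Pi\<^sub>M ?J (\<lambda>_. \<mu>)) (\<lambda>w. (1 + deviation ?J (in_state T i) w) / real N)" for i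
    by (rule deviation_mean(1)[OF N st[OF TT]])
  have i1: "integrable (Pi\<^sub>M ?J (\<lambda>_. \<mu>)) (\<lambda>w. C * (LINT t:{0..T}|lborel. law_error \<kappa> nn \<delta> D N n (t, w)))"
    by (rule integrable_mult_right[OF E(1)])
  have i2: "integrable (Pi\<^sub>M ?J (\<lambda>_. \<mu>)) (\<lambda>w. C * (\<Sum>i\<in>(UNIV::'m set). (1 + deviation ?J (in_state T i) w) / real N))"
    by (intro integrable_mult_right Bochner_Integration.integrable_sum iT)
  show "integrable (Pi\<^sub>M ?J (\<lambda>_. \<mu>)) (cost_error \<kappa> nn \<delta> D N n)"
    unfolding cost_error_def[abs_def] by (rule Bochner_Integration.integrable_add[OF i1 i2])
  have "(\<integral>w. cost_error \<kappa> nn \<delta> D N n w \<partial>Pi\<^sub>M ?J (\<lambda>_. \<mu>))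
      = (\<integral>w. C * (LINT t:{0..T}|lborel. law_error \<kappa> nn \<delta> D N n (t, w)) \<partial>Pi\<^sub>M ?J (\<lambda>_. \<mu>))
      + (\<integral>w. C * (\<Sum>i\<in>(UNIV::'m set). (1 + deviation ?J (in_state T i) w) / real N) \<partial>Pi\<^sub>M ?J (\<lambda>_. \<mu>))"
    unfolding cost_error_def by (rule Bochner_Integration.integral_add[OF i1 i2])
  also have "(\<integral>w. C * (LINT t:{0..T}|lborel. law_error \<kappa> nn \<delta> D N n (t, w)) \<partial>Pi\<^sub>M ?J (\<lambda>_. \<mu>))
      = C * (\<integral>w. (LINT t:{0..T}|lborel. law_error \<kappa> nn \<delta> D N n (t, w)) \<partial>Pi\<^sub>M ?J (\<lambda>_. \<mu>))"
    by (rule integral_mult_right_zero)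
  also have "(\<integral>w. C * (\<Sum>i\<in>(UNIV::'m set). (1 + deviation ?J (in_state T i) w) / real N) \<partial>Pi\<^sub>M ?J (\<lambda>_. \<mu>))
      = C * (\<integral>w. (\<Sum>i\<in>(UNIV::'m set). (1 + deviation ?J (in_state T i) w) / real N) \<partial>Pi\<^sub>M ?J (\<lambda>_. \<mu>))"
    by (rule integral_mult_right_zero)
  also have "(\<integral>w. (\<Sum>i\<in>(UNIV::'m set). (1 + deviation ?J (in_state T i) w) / real N) \<partial>Pi\<^sub>M ?J (\<lambda>_. \<mu>))
      = (\<Sum>i\<in>(UNIV::'m set). (\<integral>w. (1 + deviation ?J (in_state T i) w) / real N \<partial>Pi\<^sub>M ?J (\<lambda>_. \<mu>)))"
    by (rule Bochner_Integration.integral_sum) (rule iT)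
  also have "C * (\<integral>w. (LINT t:{0..T}|lborel. law_error \<kappa> nn \<delta> D N n (t, w)) \<partial>Pi\<^sub>M ?J (\<lambda>_. \<mu>))
      + C * (\<Sum>i\<in>(UNIV::'m set). (\<integral>w. (1 + deviation ?J (in_state T i) w) / real N \<partial>Pi\<^sub>M ?J (\<lambda>_. \<mu>)))
      \<le> C * (T * (real CARD('m) * ?s + (\<delta> + D * (real nn * ?s)))) + C * (\<Sum>i\<in>(UNIV::'m set). ?s)"
    using C_nonneg by (intro add_mono mult_left_mono E(2) sum_mono deviation_mean(2)[OF N st[OF TT]])
  also have "\<dots> = C * T * \<delta> + C * (T * (real CARD('m) + D * real nn) + real CARD('m)) * ?s"
    unfolding sum_constant by (simp only: ring_distribs mult_ac add_ac)
  finally show "(\<integral>w. cost_error \<kappa> nn \<delta> D N n w \<partial>Pi\<^sub>M ?J (\<lambda>_. \<mu>))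
      \<le> C * T * \<delta> + C * (T * (real CARD('m) + D * real nn) + real CARD('m)) * ?s" .
  show "set_integrable lborel {0..T} (\<lambda>t. law_error \<kappa> nn \<delta> D N n (t, w))" if w: "w \<in> space (Pi\<^sub>M ?J (\<lambda>_. P))" for w
  proof (rule set_integrable_bound[where f="\<lambda>_. ?B"])
    show "set_integrable lborel {0..T} (\<lambda>_. ?B)" using T_pos by (simp add: set_integrable_def)
    have "(\<lambda>t. law_error \<kappa> nn \<delta> D N n (t, w)) \<in> borel_measurable time_interval"
      using measurable_compose[OF measurable_Pair2'[OF w] law_error_measurable[OF \<kappa>]] by simp
    then show "set_borel_measurable lborel {0..T} (\<lambda>t. law_error \<kappa> nn \<delta> D N n (t, w))"
      by (simp add: set_borel_measurable_def borel_measurable_restrict_space_iff)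
    show "AE t in lborel. t \<in> {0..T} \<longrightarrow> norm (law_error \<kappa> nn \<delta> D N n (t, w)) \<le> norm ?B"
      using bound[OF _ w] by (intro AE_I2) fastforce
  qed
qed

section \<open>Regret of a deviating player\<close>

text \<open>For frozen \<open>w\<close>, the two costs have the same own path, the same actions and the
  same likelihood; they differ in the laws inserted into \<open>f\<close> and \<open>g\<close>. The
  bound on this difference does not depend on the own path, so it can be taken out of the integral,
  where the likelihood has mass at most \<open>lik_mass\<close>.\<close>

lemma conditional_cost_error:
  assumes N: "1 \<le> N" and n: "n \<in> {1..N}" and \<beta>: "(\<lambda>z. \<beta> (fst z) (snd z)) \<in> time_interval \<Otimes>\<^sub>M players N \<rightarrow>\<^sub>M actions"
    and w: "w \<in> space (Pi\<^sub>M ({1..N} - {n}) (\<lambda>_. P))" and sec: "(\<lambda>t x. \<beta> t (w(n := x))) \<in> mfg_controls T A"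
    and \<kappa>: "\<kappa> \<in> actions \<rightarrow>\<^sub>M count_space {..<nn}" "\<And>x y. x \<in> A \<Longrightarrow> y \<in> A \<Longrightarrow> \<kappa> x = \<kappa> y \<Longrightarrow> norm (x - y) \<le> \<delta>"
    and D: "\<And>x y. x \<in> A \<Longrightarrow> y \<in> A \<Longrightarrow> norm (x - y) \<le> D" and \<delta>0: "0 \<le> \<delta>" and D0: "0 \<le> D"
  shows "\<bar>conditional_cost N n \<beta> w - (\<integral>x. lik (\<lambda>s. \<beta> s (w(n := x))) x * path_cost x (\<lambda>t. \<beta> t (w(n := x))) p \<nu> \<partial>P)\<bar>
    \<le> lik_mass * cost_error \<kappa> nn \<delta> D N n w"
proof -
  let ?\<beta> = "\<lambda>t x. \<beta> t (w(n := x))"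
  \<comment> \<open>The likelihood, the cost with empirical laws, the cost with equilibrium laws, and the
    bound on their difference.\<close>
  define l where "l x = lik (\<lambda>s. \<beta> s (w(n := x))) x" for x
  define c1 where "c1 x = player_cost N n \<beta> (w(n := x))" for x
  define c2 where "c2 x = path_cost x (\<lambda>t. \<beta> t (w(n := x))) p \<nu>" for x
  define err where "err = cost_error \<kappa> nn \<delta> D N n w"
  obtain B where B: "0 \<le> B"
    "\<And>x u p \<nu>. x \<in> paths T \<Longrightarrow> (\<And>t. t \<in> {0..T} \<Longrightarrow> u t \<in> A) \<Longrightarrow> (\<And>t. t \<in> {0..T} \<Longrightarrow> p t \<in> prob_simplex) \<Longrightarrow>
      (\<And>t. t \<in> {0..T} \<Longrightarrow> \<nu> t \<in> prob_measures A) \<Longrightarrow> \<bar>path_cost x u p \<nu>\<bar> \<le> B"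
    using path_cost_bounded by blast
  have lm: "l \<in> borel_measurable P" unfolding l_def[abs_def] by (rule control_lik_measurable[OF sec])
  have c2m: "c2 \<in> borel_measurable P" unfolding c2_def[abs_def]
    by (rule equilibrium_cost_measurable(1)[OF sec p_measurable \<nu>_measurable])
  have lc1m: "(\<lambda>x. l x * c1 x) \<in> borel_measurable P"
    using measurable_compose[OF measurable_Pair1'[OF w, of P] conditional_cost_integrand_measurable[OF N n \<beta>]]
    by (simp only: fst_conv snd_conv l_def c1_def)
  have bA: "\<beta> t (w(n := x)) \<in> A" if "t \<in> {0..T}" "x \<in> space P" for t x
    using measurable_space[OF control_measurable[OF sec], of "(t, x)"] that by (simp add: space_pair_measure)
  have l_le: "0 < l x" "l x \<le> lik_bound x" if "x \<in> space P" for x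
    unfolding l_def using that
    by (intro lik_bounds jointly_measurable_section[OF control_measurable[OF sec]]; simp add: space_P)+
  have upd: "w(n := x) \<in> space (players N)" if "x \<in> space P" for x
    using that by (intro update_player[OF n w]) (simp add: space_P)
  have es: "empirical_states N (\<lambda>k. (w(n := x)) k t) \<in> prob_simplex" if "t \<in> {0..T}" "x \<in> space P" for t x
    by (intro empirical_states_simplex[OF N] paths_in_states[OF player_paths[OF upd[OF that(2)]]] that)
  have ea: "empirical_actions A N (\<lambda>k. profile n \<beta> k t (w(n := x))) \<in> prob_measures A" if "t \<in> {0..T}" "x \<in> space P" for t x
    by (intro empirical_actions_measure(1)[OF N] profile_in_A[OF \<beta> _ that(1) upd[OF that(2)]])
  have xp: "x \<in> paths T" if "x \<in> space P" for x using that by (simp add: space_P)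
  have c1_eq: "c1 x = path_cost x (\<lambda>t. \<beta> t (w(n := x))) (\<lambda>t. empirical_states N (\<lambda>k. (w(n := x)) k t))
      (\<lambda>t. empirical_actions A N (\<lambda>k. profile n \<beta> k t (w(n := x))))" for x
    unfolding c1_def player_cost_def by simp
  have diff: "\<bar>c1 x - c2 x\<bar> \<le> err" if x: "x \<in> space P" for x
  proof -
    have TT: "T \<in> {0..T}" using T_pos by simp
    have m1: "(\<lambda>t. f t (x t) (\<beta> t (w(n := x))) (empirical_states N (\<lambda>k. (w(n := x)) k t))
        (empirical_actions A N (\<lambda>k. profile n \<beta> k t (w(n := x))))) \<in> borel_measurable time_interval"
      using measurable_compose[OF measurable_Pair2'[OF upd[OF x]] player_cost_measurable(2)[OF N n \<beta>]]
      by (simp only: fst_conv snd_conv fun_upd_same)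
    have m2: "(\<lambda>t. f t (x t) (\<beta> t (w(n := x))) (p t) (\<nu> t)) \<in> borel_measurable time_interval"
      using measurable_compose[OF measurable_Pair2'[OF x] equilibrium_cost_measurable(2)[OF sec p_measurable \<nu>_measurable]] by simp
    have "\<bar>c1 x - c2 x\<bar> \<le> C * (LINT t:{0..T}|lborel. law_error \<kappa> nn \<delta> D N n (t, w))
        + C * norm (empirical_states N (\<lambda>k. (w(n := x)) k T) - p T)"
      unfolding c1_eq c2_def
    proof (rule path_cost_diff_le[OF xp[OF x] bA[OF _ x] es[OF _ x] p_simplex ea[OF _ x] \<nu>_prob m1 m2
          cost_error_mean(3)[OF N \<kappa>(1) \<delta>0 D0 w]])
      fix t assume t: "t \<in> {0..T}"
      show "norm (empirical_states N (\<lambda>k. (w(n := x)) k t) - p t) +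
          wasserstein1 A (empirical_actions A N (\<lambda>k. profile n \<beta> k t (w(n := x)))) (\<nu> t) \<le> law_error \<kappa> nn \<delta> D N n (t, w)"
        unfolding law_error_def fst_conv snd_conv
        using empirical_states_deviation[OF N n t, of "w(n := x)"]
          empirical_actions_deviation[OF N n t \<beta> upd[OF x] \<kappa> D \<delta>0 D0]
        unfolding deviation_update by (rule add_mono)
    qed
    also have "norm (empirical_states N (\<lambda>k. (w(n := x)) k T) - p T)
        \<le> (\<Sum>i\<in>UNIV. (1 + deviation ({1..N} - {n}) (in_state T i) w) / real N)"
      using empirical_states_deviation[OF N n TT, of "w(n := x)"] unfolding deviation_update .
    finally show ?thesis unfolding err_def cost_error_def using C_nonneg by (simp add: mult_left_mono)
  qed
  have lbB: "integrable P (\<lambda>x. lik_bound x * B)" using lik_bound_integrable(1) by simp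
  have bound: "\<bar>l x * c x\<bar> \<le> \<bar>lik_bound x * B\<bar>" if "x \<in> space P" "\<bar>c x\<bar> \<le> B" for x c
    using l_le[OF that(1)] that(2) B(1) unfolding abs_mult by (intro mult_mono) auto
  have i1: "integrable P (\<lambda>x. l x * c1 x)"
  proof (rule Bochner_Integration.integrable_bound[OF lbB lc1m], rule AE_I2)
    fix x assume x: "x \<in> space P"
    have "\<bar>c1 x\<bar> \<le> B" unfolding c1_eq by (intro B(2) xp[OF x] bA[OF _ x] es[OF _ x] ea[OF _ x])
    then show "norm (l x * c1 x) \<le> norm (lik_bound x * B)" using bound[OF x] by simp
  qed
  have i2: "integrable P (\<lambda>x. l x * c2 x)"
  proof (rule Bochner_Integration.integrable_bound[OF lbB borel_measurable_times[OF lm c2m]], rule AE_I2)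
    fix x assume x: "x \<in> space P"
    have "\<bar>c2 x\<bar> \<le> B" unfolding c2_def by (intro B(2) xp[OF x] bA[OF _ x] p_simplex \<nu>_prob)
    then show "norm (l x * c2 x) \<le> norm (lik_bound x * B)" using bound[OF x] by simp
  qed
  obtain x0 where x0: "x0 \<in> space P" using P.not_empty by blast
  have err0: "0 \<le> err" using diff[OF x0] by linarith
  have "\<bar>conditional_cost N n \<beta> w - (\<integral>x. l x * c2 x \<partial>P)\<bar> = \<bar>\<integral>x. l x * c1 x - l x * c2 x \<partial>P\<bar>"
    unfolding conditional_cost_def l_def[symmetric] c1_def[symmetric] by (simp only: Bochner_Integration.integral_diff[OF i1 i2])
  also have "\<dots> \<le> (\<integral>x. lik_bound x * err \<partial>P)"
    unfolding real_norm_def[symmetric]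
  proof (rule order_trans[OF integral_norm_bound integral_mono'])
    show "integrable P (\<lambda>x. lik_bound x * err)" using lik_bound_integrable(1) by simp
    show "norm (l x * c1 x - l x * c2 x) \<le> lik_bound x * err" if x: "x \<in> space P" for x
      unfolding right_diff_distrib[symmetric] real_norm_def abs_mult
      using l_le[OF x] diff[OF x] err0 by (intro mult_mono) auto
    show "0 \<le> lik_bound x * err" for x using err0 K_ge by (simp add: lik_bound_def)
  qed
  also have "\<dots> \<le> lik_mass * err" using lik_bound_integrable(2) err0 by (simp add: mult_right_mono)
  finally show ?thesis by (simp only: l_def c2_def err_def)
qed

lemma equilibrium_profile: "(\<lambda>k t w. \<alpha> t (w k)) = profile n (\<lambda>t w. \<alpha> t (w n))"
  by (simp add: profile_def fun_eq_iff)

text \<open>Both profiles are compared with the mean field value. The equilibrium profile costs at most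
  this value plus the error. For the deviating profile, each section of \<open>\<beta>\<close> is
  admissible in the mean field game, so its mean field cost is at least the value, for every
  \<open>w\<close> separately; integration over \<open>w\<close> gives the value minus the
  error.\<close>

lemma nplayer_regret_bound:
  assumes \<delta>: "0 < \<delta>"
  shows "\<exists>c\<ge>0. \<forall>N\<ge>1. \<forall>n\<in>{1..N}. \<forall>\<beta>\<in>nplayer_controls T A N.
    nplayer_cost T A r f g P N n (\<lambda>k t w. \<alpha> t (w k)) \<le> nplayer_cost T A r f g P N n ((\<lambda>k t w. \<alpha> t (w k))(n := \<beta>))
      + 2 * lik_mass * (C * T * \<delta> + c / sqrt (real N))"
proof -
  obtain \<kappa> nn where \<kappa>: "\<kappa> \<in> actions \<rightarrow>\<^sub>M count_space {..<nn::nat}"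
    "\<And>x y. x \<in> A \<Longrightarrow> y \<in> A \<Longrightarrow> \<kappa> x = \<kappa> y \<Longrightarrow> norm (x - y) \<le> \<delta>"
    using compact_small_cells[OF A_compact \<delta>] by blast
  obtain D where D: "0 \<le> D" "\<And>x y. x \<in> A \<Longrightarrow> y \<in> A \<Longrightarrow> norm (x - y) \<le> D"
    using compact_norm_diff_bound[OF A_compact] by blast
  define c where "c = C * (T * (real CARD('m) + D * real nn) + real CARD('m)) * 2"
  have \<delta>0: "0 \<le> \<delta>" using \<delta> by simp
  show ?thesis
  proof (intro exI[of _ c] conjI allI impI ballI)
    show "0 \<le> c" unfolding c_def using C_nonneg T_pos D(1) by simp
    fix N n :: nat and \<beta> :: "real \<Rightarrow> (nat \<Rightarrow> real \<Rightarrow> real^'m) \<Rightarrow> real^'l" assume N: "1 \<le> N" and n: "n \<in> {1..N}" and \<beta>: "\<beta> \<in> nplayer_controls T A N"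
    let ?J = "{1..N} - {n}"
    interpret J: prob_space "Pi\<^sub>M ?J (\<lambda>_. \<mu>)" by (intro prob_space_PiM \<mu>.prob_space_axioms)
    have spaceJ: "space (Pi\<^sub>M ?J (\<lambda>_. \<mu>)) = space (Pi\<^sub>M ?J (\<lambda>_. P))" by (rule sets_eq_imp_space_eq, intro sets_PiM_cong) auto
    let ?\<alpha> = "\<lambda>t (w :: nat \<Rightarrow> real \<Rightarrow> real^'m). \<alpha> t (w n)"
    let ?err = "cost_error \<kappa> nn \<delta> D N n"
    have \<beta>m: "(\<lambda>z. \<beta> (fst z) (snd z)) \<in> time_interval \<Otimes>\<^sub>M players N \<rightarrow>\<^sub>M actions"
      by (rule nplayer_control_jointly_measurable[OF \<beta> T_pos chain])
    have \<alpha>m: "(\<lambda>z. ?\<alpha> (fst z) (snd z)) \<in> time_interval \<Otimes>\<^sub>M players N \<rightarrow>\<^sub>M actions"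
      by (rule equilibrium_control_player[OF n])
    have ierr: "integrable (Pi\<^sub>M ?J (\<lambda>_. \<mu>)) (\<lambda>w. lik_mass * ?err w)"
      by (intro integrable_mult_right cost_error_mean(1)[OF N \<kappa>(1) \<delta>0 D(1)])
    have Eerr: "(\<integral>w. lik_mass * ?err w \<partial>Pi\<^sub>M ?J (\<lambda>_. \<mu>)) \<le> lik_mass * (C * T * \<delta> + c / sqrt (real N))"
    proof -
      have "(\<integral>w. lik_mass * ?err w \<partial>Pi\<^sub>M ?J (\<lambda>_. \<mu>)) = lik_mass * (\<integral>w. ?err w \<partial>Pi\<^sub>M ?J (\<lambda>_. \<mu>))"
        by (rule integral_mult_right_zero)
      also have "\<dots> \<le> lik_mass * (C * T * \<delta> + c / sqrt (real N))"
        using cost_error_mean(2)[OF N \<kappa>(1) \<delta>0 D(1), of n] lik_mass_nonneg by (intro mult_left_mono) (simp_all add: c_def)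
      finally show ?thesis .
    qed
    have const: "(\<integral>w. mfg_value \<partial>Pi\<^sub>M ?J (\<lambda>_. \<mu>)) = mfg_value" using J.prob_space by simp
    have "nplayer_cost T A r f g P N n (\<lambda>k t w. \<alpha> t (w k)) = (\<integral>w. conditional_cost N n ?\<alpha> w \<partial>Pi\<^sub>M ?J (\<lambda>_. \<mu>))"
      unfolding equilibrium_profile[of n] by (rule nplayer_cost_conditional(2)[OF N n \<alpha>m])
    also have "\<dots> \<le> (\<integral>w. mfg_value + lik_mass * ?err w \<partial>Pi\<^sub>M ?J (\<lambda>_. \<mu>))"
    proof (rule integral_mono[OF nplayer_cost_conditional(1)[OF N n \<alpha>m] Bochner_Integration.integrable_add[OF J.integrable_const ierr]])
      fix w assume "w \<in> space (Pi\<^sub>M ?J (\<lambda>_. \<mu>))"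
      then have w: "w \<in> space (Pi\<^sub>M ?J (\<lambda>_. P))" by (simp only: spaceJ)
      have "(\<lambda>t x. ?\<alpha> t (w(n := x))) \<in> mfg_controls T A" using \<alpha> by simp
      from conditional_cost_error[OF N n \<alpha>m w this \<kappa> D(2) \<delta>0 D(1)]
      have "\<bar>conditional_cost N n ?\<alpha> w - mfg_value\<bar> \<le> lik_mass * ?err w"
        unfolding mfg_value_def by (simp only: fun_upd_same)
      then show "conditional_cost N n ?\<alpha> w \<le> mfg_value + lik_mass * ?err w" by linarith
    qed
    also have "\<dots> = mfg_value + (\<integral>w. lik_mass * ?err w \<partial>Pi\<^sub>M ?J (\<lambda>_. \<mu>))"
      by (subst Bochner_Integration.integral_add[OF J.integrable_const ierr]) (simp only: const)
    finally have up: "nplayer_cost T A r f g P N n (\<lambda>k t w. \<alpha> t (w k)) \<le> mfg_value + (\<integral>w. lik_mass * ?err w \<partial>Pi\<^sub>M ?J (\<lambda>_. \<mu>))" .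
    have "mfg_value - (\<integral>w. lik_mass * ?err w \<partial>Pi\<^sub>M ?J (\<lambda>_. \<mu>)) = (\<integral>w. mfg_value - lik_mass * ?err w \<partial>Pi\<^sub>M ?J (\<lambda>_. \<mu>))"
      by (subst Bochner_Integration.integral_diff[OF J.integrable_const ierr]) (simp only: const)
    also have "\<dots> \<le> (\<integral>w. conditional_cost N n \<beta> w \<partial>Pi\<^sub>M ?J (\<lambda>_. \<mu>))"
    proof (rule integral_mono[OF Bochner_Integration.integrable_diff[OF J.integrable_const ierr] nplayer_cost_conditional(1)[OF N n \<beta>m]])
      fix w assume "w \<in> space (Pi\<^sub>M ?J (\<lambda>_. \<mu>))"
      then have w: "w \<in> space (Pi\<^sub>M ?J (\<lambda>_. P))" by (simp only: spaceJ)
      have "w \<in> ?J \<rightarrow>\<^sub>E paths T" using w by (simp add: space_PiM space_P)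
      then have sec: "(\<lambda>t x. \<beta> t (w(n := x))) \<in> mfg_controls T A"
        using T_pos by (intro nplayer_control_section[OF \<beta> n]) auto
      show "mfg_value - lik_mass * ?err w \<le> conditional_cost N n \<beta> w"
        using conditional_cost_error[OF N n \<beta>m w sec \<kappa> D(2) \<delta>0 D(1)] optimal[OF sec]
        unfolding mfg_value_def by linarith
    qed
    also have "\<dots> = nplayer_cost T A r f g P N n ((\<lambda>k t w. \<alpha> t (w k))(n := \<beta>))"
      using nplayer_cost_conditional(2)[OF N n \<beta>m] by (simp add: profile_def)
    finally have "mfg_value - (\<integral>w. lik_mass * ?err w \<partial>Pi\<^sub>M ?J (\<lambda>_. \<mu>)) \<le> nplayer_cost T A r f g P N n ((\<lambda>k t w. \<alpha> t (w k))(n := \<beta>))" .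
    with up Eerr show "nplayer_cost T A r f g P N n (\<lambda>k t w. \<alpha> t (w k)) \<le> nplayer_cost T A r f g P N n ((\<lambda>k t w. \<alpha> t (w k))(n := \<beta>))
      + 2 * lik_mass * (C * T * \<delta> + c / sqrt (real N))" by linarith
  qed
qed

text \<open>For a mesh \<open>\<delta> = 1 / (j + 1)\<close> of the partition of \<open>A\<close> the
  regret is of the form \<open>a / (j + 1) + c\<^sub>j / sqrt N\<close>. The constants
  \<open>c\<^sub>j\<close> may grow arbitrarily with \<open>j\<close>, but the infimum over
  \<open>j\<close> still tends to 0.\<close>

lemma approximate_nash:
  "\<exists>\<epsilon> :: nat \<Rightarrow> real. \<epsilon> \<longlonglongrightarrow> 0 \<and>
    (\<forall>N\<ge>1. \<forall>n\<in>{1..N}. \<forall>\<beta>\<in>nplayer_controls T A N.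
       nplayer_cost T A r f g P N n (\<lambda>k t w. \<alpha> t (w k))
         \<le> nplayer_cost T A r f g P N n ((\<lambda>k t w. \<alpha> t (w k))(n := \<beta>)) + \<epsilon> N)"
proof -
  define regret where "regret j c N = 2 * lik_mass * (C * T * inverse (real (Suc j)) + c / sqrt (real N))" for j c N
  have "\<exists>c. \<forall>j. 0 \<le> c j \<and> (\<forall>N\<ge>1. \<forall>n\<in>{1..N}. \<forall>\<beta>\<in>nplayer_controls T A N.
    nplayer_cost T A r f g P N n (\<lambda>k t w. \<alpha> t (w k)) \<le> nplayer_cost T A r f g P N n ((\<lambda>k t w. \<alpha> t (w k))(n := \<beta>)) + regret j (c j) N)"
  proof (rule choice, rule allI)
    fix j
    have "0 < inverse (real (Suc j))" by simp
    from nplayer_regret_bound[OF this] show "\<exists>c. 0 \<le> c \<and> (\<forall>N\<ge>1. \<forall>n\<in>{1..N}. \<forall>\<beta>\<in>nplayer_controls T A N.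
      nplayer_cost T A r f g P N n (\<lambda>k t w. \<alpha> t (w k)) \<le> nplayer_cost T A r f g P N n ((\<lambda>k t w. \<alpha> t (w k))(n := \<beta>)) + regret j c N)"
      unfolding regret_def by blast
  qed
  then obtain c where c: "\<And>j. 0 \<le> c j" and
    le: "\<And>j N n \<beta>. 1 \<le> N \<Longrightarrow> n \<in> {1..N} \<Longrightarrow> \<beta> \<in> nplayer_controls T A N \<Longrightarrow>
      nplayer_cost T A r f g P N n (\<lambda>k t w. \<alpha> t (w k)) \<le> nplayer_cost T A r f g P N n ((\<lambda>k t w. \<alpha> t (w k))(n := \<beta>)) + regret j (c j) N"
    by blast
  have nn: "0 \<le> regret j (c j) N" for j N
    unfolding regret_def using lik_mass_nonneg C_nonneg T_pos c by (intro mult_nonneg_nonneg add_nonneg_nonneg divide_nonneg_nonneg) auto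
  define \<epsilon> where "\<epsilon> N = (INF j. regret j (c j) N)" for N
  have bdd: "bdd_below (range (\<lambda>j. regret j (c j) N))" for N by (rule bdd_belowI2[OF nn])
  have \<epsilon>0: "0 \<le> \<epsilon> N" for N unfolding \<epsilon>_def by (rule cINF_greatest) (auto intro: nn)
  have \<epsilon>_le: "\<epsilon> N \<le> regret j (c j) N" for j N unfolding \<epsilon>_def by (rule cINF_lower[OF bdd]) simp
  have "\<epsilon> \<longlonglongrightarrow> 0"
  proof (rule order_tendstoI)
    fix a :: real assume "a < 0"
    then show "\<forall>\<^sub>F N in sequentially. a < \<epsilon> N" using \<epsilon>0 by (intro always_eventually allI) (meson less_le_trans)
  next
    fix a :: real assume a: "0 < a"
    have "(\<lambda>j. 2 * lik_mass * (C * T * inverse (real (Suc j)))) \<longlonglongrightarrow> 2 * lik_mass * (C * T * 0)"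
      by (intro tendsto_mult tendsto_const LIMSEQ_inverse_real_of_nat)
    then have "eventually (\<lambda>j. 2 * lik_mass * (C * T * inverse (real (Suc j))) < a) sequentially"
      using a by (intro order_tendstoD(2)) auto
    then obtain j where j: "2 * lik_mass * (C * T * inverse (real (Suc j))) < a"
      by (auto simp: eventually_sequentially)
    have "(\<lambda>N. c j / sqrt (real N)) \<longlonglongrightarrow> 0"
      by (intro tendsto_divide_0[OF tendsto_const] filterlim_at_top_imp_at_infinity
          filterlim_compose[OF sqrt_at_top filterlim_real_sequentially])
    then have "(\<lambda>N. regret j (c j) N) \<longlonglongrightarrow> 2 * lik_mass * (C * T * inverse (real (Suc j)) + 0)"
      unfolding regret_def by (intro tendsto_mult tendsto_const tendsto_add)
    then have "eventually (\<lambda>N. regret j (c j) N < a) sequentially"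
      using j by (intro order_tendstoD(2)) auto
    then show "\<forall>\<^sub>F N in sequentially. \<epsilon> N < a"
      by eventually_elim (use \<epsilon>_le le_less_trans in blast)
  qed
  moreover have "nplayer_cost T A r f g P N n (\<lambda>k t w. \<alpha> t (w k)) \<le> nplayer_cost T A r f g P N n ((\<lambda>k t w. \<alpha> t (w k))(n := \<beta>)) + \<epsilon> N"
    if "1 \<le> N" "n \<in> {1..N}" "\<beta> \<in> nplayer_controls T A N" for N n \<beta>
  proof -
    have "nplayer_cost T A r f g P N n (\<lambda>k t w. \<alpha> t (w k)) - nplayer_cost T A r f g P N n ((\<lambda>k t w. \<alpha> t (w k))(n := \<beta>)) \<le> \<epsilon> N"
      unfolding \<epsilon>_def using le[OF that] by (intro cINF_greatest) (auto simp: algebra_simps)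
    then show ?thesis by linarith
  qed
  ultimately show ?thesis by blast
qed

end

section \<open>The approximate Nash property\<close>

lemma admissible_rates_cong:
  assumes R: "admissible_rates T K R" and eq: "\<And>s. s \<in> {0..T} \<Longrightarrow> R s = R' s"
  shows "admissible_rates T K R'"
proof -
  note RD = R[unfolded admissible_rates_def]
  have "bounded_measurable_on T (\<lambda>s. R' s $ i $ j)" for i j
    using RD[THEN conjunct1, THEN spec, THEN spec]
  proof (rule bounded_measurable_on_cong)
    show "R s $ i $ j = R' s $ i $ j" if "s \<in> {0..T}" for s by (simp only: eq[OF that])
  qed
  moreover have "(\<Sum>j\<in>UNIV. R' s $ i $ j) = 0" "\<forall>j. i \<noteq> j \<longrightarrow> 0 < R' s $ i $ j \<and> R' s $ i $ j \<le> K"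
    if "s \<in> {0..T}" for s i
    using RD[THEN conjunct2, THEN conjunct1, rule_format, OF that, of i]
      RD[THEN conjunct2, THEN conjunct2, rule_format, OF that, of i] by (simp_all add: eq[OF that])
  ultimately show ?thesis unfolding admissible_rates_def by (intro conjI allI ballI) simp_all
qed

lemma set_integrable_of_square:
  fixes h :: "real \<Rightarrow> real"
  assumes h: "h \<in> borel_measurable (restrict_space borel {0..T})" and sq: "set_integrable lborel {0..T} (\<lambda>t. \<bar>h t\<bar>\<^sup>2)"
  shows "set_integrable lborel {0..T} h"
proof (rule set_integrable_bound[where f="\<lambda>t. 1 + \<bar>h t\<bar>\<^sup>2"])
  show "set_integrable lborel {0..T} (\<lambda>t. 1 + \<bar>h t\<bar>\<^sup>2)"
    by (rule set_integral_add(1)[OF _ sq]) (cases "0 \<le> T"; simp add: set_integrable_def)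
  show "set_borel_measurable lborel {0..T} h"
    using h by (simp add: set_borel_measurable_def borel_measurable_restrict_space_iff)
  have "\<bar>h t\<bar> \<le> 1 + \<bar>h t\<bar>\<^sup>2" for t
    using zero_le_power2[of "\<bar>h t\<bar> - 1"] by (simp add: power2_diff)
  then show "AE t in lborel. t \<in> {0..T} \<longrightarrow> norm (h t) \<le> norm (1 + \<bar>h t\<bar>\<^sup>2)"
    by (intro AE_I2) (auto intro: order_trans)
qed

theorem theorem6p5:
  fixes T :: real
    and A :: "(real^'l) set"
    and p0 :: "real^'m"
    and P :: "(real \<Rightarrow> real^'m) measure"
    and q :: "('m::finite, 'l::finite) rates"
    and r :: "('m, 'l) rates_reduced"
    and f :: "('m, 'l) running_cost"
    and g :: "'m terminal_cost"
    and \<alpha> :: "real \<Rightarrow> (real \<Rightarrow> real^'m) \<Rightarrow> real^'l"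
    and p :: "real \<Rightarrow> real^'m"
    and \<nu> :: "real \<Rightarrow> (real^'l) measure"
  assumes "0 < T"
    and "2 \<le> CARD('m)"
    and "compact A"
    and "p0 \<in> prob_simplex"
    and "is_chain_law T p0 P"
    and "measurable_data T A q f"
    and "assumption_A T A q"
    and "assumption_B T A f g"
    and "assumption_C T A q f"
    and "assumption_D T A q r"
    and "mfg_nash T A q f g P \<alpha> p \<nu>"
  shows "\<exists>\<epsilon> :: nat \<Rightarrow> real. \<epsilon> \<longlonglongrightarrow> 0 \<and>
    (\<forall>N\<ge>1. \<forall>n\<in>{1..N}. \<forall>\<beta>\<in>nplayer_controls T A N.
       nplayer_cost T A r f g P N n (\<lambda>k t w. \<alpha> t (w k))
         \<le> nplayer_cost T A r f g P N n ((\<lambda>k t w. \<alpha> t (w k))(n := \<beta>)) + \<epsilon> N)"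
proof -
  note T = assms(1) and A = assms(3) and chain = assms(5)
  note nash = assms(11)[unfolded mfg_nash_def]
  have \<alpha>: "\<alpha> \<in> mfg_controls T A" using nash by blast
  have pm: "p \<in> restrict_space borel {0..T} \<rightarrow>\<^sub>M restrict_space borel prob_simplex" using nash by blast
  have \<nu>m: "\<nu> \<in> restrict_space borel {0..T} \<rightarrow>\<^sub>M prob_algebra (restrict_space borel A)" using nash by blast
  have p_in: "p t \<in> prob_simplex" if "t \<in> {0..T}" for t
    using measurable_space[OF pm, of t] that by (simp add: space_restrict_space)
  have \<nu>_in: "\<nu> t \<in> prob_measures A" if "t \<in> {0..T}" for t
    using measurable_space[OF \<nu>m, of t] that by (simp add: space_restrict_space prob_measures_def)
  have zero: "0 \<in> {0..T}" using T by simp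
  have rq: "q t i j a p' \<nu>' = r t i j a" if "t \<in> {0..T}" "a \<in> A" "p' \<in> prob_simplex" "\<nu>' \<in> prob_measures A" for t i j a p' \<nu>'
    using assms(10) that unfolding assumption_D_def by blast
  note sA = assms(7)[unfolded assumption_A_def]
  obtain CA where CA: "0 < CA" "\<forall>t\<in>{0..T}. \<forall>i j. \<forall>\<alpha>\<in>A. \<forall>\<alpha>'\<in>A. \<forall>p\<in>prob_simplex. \<forall>p'\<in>prob_simplex.
      \<forall>\<nu>\<in>prob_measures A. \<forall>\<nu>'\<in>prob_measures A.
      \<bar>q t i j \<alpha> p \<nu> - q t i j \<alpha>' p' \<nu>'\<bar> \<le> CA * (norm (\<alpha> - \<alpha>') + norm (p - p') + wasserstein1 A \<nu> \<nu>')"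
    using sA[THEN conjunct2, THEN conjunct2] by (elim exE conjE) (rule that)
  obtain C1 C2 where C12: "0 < C1" "\<forall>t\<in>{0..T}. \<forall>\<alpha>\<in>A. \<forall>p\<in>prob_simplex. \<forall>\<nu>\<in>prob_measures A. \<forall>i j.
      i \<noteq> j \<longrightarrow> C1 < q t i j \<alpha> p \<nu> \<and> q t i j \<alpha> p \<nu> < C2"
    using sA[THEN conjunct2, THEN conjunct1] by (elim exE conjE) (rule that)
  note rows = sA[THEN conjunct1, rule_format, THEN conjunct2, rule_format]
  obtain CB where CB: "0 < CB" "\<forall>t\<in>{0..T}. \<forall>i. \<forall>\<alpha>\<in>A. \<forall>\<alpha>'\<in>A. \<forall>p\<in>prob_simplex. \<forall>p'\<in>prob_simplex.
      \<forall>\<nu>\<in>prob_measures A. \<forall>\<nu>'\<in>prob_measures A.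
      \<bar>f t (axis i 1) \<alpha> p \<nu> - f t (axis i 1) \<alpha>' p' \<nu>'\<bar> \<le> CB * (norm (\<alpha> - \<alpha>') + norm (p - p') + wasserstein1 A \<nu> \<nu>')"
    "\<forall>i. \<forall>p\<in>prob_simplex. \<forall>p'\<in>prob_simplex. \<bar>g (axis i 1) p - g (axis i 1) p'\<bar> \<le> CB * norm (p - p')"
    using assms(8)[unfolded assumption_B_def] by (elim exE conjE) (rule that)
  define C where "C = CA + CB"
  define K where "K = max 1 C2"
  have C: "CA \<le> C" "CB \<le> C" "0 \<le> C" using CA(1) CB(1) by (simp_all add: C_def)
  have sp: "space P = paths T" by (rule chain_law_space[OF chain])
  interpret P: prob_space P using chain by (simp add: is_chain_law_def)
  obtain x0 :: "real \<Rightarrow> real^'m" where x0: "x0 \<in> paths T" using P.not_empty unfolding sp by blast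
  \<comment> \<open>An admissible control exists and the path space is nonempty, hence so is the set of
    actions.\<close>
  have "\<alpha> 0 x0 \<in> A"
    using measurable_space[OF mfg_control_jointly_measurable[OF \<alpha> T], of "(0, x0)"] x0 zero
    by (simp add: space_pair_measure space_restrict_space)
  then have A_ne: "A \<noteq> {}" by blast
  have br: "0 \<le> norm (a - a') + norm (p1 - p2) + wasserstein1 A \<nu>1 \<nu>2" if "\<nu>1 \<in> prob_measures A" "\<nu>2 \<in> prob_measures A"
    for a a' :: "real^'l" and p1 p2 :: "real^'m" and \<nu>1 \<nu>2
    using wasserstein1_nonneg[OF that] by simp
  \<comment> \<open>The maximum of \<open>C2\<close> and 1, so that additional jumps can only increase the
    bound \<open>K ^ card (jumps T x)\<close>.\<close>
  interpret mean_field_setting T A p0 P r f g K C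
  proof
    show "0 < T" "compact A" "A \<noteq> {}" "is_chain_law T p0 P" by fact+
    show "1 \<le> K" by (simp add: K_def)
    show "caratheodory_lipschitz T A C (\<lambda>t a (p'::real^'m) \<nu>'. r t i j a)" for i j
      unfolding caratheodory_lipschitz_def
    proof (intro conjI ballI)
      show "0 \<le> C" by fact
      fix a assume a: "a \<in> A"
      have "(\<lambda>t. q t i j a (p 0) (\<nu> 0)) \<in> borel_measurable (restrict_space borel {0..T})"
        using assms(6) a p_in[OF zero] \<nu>_in[OF zero] unfolding measurable_data_def by blast
      then show "(\<lambda>t. r t i j a) \<in> borel_measurable (restrict_space borel {0..T})"
        by (rule measurable_cong[THEN iffD1, rotated])
           (simp add: space_restrict_space rq[OF _ a p_in[OF zero] \<nu>_in[OF zero]])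
    next
      fix t a a' and p1 p2 :: "real^'m" and \<nu>1 \<nu>2
      assume h: "t \<in> {0..T}" "a \<in> A" "a' \<in> A" "p1 \<in> prob_simplex" "p2 \<in> prob_simplex" "\<nu>1 \<in> prob_measures A" "\<nu>2 \<in> prob_measures A"
      have "\<bar>r t i j a - r t i j a'\<bar> \<le> CA * (norm (a - a') + norm (p1 - p2) + wasserstein1 A \<nu>1 \<nu>2)"
        using CA(2)[rule_format, OF h, of i j] rq[OF h(1,2,4,6)] rq[OF h(1,3,5,7)] by simp
      also have "\<dots> \<le> C * (norm (a - a') + norm (p1 - p2) + wasserstein1 A \<nu>1 \<nu>2)"
        by (rule mult_right_mono[OF C(1) br[OF h(6,7)]])
      finally show "\<bar>r t i j a - r t i j a'\<bar> \<le> C * (norm (a - a') + norm (p1 - p2) + wasserstein1 A \<nu>1 \<nu>2)" .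
    qed
    fix t a i assume ta: "t \<in> {0..T}" "a \<in> A"
    note ra = rq[OF ta p_in[OF zero] \<nu>_in[OF zero]]
    show "(\<Sum>j\<in>UNIV. r t i j a) = 0"
      using rows[OF ta p_in[OF zero] \<nu>_in[OF zero], of i] by (simp add: ra)
    show "0 < r t i j a \<and> r t i j a \<le> K" if "i \<noteq> j" for j
      using C12(2)[rule_format, OF ta p_in[OF zero] \<nu>_in[OF zero] that] C12(1) unfolding ra K_def by linarith
  next
    show "caratheodory_lipschitz T A C (\<lambda>t. f t (axis i 1))" for i
      unfolding caratheodory_lipschitz_def
    proof (intro conjI ballI)
      show "0 \<le> C" by fact
      show "(\<lambda>t. f t (axis i 1) a p' \<nu>') \<in> borel_measurable (restrict_space borel {0..T})"
        if "a \<in> A" "p' \<in> prob_simplex" "\<nu>' \<in> prob_measures A" for a p' \<nu>'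
        using assms(6) that unfolding measurable_data_def by blast
      fix t a a' and p1 p2 :: "real^'m" and \<nu>1 \<nu>2
      assume h: "t \<in> {0..T}" "a \<in> A" "a' \<in> A" "p1 \<in> prob_simplex" "p2 \<in> prob_simplex" "\<nu>1 \<in> prob_measures A" "\<nu>2 \<in> prob_measures A"
      show "\<bar>f t (axis i 1) a p1 \<nu>1 - f t (axis i 1) a' p2 \<nu>2\<bar> \<le> C * (norm (a - a') + norm (p1 - p2) + wasserstein1 A \<nu>1 \<nu>2)"
        by (rule order_trans[OF CB(2)[rule_format, OF h] mult_right_mono[OF C(2) br[OF h(6,7)]]])
    qed
    show "set_integrable lborel {0..T} (\<lambda>t. f t (axis i 1) a p' \<nu>')"
      if "a \<in> A" "p' \<in> prob_simplex" "\<nu>' \<in> prob_measures A" for i a p' \<nu>'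
      using assms(6)[unfolded measurable_data_def, rule_format, OF that, THEN conjunct2, rule_format, of i]
      by (elim conjE) (rule set_integrable_of_square)
    show "\<bar>g (axis i 1) p1 - g (axis i 1) p2\<bar> \<le> C * norm (p1 - p2)"
      if "p1 \<in> prob_simplex" "p2 \<in> prob_simplex" for i p1 p2
      by (rule order_trans[OF CB(3)[rule_format, OF that] mult_right_mono[OF C(2) norm_ge_zero]])
  qed
  \<comment> \<open>The stochastic exponential is evaluated path by path.\<close>
  have measure_eq: "mfg_measure T q P \<beta> p \<nu> = density P (\<lambda>\<omega>. ennreal (lik (\<lambda>s. \<beta> s \<omega>) \<omega>))" if \<beta>: "\<beta> \<in> mfg_controls T A" for \<beta>
    unfolding mfg_measure_def
  proof (rule density_cong_AE, rule AE_I2)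
    fix \<omega> assume \<omega>: "\<omega> \<in> space P"
    have u: "(\<lambda>s. \<beta> s \<omega>) \<in> time_interval \<rightarrow>\<^sub>M actions" by (rule jointly_measurable_section[OF control_measurable[OF \<beta>] \<omega>])
    have eq: "rate_matrix (\<lambda>s. \<beta> s \<omega>) s = (\<chi> i j. q s i j (\<beta> s \<omega>) (p s) (\<nu> s))" if s: "s \<in> {0..T}" for s
      using measurable_space[OF u, of s] s rq[OF s _ p_in[OF s] \<nu>_in[OF s]] by (simp add: rate_matrix_def)
    have "doleans_exp (girsanov_integral (\<lambda>s. \<chi> i j. q s i j (\<beta> s \<omega>) (p s) (\<nu> s)) \<omega>) T
        = likelihood T (\<lambda>s. \<chi> i j. q s i j (\<beta> s \<omega>) (p s) (\<nu> s)) \<omega>"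
      using \<omega> by (intro doleans_exp_girsanov[OF T admissible_rates_cong[OF admissible_rate_matrix[OF u] eq]]) (simp_all add: sp)
    also have "\<dots> = lik (\<lambda>s. \<beta> s \<omega>) \<omega>" unfolding lik_def by (rule likelihood_cong) (simp add: eq)
    finally show "ennreal (doleans_exp (girsanov_integral (\<lambda>s. \<chi> i j. q s i j (\<beta> s \<omega>) (p s) (\<nu> s)) \<omega>) T) = ennreal (lik (\<lambda>s. \<beta> s \<omega>) \<omega>)"
      by simp
  qed
  have cost_eq: "mfg_cost T q f g P \<beta> p \<nu> = (\<integral>\<omega>. lik (\<lambda>s. \<beta> s \<omega>) \<omega> * path_cost \<omega> (\<lambda>t. \<beta> t \<omega>) p \<nu> \<partial>P)" if \<beta>: "\<beta> \<in> mfg_controls T A" for \<beta>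
  proof -
    have pos: "AE \<omega> in P. 0 \<le> lik (\<lambda>s. \<beta> s \<omega>) \<omega>"
      using lik_bounds(1)[OF jointly_measurable_section[OF control_measurable[OF \<beta>]]] by (intro AE_I2) (auto simp: sp intro: less_imp_le)
    have "mfg_cost T q f g P \<beta> p \<nu>
        = (\<integral>\<omega>. path_cost \<omega> (\<lambda>t. \<beta> t \<omega>) p \<nu> \<partial>density P (\<lambda>\<omega>. ennreal (lik (\<lambda>s. \<beta> s \<omega>) \<omega>)))"
      unfolding mfg_cost_def measure_eq[OF \<beta>] path_cost_def ..
    also have "\<dots> = (\<integral>\<omega>. lik (\<lambda>s. \<beta> s \<omega>) \<omega> *\<^sub>R path_cost \<omega> (\<lambda>t. \<beta> t \<omega>) p \<nu> \<partial>P)"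
      by (rule integral_density[OF equilibrium_cost_measurable(1)[OF \<beta> pm \<nu>m] control_lik_measurable[OF \<beta>] pos])
    finally show ?thesis by simp
  qed
  interpret mean_field_equilibrium T A p0 P r f g K C \<alpha> p \<nu> "mfg_measure T q P \<alpha> p \<nu>"
  proof
    show "\<alpha> \<in> mfg_controls T A" by fact
    show "mfg_measure T q P \<alpha> p \<nu> = density P (\<lambda>\<omega>. ennreal (lik (\<lambda>s. \<alpha> s \<omega>) \<omega>))" by (rule measure_eq[OF \<alpha>])
    show "p \<in> time_interval \<rightarrow>\<^sub>M restrict_space borel prob_simplex" "\<nu> \<in> time_interval \<rightarrow>\<^sub>M prob_algebra actions" by fact+
    show "p t $ i = measure (mfg_measure T q P \<alpha> p \<nu>) {\<omega> \<in> paths T. \<omega> t = axis i 1}" if "t \<in> {0..T}" for t i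
    proof -
      have "p t = (\<chi> i. measure (mfg_measure T q P \<alpha> p \<nu>) {\<omega> \<in> paths T. \<omega> t = axis i 1})" using nash that by blast
      then have "p t $ i = (\<chi> i. measure (mfg_measure T q P \<alpha> p \<nu>) {\<omega> \<in> paths T. \<omega> t = axis i 1}) $ i" by (rule arg_cong)
      then show ?thesis by (simp only: vec_lambda_beta)
    qed
    show "\<nu> t = distr (mfg_measure T q P \<alpha> p \<nu>) actions (\<alpha> t)" if "t \<in> {0..T}" for t
      using nash that by blast
    show "(\<integral>\<omega>. lik (\<lambda>s. \<alpha> s \<omega>) \<omega> * path_cost \<omega> (\<lambda>t. \<alpha> t \<omega>) p \<nu> \<partial>P) \<le> (\<integral>\<omega>. lik (\<lambda>s. \<beta> s \<omega>) \<omega> * path_cost \<omega> (\<lambda>t. \<beta> t \<omega>) p \<nu> \<partial>P)"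
      if "\<beta> \<in> mfg_controls T A" for \<beta>
      using nash that unfolding cost_eq[OF \<alpha>, symmetric] cost_eq[OF that, symmetric] by blast
  qed
  show ?thesis by (rule approximate_nash)
qed

end
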